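(* Assume Conditions 1–4 listed in the context hold and that the covariance function $\mathcal{K}(u,v)$ is of rank $R$ (i.e. $\omega_R=0$). Assume $N,K\to\infty$, $K^2\log(K)/N\to 0$ and $\eta K^{1+2(q-p)_+}\to 0$. Let $$\mathbb S=\Big\{(\mathbf U,\mathbf D,\sigma_e^2)\in\mathrm{St}(R,K)\times\mathbb D_+\times\mathbb R_+:\ \mathrm{tr}(\mathbf U^{\mathsf T}\boldsymbol\Gamma\mathbf U)\le b_0,\ \lambda_r\in[b_1,b_2]\text{ for }r=1,\dots,R,\ \sigma_e^2\in[b_1,b_2]\Big\},$$ where $\mathbf D=\mathrm{diag}(\lambda_1,\dots,\lambda_R)$ and $b_0,b_1,b_2$ are fixed positive values with $b_2>b_1>0$ and such that the optimal parameters $(\bar{\mathbf U},\bar{\mathbf D},\sigma_{0e}^2)$ are in $\mathbb S$. Consider the global minimizer $$(\widehat{\mathbf U},\widehat{\mathbf D},\widehat\sigma_e^2)=\arg\min_{(\mathbf U,\mathbf D,\sigma_e^2)\in\mathbb S}\ell(\mathbf U,\mathbf D,\sigma_e^2),$$ let $\widehat\lambda_r$ be the $r$-th diagonal element of $\widehat{\mathbf D}$, $\widehat{\mathbf u}_r$ the $r$-th column of $\widehat{\mathbf U}$, and $\widehat\psi_r(u)=\mathbf b^{\mathsf T}(u)\widehat{\mathbf u}_r$. Then, for $r=1,\dots,R$, $$|\widehat\lambda_r-\lambda_{0r}|=o_p(1),\qquad\|\widehat\psi_r-\psi_{0r}\|^2=o_p(1),\qquad|\widehat\sigma_e^2-\sigma_{0e}^2|=o_p(1),$$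 where $\|\cdot\|$ is the $L_2$ norm.
   Context: Notation: $(x)_+=\max\{x,0\}$, $\mathcal U=[0,1]$. The integers $R\ge1$, $p\ge 1$, $m\ge1$ and $1\le q\le m$ are fixed; $K=K_N$ and the penalty parameter $\eta=\eta_N>0$ may depend on $N$. Covariance. $x$ is a random function on $\mathcal U$ with mean zero and covariance function $\mathcal K(u,v)=\mathbb E\{x(u)x(v)\}$ (a smooth, in particular continuous, version is taken), with Mercer expansion $\mathcal K(u,v)=\sum_{r\ge1}\lambda_{0r}\psi_{0r}(u)\psi_{0r}(v)$, where $\lambda_{01}\ge\lambda_{02}\ge\dots\ge0$ and $\{\psi_{0r}\}$ is orthonormal in $L_2(\mathcal U)$. Condition 1: $\mathcal K\in L_2(\mathcal U^2)$ and, with weak derivatives, $\sum_{i+j=p}\|\partial^p\mathcal K/\partial u^i\partial v^j\|_{L_2}<\infty$. Condition 2: $\min_{1\le r<r'\le R+1}(\lambda_{0r}-\lambda_{0r'})\ge C_E>0$ for some constant $C_E$. Let $\omega_R=\sup_{u,v}|\mathcal K(u,v)-\sum_{r=1}^R\lambda_{0r}\psi_{0r}(u)\psi_{0r}(v)|$. Data. $x_1,\dots,x_N$ are realized functions of $x$; one observes $y_{nj}=x_n(u_{nj})+\epsilon_{nj}$, $1\le j\le M_n$, $1\le n\le N$. Write $\mathbf u_n=(u_{n1},\dots,u_{nM_n})^{\mathsf T}$, $\mathbf x_n=(x_n(u_{n1}),\dots,x_n(u_{nM_n}))^{\mathsf T}$, $\mathbf y_n=(y_{n1},\dots,y_{nM_n})^{\mathsf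 T}$, $\mathbf S_n=\mathbf y_n\mathbf y_n^{\mathsf T}$, where $\mathbf S_n$ is an unbiased estimate of the covariance matrix $\mathbf K_n=\mathrm{Var}(\mathbf y_n)=[\mathcal K(u_{nj},u_{nj'})]_{j,j'}+\sigma_{0e}^2\mathbf I$, with $\sigma_{0e}^2$ the true noise variance. Condition 3: (i) for fixed constants $\underline M>1$ and $\overline M<\infty$, $\underline M\le M_n\le\overline M$ for all $n$; (ii) the $u_{nj}$ are independently sampled according to a density $G$ with support $[0,1]$, and there are positive constants $c_g,C_g$ with $0<c_g<G(u)<C_g$ for all $u\in[0,1]$. Condition 4: (i) the $\epsilon_{nj}$ are independent of each other with mean zero and finite variance $\sigma_{0e}^2$, and $\mathbb E\epsilon_{nj}^4\le C_m\sigma_{0e}^4$ for a constant $C_m\ge1$; (ii) for any fixed vector $\mathbf v\in\mathbb R^{M_n}$, $\mathbb E\{(\mathbf x_n^{\mathsf T}\mathbf v)^4\mid\mathbf u_n\}\le C_m[\mathbb E\{(\mathbf x_n^{\mathsf T}\mathbf v)^2\mid\mathbf u_n\}]^2$. Splines. Consider a $K$-dimensional linear space of spline functions of degree $m$ on $\mathcal U$, and let $\mathbf b(\cdot)\in\mathbb R^K$ be a vector whose elements form an orthonormal basis of it: $\int_{\mathcal U}\mathbf b\mathbf b^{\mathsf T}=\mathbf I$. Let $\boldsymbol\Gamma=\int_{\mathcal U}\mathbf b^{(q)}\{\mathbf b^{(q)}\}^{\mathsf T}$. Optimal parameters: let $\bar{\mathbf W}_K=\arg\min\int_{\mathcal U^2}\{\mathcal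 K(u,v)-\mathbf b^{\mathsf T}(u)\mathbf W\mathbf b(v)\}^2du\,dv$ over symmetric $\mathbf W\in\mathbb R^{K\times K}$, let $\bar{\mathbf u}_r$ be its $r$-th (unit) eigenvector, ordered according to eigenvalues, $\bar{\mathbf U}=(\bar{\mathbf u}_1,\dots,\bar{\mathbf u}_R)$ and $\bar{\mathbf D}=\mathrm{diag}(\lambda_{01},\dots,\lambda_{0R})$. Loss. The seed function $\varphi$ is strictly convex and twice continuously differentiable, and $\varphi'$ is matrix monotone (for positive definite matrices of the same size, $\mathbf A\succeq\mathbf B$ implies $\varphi'(\mathbf A)\succeq\varphi'(\mathbf B)$); functions are applied to positive definite matrices through the eigendecomposition. Such $\varphi'$ has the expression $\varphi'(x)=\alpha+\beta x+\int_0^\infty\big(\frac{\xi}{\xi^2+1}-\frac1{\xi+x}\big)d\mu(\xi)$ with $\alpha\in\mathbb R$, $\beta\ge0$, $\mu$ a non-negative measure with $C_\mu=\int_0^\infty(\xi^2+1)^{-1}d\mu(\xi)<\infty$, and it is required that $\beta+C_\mu>0$. For $\mathbf U\in\mathrm{St}(R,K)=\{\mathbf U\in\mathbb R^{K\times R}:\mathbf U^{\mathsf T}\mathbf U=\mathbf I\}$, $\mathbf D\in\mathbb D_+$ (the $R\times R$ diagonal matrices with positive diagonal) and $\sigma_e^2>0$, set $\mathcal C(u,v)=\mathbf b^{\mathsf T}(u)\mathbf U\mathbf D\mathbf U^{\mathsf T}\mathbf b(v)$, $\mathbf C_n=[\mathcal C(u_{nj},u_{nj'})]_{j,j'}+\sigma_e^2\mathbf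 I$, $$\mathcal L(\mathbf U,\mathbf D,\sigma_e^2)=\frac1N\sum_{n=1}^N\frac1{M_n^2}\mathrm{tr}\{-\varphi(\mathbf C_n)-\varphi'(\mathbf C_n)(\mathbf S_n-\mathbf C_n)\},$$ and $\ell(\mathbf U,\mathbf D,\sigma_e^2)=\mathcal L(\mathbf U,\mathbf D,\sigma_e^2)+\eta\,\mathrm{tr}(\mathbf U^{\mathsf T}\boldsymbol\Gamma\mathbf U)$.
   Formalization: The minimizer is taken with its eigenvalues in decreasing order and each estimated eigenfunction having nonnegative inner product with the true one, since the loss ignores column order and sign; the maximal knot spacing of the spline spaces is assumed to tend to 0, without which the claim fails. *)

theory Defs
  imports "HOL-Probability.Probability" "Jordan_Normal_Form.Matrix"
begin

(* All indices are 0-based, as in Jordan_Normal_Form: lam 0 is the leading eigenvalue, the first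
   N subjects are n < N, and the observations of subject n are j < Mn n. Matrices and vectors are
   those of Jordan_Normal_Form, because the sizes K = K_N and M_n vary inside the statement. *)

unbundle no vec_syntax
unbundle no inner_syntax
hide_const (open) Finite_Cartesian_Product.vec Finite_Cartesian_Product.mat
hide_const (open) Finite_Cartesian_Product.row Finite_Cartesian_Product.column
hide_type (open) Finite_Cartesian_Product.vec

section \<open>Function spaces on the unit interval and the unit square\<close>

abbreviation unit_ivl :: "real set" where "unit_ivl \<equiv> {0..1}"

abbreviation unit_sq :: "(real \<times> real) set" where "unit_sq \<equiv> unit_ivl \<times> unit_ivl"

definition L2_on :: "'a::euclidean_space set \<Rightarrow> ('a \<Rightarrow> real) \<Rightarrow> bool" where
  "L2_on A f \<longleftrightarrow> set_borel_measurable lborel A f \<and> set_integrable lborel A (\<lambda>x. (f x)\<^sup>2)"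

definition L2_inner :: "(real \<Rightarrow> real) \<Rightarrow> (real \<Rightarrow> real) \<Rightarrow> real" where
  "L2_inner f g = (LINT t:unit_ivl|lborel. f t * g t)"

definition L2_norm :: "(real \<Rightarrow> real) \<Rightarrow> real" where
  "L2_norm f = sqrt (LINT t:unit_ivl|lborel. (f t)\<^sup>2)"

definition pd_fst :: "(real \<Rightarrow> real \<Rightarrow> real) \<Rightarrow> real \<Rightarrow> real \<Rightarrow> real" where
  "pd_fst f = (\<lambda>s t. deriv (\<lambda>a. f a t) s)"

definition pd_snd :: "(real \<Rightarrow> real \<Rightarrow> real) \<Rightarrow> real \<Rightarrow> real \<Rightarrow> real" where
  "pd_snd f = (\<lambda>s t. deriv (\<lambda>a. f s a) t)"

definition mixed_pd :: "nat \<Rightarrow> nat \<Rightarrow> (real \<Rightarrow> real \<Rightarrow> real) \<Rightarrow> real \<Rightarrow> real \<Rightarrow> real" where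
  "mixed_pd i j f = (pd_fst ^^ i) ((pd_snd ^^ j) f)"

(* Infinitely differentiable functions with compact support in the open unit square. Existence and
   joint continuity of all partial derivatives in one order of differentiation suffices: by
   Schwarz's theorem the other orders then exist and agree. *)
definition test_function :: "(real \<Rightarrow> real \<Rightarrow> real) \<Rightarrow> bool" where
  "test_function g \<longleftrightarrow>
     (\<forall>i j. (\<forall>s t. (\<lambda>a. mixed_pd i j g a t) differentiable at s
                \<and> (\<lambda>a. mixed_pd i j g s a) differentiable at t)
          \<and> continuous_on UNIV (\<lambda>(s, t). mixed_pd i j g s t))
     \<and> closure {(s, t). g s t \<noteq> 0} \<subseteq> {0<..<1} \<times> {0<..<1}"

definition weak_pd ::
  "nat \<Rightarrow> nat \<Rightarrow> (real \<Rightarrow> real \<Rightarrow> real) \<Rightarrow> (real \<Rightarrow> real \<Rightarrow> real) \<Rightarrow> bool" where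
  "weak_pd i j f h \<longleftrightarrow> (\<forall>g. test_function g \<longrightarrow>
     (LINT z:unit_sq|lborel. f (fst z) (snd z) * mixed_pd i j g (fst z) (snd z))
       = (-1) ^ (i + j) * (LINT z:unit_sq|lborel. h (fst z) (snd z) * g (fst z) (snd z)))"

(* The finite sum of the L2 norms of the order-p weak derivatives is finite iff each of these
   derivatives exists as an element of L2. *)
definition sobolev_cov :: "nat \<Rightarrow> (real \<Rightarrow> real \<Rightarrow> real) \<Rightarrow> bool" where
  "sobolev_cov p kern \<longleftrightarrow> L2_on unit_sq (\<lambda>(s, t). kern s t)
     \<and> (\<forall>i j. i + j = p \<longrightarrow> (\<exists>h. L2_on unit_sq (\<lambda>(s, t). h s t) \<and> weak_pd i j kern h))"

section \<open>Covariance function\<close>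

definition cov_fun :: "'s measure \<Rightarrow> ('s \<Rightarrow> real \<Rightarrow> real) \<Rightarrow> real \<Rightarrow> real \<Rightarrow> real" where
  "cov_fun P x s t = (LINT \<zeta>|P. x \<zeta> s * x \<zeta> t)"

definition mercer_expansion ::
  "(real \<Rightarrow> real \<Rightarrow> real) \<Rightarrow> (nat \<Rightarrow> real) \<Rightarrow> (nat \<Rightarrow> real \<Rightarrow> real) \<Rightarrow> bool" where
  "mercer_expansion kern lam psi \<longleftrightarrow>
     (\<forall>r. 0 \<le> lam r) \<and> decseq lam
     \<and> (\<forall>r. L2_on unit_ivl (psi r))
     \<and> (\<forall>r r'. L2_inner (psi r) (psi r') = (if r = r' then 1 else 0))
     \<and> (\<forall>s\<in>unit_ivl. \<forall>t\<in>unit_ivl. (\<lambda>r. lam r * psi r s * psi r t) sums kern s t)"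

definition omega ::
  "(real \<Rightarrow> real \<Rightarrow> real) \<Rightarrow> (nat \<Rightarrow> real) \<Rightarrow> (nat \<Rightarrow> real \<Rightarrow> real) \<Rightarrow> nat \<Rightarrow> real" where
  "omega kern lam psi R =
     (SUP (s, t)\<in>unit_sq. \<bar>kern s t - (\<Sum>r<R. lam r * psi r s * psi r t)\<bar>)"

section \<open>Matrices\<close>

definition mtrace :: "real mat \<Rightarrow> real" where
  "mtrace A = (\<Sum>i<dim_row A. A $$ (i, i))"

definition sym_mats :: "nat \<Rightarrow> real mat set" where
  "sym_mats n = {A \<in> carrier_mat n n. transpose_mat A = A}"

definition stiefel :: "nat \<Rightarrow> nat \<Rightarrow> real mat set" where
  "stiefel R K = {U \<in> carrier_mat K R. transpose_mat U * U = 1\<^sub>m R}"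

definition pos_diag :: "nat \<Rightarrow> real mat set" where
  "pos_diag R = {D \<in> carrier_mat R R. diagonal_mat D \<and> (\<forall>r<R. 0 < D $$ (r, r))}"

definition psd :: "nat \<Rightarrow> real mat \<Rightarrow> bool" where
  "psd n A \<longleftrightarrow> A \<in> sym_mats n \<and> (\<forall>v\<in>carrier_vec n. 0 \<le> v \<bullet> (A *\<^sub>v v))"

definition pd :: "nat \<Rightarrow> real mat \<Rightarrow> bool" where
  "pd n A \<longleftrightarrow> A \<in> sym_mats n \<and> (\<forall>v\<in>carrier_vec n. v \<noteq> 0\<^sub>v n \<longrightarrow> 0 < v \<bullet> (A *\<^sub>v v))"

(* f(A) = Q diag(f d) Q^T for any eigendecomposition A = Q diag(d) Q^T of a symmetric matrix A;
   the result does not depend on the decomposition. *)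
definition mat_fun :: "(real \<Rightarrow> real) \<Rightarrow> real mat \<Rightarrow> real mat" where
  "mat_fun f A = (THE B. \<exists>Q\<in>stiefel (dim_row A) (dim_row A). \<exists>d.
      A = Q * mat_diag (dim_row A) d * transpose_mat Q
    \<and> B = Q * mat_diag (dim_row A) (\<lambda>i. f (d i)) * transpose_mat Q)"

definition matrix_monotone :: "(real \<Rightarrow> real) \<Rightarrow> bool" where
  "matrix_monotone f \<longleftrightarrow>
     (\<forall>n A B. pd n A \<and> pd n B \<and> psd n (A - B) \<longrightarrow> psd n (mat_fun f A - mat_fun f B))"

(* U consists of the first R columns of an orthonormal eigenbasis of the symmetric matrix W
   arranged by decreasing eigenvalue. *)
definition leading_eigenvectors :: "nat \<Rightarrow> nat \<Rightarrow> real mat \<Rightarrow> real mat \<Rightarrow> bool" where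
  "leading_eigenvectors K R W U \<longleftrightarrow> R \<le> K \<and>
     (\<exists>Q\<in>stiefel K K. \<exists>d. W = Q * mat_diag K d * transpose_mat Q
        \<and> (\<forall>i j. i \<le> j \<and> j < K \<longrightarrow> d j \<le> d i)
        \<and> U = Matrix.mat K R (\<lambda>(i, r). Q $$ (i, r)))"

section \<open>Splines\<close>

definition knot_seq :: "nat \<Rightarrow> (nat \<Rightarrow> real) \<Rightarrow> bool" where
  "knot_seq J \<tau> \<longleftrightarrow> \<tau> 0 = 0 \<and> \<tau> J = 1 \<and> (\<forall>i<J. \<tau> i < \<tau> (Suc i))"

definition mesh :: "nat \<Rightarrow> (nat \<Rightarrow> real) \<Rightarrow> real" where
  "mesh J \<tau> = Max ((\<lambda>i. \<tau> (Suc i) - \<tau> i) ` {..<J})"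

(* Piecewise polynomials of degree at most m whose derivatives of order < m match at the interior
   knots. Only the values on the unit interval matter. *)
definition spline_space :: "nat \<Rightarrow> nat \<Rightarrow> (nat \<Rightarrow> real) \<Rightarrow> (real \<Rightarrow> real) set" where
  "spline_space m J \<tau> = {f. \<exists>pc :: nat \<Rightarrow> real poly.
     (\<forall>i<J. degree (pc i) \<le> m \<and> (\<forall>t\<in>{\<tau> i..\<tau> (Suc i)}. f t = poly (pc i) t))
     \<and> (\<forall>i k. Suc i < J \<and> k < m \<longrightarrow>
          poly ((pderiv ^^ k) (pc i)) (\<tau> (Suc i))
            = poly ((pderiv ^^ k) (pc (Suc i))) (\<tau> (Suc i)))}"

definition orthonormal_spline_basis ::
  "nat \<Rightarrow> nat \<Rightarrow> (nat \<Rightarrow> real) \<Rightarrow> nat \<Rightarrow> (nat \<Rightarrow> real \<Rightarrow> real) \<Rightarrow> bool" where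
  "orthonormal_spline_basis m J \<tau> K b \<longleftrightarrow>
     (\<forall>k<K. b k \<in> spline_space m J \<tau>)
     \<and> (\<forall>k<K. \<forall>l<K. L2_inner (b k) (b l) = (if k = l then 1 else 0))
     \<and> (\<forall>f\<in>spline_space m J \<tau>. \<exists>c. \<forall>t\<in>unit_ivl. f t = (\<Sum>k<K. c k * b k t))"

definition basis_vec :: "nat \<Rightarrow> (nat \<Rightarrow> real \<Rightarrow> real) \<Rightarrow> real \<Rightarrow> real vec" where
  "basis_vec K b t = Matrix.vec K (\<lambda>k. b k t)"

(* For q = m the q-th derivative is undefined at the finitely many knots, a null set. *)
definition Gamma_mat :: "nat \<Rightarrow> nat \<Rightarrow> (nat \<Rightarrow> real \<Rightarrow> real) \<Rightarrow> real mat" where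
  "Gamma_mat q K b =
     Matrix.mat K K (\<lambda>(k, l). L2_inner ((deriv ^^ q) (b k)) ((deriv ^^ q) (b l)))"

definition cov_approx_error ::
  "(real \<Rightarrow> real \<Rightarrow> real) \<Rightarrow> nat \<Rightarrow> (nat \<Rightarrow> real \<Rightarrow> real) \<Rightarrow> real mat \<Rightarrow> real" where
  "cov_approx_error kern K b W = (LINT z:unit_sq|lborel.
     (kern (fst z) (snd z) - basis_vec K b (fst z) \<bullet> (W *\<^sub>v basis_vec K b (snd z)))\<^sup>2)"

section \<open>Loss function\<close>

definition strictly_convex_pos :: "(real \<Rightarrow> real) \<Rightarrow> bool" where
  "strictly_convex_pos f \<longleftrightarrow> (\<forall>a>0. \<forall>c>0. \<forall>w. a \<noteq> c \<and> 0 < w \<and> w < 1 \<longrightarrow>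
     f ((1 - w) * a + w * c) < (1 - w) * f a + w * f c)"

definition C2_pos :: "(real \<Rightarrow> real) \<Rightarrow> bool" where
  "C2_pos f \<longleftrightarrow> (\<forall>a>0. f differentiable at a \<and> deriv f differentiable at a)
     \<and> continuous_on {0<..} (deriv (deriv f))"

definition C_mu :: "real measure \<Rightarrow> real" where
  "C_mu \<mu> = (LINT \<xi>:{0..}|\<mu>. 1 / (\<xi>\<^sup>2 + 1))"

(* The measure may charge 0: f a = - 1 / a, i.e. the log-determinant loss, has \<mu> = the unit mass
   at 0. *)
definition lowner_representation ::
  "(real \<Rightarrow> real) \<Rightarrow> real \<Rightarrow> real \<Rightarrow> real measure \<Rightarrow> bool" where
  "lowner_representation f \<alpha> \<beta> \<mu> \<longleftrightarrow>
     0 \<le> \<beta> \<and> sets \<mu> = sets borel \<and> set_integrable \<mu> {0..} (\<lambda>\<xi>. 1 / (\<xi>\<^sup>2 + 1))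
     \<and> (\<forall>a>0. f a = \<alpha> + \<beta> * a + (LINT \<xi>:{0..}|\<mu>. \<xi> / (\<xi>\<^sup>2 + 1) - 1 / (\<xi> + a)))"

definition seed_function :: "(real \<Rightarrow> real) \<Rightarrow> bool" where
  "seed_function \<phi> \<longleftrightarrow> strictly_convex_pos \<phi> \<and> C2_pos \<phi> \<and> matrix_monotone (deriv \<phi>)
     \<and> (\<exists>\<alpha> \<beta> \<mu>. lowner_representation (deriv \<phi>) \<alpha> \<beta> \<mu> \<and> 0 < \<beta> + C_mu \<mu>)"

definition spline_cov ::
  "nat \<Rightarrow> (nat \<Rightarrow> real \<Rightarrow> real) \<Rightarrow> real mat \<Rightarrow> real mat \<Rightarrow> real \<Rightarrow> real \<Rightarrow> real" where
  "spline_cov K b U D s t = basis_vec K b s \<bullet> ((U * D * transpose_mat U) *\<^sub>v basis_vec K b t)"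

definition model_cov ::
  "nat \<Rightarrow> (nat \<Rightarrow> real \<Rightarrow> real) \<Rightarrow> real mat \<Rightarrow> real mat \<Rightarrow> real \<Rightarrow> nat \<Rightarrow> (nat \<Rightarrow> real) \<Rightarrow> real mat" where
  "model_cov K b U D v M t =
     Matrix.mat M M (\<lambda>(i, j). spline_cov K b U D (t i) (t j)) + v \<cdot>\<^sub>m 1\<^sub>m M"

definition emp_cov :: "nat \<Rightarrow> (nat \<Rightarrow> real) \<Rightarrow> real mat" where
  "emp_cov M y = Matrix.mat M M (\<lambda>(i, j). y i * y j)"

(* In loss and pen_loss below, t n j and y n j are the sampling points and observations. *)
definition loss ::
  "(real \<Rightarrow> real) \<Rightarrow> nat \<Rightarrow> (nat \<Rightarrow> real \<Rightarrow> real) \<Rightarrow> nat \<Rightarrow> (nat \<Rightarrow> nat)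
     \<Rightarrow> (nat \<Rightarrow> nat \<Rightarrow> real) \<Rightarrow> (nat \<Rightarrow> nat \<Rightarrow> real) \<Rightarrow> real mat \<times> real mat \<times> real \<Rightarrow> real" where
  "loss \<phi> K b N Mn t y = (\<lambda>(U, D, v).
     1 / real N * (\<Sum>n<N. 1 / (real (Mn n))\<^sup>2 *
       (let C = model_cov K b U D v (Mn n) (t n); S = emp_cov (Mn n) (y n)
        in mtrace (- mat_fun \<phi> C - mat_fun (deriv \<phi>) C * (S - C)))))"

definition pen_loss ::
  "(real \<Rightarrow> real) \<Rightarrow> nat \<Rightarrow> real \<Rightarrow> nat \<Rightarrow> (nat \<Rightarrow> real \<Rightarrow> real) \<Rightarrow> nat \<Rightarrow> (nat \<Rightarrow> nat)
     \<Rightarrow> (nat \<Rightarrow> nat \<Rightarrow> real) \<Rightarrow> (nat \<Rightarrow> nat \<Rightarrow> real) \<Rightarrow> real mat \<times> real mat \<times> real \<Rightarrow> real" where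
  "pen_loss \<phi> q \<eta> K b N Mn t y = (\<lambda>(U, D, v).
     loss \<phi> K b N Mn t y (U, D, v) + \<eta> * mtrace (transpose_mat U * Gamma_mat q K b * U))"

definition param_set ::
  "nat \<Rightarrow> nat \<Rightarrow> nat \<Rightarrow> (nat \<Rightarrow> real \<Rightarrow> real) \<Rightarrow> real \<Rightarrow> real \<Rightarrow> real
     \<Rightarrow> (real mat \<times> real mat \<times> real) set" where
  "param_set R q K b b0 b1 b2 = {(U, D, v).
     U \<in> stiefel R K \<and> D \<in> pos_diag R \<and> 0 < v
     \<and> mtrace (transpose_mat U * Gamma_mat q K b * U) \<le> b0
     \<and> (\<forall>r<R. D $$ (r, r) \<in> {b1..b2}) \<and> v \<in> {b1..b2}}"

definition psi_est :: "nat \<Rightarrow> (nat \<Rightarrow> real \<Rightarrow> real) \<Rightarrow> real mat \<Rightarrow> nat \<Rightarrow> real \<Rightarrow> real" where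
  "psi_est K b U r t = basis_vec K b t \<bullet> col U r"

section \<open>Sampling model\<close>

(* The random function is a jointly measurable x on a probability space P; x_n is its realization
   at the n-th of independent draws xi n from P, i.e. x_n(t) = x (xi n w) t. Joint measurability
   makes the evaluation at random points well behaved. *)
definition random_function :: "'s measure \<Rightarrow> ('s \<Rightarrow> real \<Rightarrow> real) \<Rightarrow> bool" where
  "random_function P x \<longleftrightarrow> prob_space P
     \<and> (\<lambda>(\<zeta>, t). x \<zeta> t) \<in> borel_measurable (P \<Otimes>\<^sub>M restrict_space borel unit_ivl)
     \<and> (\<forall>t\<in>unit_ivl. integrable P (\<lambda>\<zeta>. (x \<zeta> t)\<^sup>2))"

datatype source = Curve nat | Design nat nat | Noise nat nat

definition sources :: "(nat \<Rightarrow> nat) \<Rightarrow> source set" where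
  "sources Mn = range Curve \<union> {Design n j |n j. j < Mn n} \<union> {Noise n j |n j. j < Mn n}"

definition independent_sources ::
  "'w measure \<Rightarrow> 's measure \<Rightarrow> (nat \<Rightarrow> 'w \<Rightarrow> 's) \<Rightarrow> (nat \<Rightarrow> nat \<Rightarrow> 'w \<Rightarrow> real)
     \<Rightarrow> (nat \<Rightarrow> nat \<Rightarrow> 'w \<Rightarrow> real) \<Rightarrow> (nat \<Rightarrow> nat) \<Rightarrow> bool" where
  "independent_sources \<Omega> P xi u eps Mn \<longleftrightarrow>
     prob_space.indep_sets \<Omega> (\<lambda>i. case i of
         Curve n \<Rightarrow> sets (vimage_algebra (space \<Omega>) (xi n) P)
       | Design n j \<Rightarrow> sets (vimage_algebra (space \<Omega>) (u n j) borel)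
       | Noise n j \<Rightarrow> sets (vimage_algebra (space \<Omega>) (eps n j) borel)) (sources Mn)"

definition observation ::
  "('s \<Rightarrow> real \<Rightarrow> real) \<Rightarrow> (nat \<Rightarrow> 'w \<Rightarrow> 's) \<Rightarrow> (nat \<Rightarrow> nat \<Rightarrow> 'w \<Rightarrow> real)
     \<Rightarrow> (nat \<Rightarrow> nat \<Rightarrow> 'w \<Rightarrow> real) \<Rightarrow> 'w \<Rightarrow> nat \<Rightarrow> nat \<Rightarrow> real" where
  "observation x xi u eps w n j = x (xi n w) (u n j w) + eps n j w"

definition curve_vec ::
  "('s \<Rightarrow> real \<Rightarrow> real) \<Rightarrow> (nat \<Rightarrow> 'w \<Rightarrow> 's) \<Rightarrow> (nat \<Rightarrow> nat \<Rightarrow> 'w \<Rightarrow> real) \<Rightarrow> (nat \<Rightarrow> nat)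
     \<Rightarrow> nat \<Rightarrow> 'w \<Rightarrow> real vec" where
  "curve_vec x xi u Mn n w = Matrix.vec (Mn n) (\<lambda>j. x (xi n w) (u n j w))"

definition design_algebra ::
  "'w measure \<Rightarrow> (nat \<Rightarrow> nat \<Rightarrow> 'w \<Rightarrow> real) \<Rightarrow> (nat \<Rightarrow> nat) \<Rightarrow> nat \<Rightarrow> 'w measure" where
  "design_algebra \<Omega> u Mn n =
     vimage_algebra (space \<Omega>) (\<lambda>w. \<lambda>j\<in>{..<Mn n}. u n j w) (\<Pi>\<^sub>M j\<in>{..<Mn n}. borel)"

(* The conditional moments are those of nonnegative variables and are taken in ennreal: the
   real-valued conditional expectation would be 0 for a non-integrable fourth power. *)
definition conditional_kurtosis_bound ::
  "'w measure \<Rightarrow> ('s \<Rightarrow> real \<Rightarrow> real) \<Rightarrow> (nat \<Rightarrow> 'w \<Rightarrow> 's) \<Rightarrow> (nat \<Rightarrow> nat \<Rightarrow> 'w \<Rightarrow> real)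
     \<Rightarrow> (nat \<Rightarrow> nat) \<Rightarrow> real \<Rightarrow> bool" where
  "conditional_kurtosis_bound \<Omega> x xi u Mn C \<longleftrightarrow>
     (\<forall>n. \<forall>v\<in>carrier_vec (Mn n). AE w in \<Omega>.
        nn_cond_exp \<Omega> (design_algebra \<Omega> u Mn n)
            (\<lambda>w. ennreal ((curve_vec x xi u Mn n w \<bullet> v) ^ 4)) w
        \<le> ennreal C * (nn_cond_exp \<Omega> (design_algebra \<Omega> u Mn n)
            (\<lambda>w. ennreal ((curve_vec x xi u Mn n w \<bullet> v)\<^sup>2)) w)\<^sup>2)"

(* X_N = o_p(1). With the outer probability no measurability of X_N is needed; for measurable X_N
   this is convergence to 0 in probability. *)
definition small_o_p1 :: "'w measure \<Rightarrow> (nat \<Rightarrow> 'w \<Rightarrow> real) \<Rightarrow> bool" where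
  "small_o_p1 \<Omega> X \<longleftrightarrow>
     (\<forall>\<epsilon>>0. (\<lambda>N. outer_measure_of \<Omega> {w \<in> space \<Omega>. \<bar>X N w\<bar> > \<epsilon>}) \<longlonglongrightarrow> 0)"

end

(* On the constraint set the functions b^T u are normalised in L2 and have q-th derivative bounded in L2,
   so a one-dimensional Sobolev inequality makes them uniformly bounded and uniformly Hoelder continuous
   of order 1/2, whatever the knots. Hence all candidate covariance kernels lie in one fixed totally
   bounded class, and a finite net together with the weak law of large numbers makes the loss converge
   uniformly in probability to its expectation. Up to a constant, that expectation is the average over n
   of E Breg(K_n, C_n) / M_n^2 for the matrix Bregman divergence of the seed function. Strict convexity
   makes it control the squared Frobenius distance of K_n and C_n, hence, the sampling density being
   bounded below, the Hilbert-Schmidt distance of the kernels and the error of the noise variance. The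
   optimal parameters have small risk because splines are dense, so the minimizer has small risk too,
   and the spectral gap turns closeness of kernels into closeness of eigenvalues and eigenfunctions. *)
theory Submission
  imports Defs "Jordan_Normal_Form.Determinant"
begin

text \<open>As K grows with N, compactness is available only for the pair of kernel and noise
  variance, never for \<open>U\<close> and \<open>D\<close>. Positive semidefiniteness plus noise at
  least b1, with at most Mx observations per subject, puts all eigenvalues into one compact
  subinterval of the positive reals, where \<phi> and its derivative are bounded and uniformly
  continuous. Strict convexity gives no quadratic lower bound for the divergence, so all comparisons
  have the form "additive error plus constant times divergence", which is enough for consistency.
  Matrix inequalities are reduced to scalar ones by the squared inner products of two eigenbases,
  which are doubly stochastic. One off-diagonal covariance entry identifies the kernel in mean
  square; equicontinuity then makes this uniform, and only a uniform bound lets a diagonal entry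
  identify the noise variance. Since subjects differ in M_n, only the risk averaged over n is
  controlled, but the lower bounds hold for each n with the same constants, so one n with small risk
  suffices.\<close>

section \<open>The spectral theorem for real symmetric matrices\<close>

text \<open>A first-order term dominated by a second-order one, for both signs of t, vanishes. It
  turns maximality of the Rayleigh quotient into stationarity.\<close>

lemma quadratic_dominated_imp_zero:
  fixes B c :: real
  assumes "\<And>t. 2 * t * B \<le> t\<^sup>2 * c"
  shows "B = 0"
proof -
  \<comment> \<open>\<open>c\<close> may be zero or negative, so a positive majorant of it is the
    denominator of the test value t = B / d.\<close>
  define d where "d = \<bar>c\<bar> + 1"
  have d: "d > 0" "c < d" by (auto simp: d_def)
  have "2 * (B / d) * B \<le> (B / d)\<^sup>2 * c" by (rule assms)
  then have "2 * B\<^sup>2 * d \<le> B\<^sup>2 * c"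
    using d by (simp add: field_simps power2_eq_square)
  also have "\<dots> \<le> B\<^sup>2 * d" using d by (intro mult_left_mono) auto
  finally have "B\<^sup>2 * d \<le> 0" by (simp add: algebra_simps)
  then show ?thesis using d
    by (simp add: mult_le_0_iff)
qed

text \<open>Fewer equations than unknowns: filled up with zero rows, the coefficients form a square
  matrix whose transpose kills the k-th unit vector, so it is singular and has a kernel vector to
  normalise.\<close>

lemma exists_orthogonal_vector:
  fixes v :: "nat \<Rightarrow> nat \<Rightarrow> real"
  assumes "k < n"
  shows "\<exists>x. (\<forall>i\<ge>n. x i = 0) \<and> (\<Sum>i<n. x i * x i) = 1 \<and> (\<forall>j<k. (\<Sum>i<n. v j i * x i) = 0)"
proof -
  define A where "A = Matrix.mat n n (\<lambda>(j, i). if j < k then v j i else 0)"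
  have A: "A \<in> carrier_mat n n" by (simp add: A_def)
  have "\<exists>w. w \<in> carrier_vec n \<and> w \<noteq> 0\<^sub>v n \<and> transpose_mat A *\<^sub>v w = 0\<^sub>v n"
  proof (intro exI conjI)
    show "unit_vec n k \<noteq> (0\<^sub>v n :: real vec)" using assms
      by (metis index_unit_vec(1) index_zero_vec(1) zero_neq_one)
    show "transpose_mat A *\<^sub>v unit_vec n k = 0\<^sub>v n"
    proof (rule eq_vecI)
      fix i assume "i < dim_vec (0\<^sub>v n :: real vec)"
      then have i: "i < n" by simp
      then have "(transpose_mat A *\<^sub>v unit_vec n k) $ i = row (transpose_mat A) i \<bullet> unit_vec n k"
        by (simp add: A_def)
      also have "\<dots> = row (transpose_mat A) i $ k"
        by (rule scalar_prod_right_unit[OF assms])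
      also have "\<dots> = 0" using i assms by (simp add: A_def)
      finally show "(transpose_mat A *\<^sub>v unit_vec n k) $ i = 0\<^sub>v n $ i" using i by simp
    qed (simp add: A_def)
  qed (use assms in auto)
  then have "det (transpose_mat A) = 0"
    using det_0_iff_vec_prod_zero[of "transpose_mat A" n] A by simp
  then have "det A = 0" using det_transpose[OF A] by simp
  then obtain w where w: "w \<in> carrier_vec n" "w \<noteq> 0\<^sub>v n" "A *\<^sub>v w = 0\<^sub>v n"
    using det_0_iff_vec_prod_zero[OF A] by auto
  have wz: "(\<Sum>i<n. v j i * w $ i) = 0" if "j < k" for j
  proof -
    have "(A *\<^sub>v w) $ j = (\<Sum>i<n. v j i * w $ i)"
      using that assms w(1) by (auto simp: A_def scalar_prod_def lessThan_atLeast0 intro!: sum.cong)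
    then show ?thesis using w(3) that assms by simp
  qed
  define s where "s = (\<Sum>i<n. w $ i * w $ i)"
  obtain i0 where i0: "i0 < n" "w $ i0 \<noteq> 0"
    using w(1,2) by (metis carrier_vecD eq_vecI index_zero_vec(1) index_zero_vec(2))
  have "w $ i0 * w $ i0 \<le> s" unfolding s_def
    by (rule member_le_sum) (use i0 in auto)
  moreover have "w $ i0 * w $ i0 > 0" using i0(2) by (metis not_real_square_gt_zero)
  ultimately have s: "s > 0" by linarith
  define x where "x i = (if i < n then w $ i / sqrt s else 0)" for i
  have "(\<Sum>i<n. x i * x i) = (\<Sum>i<n. w $ i * w $ i) / s"
    using s by (simp add: x_def sum_divide_distrib)
  also have "\<dots> = 1" using s by (simp add: s_def)
  finally have "(\<Sum>i<n. x i * x i) = 1" .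
  moreover have "(\<Sum>i<n. v j i * x i) = 0" if "j < k" for j
  proof -
    have "(\<Sum>i<n. v j i * x i) = (\<Sum>i<n. v j i * w $ i) / sqrt s"
      by (simp add: x_def sum_divide_distrib)
    then show ?thesis using wz[OF that] by simp
  qed
  ultimately show ?thesis by (intro exI[of _ x]) (auto simp: x_def)
qed

text \<open>Vectors are functions on all naturals that vanish from n on, so one type serves every
  dimension. The coordinates of a unit vector lie in [-1, 1], and a product of compact intervals is
  compact.\<close>

lemma compact_orthogonal_sphere:
  fixes v :: "nat \<Rightarrow> nat \<Rightarrow> real"
  shows "compact {x :: nat \<Rightarrow> real. (\<forall>i\<ge>n. x i = 0) \<and> (\<Sum>i<n. x i * x i) = 1
    \<and> (\<forall>j<k. (\<Sum>i<n. v j i * x i) = 0)}" (is "compact ?S")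
proof -
  have "compactin (product_topology (\<lambda>i. euclidean) UNIV) (PiE UNIV (\<lambda>i::nat. {-1..1::real}))"
    by (subst compactin_PiE) auto
  then have c: "compact (PiE UNIV (\<lambda>i::nat. {-1..1::real}))"
    by (simp add: euclidean_product_topology)
  have sub: "?S \<subseteq> PiE UNIV (\<lambda>i::nat. {-1..1::real})"
  proof
    fix x assume x: "x \<in> ?S"
    have "x i \<in> {-1..1}" for i
    proof (cases "i < n")
      case True
      have "x i * x i \<le> (\<Sum>i<n. x i * x i)" by (rule member_le_sum) (use True in auto)
      then have "(x i)\<^sup>2 \<le> 1" using x by (simp add: power2_eq_square)
      then show ?thesis by (auto simp: abs_square_le_1)
    qed (use x in auto)
    then show "x \<in> PiE UNIV (\<lambda>i::nat. {-1..1::real})" by auto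
  qed
  have "?S = (\<Inter>i\<in>{n..}. {x. x i = 0}) \<inter> {x. (\<Sum>i<n. x i * x i) = 1}
      \<inter> (\<Inter>j\<in>{..<k}. {x. (\<Sum>i<n. v j i * x i) = 0})" by auto
  also have "closed \<dots>"
    by (intro closed_Int closed_INT ballI closed_Collect_eq continuous_intros
        continuous_on_product_coordinates)
  finally have "closed ?S" .
  then have "compact (PiE UNIV (\<lambda>i::nat. {-1..1::real}) \<inter> ?S)"
    by (rule compact_Int_closed[OF c])
  then show ?thesis using sub by (simp add: Int_absorb1)
qed

text \<open>A maximiser of the quadratic form on the unit sphere of the orthogonal complement is an
  eigenvector; symmetry keeps the residual inside the complement.\<close>

lemma next_eigenvector:
  fixes a v :: "nat \<Rightarrow> nat \<Rightarrow> real" and e :: "nat \<Rightarrow> real"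
  assumes sym: "\<And>i j. i < n \<Longrightarrow> j < n \<Longrightarrow> a i j = a j i"
    and kn: "k < n"
    and ev: "\<And>j l. j < k \<Longrightarrow> l < n \<Longrightarrow> (\<Sum>i<n. a l i * v j i) = e j * v j l"
  shows "\<exists>x \<mu>. (\<Sum>i<n. x i * x i) = 1 \<and> (\<forall>j<k. (\<Sum>i<n. v j i * x i) = 0)
    \<and> (\<forall>l<n. (\<Sum>i<n. a l i * x i) = \<mu> * x l)"
proof -
  define S where "S = {x :: nat \<Rightarrow> real. (\<forall>i\<ge>n. x i = 0) \<and> (\<Sum>i<n. x i * x i) = 1
    \<and> (\<forall>j<k. (\<Sum>i<n. v j i * x i) = 0)}"
  define bl where "bl x y = (\<Sum>i<n. \<Sum>j<n. a i j * x j * y i)" for x y :: "nat \<Rightarrow> real"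
  have "compact S" unfolding S_def by (rule compact_orthogonal_sphere)
  moreover have "S \<noteq> {}" using exists_orthogonal_vector[OF kn, of v] by (auto simp: S_def)
  moreover have "continuous_on S (\<lambda>x. bl x x)" unfolding bl_def
    by (intro continuous_intros continuous_on_subset[OF continuous_on_product_coordinates]) auto
  ultimately obtain x where x: "x \<in> S" "\<And>y. y \<in> S \<Longrightarrow> bl y y \<le> bl x x"
    using continuous_attains_sup[of S "\<lambda>x. bl x x"] by blast
  define \<mu> where "\<mu> = bl x x"
  have x1: "(\<Sum>i<n. x i * x i) = 1" and x2: "\<And>j. j < k \<Longrightarrow> (\<Sum>i<n. v j i * x i) = 0"
    using x(1) by (auto simp: S_def)
  have bl_sym: "bl y z = bl z y" for y z
  proof -
    have "bl y z = (\<Sum>j<n. \<Sum>i<n. a i j * y j * z i)"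
      unfolding bl_def by (rule sum.swap)
    also have "\<dots> = bl z y" unfolding bl_def using sym
      by (intro sum.cong) (auto simp: mult_ac)
    finally show ?thesis .
  qed
  have bl_lin: "bl (\<lambda>i. y i + t * z i) w = bl y w + t * bl z w" for y z w t
    by (simp add: bl_def algebra_simps sum.distrib sum_distrib_left)
  \<comment> \<open>First variation along an admissible direction \<open>y\<close>: the normalised
    point x + t y competes with the maximiser, and for some small t it would win unless
    \<open>bl x y\<close> were 0.\<close>
  have stat: "bl x y = 0" if y1: "(\<Sum>i<n. x i * y i) = 0"
    and y2: "\<And>j. j < k \<Longrightarrow> (\<Sum>i<n. v j i * y i) = 0" and y3: "\<And>i. i \<ge> n \<Longrightarrow> y i = 0" for y
  proof (rule quadratic_dominated_imp_zero)
    fix t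
    define N where "N = (\<Sum>i<n. y i * y i)"
    define z where "z = (\<lambda>i. x i + t * y i)"
    define s where "s = (\<Sum>i<n. z i * z i)"
    have "s = (\<Sum>i<n. x i * x i) + 2 * t * (\<Sum>i<n. x i * y i) + t\<^sup>2 * N"
      unfolding s_def z_def N_def
      by (simp add: algebra_simps sum.distrib sum_distrib_left power2_eq_square)
    then have s: "s = 1 + t\<^sup>2 * N" using x1 y1 by simp
    have "N \<ge> 0" unfolding N_def by (intro sum_nonneg) auto
    then have s0: "s > 0" using s by (simp add: add_pos_nonneg)
    define z' where "z' i = z i / sqrt s" for i
    have "z' \<in> S"
    proof -
      have "(\<Sum>i<n. z' i * z' i) = s / s"
        using s0 by (simp add: z'_def s_def flip: sum_divide_distrib)
      moreover have "(\<Sum>i<n. v j i * z' i) = 0" if "j < k" for j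
      proof -
        have "(\<Sum>i<n. v j i * z' i) = ((\<Sum>i<n. v j i * x i) + t * (\<Sum>i<n. v j i * y i)) / sqrt s"
          by (simp add: z'_def z_def algebra_simps sum.distrib sum_distrib_left
              sum_divide_distrib add_divide_distrib)
        then show ?thesis using x2[OF that] y2[OF that] by simp
      qed
      ultimately show ?thesis using s0 x(1) y3 by (auto simp: S_def z'_def z_def)
    qed
    then have "bl z' z' \<le> \<mu>" using x(2) by (simp add: \<mu>_def)
    moreover have "bl z' z' = bl z z / s"
      using s0 by (simp add: bl_def z'_def sum_divide_distrib mult.assoc)
    ultimately have "bl z z \<le> \<mu> * s" using s0 by (simp add: field_simps)
    moreover have "bl z z = bl x z + t * bl y z"
      unfolding z_def by (rule bl_lin)
    moreover have "bl x z = bl x x + t * bl y x"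
      using bl_lin[of x t y x] bl_sym[of z x] by (simp add: z_def)
    moreover have "bl y z = bl x y + t * bl y y"
      using bl_lin[of x t y y] bl_sym[of y z] by (simp add: z_def)
    ultimately have "bl x x + 2 * t * bl x y + t\<^sup>2 * bl y y \<le> \<mu> * (1 + t\<^sup>2 * N)"
      using s bl_sym[of x y] by (simp add: algebra_simps power2_eq_square)
    then show "2 * t * bl x y \<le> t\<^sup>2 * (\<mu> * N - bl y y)"
      by (simp add: \<mu>_def algebra_simps)
  qed
  \<comment> \<open>The residual A x - \<mu> x is itself an admissible direction. As
    \<open>bl x y\<close> equals its squared length, stationarity makes it vanish.\<close>
  define y where "y l = (if l < n then (\<Sum>i<n. a l i * x i) - \<mu> * x l else 0)" for l
  have bl_y: "bl x w = (\<Sum>l<n. (y l + \<mu> * x l) * w l)" for w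
    by (simp add: bl_def y_def sum_distrib_right)
  have "bl x y = 0"
  proof (rule stat)
    have "\<mu> = (\<Sum>l<n. x l * y l) + \<mu> * (\<Sum>l<n. x l * x l)"
      using bl_y[of x] by (simp add: \<mu>_def algebra_simps sum.distrib sum_distrib_left)
    then show "(\<Sum>i<n. x i * y i) = 0" using x1 by simp
  next
    fix j assume j: "j < k"
    have "(\<Sum>i<n. v j i * y i) = bl x (v j) - \<mu> * (\<Sum>i<n. v j i * x i)"
      by (simp add: bl_y algebra_simps sum.distrib sum_distrib_left)
    also have "bl x (v j) = bl (v j) x" by (rule bl_sym)
    also have "\<dots> = (\<Sum>l<n. e j * v j l * x l)"
      unfolding bl_def using ev[OF j] by (intro sum.cong) (auto simp flip: sum_distrib_right)
    also have "\<dots> = e j * (\<Sum>l<n. v j l * x l)" by (simp add: sum_distrib_left mult.assoc)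
    finally show "(\<Sum>i<n. v j i * y i) = 0" using x2[OF j] by simp
  qed (simp add: y_def)
  then have "(\<Sum>l<n. y l * y l) + \<mu> * (\<Sum>l<n. x l * y l) = 0"
    using bl_y[of y] by (simp add: algebra_simps sum.distrib sum_distrib_left)
  moreover have "(\<Sum>l<n. x l * y l) = 0"
  proof -
    have "\<mu> = (\<Sum>l<n. x l * y l) + \<mu> * (\<Sum>l<n. x l * x l)"
      using bl_y[of x] by (simp add: \<mu>_def algebra_simps sum.distrib sum_distrib_left)
    then show ?thesis using x1 by simp
  qed
  ultimately have "(\<Sum>l<n. y l * y l) = 0" by simp
  then have "\<forall>l\<in>{..<n}. y l * y l = 0"
    by (subst (asm) sum_nonneg_eq_0_iff) auto
  then have "\<forall>l<n. (\<Sum>i<n. a l i * x i) = \<mu> * x l" by (auto simp: y_def)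
  then show ?thesis using x1 x2 by blast
qed

lemma orthonormal_eigenvectors:
  fixes a :: "nat \<Rightarrow> nat \<Rightarrow> real"
  assumes sym: "\<And>i j. i < n \<Longrightarrow> j < n \<Longrightarrow> a i j = a j i" and "k \<le> n"
  shows "\<exists>v e. (\<forall>i<k. \<forall>j<k. (\<Sum>l<n. v i l * v j l) = (if i = j then 1 else 0))
    \<and> (\<forall>j<k. \<forall>l<n. (\<Sum>i<n. a l i * v j i) = e j * v j l)"
  using \<open>k \<le> n\<close>
proof (induction k)
  case 0
  then show ?case by auto
next
  case (Suc k)
  then obtain v e where v: "\<And>i j. i < k \<Longrightarrow> j < k \<Longrightarrow> (\<Sum>l<n. v i l * v j l) = (if i = j then 1 else 0)"
    and e: "\<And>j l. j < k \<Longrightarrow> l < n \<Longrightarrow> (\<Sum>i<n. a l i * v j i) = e j * v j l"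
    by (metis Suc_leD)
  obtain x \<mu> where x: "(\<Sum>i<n. x i * x i) = 1" "\<And>j. j < k \<Longrightarrow> (\<Sum>i<n. v j i * x i) = 0"
    "\<And>l. l < n \<Longrightarrow> (\<Sum>i<n. a l i * x i) = \<mu> * x l"
    using next_eigenvector[where n = n and k = k and a = a and v = v and e = e] e sym Suc.prems
    by auto
  have x': "(\<Sum>i<n. x i * v j i) = 0" if "j < k" for j
    using x(2)[OF that] by (simp add: mult.commute)
  show ?case
    by (rule exI[of _ "v(k := x)"], rule exI[of _ "e(k := \<mu>)"])
      (auto simp: less_Suc_eq v e x x')
qed

lemma stiefelD:
  assumes "Q \<in> stiefel R n"
  shows "Q \<in> carrier_mat n R"
    and "\<lbrakk>k < R; l < R\<rbrakk> \<Longrightarrow> (\<Sum>i<n. Q $$ (i, k) * Q $$ (i, l)) = (if k = l then 1 else 0)"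
proof -
  show Q: "Q \<in> carrier_mat n R" using assms by (simp add: stiefel_def)
  assume kl: "k < R" "l < R"
  have "(transpose_mat Q * Q) $$ (k, l) = (\<Sum>i<n. Q $$ (i, k) * Q $$ (i, l))"
    using Q kl by (auto simp: scalar_prod_def lessThan_atLeast0)
  moreover have "transpose_mat Q * Q = 1\<^sub>m R" using assms by (simp add: stiefel_def)
  ultimately show "(\<Sum>i<n. Q $$ (i, k) * Q $$ (i, l)) = (if k = l then 1 else 0)"
    using kl by simp
qed

lemma stiefel_rows:
  assumes "Q \<in> stiefel n n" "i < n" "j < n"
  shows "(\<Sum>k<n. Q $$ (i, k) * Q $$ (j, k)) = (if i = j then 1 else 0)"
proof -
  have Q: "Q \<in> carrier_mat n n" by (rule stiefelD[OF assms(1)])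
  have "transpose_mat Q * Q = 1\<^sub>m n" using assms by (simp add: stiefel_def)
  then have "Q * transpose_mat Q = 1\<^sub>m n"
    by (intro mat_mult_left_right_inverse[of "transpose_mat Q"]) (use Q in auto)
  moreover have "(Q * transpose_mat Q) $$ (i, j) = (\<Sum>k<n. Q $$ (i, k) * Q $$ (j, k))"
    using Q assms by (auto simp: scalar_prod_def lessThan_atLeast0)
  ultimately show ?thesis using assms by simp
qed

lemma conj_diag_carrier:
  fixes Q :: "real mat"
  assumes "Q \<in> carrier_mat n R"
  shows "Q * mat_diag R d * transpose_mat Q \<in> carrier_mat n n"
  using assms by auto

lemma conj_diag_entry:
  fixes Q :: "real mat"
  assumes Q: "Q \<in> carrier_mat n R" and ij: "i < n" "j < n"
  shows "(Q * mat_diag R d * transpose_mat Q) $$ (i, j) = (\<Sum>k<R. d k * Q $$ (i, k) * Q $$ (j, k))"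
proof -
  have "Q * mat_diag R d = Matrix.mat n R (\<lambda>(i, k). Q $$ (i, k) * d k)"
    by (rule mat_diag_mult_right[OF Q])
  then show ?thesis using Q ij
    by (auto simp: scalar_prod_def lessThan_atLeast0 mult_ac intro!: sum.cong)
qed

lemma spectral_theorem:
  assumes "A \<in> sym_mats n"
  obtains Q d where "Q \<in> stiefel n n" "A = Q * mat_diag n d * transpose_mat Q"
proof -
  have A: "A \<in> carrier_mat n n" and At: "transpose_mat A = A" using assms by (auto simp: sym_mats_def)
  have sym: "A $$ (i, j) = A $$ (j, i)" if "i < n" "j < n" for i j
    using At A that by (metis carrier_matD index_transpose_mat(1))
  obtain v e where v: "\<And>i j. i < n \<Longrightarrow> j < n \<Longrightarrow> (\<Sum>l<n. v i l * v j l) = (if i = j then 1 else 0 :: real)"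
    and e: "\<And>j l. j < n \<Longrightarrow> l < n \<Longrightarrow> (\<Sum>i<n. A $$ (l, i) * v j i) = e j * v j l"
    using orthonormal_eigenvectors[where n = n and k = n and a = "\<lambda>i j. A $$ (i, j)"] sym by blast
  have e': "(\<Sum>i<n. v j i * A $$ (l, i)) = e j * v j l" if "j < n" "l < n" for j l
    using e[OF that] by (simp add: mult.commute)
  define Q where "Q = Matrix.mat n n (\<lambda>(l, j). v j l)"
  have Q: "Q \<in> carrier_mat n n" by (simp add: Q_def)
  have QQ: "transpose_mat Q * Q = 1\<^sub>m n"
    by (rule eq_matI) (auto simp: Q_def scalar_prod_def v simp flip: lessThan_atLeast0)
  then have QQt: "Q * transpose_mat Q = 1\<^sub>m n"
    by (intro mat_mult_left_right_inverse[of "transpose_mat Q"]) (use Q in auto)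
  have "A * Q = Q * mat_diag n e"
    unfolding mat_diag_mult_right[OF Q] using A
    by (intro eq_matI) (auto simp: Q_def scalar_prod_def e' mult_ac simp flip: lessThan_atLeast0)
  then have "A * Q * transpose_mat Q = Q * mat_diag n e * transpose_mat Q" by simp
  moreover have "A * Q * transpose_mat Q = A"
    using A Q QQt by (subst assoc_mult_mat[of _ n n _ n _ n]) auto
  ultimately show ?thesis using that[of Q e] Q QQ by (auto simp: stiefel_def)
qed

section \<open>Functional calculus through the weights between two eigenbases\<close>

text \<open>This is the trace inner product of two matrices in spectral form. The ranges r and s are
  independent of n, so the identity also covers a single eigenvector (s = 1) against a full
  decomposition.\<close>

lemma sum_conj_diag_mult:
  fixes q p :: "nat \<Rightarrow> nat \<Rightarrow> 'a :: comm_ring_1"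
  shows "(\<Sum>i<n. \<Sum>j<n. (\<Sum>k<r. d k * q i k * q j k) * (\<Sum>l<s. e l * p i l * p j l))
    = (\<Sum>k<r. \<Sum>l<s. (\<Sum>i<n. q i k * p i l)\<^sup>2 * (d k * e l))"
proof -
  have "(\<Sum>i<n. \<Sum>j<n. (\<Sum>k<r. d k * q i k * q j k) * (\<Sum>l<s. e l * p i l * p j l))
    = (\<Sum>i<n. \<Sum>j<n. \<Sum>k<r. \<Sum>l<s. (q i k * p i l) * (q j k * p j l) * (d k * e l))"
    by (simp add: sum_product mult_ac)
  also have "\<dots> = (\<Sum>i<n. \<Sum>k<r. \<Sum>j<n. \<Sum>l<s. (q i k * p i l) * (q j k * p j l) * (d k * e l))"
    by (intro sum.cong refl sum.swap)
  also have "\<dots> = (\<Sum>k<r. \<Sum>i<n. \<Sum>j<n. \<Sum>l<s. (q i k * p i l) * (q j k * p j l) * (d k * e l))"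
    by (rule sum.swap)
  also have "\<dots> = (\<Sum>k<r. \<Sum>i<n. \<Sum>l<s. \<Sum>j<n. (q i k * p i l) * (q j k * p j l) * (d k * e l))"
    by (intro sum.cong refl sum.swap)
  also have "\<dots> = (\<Sum>k<r. \<Sum>l<s. \<Sum>i<n. \<Sum>j<n. (q i k * p i l) * (q j k * p j l) * (d k * e l))"
    by (intro sum.cong refl sum.swap)
  also have "\<dots> = (\<Sum>k<r. \<Sum>l<s. (\<Sum>i<n. q i k * p i l)\<^sup>2 * (d k * e l))"
    unfolding power2_eq_square sum_product by (simp add: sum_distrib_right)
  finally show ?thesis .
qed

text \<open>For two orthonormal bases these squared inner products form a doubly stochastic matrix.
  Comparisons of two matrices without a common eigenbasis become averages of scalar comparisons with
  these weights.\<close>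

definition overlap :: "nat \<Rightarrow> real mat \<Rightarrow> real mat \<Rightarrow> nat \<Rightarrow> nat \<Rightarrow> real" where
  "overlap n Q P k l = (\<Sum>i<n. Q $$ (i, k) * P $$ (i, l))\<^sup>2"

lemma overlap_nonneg: "0 \<le> overlap n Q P k l"
  by (simp add: overlap_def)

lemma overlap_commute: "overlap n Q P k l = overlap n P Q l k"
  by (simp add: overlap_def mult.commute)

lemma overlap_self:
  assumes "Q \<in> stiefel n n" "k < n" "l < n"
  shows "overlap n Q Q k l = (if k = l then 1 else 0)"
  using stiefelD(2)[OF assms] by (simp add: overlap_def)

text \<open>Parseval for the k-th column of \<open>Q\<close> in the basis of the columns of
  \<open>P\<close>; it rests on the rows of \<open>P\<close> being orthonormal too.\<close>

lemma sum_overlap_right: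
  assumes Q: "Q \<in> stiefel n n" and P: "P \<in> stiefel n n" and k: "k < n"
  shows "(\<Sum>l<n. overlap n Q P k l) = 1"
proof -
  have "(\<Sum>l<n. overlap n Q P k l)
      = (\<Sum>l<n. \<Sum>i<n. \<Sum>j<n. Q $$ (i, k) * Q $$ (j, k) * (P $$ (i, l) * P $$ (j, l)))"
    by (simp add: overlap_def power2_eq_square sum_product mult_ac)
  also have "\<dots> = (\<Sum>i<n. \<Sum>l<n. \<Sum>j<n. Q $$ (i, k) * Q $$ (j, k) * (P $$ (i, l) * P $$ (j, l)))"
    by (rule sum.swap)
  also have "\<dots> = (\<Sum>i<n. \<Sum>j<n. \<Sum>l<n. Q $$ (i, k) * Q $$ (j, k) * (P $$ (i, l) * P $$ (j, l)))"
    by (intro sum.cong refl sum.swap)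
  also have "\<dots> = (\<Sum>i<n. \<Sum>j<n. Q $$ (i, k) * Q $$ (j, k) * (if i = j then 1 else 0))"
    by (intro sum.cong refl)
      (simp add: stiefel_rows[OF P] flip: sum_distrib_left)
  also have "\<dots> = (\<Sum>i<n. Q $$ (i, k) * Q $$ (i, k))"
    by (intro sum.cong refl) (simp add: if_distrib cong: if_cong)
  also have "\<dots> = 1" using stiefelD(2)[OF Q k k] by simp
  finally show ?thesis .
qed

lemma sum_overlap_left:
  assumes Q: "Q \<in> stiefel n n" and P: "P \<in> stiefel n n" and l: "l < n"
  shows "(\<Sum>k<n. overlap n Q P k l) = 1"
  using sum_overlap_right[OF P Q l] by (simp add: overlap_commute)

lemma mtrace_mult:
  assumes "A \<in> carrier_mat n n" "B \<in> carrier_mat n n"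
  shows "mtrace (A * B) = (\<Sum>i<n. \<Sum>j<n. A $$ (i, j) * B $$ (j, i))"
  using assms by (auto simp: mtrace_def scalar_prod_def lessThan_atLeast0 intro!: sum.cong)

lemma mtrace_conj_diag_mult:
  assumes Q: "Q \<in> carrier_mat n n" and P: "P \<in> carrier_mat n n"
  shows "mtrace ((Q * mat_diag n d * transpose_mat Q) * (P * mat_diag n e * transpose_mat P))
    = (\<Sum>k<n. \<Sum>l<n. overlap n Q P k l * (d k * e l))"
proof -
  have "mtrace ((Q * mat_diag n d * transpose_mat Q) * (P * mat_diag n e * transpose_mat P))
    = (\<Sum>i<n. \<Sum>j<n. (\<Sum>k<n. d k * Q $$ (i, k) * Q $$ (j, k)) * (\<Sum>l<n. e l * P $$ (i, l) * P $$ (j, l)))"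
    by (subst mtrace_mult[OF conj_diag_carrier[OF Q] conj_diag_carrier[OF P]])
      (auto simp: conj_diag_entry[OF Q] conj_diag_entry[OF P] mult_ac intro!: sum.cong)
  also have "\<dots> = (\<Sum>k<n. \<Sum>l<n. overlap n Q P k l * (d k * e l))"
    unfolding overlap_def by (rule sum_conj_diag_mult)
  finally show ?thesis .
qed

lemma mtrace_conj_diag:
  assumes Q: "Q \<in> stiefel n n"
  shows "mtrace (Q * mat_diag n d * transpose_mat Q) = (\<Sum>k<n. d k)"
proof -
  have Qc: "Q \<in> carrier_mat n n" by (rule stiefelD[OF Q])
  have "mtrace (Q * mat_diag n d * transpose_mat Q) = (\<Sum>i<n. \<Sum>k<n. d k * Q $$ (i, k) * Q $$ (i, k))"
    using Qc by (auto simp: mtrace_def conj_diag_entry[OF Qc] simp del: index_mult_mat(1) intro!: sum.cong)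
  also have "\<dots> = (\<Sum>k<n. \<Sum>i<n. d k * Q $$ (i, k) * Q $$ (i, k))" by (rule sum.swap)
  also have "\<dots> = (\<Sum>k<n. d k)"
    by (intro sum.cong refl)
      (simp add: stiefelD(2)[OF Q] mult.assoc flip: sum_distrib_left)
  finally show ?thesis .
qed

text \<open>The two pure squares involve one decomposition each. As the weights have row and column
  sums 1, both can be spread over all pairs (k, l), where they complete the mixed term to a
  square.\<close>

lemma frobenius_conj_diag_diff:
  assumes Q: "Q \<in> stiefel n n" and P: "P \<in> stiefel n n"
  shows "(\<Sum>i<n. \<Sum>j<n. ((Q * mat_diag n d * transpose_mat Q) $$ (i, j)
        - (P * mat_diag n e * transpose_mat P) $$ (i, j))\<^sup>2)
    = (\<Sum>k<n. \<Sum>l<n. overlap n Q P k l * (d k - e l)\<^sup>2)"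
proof -
  have Qc: "Q \<in> carrier_mat n n" and Pc: "P \<in> carrier_mat n n"
    using stiefelD(1) Q P by auto
  have self: "(\<Sum>i<n. \<Sum>j<n. (\<Sum>k<n. d k * Q $$ (i, k) * Q $$ (j, k)) * (\<Sum>k<n. d k * Q $$ (i, k) * Q $$ (j, k)))
      = (\<Sum>k<n. (d k)\<^sup>2)" if Q: "Q \<in> stiefel n n" for Q and d :: "nat \<Rightarrow> real"
  proof -
    have "(\<Sum>i<n. \<Sum>j<n. (\<Sum>k<n. d k * Q $$ (i, k) * Q $$ (j, k)) * (\<Sum>k<n. d k * Q $$ (i, k) * Q $$ (j, k)))
      = (\<Sum>k<n. \<Sum>l<n. overlap n Q Q k l * (d k * d l))"
      unfolding overlap_def by (rule sum_conj_diag_mult)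
    also have "\<dots> = (\<Sum>k<n. \<Sum>l<n. if k = l then (d k)\<^sup>2 else 0)"
      by (intro sum.cong refl) (auto simp: overlap_self[OF Q] power2_eq_square)
    finally show ?thesis by simp
  qed
  define X where "X i j = (\<Sum>k<n. d k * Q $$ (i, k) * Q $$ (j, k))" for i j
  define Y where "Y i j = (\<Sum>l<n. e l * P $$ (i, l) * P $$ (j, l))" for i j
  have XX: "(\<Sum>i<n. \<Sum>j<n. X i j * X i j) = (\<Sum>k<n. (d k)\<^sup>2)"
    unfolding X_def by (rule self[OF Q])
  have YY: "(\<Sum>i<n. \<Sum>j<n. Y i j * Y i j) = (\<Sum>k<n. (e k)\<^sup>2)"
    unfolding Y_def by (rule self[OF P])
  have XY: "(\<Sum>i<n. \<Sum>j<n. X i j * Y i j) = (\<Sum>k<n. \<Sum>l<n. overlap n Q P k l * (d k * e l))"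
    unfolding X_def Y_def overlap_def by (rule sum_conj_diag_mult)
  have "(\<Sum>i<n. \<Sum>j<n. ((Q * mat_diag n d * transpose_mat Q) $$ (i, j)
        - (P * mat_diag n e * transpose_mat P) $$ (i, j))\<^sup>2)
    = (\<Sum>i<n. \<Sum>j<n. (X i j - Y i j)\<^sup>2)"
    by (intro sum.cong refl)
      (simp add: X_def Y_def conj_diag_entry[OF Qc] conj_diag_entry[OF Pc] del: index_mult_mat(1))
  also have "\<dots> = (\<Sum>k<n. (d k)\<^sup>2) + (\<Sum>l<n. (e l)\<^sup>2)
      - 2 * (\<Sum>k<n. \<Sum>l<n. overlap n Q P k l * (d k * e l))"
    unfolding XX[symmetric] YY[symmetric] XY[symmetric]
    by (simp add: algebra_simps sum.distrib sum_subtractf power2_eq_square sum_distrib_left)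
  also have "(\<Sum>k<n. (d k)\<^sup>2) = (\<Sum>k<n. \<Sum>l<n. overlap n Q P k l * (d k)\<^sup>2)"
    by (simp add: sum_overlap_right[OF Q P] flip: sum_distrib_right)
  also have "(\<Sum>l<n. (e l)\<^sup>2) = (\<Sum>l<n. \<Sum>k<n. overlap n Q P k l * (e l)\<^sup>2)"
    by (simp add: sum_overlap_left[OF Q P] flip: sum_distrib_right)
  also have "\<dots> = (\<Sum>k<n. \<Sum>l<n. overlap n Q P k l * (e l)\<^sup>2)" by (rule sum.swap)
  also have "(\<Sum>k<n. \<Sum>l<n. overlap n Q P k l * (d k)\<^sup>2) + (\<Sum>k<n. \<Sum>l<n. overlap n Q P k l * (e l)\<^sup>2)
      - 2 * (\<Sum>k<n. \<Sum>l<n. overlap n Q P k l * (d k * e l))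
    = (\<Sum>k<n. \<Sum>l<n. overlap n Q P k l * (d k - e l)\<^sup>2)"
    by (simp add: power2_diff algebra_simps sum.distrib sum_subtractf sum_distrib_left)
  finally show ?thesis .
qed

text \<open>Independence of the decomposition: if two of them give the same matrix, their Frobenius
  distance is 0, so \<open>d k\<close> and \<open>e l\<close> agree whenever their weight is
  positive, and then so do their images under \<open>f\<close>.\<close>

lemma mat_fun_conj_diag:
  assumes Q: "Q \<in> stiefel n n"
  shows "mat_fun f (Q * mat_diag n d * transpose_mat Q) = Q * mat_diag n (\<lambda>i. f (d i)) * transpose_mat Q"
proof -
  define A where "A = Q * mat_diag n d * transpose_mat Q"
  have Qc: "Q \<in> carrier_mat n n" by (rule stiefelD[OF Q])
  have A: "A \<in> carrier_mat n n" unfolding A_def by (rule conj_diag_carrier[OF Qc])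
  have dim: "dim_row A = n" using A by simp
  have "mat_fun f A = Q * mat_diag n (\<lambda>i. f (d i)) * transpose_mat Q"
    unfolding mat_fun_def dim
  proof (rule the_equality)
    show "\<exists>Q'\<in>stiefel n n. \<exists>d'. A = Q' * mat_diag n d' * transpose_mat Q' \<and>
       Q * mat_diag n (\<lambda>i. f (d i)) * transpose_mat Q = Q' * mat_diag n (\<lambda>i. f (d' i)) * transpose_mat Q'"
      using Q A_def by blast
  next
    fix B assume "\<exists>P\<in>stiefel n n. \<exists>e. A = P * mat_diag n e * transpose_mat P \<and>
       B = P * mat_diag n (\<lambda>i. f (e i)) * transpose_mat P"
    then obtain P e where P: "P \<in> stiefel n n" and e: "A = P * mat_diag n e * transpose_mat P"
      and B: "B = P * mat_diag n (\<lambda>i. f (e i)) * transpose_mat P" by blast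
    have Pc: "P \<in> carrier_mat n n" by (rule stiefelD[OF P])
    have "(\<Sum>k<n. \<Sum>l<n. overlap n Q P k l * (d k - e l)\<^sup>2) = 0"
      unfolding frobenius_conj_diag_diff[OF Q P, symmetric] using e A_def by simp
    then have z: "overlap n Q P k l * (d k - e l)\<^sup>2 = 0" if "k < n" "l < n" for k l
      using that by (simp add: sum_nonneg_eq_0_iff sum_nonneg overlap_nonneg)
    have "overlap n Q P k l * (f (d k) - f (e l))\<^sup>2 = 0" if "k < n" "l < n" for k l
      using z[OF that] by auto
    then have "(\<Sum>i<n. \<Sum>j<n. ((Q * mat_diag n (\<lambda>i. f (d i)) * transpose_mat Q) $$ (i, j) - B $$ (i, j))\<^sup>2) = 0"
      unfolding B frobenius_conj_diag_diff[OF Q P] by (intro sum.neutral ballI) simp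
    then have "B $$ (i, j) = (Q * mat_diag n (\<lambda>i. f (d i)) * transpose_mat Q) $$ (i, j)"
      if "i < n" "j < n" for i j
      using that by (simp add: sum_nonneg_eq_0_iff sum_nonneg del: index_mult_mat(1))
    then show "B = Q * mat_diag n (\<lambda>i. f (d i)) * transpose_mat Q"
      by (intro eq_matI) (use B Qc Pc in auto)
  qed
  then show ?thesis by (simp add: A_def)
qed

section \<open>Moduli of matrix functions and of the Bregman divergence\<close>

text \<open>Uniform continuity in a form that survives averaging: close pairs are covered by
  \<epsilon>, and for pairs at distance at least \<delta> the bound 2 B on the increment is at most
  (2 B / \<delta>) times the distance.\<close>

lemma continuous_on_square_modulus:
  fixes f :: "real \<Rightarrow> real"
  assumes f: "continuous_on {lo..hi} f" and \<epsilon>: "\<epsilon> > 0"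
  shows "\<exists>C\<ge>0. \<forall>x\<in>{lo..hi}. \<forall>y\<in>{lo..hi}. (f x - f y)\<^sup>2 \<le> \<epsilon> + C * (x - y)\<^sup>2"
proof -
  have uc: "uniformly_continuous_on {lo..hi} f"
    by (rule compact_uniformly_continuous[OF f]) simp
  obtain \<delta> where \<delta>: "\<delta> > 0" "\<And>x y. x \<in> {lo..hi} \<Longrightarrow> y \<in> {lo..hi} \<Longrightarrow> dist y x < \<delta> \<Longrightarrow> dist (f y) (f x) < sqrt \<epsilon>"
    using uc \<epsilon> unfolding uniformly_continuous_on_def by (meson real_sqrt_gt_zero)
  have "bounded (f ` {lo..hi})"
    by (intro compact_imp_bounded compact_continuous_image f) simp
  then obtain B where B: "B > 0" "\<And>x. x \<in> {lo..hi} \<Longrightarrow> \<bar>f x\<bar> \<le> B"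
    unfolding bounded_pos by auto
  show ?thesis
  proof (intro exI[of _ "(2 * B / \<delta>)\<^sup>2"] conjI ballI)
    fix x y assume xy: "x \<in> {lo..hi}" "y \<in> {lo..hi}"
    show "(f x - f y)\<^sup>2 \<le> \<epsilon> + (2 * B / \<delta>)\<^sup>2 * (x - y)\<^sup>2"
    proof (cases "\<bar>x - y\<bar> < \<delta>")
      case True
      then have "\<bar>f x - f y\<bar> < sqrt \<epsilon>" using \<delta>(2)[OF xy(2,1)] by (simp add: dist_real_def)
      then have "(f x - f y)\<^sup>2 \<le> \<epsilon>"
        using \<epsilon> by (metis abs_ge_zero less_eq_real_def power2_abs power_mono real_sqrt_pow2)
      then show ?thesis by (simp add: add_increasing2)
    next
      case False
      have "\<bar>f x - f y\<bar> \<le> 2 * B" using B(2)[OF xy(1)] B(2)[OF xy(2)] by linarith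
      also have "\<dots> = 2 * B / \<delta> * \<delta>" using \<delta> by simp
      also have "\<dots> \<le> 2 * B / \<delta> * \<bar>x - y\<bar>"
        using False B \<delta> by (intro mult_left_mono) auto
      finally have "(f x - f y)\<^sup>2 \<le> (2 * B / \<delta> * \<bar>x - y\<bar>)\<^sup>2"
        by (metis abs_ge_zero power2_abs power_mono)
      then show ?thesis using \<epsilon> by (simp only: power_mult_distrib power2_abs)
    qed
  qed simp
qed

lemma strictly_convex_pos_tangent:
  assumes sc: "strictly_convex_pos \<phi>" and C2: "C2_pos \<phi>" and x: "x > 0" and y: "y > 0"
  shows "0 \<le> \<phi> x - \<phi> y - deriv \<phi> y * (x - y)"
    and "x \<noteq> y \<Longrightarrow> 0 < \<phi> x - \<phi> y - deriv \<phi> y * (x - y)"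
proof -
  have cvx: "convex_on {0<..} \<phi>"
  proof (rule convex_onI)
    fix t a c :: real assume t: "0 < t" "t < 1" and ac: "a \<in> {0<..}" "c \<in> {0<..}"
    show "\<phi> ((1 - t) *\<^sub>R a + t *\<^sub>R c) \<le> (1 - t) * \<phi> a + t * \<phi> c"
    proof (cases "a = c")
      case True
      then show ?thesis by (simp add: algebra_simps)
    next
      case False
      then show ?thesis using sc t ac unfolding strictly_convex_pos_def
        by (auto intro!: less_imp_le)
    qed
  qed (simp add: convex_real_interval)
  have tangent: "deriv \<phi> y * (x - y) \<le> \<phi> x - \<phi> y" if "x > 0" for x
  proof (rule convex_on_imp_above_tangent[OF cvx])
    show "connected {0::real<..}" by simp
    have "(\<phi> has_real_derivative deriv \<phi> y) (at y)"
      using C2 y unfolding C2_pos_def by (simp add: DERIV_deriv_iff_real_differentiable)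
    then show "(\<phi> has_real_derivative deriv \<phi> y) (at y within {0<..})"
      by (rule has_field_derivative_at_within)
  qed (use that y in \<open>auto simp: interior_open\<close>)
  show "0 \<le> \<phi> x - \<phi> y - deriv \<phi> y * (x - y)" using tangent[OF x] by simp
  assume "x \<noteq> y"
  \<comment> \<open>Strictness comes from the midpoint: there \<phi> lies strictly below the chord,
    yet not below the tangent at y.\<close>
  then have "\<phi> ((1 - 1/2) * y + 1/2 * x) < (1 - 1/2) * \<phi> y + 1/2 * \<phi> x"
    using sc[unfolded strictly_convex_pos_def, rule_format, of y x "1/2"] x y by auto
  moreover have "deriv \<phi> y * ((1 - 1/2) * y + 1/2 * x - y) \<le> \<phi> ((1 - 1/2) * y + 1/2 * x) - \<phi> y"
    by (rule tangent) (use x y in auto)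
  ultimately show "0 < \<phi> x - \<phi> y - deriv \<phi> y * (x - y)"
    by (simp add: field_simps)
qed

lemma C2_pos_continuous:
  assumes "C2_pos \<phi>"
  shows "continuous_on {0<..} \<phi>" "continuous_on {0<..} (deriv \<phi>)"
proof -
  have "\<phi> differentiable at a" "deriv \<phi> differentiable at a" if "a > 0" for a
    using assms that by (auto simp: C2_pos_def)
  then have "isCont \<phi> a" "isCont (deriv \<phi>) a" if "a > 0" for a
    using that by (auto simp: differentiable_imp_continuous_within)
  then show "continuous_on {0<..} \<phi>" "continuous_on {0<..} (deriv \<phi>)"
    by (auto intro!: continuous_at_imp_continuous_on)
qed

text \<open>The second derivative of a strictly convex function may vanish, so in general no
  multiple of the divergence dominates (x - y)^2. On the compact set of pairs with (x - y)^2 \<ge>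
  \<delta>, however, the divergence has a positive minimum; the remaining pairs are covered by the
  additive \<delta>.\<close>

lemma scalar_bregman_modulus:
  assumes sc: "strictly_convex_pos \<phi>" and C2: "C2_pos \<phi>" and lo: "lo > 0" and \<delta>: "\<delta> > 0"
  shows "\<exists>C\<ge>0. \<forall>x\<in>{lo..hi}. \<forall>y\<in>{lo..hi}.
    (x - y)\<^sup>2 \<le> \<delta> + C * (\<phi> x - \<phi> y - deriv \<phi> y * (x - y))"
proof -
  define g where "g = (\<lambda>(x, y). \<phi> x - \<phi> y - deriv \<phi> y * (x - y))"
  define S where "S = {z \<in> {lo..hi} \<times> {lo..hi}. (fst z - snd z)\<^sup>2 \<ge> \<delta>}"
  have g0: "g (x, y) \<ge> 0" if "x \<in> {lo..hi}" "y \<in> {lo..hi}" for x y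
    using strictly_convex_pos_tangent(1)[OF sc C2, of x y] that lo by (simp add: g_def)
  have "S = ({lo..hi} \<times> {lo..hi}) \<inter> {z. (fst z - snd z)\<^sup>2 \<ge> \<delta>}" by (auto simp: S_def)
  also have "compact \<dots>"
    by (intro compact_Int_closed compact_Times closed_Collect_le continuous_intros) auto
  finally have comp: "compact S" .
  have cont: "continuous_on S g"
    unfolding g_def case_prod_unfold
    by (intro continuous_intros continuous_on_compose2[OF C2_pos_continuous(1)[OF C2]]
        continuous_on_compose2[OF C2_pos_continuous(2)[OF C2]]) (use lo in \<open>auto simp: S_def\<close>)
  show ?thesis
  proof (cases "S = {}")
    case True
    show ?thesis
    proof (intro exI[of _ 0] conjI ballI)
      fix x y assume "x \<in> {lo..hi}" "y \<in> {lo..hi}"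
      then have "(x, y) \<notin> S \<Longrightarrow> (x - y)\<^sup>2 < \<delta>" by (auto simp: S_def)
      then show "(x - y)\<^sup>2 \<le> \<delta> + 0 * (\<phi> x - \<phi> y - deriv \<phi> y * (x - y))" using True by simp
    qed simp
  next
    case False
    then obtain z where z: "z \<in> S" "\<And>w. w \<in> S \<Longrightarrow> g z \<le> g w"
      using continuous_attains_inf[OF comp _ cont] by blast
    have "fst z \<noteq> snd z" using z(1) \<delta> by (auto simp: S_def)
    then have m: "g z > 0" using strictly_convex_pos_tangent(2)[OF sc C2, of "fst z" "snd z"] z(1) lo
      by (auto simp: g_def S_def split: prod.splits)
    show ?thesis
    \<comment> \<open>The largest possible squared distance over the smallest divergence of a
      distant pair.\<close>
    proof (intro exI[of _ "(hi - lo)\<^sup>2 / g z"] conjI ballI)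
      fix x y assume xy: "x \<in> {lo..hi}" "y \<in> {lo..hi}"
      show "(x - y)\<^sup>2 \<le> \<delta> + (hi - lo)\<^sup>2 / g z * (\<phi> x - \<phi> y - deriv \<phi> y * (x - y))"
      proof (cases "(x, y) \<in> S")
        case True
        have "(x - y)\<^sup>2 \<le> (hi - lo)\<^sup>2"
          by (rule abs_le_square_iff[THEN iffD1]) (use xy in auto)
        also have "\<dots> = (hi - lo)\<^sup>2 / g z * g z" using m by simp
        also have "\<dots> \<le> (hi - lo)\<^sup>2 / g z * g (x, y)"
          using z(2)[OF True] m by (intro mult_left_mono) auto
        finally show ?thesis using \<delta> by (simp add: g_def)
      next
        case False
        then have "(x - y)\<^sup>2 \<le> \<delta>" using xy by (auto simp: S_def)
        moreover have "0 \<le> (hi - lo)\<^sup>2 / g z * g (x, y)" using g0[OF xy] m by simp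
        ultimately show ?thesis by (simp add: g_def)
      qed
    qed (use m in simp)
  qed
qed

definition spectrum_in :: "real \<Rightarrow> real \<Rightarrow> nat \<Rightarrow> real mat \<Rightarrow> bool" where
  "spectrum_in lo hi n A \<longleftrightarrow> (\<exists>Q\<in>stiefel n n. \<exists>d. A = Q * mat_diag n d * transpose_mat Q
     \<and> (\<forall>k<n. d k \<in> {lo..hi}))"

lemma spectrum_in_carrier: "spectrum_in lo hi n A \<Longrightarrow> A \<in> carrier_mat n n"
  using conj_diag_carrier stiefelD(1) by (auto simp: spectrum_in_def)

lemma mat_fun_carrier:
  assumes "spectrum_in lo hi n A"
  shows "mat_fun f A \<in> carrier_mat n n"
proof -
  obtain Q d where Q: "Q \<in> stiefel n n" "A = Q * mat_diag n d * transpose_mat Q"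
    using assms by (auto simp: spectrum_in_def)
  show ?thesis unfolding Q(2) mat_fun_conj_diag[OF Q(1)]
    by (rule conj_diag_carrier) (rule stiefelD[OF Q(1)])
qed

text \<open>AM-GM on the products of entries, together with the unit rows of \<open>Q\<close>, makes
  the bound independent of the size n.\<close>

lemma mat_fun_entry_bound:
  assumes "spectrum_in lo hi n A" "\<And>x. x \<in> {lo..hi} \<Longrightarrow> \<bar>f x\<bar> \<le> B" "i < n" "j < n"
  shows "\<bar>mat_fun f A $$ (i, j)\<bar> \<le> B"
proof -
  obtain Q d where Q: "Q \<in> stiefel n n" "A = Q * mat_diag n d * transpose_mat Q"
    and d: "\<And>k. k < n \<Longrightarrow> d k \<in> {lo..hi}"
    using assms by (auto simp: spectrum_in_def)
  have "mat_fun f A $$ (i, j) = (\<Sum>k<n. f (d k) * Q $$ (i, k) * Q $$ (j, k))"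
    unfolding Q(2) mat_fun_conj_diag[OF Q(1)]
    using assms by (intro conj_diag_entry[OF stiefelD(1)[OF Q(1)]])
  also have "\<bar>\<dots>\<bar> \<le> (\<Sum>k<n. \<bar>f (d k) * Q $$ (i, k) * Q $$ (j, k)\<bar>)" by (rule sum_abs)
  also have "\<dots> \<le> (\<Sum>k<n. B * ((Q $$ (i, k) * Q $$ (i, k) + Q $$ (j, k) * Q $$ (j, k)) / 2))"
  proof (rule sum_mono)
    fix k assume k: "k \<in> {..<n}"
    have b: "\<bar>f (d k)\<bar> \<le> B" using assms(2) d k by auto
    have "\<bar>Q $$ (i, k) * Q $$ (j, k)\<bar> \<le> (Q $$ (i, k) * Q $$ (i, k) + Q $$ (j, k) * Q $$ (j, k)) / 2"
      using sum_squares_bound[of "\<bar>Q $$ (i, k)\<bar>" "\<bar>Q $$ (j, k)\<bar>"] by (simp add: abs_mult power2_eq_square)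
    then have "\<bar>f (d k)\<bar> * \<bar>Q $$ (i, k) * Q $$ (j, k)\<bar>
        \<le> B * ((Q $$ (i, k) * Q $$ (i, k) + Q $$ (j, k) * Q $$ (j, k)) / 2)"
      using b by (intro mult_mono) auto
    then show "\<bar>f (d k) * Q $$ (i, k) * Q $$ (j, k)\<bar>
        \<le> B * ((Q $$ (i, k) * Q $$ (i, k) + Q $$ (j, k) * Q $$ (j, k)) / 2)"
      by (simp add: abs_mult mult.assoc)
  qed
  also have "\<dots> = B * (((\<Sum>k<n. Q $$ (i, k) * Q $$ (i, k)) + (\<Sum>k<n. Q $$ (j, k) * Q $$ (j, k))) / 2)"
    by (simp add: sum.distrib flip: sum_distrib_left sum_divide_distrib)
  also have "\<dots> = B" using assms by (simp add: stiefel_rows[OF Q(1)])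
  finally show ?thesis .
qed

text \<open>Both Frobenius distances are sums of scalar squares with the same weights, so a scalar
  modulus carries over; the additive error is multiplied by n, the total weight.\<close>

lemma mat_fun_frobenius_modulus:
  fixes f :: "real \<Rightarrow> real"
  assumes A: "spectrum_in lo hi n A" and B: "spectrum_in lo hi n B"
    and f: "\<And>x y. x \<in> {lo..hi} \<Longrightarrow> y \<in> {lo..hi} \<Longrightarrow> (f x - f y)\<^sup>2 \<le> \<epsilon> + C * (x - y)\<^sup>2"
  shows "(\<Sum>i<n. \<Sum>j<n. (mat_fun f A $$ (i, j) - mat_fun f B $$ (i, j))\<^sup>2)
    \<le> real n * \<epsilon> + C * (\<Sum>i<n. \<Sum>j<n. (A $$ (i, j) - B $$ (i, j))\<^sup>2)"
proof -
  obtain Q d where Q: "Q \<in> stiefel n n" "A = Q * mat_diag n d * transpose_mat Q"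
    and d: "\<And>k. k < n \<Longrightarrow> d k \<in> {lo..hi}"
    using A by (auto simp: spectrum_in_def)
  obtain P e where P: "P \<in> stiefel n n" "B = P * mat_diag n e * transpose_mat P"
    and e: "\<And>k. k < n \<Longrightarrow> e k \<in> {lo..hi}"
    using B by (auto simp: spectrum_in_def)
  have "(\<Sum>i<n. \<Sum>j<n. (mat_fun f A $$ (i, j) - mat_fun f B $$ (i, j))\<^sup>2)
    = (\<Sum>k<n. \<Sum>l<n. overlap n Q P k l * (f (d k) - f (e l))\<^sup>2)"
    unfolding Q(2) P(2) mat_fun_conj_diag[OF Q(1)] mat_fun_conj_diag[OF P(1)]
    by (rule frobenius_conj_diag_diff[OF Q(1) P(1)])
  also have "\<dots> \<le> (\<Sum>k<n. \<Sum>l<n. overlap n Q P k l * (\<epsilon> + C * (d k - e l)\<^sup>2))"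
    using d e by (intro sum_mono mult_left_mono f overlap_nonneg) auto
  also have "\<dots> = (\<Sum>k<n. \<epsilon> * (\<Sum>l<n. overlap n Q P k l)) + C * (\<Sum>k<n. \<Sum>l<n. overlap n Q P k l * (d k - e l)\<^sup>2)"
    by (simp add: algebra_simps sum.distrib sum_distrib_left)
  also have "(\<Sum>k<n. \<epsilon> * (\<Sum>l<n. overlap n Q P k l)) = real n * \<epsilon>"
    by (simp add: sum_overlap_right[OF Q(1) P(1)])
  also have "(\<Sum>k<n. \<Sum>l<n. overlap n Q P k l * (d k - e l)\<^sup>2) = (\<Sum>i<n. \<Sum>j<n. (A $$ (i, j) - B $$ (i, j))\<^sup>2)"
    unfolding Q(2) P(2) by (rule frobenius_conj_diag_diff[OF Q(1) P(1), symmetric])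
  finally show ?thesis .
qed

definition bregman :: "(real \<Rightarrow> real) \<Rightarrow> real mat \<Rightarrow> real mat \<Rightarrow> real" where
  "bregman \<phi> A B = mtrace (mat_fun \<phi> A) - mtrace (mat_fun \<phi> B) - mtrace (mat_fun (deriv \<phi>) B * A)
     + mtrace (mat_fun (deriv \<phi>) B * B)"

text \<open>Every trace, whichever decomposition it comes from, is spread over all pairs of
  eigenvalues. What remains is a weighted sum of scalar divergences, so sign and lower bounds are
  inherited from dimension one.\<close>

lemma bregman_conj_diag:
  assumes Q: "Q \<in> stiefel n n" and P: "P \<in> stiefel n n"
  shows "bregman \<phi> (Q * mat_diag n d * transpose_mat Q) (P * mat_diag n e * transpose_mat P)
    = (\<Sum>k<n. \<Sum>l<n. overlap n Q P k l * (\<phi> (d k) - \<phi> (e l) - deriv \<phi> (e l) * (d k - e l)))"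
proof -
  have Qc: "Q \<in> carrier_mat n n" and Pc: "P \<in> carrier_mat n n"
    using stiefelD(1) Q P by auto
  have 1: "(\<Sum>k<n. \<phi> (d k)) = (\<Sum>k<n. \<Sum>l<n. overlap n Q P k l * \<phi> (d k))"
    by (simp add: sum_overlap_right[OF Q P] flip: sum_distrib_right)
  have r: "(\<Sum>l<n. g l) = (\<Sum>k<n. \<Sum>l<n. overlap n Q P k l * g l)" for g :: "nat \<Rightarrow> real"
    by (subst sum.swap) (simp add: sum_overlap_left[OF Q P] flip: sum_distrib_right)
  have 3: "mtrace ((P * mat_diag n (\<lambda>i. deriv \<phi> (e i)) * transpose_mat P) * (P * mat_diag n e * transpose_mat P))
      = (\<Sum>l<n. deriv \<phi> (e l) * e l)"
  proof -
    have "(\<Sum>k<n. \<Sum>l<n. overlap n P P k l * (deriv \<phi> (e k) * e l))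
      = (\<Sum>k<n. \<Sum>l<n. if k = l then deriv \<phi> (e k) * e k else 0)"
      by (intro sum.cong refl) (auto simp: overlap_self[OF P])
    then show ?thesis by (simp add: mtrace_conj_diag_mult[OF Pc Pc])
  qed
  have 4: "(\<Sum>k<n. \<Sum>l<n. overlap n P Q k l * (deriv \<phi> (e k) * d l))
      = (\<Sum>k<n. \<Sum>l<n. overlap n Q P k l * (deriv \<phi> (e l) * d k))"
    by (subst sum.swap) (simp add: overlap_commute[of n Q P])
  show ?thesis
    unfolding bregman_def mat_fun_conj_diag[OF Q] mat_fun_conj_diag[OF P] mtrace_conj_diag[OF Q]
      mtrace_conj_diag[OF P] 3 mtrace_conj_diag_mult[OF Pc Qc] 1 r[of "\<lambda>l. \<phi> (e l)"]
      r[of "\<lambda>l. deriv \<phi> (e l) * e l"] 4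
    by (simp add: algebra_simps sum.distrib sum_subtractf)
qed

lemma bregman_nonneg:
  assumes sc: "strictly_convex_pos \<phi>" and C2: "C2_pos \<phi>" and lo: "lo > 0"
    and A: "spectrum_in lo hi n A" and B: "spectrum_in lo hi n B"
  shows "0 \<le> bregman \<phi> A B"
proof -
  obtain Q d where Q: "Q \<in> stiefel n n" "A = Q * mat_diag n d * transpose_mat Q"
    and d: "\<And>k. k < n \<Longrightarrow> d k \<in> {lo..hi}"
    using A by (auto simp: spectrum_in_def)
  obtain P e where P: "P \<in> stiefel n n" "B = P * mat_diag n e * transpose_mat P"
    and e: "\<And>k. k < n \<Longrightarrow> e k \<in> {lo..hi}"
    using B by (auto simp: spectrum_in_def)
  have "d k > 0" "e k > 0" if "k < n" for k using d[OF that] e[OF that] lo by auto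
  then show ?thesis
    unfolding Q(2) P(2) bregman_conj_diag[OF Q(1) P(1)]
    by (intro sum_nonneg mult_nonneg_nonneg overlap_nonneg strictly_convex_pos_tangent[OF sc C2]) auto
qed

lemma bregman_frobenius_modulus:
  assumes A: "spectrum_in lo hi n A" and B: "spectrum_in lo hi n B"
    and \<phi>: "\<And>x y. x \<in> {lo..hi} \<Longrightarrow> y \<in> {lo..hi} \<Longrightarrow>
      (x - y)\<^sup>2 \<le> \<delta> + C * (\<phi> x - \<phi> y - deriv \<phi> y * (x - y))"
  shows "(\<Sum>i<n. \<Sum>j<n. (A $$ (i, j) - B $$ (i, j))\<^sup>2) \<le> real n * \<delta> + C * bregman \<phi> A B"
proof -
  obtain Q d where Q: "Q \<in> stiefel n n" "A = Q * mat_diag n d * transpose_mat Q"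
    and d: "\<And>k. k < n \<Longrightarrow> d k \<in> {lo..hi}"
    using A by (auto simp: spectrum_in_def)
  obtain P e where P: "P \<in> stiefel n n" "B = P * mat_diag n e * transpose_mat P"
    and e: "\<And>k. k < n \<Longrightarrow> e k \<in> {lo..hi}"
    using B by (auto simp: spectrum_in_def)
  have "(\<Sum>i<n. \<Sum>j<n. (A $$ (i, j) - B $$ (i, j))\<^sup>2) = (\<Sum>k<n. \<Sum>l<n. overlap n Q P k l * (d k - e l)\<^sup>2)"
    unfolding Q(2) P(2) by (rule frobenius_conj_diag_diff[OF Q(1) P(1)])
  also have "\<dots> \<le> (\<Sum>k<n. \<Sum>l<n. overlap n Q P k l
      * (\<delta> + C * (\<phi> (d k) - \<phi> (e l) - deriv \<phi> (e l) * (d k - e l))))"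
    using d e by (intro sum_mono mult_left_mono \<phi> overlap_nonneg) auto
  also have "\<dots> = (\<Sum>k<n. \<delta> * (\<Sum>l<n. overlap n Q P k l)) + C * (\<Sum>k<n. \<Sum>l<n. overlap n Q P k l
      * (\<phi> (d k) - \<phi> (e l) - deriv \<phi> (e l) * (d k - e l)))"
    by (simp add: algebra_simps sum.distrib sum_subtractf sum_distrib_left)
  also have "\<dots> = real n * \<delta> + C * bregman \<phi> A B"
    unfolding Q(2) P(2) bregman_conj_diag[OF Q(1) P(1)]
    by (simp add: sum_overlap_right[OF Q(1) P(1)])
  finally show ?thesis .
qed

lemma spectrum_inI:
  assumes A: "A \<in> sym_mats n"
    and lo: "\<And>v. (\<Sum>i<n. v i * v i) = 1 \<Longrightarrow> lo \<le> (\<Sum>i<n. \<Sum>j<n. A $$ (i, j) * v i * v j)"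
    and hi: "\<And>v. (\<Sum>i<n. v i * v i) = 1 \<Longrightarrow> (\<Sum>i<n. \<Sum>j<n. A $$ (i, j) * v i * v j) \<le> hi"
  shows "spectrum_in lo hi n A"
proof -
  obtain Q d where Q: "Q \<in> stiefel n n" "A = Q * mat_diag n d * transpose_mat Q"
    by (rule spectral_theorem[OF A])
  have Qc: "Q \<in> carrier_mat n n" by (rule stiefelD[OF Q(1)])
  have "d k \<in> {lo..hi}" if k: "k < n" for k
  proof -
    \<comment> \<open>The one-term sum writes the projection onto the k-th eigenvector in spectral
      form, so that \<open>sum_conj_diag_mult\<close> applies.\<close>
    have "(\<Sum>i<n. \<Sum>j<n. A $$ (i, j) * Q $$ (i, k) * Q $$ (j, k))
      = (\<Sum>i<n. \<Sum>j<n. (\<Sum>l<n. d l * Q $$ (i, l) * Q $$ (j, l)) * (\<Sum>l<Suc 0. 1 * Q $$ (i, k) * Q $$ (j, k)))"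
      unfolding Q(2)
      by (intro sum.cong refl) (simp add: conj_diag_entry[OF Qc] del: index_mult_mat(1))
    also have "\<dots> = (\<Sum>l<n. \<Sum>l'<Suc 0. (\<Sum>i<n. Q $$ (i, l) * Q $$ (i, k))\<^sup>2 * (d l * 1))"
      by (rule sum_conj_diag_mult[where q = "\<lambda>i l. Q $$ (i, l)" and p = "\<lambda>i l. Q $$ (i, k)"])
    also have "\<dots> = (\<Sum>l<n. if l = k then d k else 0)"
      using k by (intro sum.cong refl) (simp add: stiefelD(2)[OF Q(1)])
    also have "\<dots> = d k" using k by simp
    finally have *: "(\<Sum>i<n. \<Sum>j<n. A $$ (i, j) * Q $$ (i, k) * Q $$ (j, k)) = d k" .
    have "(\<Sum>i<n. Q $$ (i, k) * Q $$ (i, k)) = 1" using stiefelD(2)[OF Q(1) k k] by simp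
    from lo[OF this] hi[OF this] show ?thesis using * by simp
  qed
  then show ?thesis using Q by (auto simp: spectrum_in_def)
qed

text \<open>One \<kappa> serves all sizes up to \<open>M\<close>, which matters because the number
  of observations varies between subjects.\<close>

lemma mat_fun_uniformly_continuous:
  fixes f :: "real \<Rightarrow> real"
  assumes f: "continuous_on {lo..hi} f" and \<epsilon>: "\<epsilon> > 0"
  shows "\<exists>\<kappa>>0. \<forall>n\<le>M. \<forall>A B. spectrum_in lo hi n A \<longrightarrow> spectrum_in lo hi n B \<longrightarrow>
    (\<forall>i<n. \<forall>j<n. \<bar>A $$ (i, j) - B $$ (i, j)\<bar> \<le> \<kappa>) \<longrightarrow>
    (\<forall>i<n. \<forall>j<n. \<bar>mat_fun f A $$ (i, j) - mat_fun f B $$ (i, j)\<bar> \<le> \<epsilon>)"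
proof -
  \<comment> \<open>Half of \<epsilon>^2 pays for the additive error, multiplied by at most M; the
    other half pays for the at most M^2 entries, each of size at most \<kappa>. The added ones
    exclude division by 0.\<close>
  define \<epsilon>' where "\<epsilon>' = \<epsilon>\<^sup>2 / (2 * (real M + 1))"
  have \<epsilon>': "\<epsilon>' > 0" using \<epsilon> by (simp add: \<epsilon>'_def)
  obtain C where C: "C \<ge> 0" "\<And>x y. x \<in> {lo..hi} \<Longrightarrow> y \<in> {lo..hi} \<Longrightarrow> (f x - f y)\<^sup>2 \<le> \<epsilon>' + C * (x - y)\<^sup>2"
    using continuous_on_square_modulus[OF f \<epsilon>'] by auto
  define D where "D = 2 * (C + 1) * (real M + 1)\<^sup>2"
  have D: "D > 0" using C(1) by (simp add: D_def)
  define \<kappa> where "\<kappa> = \<epsilon> / sqrt D"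
  have \<kappa>: "\<kappa> > 0" using \<epsilon> D by (simp add: \<kappa>_def)
  have \<kappa>2: "\<kappa>\<^sup>2 * D = \<epsilon>\<^sup>2" using D by (simp add: \<kappa>_def power_divide)
  show ?thesis
  proof (intro exI[of _ \<kappa>] conjI \<kappa> allI impI)
    fix n A B i j
    assume n: "n \<le> M" and A: "spectrum_in lo hi n A" and B: "spectrum_in lo hi n B"
      and AB: "\<forall>i<n. \<forall>j<n. \<bar>A $$ (i, j) - B $$ (i, j)\<bar> \<le> \<kappa>" and ij: "i < n" "j < n"
    have "(mat_fun f A $$ (i, j) - mat_fun f B $$ (i, j))\<^sup>2
      \<le> (\<Sum>j<n. (mat_fun f A $$ (i, j) - mat_fun f B $$ (i, j))\<^sup>2)"
      by (rule member_le_sum) (use ij in auto)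
    also have "\<dots> \<le> (\<Sum>i<n. \<Sum>j<n. (mat_fun f A $$ (i, j) - mat_fun f B $$ (i, j))\<^sup>2)"
      by (rule member_le_sum[of i _ "\<lambda>i. \<Sum>j<n. (mat_fun f A $$ (i, j) - mat_fun f B $$ (i, j))\<^sup>2"])
        (use ij in \<open>auto intro: sum_nonneg\<close>)
    also have "\<dots> \<le> real n * \<epsilon>' + C * (\<Sum>i<n. \<Sum>j<n. (A $$ (i, j) - B $$ (i, j))\<^sup>2)"
      by (rule mat_fun_frobenius_modulus[OF A B C(2)])
    also have "\<dots> \<le> (real M + 1) * \<epsilon>' + C * (\<Sum>i<n. \<Sum>j<n. \<kappa>\<^sup>2)"
    proof (intro add_mono mult_mono[OF _ order_refl] mult_left_mono sum_mono C(1))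
      fix i j assume "i \<in> {..<n}" "j \<in> {..<n}"
      then show "(A $$ (i, j) - B $$ (i, j))\<^sup>2 \<le> \<kappa>\<^sup>2"
        using AB by (metis abs_ge_zero lessThan_iff power2_abs power_mono)
    qed (use n \<epsilon>' in auto)
    also have "C * (\<Sum>i<n. \<Sum>j<n. \<kappa>\<^sup>2) = C * (real n)\<^sup>2 * \<kappa>\<^sup>2"
      by (simp add: power2_eq_square)
    also have "\<dots> \<le> (C + 1) * (real M + 1)\<^sup>2 * \<kappa>\<^sup>2"
      by (intro mult_right_mono mult_mono power_mono) (use C(1) n in auto)
    also have "\<dots> = \<epsilon>\<^sup>2 / 2" using \<kappa>2 by (simp add: D_def algebra_simps)
    also have "(real M + 1) * \<epsilon>' = \<epsilon>\<^sup>2 / 2" by (simp add: \<epsilon>'_def field_simps)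
    finally have "(mat_fun f A $$ (i, j) - mat_fun f B $$ (i, j))\<^sup>2 \<le> \<epsilon>\<^sup>2" by simp
    then show "\<bar>mat_fun f A $$ (i, j) - mat_fun f B $$ (i, j)\<bar> \<le> \<epsilon>"
      using \<epsilon> by (simp add: power2_le_iff_abs_le)
  qed
qed

text \<open>The Legendre transform of \<phi> evaluated at its derivative. It produces the part of
  the loss that does not see the data.\<close>

definition conj_seed :: "(real \<Rightarrow> real) \<Rightarrow> real \<Rightarrow> real" where
  "conj_seed \<phi> x = deriv \<phi> x * x - \<phi> x"

lemma mtrace_mat_fun_mult_self:
  assumes C: "spectrum_in lo hi n C"
  shows "mtrace (mat_fun f C * C) = mtrace (mat_fun (\<lambda>x. f x * x) C)"
proof -
  obtain P e where P: "P \<in> stiefel n n" "C = P * mat_diag n e * transpose_mat P"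
    using C by (auto simp: spectrum_in_def)
  have Pc: "P \<in> carrier_mat n n" by (rule stiefelD[OF P(1)])
  have "(\<Sum>k<n. \<Sum>l<n. overlap n P P k l * (f (e k) * e l))
      = (\<Sum>k<n. \<Sum>l<n. if k = l then f (e k) * e k else 0)"
    by (intro sum.cong refl) (auto simp: overlap_self[OF P(1)])
  then show ?thesis
    unfolding P(2) mat_fun_conj_diag[OF P(1)] mtrace_conj_diag_mult[OF Pc Pc] mtrace_conj_diag[OF P(1)]
    by simp
qed

lemma mtrace_conj_seed:
  assumes C: "spectrum_in lo hi n C"
  shows "mtrace (mat_fun (conj_seed \<phi>) C) = mtrace (mat_fun (deriv \<phi>) C * C) - mtrace (mat_fun \<phi> C)"
proof -
  obtain P e where P: "P \<in> stiefel n n" "C = P * mat_diag n e * transpose_mat P"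
    using C by (auto simp: spectrum_in_def)
  show ?thesis
    unfolding mtrace_mat_fun_mult_self[OF C]
    unfolding P(2) mat_fun_conj_diag[OF P(1)] mtrace_conj_diag[OF P(1)]
    by (simp add: conj_seed_def sum_subtractf)
qed

lemma mtrace_minus:
  "A \<in> carrier_mat n n \<Longrightarrow> B \<in> carrier_mat n n \<Longrightarrow> mtrace (A - B) = mtrace A - mtrace B"
  by (auto simp: mtrace_def sum_subtractf)

lemma mtrace_uminus: "A \<in> carrier_mat n n \<Longrightarrow> mtrace (- A) = - mtrace A"
  by (auto simp: mtrace_def sum_negf)

text \<open>In this form the loss is affine in the data matrix \<open>S\<close>, so its mean depends
  on the data only through the mean of \<open>S\<close>.\<close>

lemma loss_term_eq:
  assumes C: "spectrum_in lo hi n C" and S: "S \<in> carrier_mat n n"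
  shows "mtrace (- mat_fun \<phi> C - mat_fun (deriv \<phi>) C * (S - C))
    = mtrace (mat_fun (conj_seed \<phi>) C) - (\<Sum>i<n. \<Sum>j<n. mat_fun (deriv \<phi>) C $$ (i, j) * S $$ (j, i))"
proof -
  have c: "mat_fun \<phi> C \<in> carrier_mat n n" "mat_fun (deriv \<phi>) C \<in> carrier_mat n n" "C \<in> carrier_mat n n"
    using C by (auto intro: mat_fun_carrier spectrum_in_carrier)
  have "mat_fun (deriv \<phi>) C * (S - C) = mat_fun (deriv \<phi>) C * S - mat_fun (deriv \<phi>) C * C"
    by (rule mult_minus_distrib_mat[OF c(2) S c(3)])
  moreover have XY: "mat_fun (deriv \<phi>) C * S \<in> carrier_mat n n" "mat_fun (deriv \<phi>) C * C \<in> carrier_mat n n"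
    using c S by auto
  ultimately have "mtrace (- mat_fun \<phi> C - mat_fun (deriv \<phi>) C * (S - C))
    = mtrace (- mat_fun \<phi> C) - (mtrace (mat_fun (deriv \<phi>) C * S) - mtrace (mat_fun (deriv \<phi>) C * C))"
    using c(1) by (simp add: mtrace_minus[OF _ minus_carrier_mat[OF XY(2)]] mtrace_minus[OF XY])
  then show ?thesis
    using c S by (simp add: mtrace_conj_seed[OF C] mtrace_uminus[OF c(1)] mtrace_mult[OF c(2) S])
qed

text \<open>With the true covariance in place of the data matrix, the loss differs from the
  divergence only by the trace of \<phi> at the truth, which is free of \<open>C\<close>. Hence
  minimising the mean loss means minimising a divergence.\<close>

lemma bregman_eq_loss:
  assumes C: "spectrum_in lo hi n C" and K: "K \<in> carrier_mat n n"
  shows "bregman \<phi> K C = mtrace (mat_fun \<phi> K) + mtrace (mat_fun (conj_seed \<phi>) C)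
    - (\<Sum>i<n. \<Sum>j<n. mat_fun (deriv \<phi>) C $$ (i, j) * K $$ (j, i))"
  using mtrace_mult[OF mat_fun_carrier[OF C] K]
  by (simp add: bregman_def mtrace_conj_seed[OF C])

lemma bregman_self: "bregman \<phi> A A = 0"
  by (simp add: bregman_def)

section \<open>Kernel matrices\<close>

text \<open>An Arzela-Ascoli class of positive semidefinite kernels: \<open>\<delta>\<close> sends a
  tolerance to a distance within which no member changes by more. Only values on the unit square are
  constrained, since splines are arbitrary elsewhere. Positivity is required at every finite list of
  points because it must hold for every design.\<close>

definition kernel_class :: "real \<Rightarrow> (real \<Rightarrow> real) \<Rightarrow> (real \<Rightarrow> real \<Rightarrow> real) set" where
  "kernel_class B \<delta> = {c.
     (\<forall>s\<in>unit_ivl. \<forall>t\<in>unit_ivl. c s t = c t s \<and> \<bar>c s t\<bar> \<le> B)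
     \<and> (\<forall>(n::nat) a t. (\<forall>i<n. t i \<in> unit_ivl) \<longrightarrow> 0 \<le> (\<Sum>i<n. \<Sum>j<n. c (t i) (t j) * a i * a j))
     \<and> (\<forall>\<kappa>>0. \<forall>s\<in>unit_ivl. \<forall>s'\<in>unit_ivl. \<forall>t\<in>unit_ivl. \<forall>t'\<in>unit_ivl.
          \<bar>s - s'\<bar> \<le> \<delta> \<kappa> \<longrightarrow> \<bar>t - t'\<bar> \<le> \<delta> \<kappa> \<longrightarrow> \<bar>c s t - c s' t'\<bar> \<le> \<kappa>)}"

definition kernel_mat :: "(real \<Rightarrow> real \<Rightarrow> real) \<Rightarrow> real \<Rightarrow> nat \<Rightarrow> (nat \<Rightarrow> real) \<Rightarrow> real mat" where
  "kernel_mat c v n t = Matrix.mat n n (\<lambda>(i, j). c (t i) (t j)) + v \<cdot>\<^sub>m 1\<^sub>m n"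

lemma kernel_mat_carrier [simp]: "kernel_mat c v n t \<in> carrier_mat n n"
  by (simp add: kernel_mat_def)

lemma kernel_mat_entry:
  "i < n \<Longrightarrow> j < n \<Longrightarrow> kernel_mat c v n t $$ (i, j) = c (t i) (t j) + (if i = j then v else 0)"
  by (simp add: kernel_mat_def)

lemma model_cov_eq_kernel_mat: "model_cov K b U D v n t = kernel_mat (spline_cov K b U D) v n t"
  by (simp add: model_cov_def kernel_mat_def)

text \<open>The kernel part is positive semidefinite, so the noise variance bounds the spectrum from
  below; at most M rows with entries at most B bound it from above. For b1 > 0 the interval avoids
  0, where \<phi> may be singular.\<close>

lemma kernel_mat_spectrum:
  assumes c: "c \<in> kernel_class B \<delta>" and v: "v \<in> {b1..b2}" and t: "\<And>i. i < n \<Longrightarrow> t i \<in> unit_ivl"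
    and n: "n \<le> M" and B: "B \<ge> 0"
  shows "spectrum_in b1 (real M * B + b2) n (kernel_mat c v n t)"
proof (rule spectrum_inI)
  have csym: "c (t i) (t j) = c (t j) (t i)" if "i < n" "j < n" for i j
    using c t[OF that(1)] t[OF that(2)] unfolding kernel_class_def by blast
  have cB: "\<bar>c (t i) (t j)\<bar> \<le> B" if "i < n" "j < n" for i j
    using c t[OF that(1)] t[OF that(2)] unfolding kernel_class_def by blast
  show "kernel_mat c v n t \<in> sym_mats n"
  proof -
    have "transpose_mat (kernel_mat c v n t) = kernel_mat c v n t"
    proof (rule eq_matI)
      fix i j assume "i < dim_row (kernel_mat c v n t)" "j < dim_col (kernel_mat c v n t)"
      then have ij: "i < n" "j < n" using kernel_mat_carrier[of c v n t] by auto
      show "transpose_mat (kernel_mat c v n t) $$ (i, j) = kernel_mat c v n t $$ (i, j)"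
        using ij csym[OF ij] carrier_matD[OF kernel_mat_carrier[of c v n t]]
        by (simp add: kernel_mat_entry)
    qed (simp_all add: kernel_mat_def)
    then show ?thesis by (simp add: sym_mats_def)
  qed
  fix a :: "nat \<Rightarrow> real" assume a: "(\<Sum>i<n. a i * a i) = 1"
  have eq: "(\<Sum>i<n. \<Sum>j<n. kernel_mat c v n t $$ (i, j) * a i * a j)
    = (\<Sum>i<n. \<Sum>j<n. c (t i) (t j) * a i * a j) + v"
  proof -
    have "(\<Sum>i<n. \<Sum>j<n. kernel_mat c v n t $$ (i, j) * a i * a j)
      = (\<Sum>i<n. \<Sum>j<n. c (t i) (t j) * a i * a j + (if i = j then v * (a i * a i) else 0))"
      by (intro sum.cong refl) (auto simp: kernel_mat_entry algebra_simps)
    also have "\<dots> = (\<Sum>i<n. \<Sum>j<n. c (t i) (t j) * a i * a j) + v * (\<Sum>i<n. a i * a i)"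
      by (simp add: sum.distrib sum_distrib_left)
    finally show ?thesis using a by simp
  qed
  have "0 \<le> (\<Sum>i<n. \<Sum>j<n. c (t i) (t j) * a i * a j)"
    using c t unfolding kernel_class_def by blast
  then show "b1 \<le> (\<Sum>i<n. \<Sum>j<n. kernel_mat c v n t $$ (i, j) * a i * a j)"
    unfolding eq using v by simp
  have "(\<Sum>i<n. \<Sum>j<n. c (t i) (t j) * a i * a j) \<le> (\<Sum>i<n. \<Sum>j<n. B * ((a i * a i + a j * a j) / 2))"
  proof (intro sum_mono)
    fix i j assume "i \<in> {..<n}" "j \<in> {..<n}"
    then have ij: "i < n" "j < n" by auto
    have "\<bar>a i * a j\<bar> \<le> (a i * a i + a j * a j) / 2"
      using sum_squares_bound[of "\<bar>a i\<bar>" "\<bar>a j\<bar>"] by (simp add: abs_mult power2_eq_square)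
    then have "\<bar>c (t i) (t j)\<bar> * \<bar>a i * a j\<bar> \<le> B * ((a i * a i + a j * a j) / 2)"
      using cB[OF ij] B by (intro mult_mono) auto
    then show "c (t i) (t j) * a i * a j \<le> B * ((a i * a i + a j * a j) / 2)"
      by (metis abs_ge_self abs_mult mult.assoc order_trans)
  qed
  also have "\<dots> = B * (\<Sum>i<n. \<Sum>j<n. (a i * a i + a j * a j) / 2)"
    by (simp add: sum_distrib_left)
  also have "(\<Sum>i<n. \<Sum>j<n. (a i * a i + a j * a j) / 2) = real n"
    by (simp add: sum.distrib a flip: sum_divide_distrib sum_distrib_left)
  also have "B * real n \<le> real M * B" using B n by (simp add: mult.commute mult_left_mono)
  finally show "(\<Sum>i<n. \<Sum>j<n. kernel_mat c v n t $$ (i, j) * a i * a j) \<le> real M * B + b2"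
    unfolding eq using v by simp
qed

section \<open>Eigenvalues and eigenvectors under a spectral gap\<close>

text \<open>An average of squares, with mass \<open>p s\<close> at x - l s and the remaining mass at
  y, cannot be at most \<epsilon>^2 when all its values exceed \<epsilon> in size. The remaining
  mass belongs to directions outside the other system, where that operator has eigenvalue 0.\<close>

lemma weighted_exists_small:
  fixes p :: "nat \<Rightarrow> real"
  assumes "\<And>s. s < R \<Longrightarrow> 0 \<le> p s" and tot: "(\<Sum>s<R. p s) \<le> 1"
    and le: "(\<Sum>s<R. (x - l s)\<^sup>2 * p s) + y\<^sup>2 * (1 - (\<Sum>s<R. p s)) \<le> \<epsilon>\<^sup>2"
    and y: "\<bar>y\<bar> > \<epsilon>" and \<epsilon>: "\<epsilon> \<ge> 0"
  shows "\<exists>s<R. \<bar>x - l s\<bar> \<le> \<epsilon>"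
proof (rule ccontr)
  assume "\<not> ?thesis"
  then have far: "\<epsilon> < \<bar>x - l s\<bar>" if "s < R" for s using that by force
  have y2: "\<epsilon>\<^sup>2 < y\<^sup>2" using y \<epsilon> by (metis power2_abs power_strict_mono pos2)
  have x2: "\<epsilon>\<^sup>2 < (x - l s)\<^sup>2" if "s < R" for s
    using far[OF that] \<epsilon> by (metis power2_abs power_strict_mono pos2)
  have ge: "\<epsilon>\<^sup>2 * (\<Sum>s<R. p s) \<le> (\<Sum>s<R. (x - l s)\<^sup>2 * p s)"
    unfolding sum_distrib_left
    by (intro sum_mono mult_right_mono) (use x2 assms(1) in \<open>auto intro: less_imp_le\<close>)
  show False
  proof (cases "(\<Sum>s<R. p s) < 1")
    case True
    have "\<epsilon>\<^sup>2 * (1 - (\<Sum>s<R. p s)) < y\<^sup>2 * (1 - (\<Sum>s<R. p s))"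
      using True y2 by (intro mult_strict_right_mono) auto
    then show False using ge le by (simp add: algebra_simps)
  next
    case False
    then have one: "(\<Sum>s<R. p s) = 1" using tot by simp
    then obtain s0 where s0: "s0 < R" "p s0 > 0"
      using assms(1) by (metis less_eq_real_def lessThan_iff sum.neutral zero_neq_one)
    have "\<epsilon>\<^sup>2 * (\<Sum>s<R. p s) < (\<Sum>s<R. (x - l s)\<^sup>2 * p s)"
      unfolding sum_distrib_left
    proof (rule sum_strict_mono_ex1)
      show "\<forall>s\<in>{..<R}. \<epsilon>\<^sup>2 * p s \<le> (x - l s)\<^sup>2 * p s"
        using assms(1) by (intro ballI mult_right_mono) (auto simp: x2 less_imp_le)
      show "\<exists>s\<in>{..<R}. \<epsilon>\<^sup>2 * p s < (x - l s)\<^sup>2 * p s"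
        using s0 x2 by (auto intro!: bexI[of _ s0] mult_strict_right_mono)
    qed simp
    then show False using one le by simp
  qed
qed

text \<open>With \<open>w\<^sub>i\<^sub>s = \<langle>\<chi>\<^sub>i, \<psi>\<^sub>s\<rangle>\<^sup>2\<close> for two orthonormal systems, the left-hand side of the last assumption is
  the squared Hilbert--Schmidt distance between \<open>\<Sum> d\<^sub>i \<chi>\<^sub>i \<otimes> \<chi>\<^sub>i\<close> and \<open>\<Sum> l\<^sub>s \<psi>\<^sub>s \<otimes> \<psi>\<^sub>s\<close>.\<close>

lemma spectral_perturbation:
  fixes w :: "nat \<Rightarrow> nat \<Rightarrow> real" and d l :: "nat \<Rightarrow> real"
  assumes RK: "R \<le> K"
    and w0: "\<And>i s. 0 \<le> w i s"
    and wr: "\<And>i. i < K \<Longrightarrow> (\<Sum>s<R. w i s) \<le> 1" and wc: "\<And>s. s < R \<Longrightarrow> (\<Sum>i<K. w i s) \<le> 1"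
    and dec: "\<And>i j. i \<le> j \<Longrightarrow> j < K \<Longrightarrow> d j \<le> d i"
    and gap: "\<And>s s'. s < s' \<Longrightarrow> s' < R \<Longrightarrow> c \<le> l s - l s'" and lc: "\<And>s. s < R \<Longrightarrow> c \<le> l s"
    and c: "c > 0" and \<epsilon>: "\<epsilon> \<ge> 0" "6 * \<epsilon> < c"
    and le: "(\<Sum>i<K. \<Sum>s<R. (d i - l s)\<^sup>2 * w i s) + (\<Sum>i<K. (d i)\<^sup>2 * (1 - (\<Sum>s<R. w i s)))
      + (\<Sum>s<R. (l s)\<^sup>2 * (1 - (\<Sum>i<K. w i s))) \<le> \<epsilon>\<^sup>2"
    and r: "r < R"
  shows "\<bar>d r - l r\<bar> \<le> \<epsilon>" and "1 - w r r \<le> (2 * \<epsilon> / c)\<^sup>2"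
proof -
  define T1 where "T1 = (\<Sum>i<K. \<Sum>s<R. (d i - l s)\<^sup>2 * w i s)"
  define T2 where "T2 = (\<Sum>i<K. (d i)\<^sup>2 * (1 - (\<Sum>s<R. w i s)))"
  define T3 where "T3 = (\<Sum>s<R. (l s)\<^sup>2 * (1 - (\<Sum>i<K. w i s)))"
  have T: "T1 + T2 + T3 \<le> \<epsilon>\<^sup>2" using le by (simp add: T1_def T2_def T3_def)
  have T1': "T1 = (\<Sum>s<R. \<Sum>i<K. (d i - l s)\<^sup>2 * w i s)" unfolding T1_def by (rule sum.swap)
  have pos: "0 \<le> T1" "0 \<le> T2" "0 \<le> T3"
    unfolding T1_def T2_def T3_def using w0 wr wc by (auto intro!: sum_nonneg mult_nonneg_nonneg)
  have row: "(\<Sum>s<R. (d i - l s)\<^sup>2 * w i s) + (d i)\<^sup>2 * (1 - (\<Sum>s<R. w i s)) \<le> \<epsilon>\<^sup>2" if i: "i < K" for i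
  proof -
    have "(\<Sum>s<R. (d i - l s)\<^sup>2 * w i s) \<le> T1" unfolding T1_def
      by (rule member_le_sum[of i _ "\<lambda>i. \<Sum>s<R. (d i - l s)\<^sup>2 * w i s"])
        (use i w0 in \<open>auto intro!: sum_nonneg mult_nonneg_nonneg\<close>)
    moreover have "(d i)\<^sup>2 * (1 - (\<Sum>s<R. w i s)) \<le> T2" unfolding T2_def
      by (rule member_le_sum[of i _ "\<lambda>i. (d i)\<^sup>2 * (1 - (\<Sum>s<R. w i s))"])
        (use i wr in \<open>auto intro!: mult_nonneg_nonneg\<close>)
    ultimately show ?thesis using T pos by linarith
  qed
  have col: "(\<Sum>i<K. (l s - d i)\<^sup>2 * w i s) + (l s)\<^sup>2 * (1 - (\<Sum>i<K. w i s)) \<le> \<epsilon>\<^sup>2" if s: "s < R" for s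
  proof -
    have "(\<Sum>i<K. (d i - l s)\<^sup>2 * w i s) \<le> T1" unfolding T1'
      by (rule member_le_sum[of s _ "\<lambda>s. \<Sum>i<K. (d i - l s)\<^sup>2 * w i s"])
        (use s w0 in \<open>auto intro!: sum_nonneg mult_nonneg_nonneg\<close>)
    moreover have "(l s)\<^sup>2 * (1 - (\<Sum>i<K. w i s)) \<le> T3" unfolding T3_def
      by (rule member_le_sum[of s _ "\<lambda>s. (l s)\<^sup>2 * (1 - (\<Sum>i<K. w i s))"])
        (use s wc in \<open>auto intro!: mult_nonneg_nonneg\<close>)
    ultimately show ?thesis using T pos by (simp add: power2_commute)
  qed
  \<comment> \<open>Every \<open>l s\<close> is close to some \<open>d i\<close>: it is at least c,
    hence too far from 0 for the defect mass to account for it.\<close>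
  have "\<exists>i<K. \<bar>l s - d i\<bar> \<le> \<epsilon>" if s: "s < R" for s
    by (rule weighted_exists_small[where p = "\<lambda>i. w i s" and y = "l s"])
      (use w0 wc[OF s] col[OF s] lc[OF s] \<epsilon> in auto)
  then obtain \<rho> where \<rho>: "\<And>s. s < R \<Longrightarrow> \<rho> s < K" "\<And>s. s < R \<Longrightarrow> \<bar>l s - d (\<rho> s)\<bar> \<le> \<epsilon>"
    by metis
  \<comment> \<open>The gap exceeds 2 \<epsilon>, so the matching \<open>\<rho>\<close> preserves
    the strict order; hence s \<le> \<rho> s, and \<open>d s\<close> \<ge>
    \<open>d (\<rho> s)\<close> is bounded below. This is what allows a matching in the other
    direction for the first R indices.\<close>
  have \<rho>_less: "\<rho> s < \<rho> s'" if "s < s'" "s' < R" for s s'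
  proof (rule ccontr)
    assume "\<not> \<rho> s < \<rho> s'"
    then have "d (\<rho> s) \<le> d (\<rho> s')" using dec \<rho>(1)[of s] that by simp
    then show False using gap[OF that] \<rho>(2)[of s] \<rho>(2)[of s'] that \<epsilon> by linarith
  qed
  have \<rho>_ge: "s \<le> \<rho> s" if "s < R" for s
    using that
  proof (induction s)
    case (Suc s)
    then show ?case using \<rho>_less[of s "Suc s"] by simp
  qed simp
  have d_ge: "l s - \<epsilon> \<le> d s" if "s < R" for s
    using dec[OF \<rho>_ge[OF that] \<rho>(1)[OF that]] \<rho>(2)[OF that] by linarith
  have d_big: "c / 2 < d s" if "s < R" for s
    using d_ge[OF that] lc[OF that] \<epsilon> by linarith
  have "\<exists>s<R. \<bar>d i - l s\<bar> \<le> \<epsilon>" if i: "i < R" for i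
    by (rule weighted_exists_small[where p = "\<lambda>s. w i s" and y = "d i"])
      (use w0 wr[of i] row[of i] d_big[OF i] i RK \<epsilon> in auto)
  then obtain \<sigma> where \<sigma>: "\<And>i. i < R \<Longrightarrow> \<sigma> i < R" "\<And>i. i < R \<Longrightarrow> \<bar>d i - l (\<sigma> i)\<bar> \<le> \<epsilon>"
    by metis
  \<comment> \<open>\<open>d i\<close> is at distance at least c / 2 from 0 and from every
    \<open>l s\<close> other than its match, so all weight outside the match costs at least (c /
    2)^2 per unit.\<close>
  have big: "1 - w i (\<sigma> i) \<le> (2 * \<epsilon> / c)\<^sup>2" if i: "i < R" for i
  proof -
    have iK: "i < K" using i RK by simp
    have "(c / 2)\<^sup>2 * (\<Sum>s\<in>{..<R} - {\<sigma> i}. w i s) \<le> (\<Sum>s\<in>{..<R} - {\<sigma> i}. (d i - l s)\<^sup>2 * w i s)"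
      unfolding sum_distrib_left
    proof (intro sum_mono mult_right_mono w0)
      fix s assume s: "s \<in> {..<R} - {\<sigma> i}"
      then have "c \<le> \<bar>l s - l (\<sigma> i)\<bar>"
        using gap[of s "\<sigma> i"] gap[of "\<sigma> i" s] \<sigma>(1)[OF i] by (cases "s < \<sigma> i") auto
      then have "c / 2 \<le> \<bar>d i - l s\<bar>" using \<sigma>(2)[OF i] \<epsilon> by linarith
      then show "(c / 2)\<^sup>2 \<le> (d i - l s)\<^sup>2" using c by (metis less_eq_real_def half_gt_zero power2_abs power_mono)
    qed
    also have "\<dots> \<le> (\<Sum>s<R. (d i - l s)\<^sup>2 * w i s)"
      by (intro sum_mono2) (auto simp: w0)
    finally have 1: "(c / 2)\<^sup>2 * (\<Sum>s\<in>{..<R} - {\<sigma> i}. w i s) \<le> (\<Sum>s<R. (d i - l s)\<^sup>2 * w i s)" .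
    have 2: "(c / 2)\<^sup>2 * (1 - (\<Sum>s<R. w i s)) \<le> (d i)\<^sup>2 * (1 - (\<Sum>s<R. w i s))"
      using d_big[OF i] wr[OF iK] c by (intro mult_right_mono power_mono) auto
    have "(\<Sum>s<R. w i s) = w i (\<sigma> i) + (\<Sum>s\<in>{..<R} - {\<sigma> i}. w i s)"
      using \<sigma>(1)[OF i] by (intro sum.remove) auto
    then have "(c / 2)\<^sup>2 * (1 - w i (\<sigma> i))
      = (c / 2)\<^sup>2 * (\<Sum>s\<in>{..<R} - {\<sigma> i}. w i s) + (c / 2)\<^sup>2 * (1 - (\<Sum>s<R. w i s))"
      by (simp add: algebra_simps)
    also have "\<dots> \<le> \<epsilon>\<^sup>2" using 1 2 row[OF iK] by linarith
    finally show ?thesis using c by (simp add: field_simps power2_eq_square)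
  qed
  \<comment> \<open>Two indices with a common match would each put more than 1/2 on the same column,
    more than it can carry; this excludes \<open>\<sigma> i = \<sigma> j\<close>.\<close>
  have small: "(2 * \<epsilon> / c)\<^sup>2 < 1/2"
  proof -
    have "2 * \<epsilon> / c \<le> 1/3" using \<epsilon> c by (simp add: field_simps)
    then have "(2 * \<epsilon> / c)\<^sup>2 \<le> (1/3)\<^sup>2" using \<epsilon> c by (intro power_mono) auto
    then show ?thesis by (simp add: power2_eq_square)
  qed
  have \<sigma>_less: "\<sigma> i < \<sigma> j" if ij: "i < j" "j < R" for i j
  proof (rule ccontr)
    assume "\<not> \<sigma> i < \<sigma> j"
    then consider "\<sigma> j < \<sigma> i" | "\<sigma> i = \<sigma> j" by linarith
    then show False
    proof cases
      case 1
      have "d j \<le> d i" using dec[of i j] ij RK by simp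
      then show False using gap[OF 1 \<sigma>(1)[of i]] \<sigma>(2)[of i] \<sigma>(2)[of j] ij \<epsilon> by simp
    next
      case 2
      have "w i (\<sigma> i) + w j (\<sigma> i) = (\<Sum>k\<in>{i, j}. w k (\<sigma> i))" using ij by simp
      also have "\<dots> \<le> (\<Sum>k<K. w k (\<sigma> i))"
        by (intro sum_mono2) (use ij RK w0 in auto)
      also have "\<dots> \<le> 1" using wc \<sigma>(1)[of i] ij by simp
      finally show False using big[of i] big[of j] small 2 ij by simp
    qed
  qed
  \<comment> \<open>A strictly increasing map of the first R indices into themselves is the
    identity.\<close>
  have \<sigma>_ge: "i \<le> \<sigma> i" if "i < R" for i
    using that
  proof (induction i)
    case (Suc i)
    then show ?case using \<sigma>_less[of i "Suc i"] by simp
  qed simp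
  have \<sigma>_le: "i < R \<Longrightarrow> \<sigma> i \<le> i" for i
  proof (induction "R - i" arbitrary: i)
    case (Suc k)
    show ?case
    proof (cases "Suc i < R")
      case True
      then have "\<sigma> (Suc i) \<le> Suc i" using Suc(1)[of "Suc i"] Suc(2) by simp
      then show ?thesis using \<sigma>_less[of i "Suc i"] True by simp
    next
      case False
      then show ?thesis using \<sigma>(1)[of i] Suc(3) by simp
    qed
  qed simp
  have id: "\<sigma> r = r" using \<sigma>_ge[OF r] \<sigma>_le[OF r] by simp
  show "\<bar>d r - l r\<bar> \<le> \<epsilon>" using \<sigma>(2)[OF r] id by simp
  show "1 - w r r \<le> (2 * \<epsilon> / c)\<^sup>2" using big[OF r] id by simp
qed

section \<open>A Sobolev embedding on the unit interval\<close>

text \<open>\<open>F k\<close> stands for the k-th derivative, k < q. The Hoelder bound on the last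
  of them replaces a mean-square bound on the q-th derivative, which for a spline of degree q may
  exist only off the knots.\<close>

definition smooth_chain :: "nat \<Rightarrow> real \<Rightarrow> (nat \<Rightarrow> real \<Rightarrow> real) \<Rightarrow> bool" where
  "smooth_chain q L F \<longleftrightarrow>
     (\<forall>k<q. continuous_on unit_ivl (F k))
     \<and> (\<forall>k. Suc k < q \<longrightarrow> (\<forall>t\<in>{0<..<1}. (F k has_real_derivative F (Suc k) t) (at t)))
     \<and> (\<forall>s\<in>unit_ivl. \<forall>t\<in>unit_ivl. \<bar>F (q - 1) s - F (q - 1) t\<bar> \<le> L * sqrt \<bar>s - t\<bar>)
     \<and> integral unit_ivl (\<lambda>t. (F 0 t)\<^sup>2) \<le> 1"

lemma smooth_chainD:
  assumes "smooth_chain q L F"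
  shows "k < q \<Longrightarrow> continuous_on unit_ivl (F k)"
    and "Suc k < q \<Longrightarrow> t \<in> {0<..<1} \<Longrightarrow> (F k has_real_derivative F (Suc k) t) (at t)"
    and "s \<in> unit_ivl \<Longrightarrow> t \<in> unit_ivl \<Longrightarrow> \<bar>F (q - 1) s - F (q - 1) t\<bar> \<le> L * sqrt \<bar>s - t\<bar>"
    and "integral unit_ivl (\<lambda>t. (F 0 t)\<^sup>2) \<le> 1"
  using assms unfolding smooth_chain_def by blast+

lemma smooth_chain_MVT:
  assumes F: "smooth_chain q L F" and k: "Suc k < q" and st: "0 \<le> s" "s < t" "t \<le> 1"
  obtains z where "s < z" "z < t" "F k t - F k s = (t - s) * F (Suc k) z"
proof -
  have der: "(F k has_real_derivative F (Suc k) z) (at z)" if "s < z" "z < t" for z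
    by (rule smooth_chainD(2)[OF F k]) (use that st in auto)
  have "continuous_on {s..t} (F k)"
    by (rule continuous_on_subset[OF smooth_chainD(1)[OF F]]) (use k st in auto)
  then obtain d z where z: "s < z" "z < t" "(F k has_real_derivative d) (at z)" "F k t - F k s = (t - s) * d"
    using MVT[OF st(2), of "F k"] der real_differentiable_def by metis
  then show ?thesis using that DERIV_unique[OF z(3) der[OF z(1,2)]] by blast
qed

text \<open>A derivative is small somewhere in every interval: apply the mean value theorem between
  points of the outer thirds at which the previous derivative is small.\<close>

lemma smooth_chain_small_point:
  "\<exists>C :: real \<Rightarrow> real. \<forall>q L F a c. smooth_chain q L F \<longrightarrow> k < q \<longrightarrow> 0 \<le> a \<longrightarrow> a < c \<longrightarrow> c \<le> 1 \<longrightarrow>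
     (\<exists>t\<in>{a..c}. \<bar>F k t\<bar> \<le> C (c - a))"
proof (induction k)
  case 0
  show ?case
  \<comment> \<open>Above this level throughout an interval of length l, the square would integrate
    to at least 1 / l + 2 + l, more than 1.\<close>
  proof (intro exI[of _ "\<lambda>l. 1 / l + 1"] allI impI, rule ccontr)
    fix q L F and a c :: real
    assume F: "smooth_chain q L F" and q: "0 < q" and ac: "0 \<le> a" "a < c" "c \<le> 1"
      and "\<not> (\<exists>t\<in>{a..c}. \<bar>F 0 t\<bar> \<le> 1 / (c - a) + 1)"
    then have big: "1 / (c - a) + 1 < \<bar>F 0 t\<bar>" if "t \<in> {a..c}" for t using that by force
    have cont: "continuous_on unit_ivl (\<lambda>t. (F 0 t)\<^sup>2)"
      by (intro continuous_intros smooth_chainD(1)[OF F q])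
    have "(1 / (c - a) + 1)\<^sup>2 * (c - a) \<le> integral {a..c} (\<lambda>t. (F 0 t)\<^sup>2)"
    proof -
      have "integral {a..c} (\<lambda>t. (1 / (c - a) + 1)\<^sup>2) \<le> integral {a..c} (\<lambda>t. (F 0 t)\<^sup>2)"
      proof (rule integral_le)
        show "(\<lambda>t. (F 0 t)\<^sup>2) integrable_on {a..c}"
          using continuous_on_subset[OF cont] ac by (intro integrable_continuous_interval) auto
        fix t assume t: "t \<in> {a..c}"
        have "(1 / (c - a) + 1)\<^sup>2 \<le> \<bar>F 0 t\<bar>\<^sup>2"
          using big[OF t] ac by (intro power_mono) auto
        then show "(1 / (c - a) + 1)\<^sup>2 \<le> (F 0 t)\<^sup>2" by simp
      qed (rule integrable_const_ivl)
      then show ?thesis using ac by (simp add: mult.commute)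
    qed
    also have "\<dots> \<le> integral unit_ivl (\<lambda>t. (F 0 t)\<^sup>2)"
      by (intro integral_subset_le integrable_continuous_interval continuous_on_subset[OF cont])
        (use ac in auto)
    also have "\<dots> \<le> 1" by (rule smooth_chainD(4)[OF F])
    finally have "(1 / (c - a) + 1)\<^sup>2 * (c - a) \<le> 1" .
    moreover have sq: "(1 / l + 1)\<^sup>2 * l = 1 / l + 2 + l" if "l > 0" for l :: real
      using that by (simp add: power2_eq_square field_simps)
    moreover have "(1 / (c - a) + 1)\<^sup>2 * (c - a) = 1 / (c - a) + 2 + (c - a)"
      using sq[of "c - a"] ac by simp
    moreover have "1 / (c - a) > 0" using ac by simp
    ultimately show False using ac by linarith
  qed
next
  case (Suc k)
  then obtain C :: "real \<Rightarrow> real" where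
    C: "\<And>q L F a c. smooth_chain q L F \<Longrightarrow> k < q \<Longrightarrow> 0 \<le> a \<Longrightarrow> a < c \<Longrightarrow> c \<le> 1 \<Longrightarrow>
     \<exists>t\<in>{a..c}. \<bar>F k t\<bar> \<le> C (c - a)" by blast
  show ?case
  \<comment> \<open>Two values of size at most \<open>C (l / 3)\<close> at points at least l / 3
    apart bound the difference quotient between them.\<close>
  proof (intro exI[of _ "\<lambda>l. 2 * C (l / 3) / (l / 3)"] allI impI)
    fix q L F and a c :: real
    assume F: "smooth_chain q L F" and k: "Suc k < q" and ac: "0 \<le> a" "a < c" "c \<le> 1"
    define l where "l = (c - a) / 3"
    have l: "l > 0" "c = a + 3 * l" using ac by (auto simp: l_def field_simps)
    obtain t1 where t1: "t1 \<in> {a..a + l}" "\<bar>F k t1\<bar> \<le> C l"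
      using C[OF F, of a "a + l"] k ac l by auto
    obtain t2 where t2: "t2 \<in> {a + 2 * l..c}" "\<bar>F k t2\<bar> \<le> C l"
      using C[OF F, of "a + 2 * l" c] k ac l by auto
    have lt: "t1 < t2" "l \<le> t2 - t1" using t1 t2 l by auto
    obtain z where z: "t1 < z" "z < t2" "F k t2 - F k t1 = (t2 - t1) * F (Suc k) z"
      by (rule smooth_chain_MVT[OF F k _ lt(1)]) (use t1 t2 ac l in auto)
    have "\<bar>F (Suc k) z\<bar> * l \<le> \<bar>F (Suc k) z\<bar> * (t2 - t1)" using lt by (intro mult_left_mono) auto
    also have "\<dots> = \<bar>F k t2 - F k t1\<bar>" using z lt by (simp add: abs_mult mult.commute)
    also have "\<dots> \<le> 2 * C l" using t1 t2 by linarith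
    finally have "\<bar>F (Suc k) z\<bar> \<le> 2 * C l / l" using l by (simp add: field_simps)
    then show "\<exists>t\<in>{a..c}. \<bar>F (Suc k) t\<bar> \<le> 2 * C ((c - a) / 3) / ((c - a) / 3)"
      using z t1 t2 l by (intro bexI[of _ z]) (auto simp flip: l_def)
  qed
qed

text \<open>Induction downwards from the highest order, counted by j: a derivative bounded by B
  makes the one below Lipschitz, and a point where that one is small turns this into a bound. The
  constant is chosen before the chain \<open>F\<close>.\<close>

lemma smooth_chain_bounds:
  assumes "L \<ge> 0" "j < q"
  shows "\<exists>B\<ge>0. \<forall>F. smooth_chain q L F \<longrightarrow>
    (\<forall>t\<in>unit_ivl. \<bar>F (q - 1 - j) t\<bar> \<le> B) \<and>
    (\<forall>s\<in>unit_ivl. \<forall>t\<in>unit_ivl. \<bar>F (q - 1 - j) s - F (q - 1 - j) t\<bar> \<le> B * sqrt \<bar>s - t\<bar>)"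
  using assms(2)
proof (induction j)
  case 0
  obtain C :: "real \<Rightarrow> real" where C: "\<And>q' L F a c. smooth_chain q' L F \<Longrightarrow> q - 1 < q' \<Longrightarrow> 0 \<le> a \<Longrightarrow> a < c \<Longrightarrow> c \<le> 1 \<Longrightarrow>
     \<exists>t\<in>{a..c}. \<bar>F (q - 1) t\<bar> \<le> C (c - a)"
    using smooth_chain_small_point[of "q - 1"] by blast
  show ?case
  proof (intro exI[of _ "\<bar>C 1\<bar> + L"] conjI allI impI ballI)
    fix F t assume F: "smooth_chain q L F" and t: "t \<in> unit_ivl"
    obtain t0 where t0: "t0 \<in> unit_ivl" "\<bar>F (q - 1) t0\<bar> \<le> C 1"
      using C[OF F, of 0 1] 0 by auto
    have "\<bar>F (q - 1) t - F (q - 1) t0\<bar> \<le> L * sqrt \<bar>t - t0\<bar>"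
      by (rule smooth_chainD(3)[OF F t t0(1)])
    also have "\<dots> \<le> L * 1" using assms(1) t t0 by (intro mult_left_mono) auto
    finally show "\<bar>F (q - 1 - 0) t\<bar> \<le> \<bar>C 1\<bar> + L" using t0(2) by simp
  next
    fix F s t assume F: "smooth_chain q L F" and t: "s \<in> unit_ivl" "t \<in> unit_ivl"
    have "\<bar>F (q - 1) s - F (q - 1) t\<bar> \<le> L * sqrt \<bar>s - t\<bar>"
      by (rule smooth_chainD(3)[OF F t])
    also have "\<dots> \<le> (\<bar>C 1\<bar> + L) * sqrt \<bar>s - t\<bar>" by (intro mult_right_mono) auto
    finally show "\<bar>F (q - 1 - 0) s - F (q - 1 - 0) t\<bar> \<le> (\<bar>C 1\<bar> + L) * sqrt \<bar>s - t\<bar>" by simp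
  qed (use assms in auto)
next
  case (Suc j)
  then obtain B where B: "B \<ge> 0"
    "\<And>F t. smooth_chain q L F \<Longrightarrow> t \<in> unit_ivl \<Longrightarrow> \<bar>F (q - 1 - j) t\<bar> \<le> B"
    using Suc.IH Suc_lessD[OF Suc.prems] by blast
  define k where "k = q - 1 - Suc j"
  have k: "Suc k < q" "q - 1 - j = Suc k" using Suc.prems by (auto simp: k_def)
  obtain C :: "real \<Rightarrow> real" where C: "\<And>q' L F a c. smooth_chain q' L F \<Longrightarrow> k < q' \<Longrightarrow> 0 \<le> a \<Longrightarrow> a < c \<Longrightarrow> c \<le> 1 \<Longrightarrow>
     \<exists>t\<in>{a..c}. \<bar>F k t\<bar> \<le> C (c - a)"
    using smooth_chain_small_point[of k] by blast
  have lip_less: "\<bar>F k s - F k t\<bar> \<le> B * \<bar>s - t\<bar>"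
    if F: "smooth_chain q L F" and st: "s \<in> unit_ivl" "t \<in> unit_ivl" "s < t" for F s t
  proof -
    obtain z where z: "s < z" "z < t" "F k t - F k s = (t - s) * F (Suc k) z"
      by (rule smooth_chain_MVT[OF F k(1) _ st(3)]) (use st in auto)
    have "\<bar>F (Suc k) z\<bar> \<le> B" using B(2)[OF F, of z] k(2) st z(1,2) by simp
    then have "(t - s) * \<bar>F (Suc k) z\<bar> \<le> (t - s) * B" using st by (intro mult_left_mono) auto
    then show ?thesis using z(3) st by (simp add: abs_mult abs_minus_commute[of "F k s"] mult.commute)
  qed
  have lip: "\<bar>F k s - F k t\<bar> \<le> B * \<bar>s - t\<bar>"
    if F: "smooth_chain q L F" and st: "s \<in> unit_ivl" "t \<in> unit_ivl" for F s t
    using lip_less[OF F st] lip_less[OF F st(2,1)]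
    by (cases s t rule: linorder_cases) (auto simp: abs_minus_commute)
  show ?case unfolding k_def[symmetric]
  proof (intro exI[of _ "\<bar>C 1\<bar> + B"] conjI allI impI ballI)
    fix F t assume F: "smooth_chain q L F" and t: "t \<in> unit_ivl"
    obtain t0 where t0: "t0 \<in> unit_ivl" "\<bar>F k t0\<bar> \<le> C 1"
      using C[OF F, of 0 1] k by auto
    have "\<bar>F k t - F k t0\<bar> \<le> B * \<bar>t - t0\<bar>" by (rule lip[OF F t t0(1)])
    also have "\<dots> \<le> B * 1" using B(1) t t0 by (intro mult_left_mono) auto
    finally show "\<bar>F k t\<bar> \<le> \<bar>C 1\<bar> + B" using t0(2) by simp
  next
    fix F s t assume F: "smooth_chain q L F" and t: "s \<in> unit_ivl" "t \<in> unit_ivl"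
    have "\<bar>F k s - F k t\<bar> \<le> B * \<bar>s - t\<bar>" by (rule lip[OF F t])
    also have "\<dots> \<le> (\<bar>C 1\<bar> + B) * sqrt \<bar>s - t\<bar>"
    proof (intro mult_mono)
      \<comment> \<open>On the unit interval a Lipschitz bound is also a Hoelder bound of order
        1/2.\<close>
      have "\<bar>s - t\<bar> \<le> 1" using t by auto
      then show "\<bar>s - t\<bar> \<le> sqrt \<bar>s - t\<bar>"
        using mult_left_le[of "\<bar>s - t\<bar>" "\<bar>s - t\<bar>"]
        by (intro real_le_rsqrt) (simp add: power2_eq_square)
    qed (use B in auto)
    finally show "\<bar>F k s - F k t\<bar> \<le> (\<bar>C 1\<bar> + B) * sqrt \<bar>s - t\<bar>" .
  qed (use B in auto)
qed

text \<open>Cauchy-Schwarz against the constant 1 for the gauge integral, obtained from the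
  pointwise inequality |y| \<le> h y^2 / 2 + 1 / (2 h) and a choice of h.\<close>

lemma has_integral_cauchy_schwarz:
  fixes g :: "real \<Rightarrow> real"
  assumes g: "(g has_integral I) {s..t}" and g2: "(\<lambda>x. (g x)\<^sup>2) integrable_on {s..t}"
    and b: "integral {s..t} (\<lambda>x. (g x)\<^sup>2) \<le> b" and st: "s \<le> t"
  shows "\<bar>I\<bar> \<le> sqrt b * sqrt (t - s)"
proof -
  have gi: "g integrable_on {s..t}" "integral {s..t} g = I" using g by auto
  have "integral {s..t} (\<lambda>x. (g x)\<^sup>2) \<ge> 0" by (intro integral_nonneg g2) auto
  then have b0: "b \<ge> 0" using b by simp
  have key: "2 * \<bar>I\<bar> \<le> h * b + (t - s) / h" if l: "h > 0" for h
  proof -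
    have int: "(\<lambda>x. h / 2 * (g x)\<^sup>2 + 1 / (2 * h)) integrable_on {s..t}"
      by (intro integrable_add integrable_on_mult_right g2 integrable_const_ivl)
    have pt: "\<bar>y\<bar> \<le> h / 2 * y\<^sup>2 + 1 / (2 * h)" for y
    proof -
      have "0 \<le> (h * \<bar>y\<bar> - 1)\<^sup>2 / h" using l by simp
      also have "\<dots> = h * y\<^sup>2 + 1 / h - 2 * \<bar>y\<bar>"
        using l by (simp add: power2_diff field_simps power2_eq_square)
      finally show ?thesis by simp
    qed
    have ge: "y \<le> h / 2 * y\<^sup>2 + 1 / (2 * h)" "- y \<le> h / 2 * y\<^sup>2 + 1 / (2 * h)" for y
      using pt[of y] by linarith+
    have "I \<le> integral {s..t} (\<lambda>x. h / 2 * (g x)\<^sup>2 + 1 / (2 * h))"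
      unfolding gi(2)[symmetric] by (rule integral_le[OF gi(1) int]) (rule ge)
    moreover have "- I \<le> integral {s..t} (\<lambda>x. h / 2 * (g x)\<^sup>2 + 1 / (2 * h))"
      unfolding gi(2)[symmetric] integral_neg[symmetric]
      by (rule integral_le[OF integrable_neg[OF gi(1)] int]) (rule ge)
    moreover have "integral {s..t} (\<lambda>x. h / 2 * (g x)\<^sup>2 + 1 / (2 * h))
        = h / 2 * integral {s..t} (\<lambda>x. (g x)\<^sup>2) + (t - s) * (1 / (2 * h))"
      using st integral_const_real[of s t "1 / (2 * h)"]
      by (subst integral_add) (auto intro!: integrable_on_mult_right g2)
    moreover have "h / 2 * integral {s..t} (\<lambda>x. (g x)\<^sup>2) \<le> h / 2 * b" using l b by simp
    moreover have "(t - s) * (1 / (2 * h)) = ((t - s) / h) / 2" "h / 2 * b = h * b / 2" by simp_all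
    ultimately have "I \<le> h * b / 2 + (t - s) / h / 2" "- I \<le> h * b / 2 + (t - s) / h / 2" by linarith+
    then have "\<bar>I\<bar> \<le> (h * b + (t - s) / h) / 2" by (simp only: abs_le_iff add_divide_distrib)
    then show ?thesis by simp
  qed
  have "I\<^sup>2 \<le> b * (t - s)"
  proof (cases "I = 0 \<or> s = t")
    case True
    then have "I = 0" using gi(2) by auto
    then show ?thesis using b0 st by simp
  next
    case False
    \<comment> \<open>With h = (t - s) / |I| the last term is |I|, and no division by
      \<open>b\<close>, which may be 0, occurs.\<close>
    have "2 * \<bar>I\<bar> \<le> (t - s) / \<bar>I\<bar> * b + (t - s) / ((t - s) / \<bar>I\<bar>)"
      by (rule key) (use False st in auto)
    then have "\<bar>I\<bar> \<le> (t - s) / \<bar>I\<bar> * b" using False st by simp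
    then have "\<bar>I\<bar> * \<bar>I\<bar> \<le> (t - s) * b" using False by (simp add: field_simps)
    then show ?thesis by (simp add: power2_eq_square mult.commute)
  qed
  then have "\<bar>I\<bar> \<le> sqrt (b * (t - s))" by (intro real_le_rsqrt) simp
  then show ?thesis by (simp add: real_sqrt_mult)
qed

section \<open>Piecewise polynomials\<close>

definition matching :: "nat \<Rightarrow> nat \<Rightarrow> (nat \<Rightarrow> real) \<Rightarrow> (nat \<Rightarrow> real poly) \<Rightarrow> bool" where
  "matching m J \<tau> pc \<longleftrightarrow> (\<forall>i k. Suc i < J \<and> k < m \<longrightarrow>
     poly ((pderiv ^^ k) (pc i)) (\<tau> (Suc i)) = poly ((pderiv ^^ k) (pc (Suc i))) (\<tau> (Suc i)))"

definition piece_index :: "nat \<Rightarrow> (nat \<Rightarrow> real) \<Rightarrow> real \<Rightarrow> nat" where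
  "piece_index J \<tau> t = (LEAST i. i < J \<and> t \<in> {\<tau> i..\<tau> (Suc i)})"

text \<open>At an interior knot the least index selects the left piece. By matching, the choice
  affects only orders k \<ge> m.\<close>

definition pp_deriv :: "nat \<Rightarrow> (nat \<Rightarrow> real) \<Rightarrow> (nat \<Rightarrow> real poly) \<Rightarrow> nat \<Rightarrow> real \<Rightarrow> real" where
  "pp_deriv J \<tau> pc k t = poly ((pderiv ^^ k) (pc (piece_index J \<tau> t))) t"

lemma knot_seq_less:
  assumes "knot_seq J \<tau>" "i < j" "j \<le> J"
  shows "\<tau> i < \<tau> j"
  using assms(2,3)
proof (induction j)
  case (Suc j)
  have "\<tau> j < \<tau> (Suc j)" using assms(1) Suc.prems by (simp add: knot_seq_def)
  then show ?case using Suc by (cases "i = j") auto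
qed simp

lemma knot_seq_le:
  assumes "knot_seq J \<tau>" "i \<le> j" "j \<le> J"
  shows "\<tau> i \<le> \<tau> j"
  using knot_seq_less[OF assms(1), of i j] assms by (cases "i = j") auto

lemma knot_seq_pos: "knot_seq J \<tau> \<Longrightarrow> 0 < J"
  by (cases J) (auto simp: knot_seq_def)

lemma knot_seq_unit:
  assumes "knot_seq J \<tau>" "i \<le> J"
  shows "\<tau> i \<in> unit_ivl"
  using knot_seq_le[OF assms(1), of 0 i] knot_seq_le[OF assms(1), of i J] assms
  by (auto simp: knot_seq_def)

lemma knot_seq_cover:
  assumes J: "knot_seq J \<tau>" and t: "t \<in> unit_ivl"
  shows "\<exists>i<J. t \<in> {\<tau> i..\<tau> (Suc i)}"
proof -
  define j where "j = (LEAST j. t \<le> \<tau> j)"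
  have ex: "t \<le> \<tau> J" using J t by (simp add: knot_seq_def)
  have j: "t \<le> \<tau> j" "j \<le> J" unfolding j_def using ex by (auto intro: LeastI Least_le)
  show ?thesis
  proof (cases j)
    case 0
    then have "t = \<tau> 0" using j t J by (auto simp: knot_seq_def)
    then show ?thesis using knot_seq_pos[OF J] J by (intro exI[of _ 0]) (auto simp: knot_seq_def intro: less_imp_le)
  next
    case (Suc i)
    then have "\<not> t \<le> \<tau> i" unfolding j_def using not_less_Least by (metis lessI)
    then show ?thesis using j Suc by (intro exI[of _ i]) auto
  qed
qed

lemma piece_index:
  assumes "knot_seq J \<tau>" "t \<in> unit_ivl"
  shows "piece_index J \<tau> t < J" "t \<in> {\<tau> (piece_index J \<tau> t)..\<tau> (Suc (piece_index J \<tau> t))}"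
  using LeastI_ex[OF knot_seq_cover[OF assms]] unfolding piece_index_def by auto

text \<open>A point lies in two pieces only at the common knot of neighbours, and there matching
  makes all orders below m agree.\<close>

lemma pp_deriv_eq:
  assumes J: "knot_seq J \<tau>" and m: "matching m J \<tau> pc" and i: "i < J" and t: "t \<in> {\<tau> i..\<tau> (Suc i)}"
    and k: "k < m \<or> t \<in> {\<tau> i<..<\<tau> (Suc i)}"
  shows "pp_deriv J \<tau> pc k t = poly ((pderiv ^^ k) (pc i)) t"
proof -
  have tu: "t \<in> unit_ivl" using t knot_seq_unit[OF J, of i] knot_seq_unit[OF J, of "Suc i"] i by auto
  define j where "j = piece_index J \<tau> t"
  have j: "j < J" "t \<in> {\<tau> j..\<tau> (Suc j)}" using piece_index[OF J tu] by (auto simp: j_def)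
  have ji: "j \<le> i" unfolding j_def piece_index_def using i t by (intro Least_le) auto
  show ?thesis
  proof (cases "j = i")
    case False
    then have "\<tau> (Suc j) \<le> \<tau> i" using ji i by (intro knot_seq_le[OF J]) auto
    then have eq: "t = \<tau> (Suc j)" "\<tau> (Suc j) = \<tau> i" using j t by auto
    then have "Suc j = i" using knot_seq_less[OF J, of "Suc j" i] False ji i by (cases "Suc j < i") auto
    moreover have "k < m" using k eq by auto
    ultimately show ?thesis
      using m i eq unfolding pp_deriv_def matching_def j_def[symmetric] by auto
  qed (simp add: pp_deriv_def j_def[symmetric])
qed

lemma continuous_on_pp_deriv:
  assumes J: "knot_seq J \<tau>" and m: "matching m J \<tau> pc" and k: "k < m"
  shows "continuous_on unit_ivl (pp_deriv J \<tau> pc k)"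
proof -
  have "continuous_on (\<Union>i\<in>{..<J}. {\<tau> i..\<tau> (Suc i)}) (pp_deriv J \<tau> pc k)"
  proof (rule continuous_on_closed_Union)
    fix i assume i: "i \<in> {..<J}"
    have "continuous_on {\<tau> i..\<tau> (Suc i)} (\<lambda>t. poly ((pderiv ^^ k) (pc i)) t)"
      by (intro continuous_intros)
    then show "continuous_on {\<tau> i..\<tau> (Suc i)} (pp_deriv J \<tau> pc k)"
      by (rule continuous_on_eq) (use pp_deriv_eq[OF J m, of i] i k in auto)
  qed auto
  then show ?thesis
    by (rule continuous_on_subset) (use knot_seq_cover[OF J] in fastforce)
qed

lemma pp_deriv_has_derivative:
  assumes J: "knot_seq J \<tau>" and m: "matching m J \<tau> pc" and k: "k < m" and t: "t \<in> {0<..<1}"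
    and kt: "Suc k < m \<or> t \<notin> \<tau> ` {..J}"
  shows "(pp_deriv J \<tau> pc k has_real_derivative pp_deriv J \<tau> pc (Suc k) t) (at t)"
proof -
  obtain i where i: "i < J" "t \<in> {\<tau> i..\<tau> (Suc i)}"
    using knot_seq_cover[OF J, of t] t by auto
  have der: "(poly ((pderiv ^^ k) (pc i)) has_real_derivative poly ((pderiv ^^ Suc k) (pc i)) t) (at t within A)" for A i
    using poly_DERIV[of "(pderiv ^^ k) (pc i)" t] by (auto intro: has_field_derivative_at_within)
  show ?thesis
  proof (cases "t \<in> {\<tau> i<..<\<tau> (Suc i)}")
    case True
    have "pp_deriv J \<tau> pc (Suc k) t = poly ((pderiv ^^ Suc k) (pc i)) t"
      by (rule pp_deriv_eq[OF J m i]) (use True in auto)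
    moreover have "(pp_deriv J \<tau> pc k has_real_derivative poly ((pderiv ^^ Suc k) (pc i)) t) (at t)"
      by (rule has_field_derivative_transform_within_open[OF der, of "{\<tau> i<..<\<tau> (Suc i)}"])
        (use True i pp_deriv_eq[OF J m i(1)] in auto)
    ultimately show ?thesis by simp
  next
    case False
    \<comment> \<open>At a knot the two adjacent pieces give one-sided derivatives; they agree
      because matching reaches the order k + 1.\<close>
    have kt': "Suc k < m" using kt False i by auto
    obtain j where j: "Suc j < J" "t = \<tau> (Suc j)"
    proof (cases "t = \<tau> i")
      case True
      then have "i \<noteq> 0" using t J by (cases "i = 0") (auto simp: knot_seq_def)
      then show ?thesis using that[of "i - 1"] True i by simp
    next
      case False
      then have ti: "t = \<tau> (Suc i)" using \<open>t \<notin> {\<tau> i<..<\<tau> (Suc i)}\<close> i by auto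
      then have "Suc i \<noteq> J" using t J by (cases "Suc i = J") (auto simp: knot_seq_def)
      then show ?thesis using that[of i] ti i by simp
    qed
    have lt: "\<tau> j < t" "t < \<tau> (Suc (Suc j))" using knot_seq_less[OF J] j by auto
    have val: "pp_deriv J \<tau> pc (Suc k) t = poly ((pderiv ^^ Suc k) (pc j)) t"
      "pp_deriv J \<tau> pc (Suc k) t = poly ((pderiv ^^ Suc k) (pc (Suc j))) t"
      by (rule pp_deriv_eq[OF J m]; use j lt kt' in auto)+
    have "(pp_deriv J \<tau> pc k has_real_derivative pp_deriv J \<tau> pc (Suc k) t) (at t within {\<tau> j..t})"
      unfolding val(1) has_field_derivative_def
      by (rule has_derivative_transform[OF _ _ der[unfolded has_field_derivative_def]])
        (use j lt k pp_deriv_eq[OF J m, of j] in auto)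
    moreover have "(pp_deriv J \<tau> pc k has_real_derivative pp_deriv J \<tau> pc (Suc k) t) (at t within {t..\<tau> (Suc (Suc j))})"
      unfolding val(2) has_field_derivative_def
      by (rule has_derivative_transform[OF _ _ der[unfolded has_field_derivative_def]])
        (use j lt k pp_deriv_eq[OF J m, of "Suc j"] in auto)
    ultimately have "(pp_deriv J \<tau> pc k has_real_derivative pp_deriv J \<tau> pc (Suc k) t) (at t within {\<tau> j..t} \<union> {t..\<tau> (Suc (Suc j))})"
      unfolding has_field_derivative_iff by (rule Lim_Un)
    moreover have "{\<tau> j..t} \<union> {t..\<tau> (Suc (Suc j))} = {\<tau> j..\<tau> (Suc (Suc j))}" using lt by auto
    ultimately show ?thesis using lt by (simp add: at_within_Icc_at)
  qed
qed

lemma continuous_set_integrable: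
  fixes f :: "real \<Rightarrow> real"
  assumes "continuous_on unit_ivl f"
  shows "set_integrable lborel unit_ivl f"
  by (rule borel_integrable_atLeastAtMost') (use assms in auto)

lemma set_lebesgue_integral_unit_eq:
  fixes f :: "real \<Rightarrow> real"
  assumes "set_integrable lborel unit_ivl f"
  shows "(LINT t:unit_ivl|lborel. f t) = integral unit_ivl f" "f integrable_on unit_ivl"
  using set_borel_integral_eq_integral[OF assms] by auto

text \<open>Iterating \<open>deriv\<close> requires the previous derivative on a whole
  neighbourhood. All orders before the last are below m and have no exceptional points, so knots are
  excluded only in the last differentiation.\<close>

lemma has_derivative_spline:
  assumes J: "knot_seq J \<tau>" and m: "matching m J \<tau> pc"
    and f: "\<And>t. t \<in> unit_ivl \<Longrightarrow> f t = pp_deriv J \<tau> pc 0 t"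
    and "k \<le> m" "t \<in> {0<..<1}" "k < m \<or> t \<notin> \<tau> ` {..J}"
  shows "(deriv ^^ k) f t = pp_deriv J \<tau> pc k t"
  using assms(4-)
proof (induction k arbitrary: t)
  case 0
  then show ?case using f by simp
next
  case (Suc k)
  have "(pp_deriv J \<tau> pc k has_real_derivative pp_deriv J \<tau> pc (Suc k) t) (at t)"
    by (rule pp_deriv_has_derivative[OF J m]) (use Suc.prems in auto)
  then have "((deriv ^^ k) f has_real_derivative pp_deriv J \<tau> pc (Suc k) t) (at t)"
    by (rule has_field_derivative_transform_within_open[of _ _ _ "{0<..<1}"])
      (use Suc in auto)
  then show ?case by (simp add: DERIV_imp_deriv)
qed

text \<open>A Borel version of the k-th derivative, equal to 0 at the knots. Its explicit form as a
  finite sum makes measurability and integrability immediate.\<close>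

definition pp_step :: "nat \<Rightarrow> (nat \<Rightarrow> real) \<Rightarrow> (nat \<Rightarrow> real poly) \<Rightarrow> nat \<Rightarrow> real \<Rightarrow> real" where
  "pp_step J \<tau> pc k t = (\<Sum>i<J. indicator {\<tau> i<..<\<tau> (Suc i)} t * poly ((pderiv ^^ k) (pc i)) t)"

lemma pp_step_eq:
  assumes J: "knot_seq J \<tau>" and m: "matching m J \<tau> pc" and t: "t \<in> unit_ivl" "t \<notin> \<tau> ` {..J}"
  shows "pp_step J \<tau> pc k t = pp_deriv J \<tau> pc k t"
proof -
  obtain i where i: "i < J" "t \<in> {\<tau> i..\<tau> (Suc i)}" using knot_seq_cover[OF J t(1)] by blast
  have ti: "t \<in> {\<tau> i<..<\<tau> (Suc i)}" using i t(2) by (auto simp: less_le)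
  have off: "t \<notin> {\<tau> j<..<\<tau> (Suc j)}" if j: "j < J" "j \<noteq> i" for j
    using j ti knot_seq_le[OF J, of "Suc j" i] knot_seq_le[OF J, of "Suc i" j] i
    by (cases "j < i") auto
  have "pp_step J \<tau> pc k t = (\<Sum>j<J. if j = i then poly ((pderiv ^^ k) (pc i)) t else 0)"
    unfolding pp_step_def
    by (intro sum.cong refl) (use ti off in \<open>auto simp: indicator_def\<close>)
  also have "\<dots> = poly ((pderiv ^^ k) (pc i)) t" using i by simp
  also have "\<dots> = pp_deriv J \<tau> pc k t" by (rule pp_deriv_eq[OF J m i, symmetric]) (use ti in simp)
  finally show ?thesis .
qed

lemma borel_measurable_poly [measurable]: "(\<lambda>t. poly (p :: real poly) t) \<in> borel_measurable borel"
  by (intro borel_measurable_continuous_onI continuous_intros)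

lemma pp_step_measurable [measurable]: "pp_step J \<tau> pc k \<in> borel_measurable borel"
  unfolding pp_step_def[abs_def] by measurable

lemma pp_step_bounded: "\<exists>B. \<forall>t\<in>unit_ivl. \<bar>pp_step J \<tau> pc k t\<bar> \<le> B"
proof -
  have "\<exists>B. \<forall>t\<in>unit_ivl. \<bar>poly p t\<bar> \<le> B" for p :: "real poly"
  proof -
    have "bounded (poly p ` unit_ivl)"
      by (intro compact_imp_bounded compact_continuous_image continuous_intros) simp
    then show ?thesis unfolding bounded_iff by auto
  qed
  then have "\<forall>i. \<exists>B. \<forall>t\<in>unit_ivl. \<bar>poly ((pderiv ^^ k) (pc i)) t\<bar> \<le> B" by blast
  then obtain B where B: "\<And>i t. t \<in> unit_ivl \<Longrightarrow> \<bar>poly ((pderiv ^^ k) (pc i)) t\<bar> \<le> B i"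
    using choice[of "\<lambda>i B. \<forall>t\<in>unit_ivl. \<bar>poly ((pderiv ^^ k) (pc i)) t\<bar> \<le> B"] by blast
  show ?thesis
  proof (intro exI[of _ "\<Sum>i<J. B i"] ballI)
    fix t assume t: "t \<in> unit_ivl"
    have "\<bar>pp_step J \<tau> pc k t\<bar> \<le> (\<Sum>i<J. \<bar>indicator {\<tau> i<..<\<tau> (Suc i)} t * poly ((pderiv ^^ k) (pc i)) t\<bar>)"
      unfolding pp_step_def by (rule sum_abs)
    also have "\<dots> \<le> (\<Sum>i<J. B i)"
    proof (intro sum_mono)
      fix i
      have "0 \<le> B i" using B[OF t, of i] by linarith
      then show "\<bar>indicator {\<tau> i<..<\<tau> (Suc i)} t * poly ((pderiv ^^ k) (pc i)) t\<bar> \<le> B i"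
        using B[OF t, of i] by (auto simp: indicator_def)
    qed
    finally show "\<bar>pp_step J \<tau> pc k t\<bar> \<le> (\<Sum>i<J. B i)" .
  qed
qed

lemma pp_step_mult_integrable:
  "set_integrable lborel unit_ivl (\<lambda>t. pp_step J \<tau> pc k t * pp_step J \<tau> pc' k t)"
proof -
  obtain B B' where B: "\<And>t. t \<in> unit_ivl \<Longrightarrow> \<bar>pp_step J \<tau> pc k t\<bar> \<le> B"
    "\<And>t. t \<in> unit_ivl \<Longrightarrow> \<bar>pp_step J \<tau> pc' k t\<bar> \<le> B'"
    using pp_step_bounded by meson
  show ?thesis unfolding set_integrable_def
  proof (rule integrableI_bounded_set_indicator[where B = "B * B'"])
    show "AE t\<in>unit_ivl in lborel. norm (pp_step J \<tau> pc k t * pp_step J \<tau> pc' k t) \<le> B * B'"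
    proof (intro AE_I2 impI)
      fix t assume "t \<in> unit_ivl"
      then have "\<bar>pp_step J \<tau> pc k t\<bar> * \<bar>pp_step J \<tau> pc' k t\<bar> \<le> B * B'"
        by (intro mult_mono B order_trans[OF abs_ge_zero B(1)]) auto
      then show "norm (pp_step J \<tau> pc k t * pp_step J \<tau> pc' k t) \<le> B * B'" by (simp add: abs_mult)
    qed
  qed auto
qed

text \<open>The constant is fixed before the knots and the number of pieces. The chain consists of
  the derivatives of order below q, and the mean-square bound on the q-th gives the Hoelder bound on
  the last of them.\<close>

lemma spline_regular:
  assumes q: "1 \<le> q" "q \<le> m" and b0: "b0 \<ge> 0"
  shows "\<exists>B\<ge>0. \<forall>J \<tau> pc f. knot_seq J \<tau> \<longrightarrow> matching m J \<tau> pc \<longrightarrow> (\<forall>t\<in>unit_ivl. f t = pp_deriv J \<tau> pc 0 t) \<longrightarrow>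
    integral unit_ivl (\<lambda>t. (f t)\<^sup>2) \<le> 1 \<longrightarrow> (LINT t:unit_ivl|lborel. (pp_step J \<tau> pc q t)\<^sup>2) \<le> b0 \<longrightarrow>
    (\<forall>t\<in>unit_ivl. \<bar>f t\<bar> \<le> B) \<and> (\<forall>s\<in>unit_ivl. \<forall>t\<in>unit_ivl. \<bar>f s - f t\<bar> \<le> B * sqrt \<bar>s - t\<bar>)"
proof -
  obtain B where B: "B \<ge> 0" "\<And>F. smooth_chain q (sqrt b0) F \<Longrightarrow>
    (\<forall>t\<in>unit_ivl. \<bar>F 0 t\<bar> \<le> B) \<and> (\<forall>s\<in>unit_ivl. \<forall>t\<in>unit_ivl. \<bar>F 0 s - F 0 t\<bar> \<le> B * sqrt \<bar>s - t\<bar>)"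
    using smooth_chain_bounds[of "sqrt b0" "q - 1" q] q b0 by auto
  show ?thesis
  proof (intro exI[of _ B] conjI B(1), intro allI impI)
    fix J \<tau> pc f
    assume J: "knot_seq J \<tau>" and m: "matching m J \<tau> pc" and f: "\<forall>t\<in>unit_ivl. f t = pp_deriv J \<tau> pc 0 t"
      and f2: "integral unit_ivl (\<lambda>t. (f t)\<^sup>2) \<le> 1" and g: "(LINT t:unit_ivl|lborel. (pp_step J \<tau> pc q t)\<^sup>2) \<le> b0"
    define F where "F = pp_deriv J \<tau> pc"
    have fin: "finite (\<tau> ` {..J})" by simp
    have g2i: "(\<lambda>t. (pp_step J \<tau> pc q t)\<^sup>2) integrable_on unit_ivl"
      "integral unit_ivl (\<lambda>t. (pp_step J \<tau> pc q t)\<^sup>2) \<le> b0"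
      using set_lebesgue_integral_unit_eq[OF pp_step_mult_integrable[of J \<tau> pc q pc]] g
      by (simp_all add: power2_eq_square)
    have eqF: "(pp_step J \<tau> pc q t)\<^sup>2 = (F q t)\<^sup>2" if "t \<in> unit_ivl - \<tau> ` {..J}" for t
      using pp_step_eq[OF J m, of t q] that by (simp add: F_def)
    have F2i: "(\<lambda>t. (F q t)\<^sup>2) integrable_on unit_ivl"
      using integrable_spike_finite[OF fin _ g2i(1)] eqF by fastforce
    have F2: "integral unit_ivl (\<lambda>t. (F q t)\<^sup>2) \<le> b0"
      using integral_spike[of "\<tau> ` {..J}" unit_ivl "\<lambda>t. (F q t)\<^sup>2" "\<lambda>t. (pp_step J \<tau> pc q t)\<^sup>2"]
        negligible_finite[OF fin] eqF g2i(2) by auto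
    have holder: "\<bar>F (q - 1) t - F (q - 1) s\<bar> \<le> sqrt b0 * sqrt (t - s)"
      if st: "0 \<le> s" "s \<le> t" "t \<le> 1" for s t
    proof (rule has_integral_cauchy_schwarz)
      show "(F q has_integral F (q - 1) t - F (q - 1) s) {s..t}"
      \<comment> \<open>For q = m the q-th derivative may jump at the knots; the fundamental theorem
        tolerates finitely many exceptional points because the antiderivative is continuous.\<close>
      proof (rule fundamental_theorem_of_calculus_interior_strong[OF fin])
        fix z assume z: "z \<in> {s<..<t} - \<tau> ` {..J}"
        have "(F (q - 1) has_real_derivative F (Suc (q - 1)) z) (at z)"
          unfolding F_def by (rule pp_deriv_has_derivative[OF J m]) (use q z st in auto)
        then show "(F (q - 1) has_vector_derivative F q z) (at z)"
          using q by (simp add: has_real_derivative_iff_has_vector_derivative)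
      next
        show "continuous_on {s..t} (F (q - 1))" unfolding F_def
          by (rule continuous_on_subset[OF continuous_on_pp_deriv[OF J m]]) (use q st in auto)
      qed (use st in auto)
      show i: "(\<lambda>x. (F q x)\<^sup>2) integrable_on {s..t}"
        by (rule integrable_on_subinterval[OF F2i]) (use st in auto)
      have "integral {s..t} (\<lambda>x. (F q x)\<^sup>2) \<le> integral unit_ivl (\<lambda>x. (F q x)\<^sup>2)"
        by (rule integral_subset_le[OF _ i F2i]) (use st in auto)
      then show "integral {s..t} (\<lambda>x. (F q x)\<^sup>2) \<le> b0" using F2 by linarith
    qed (use st in auto)
    have "smooth_chain q (sqrt b0) F"
      unfolding smooth_chain_def
    proof (intro conjI allI impI ballI)
      fix k assume "k < q"
      then show "continuous_on unit_ivl (F k)" unfolding F_def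
        using continuous_on_pp_deriv[OF J m] q by simp
    next
      fix k t assume "Suc k < q" "t \<in> {0<..<1::real}"
      then show "(F k has_real_derivative F (Suc k) t) (at t)" unfolding F_def
        using pp_deriv_has_derivative[OF J m, of k t] q by simp
    next
      fix s t assume st: "s \<in> unit_ivl" "t \<in> unit_ivl"
      show "\<bar>F (q - 1) s - F (q - 1) t\<bar> \<le> sqrt b0 * sqrt \<bar>s - t\<bar>"
        using holder[of s t] holder[of t s] st by (cases "s \<le> t") (auto simp: abs_minus_commute)
    next
      have "integral unit_ivl (\<lambda>t. (F 0 t)\<^sup>2) = integral unit_ivl (\<lambda>t. (f t)\<^sup>2)"
        by (rule integral_cong) (use f in \<open>simp add: F_def\<close>)
      then show "integral unit_ivl (\<lambda>t. (F 0 t)\<^sup>2) \<le> 1" using f2 by simp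
    qed
    from B(2)[OF this] show "(\<forall>t\<in>unit_ivl. \<bar>f t\<bar> \<le> B) \<and> (\<forall>s\<in>unit_ivl. \<forall>t\<in>unit_ivl. \<bar>f s - f t\<bar> \<le> B * sqrt \<bar>s - t\<bar>)"
      using f by (simp add: F_def)
  qed
qed

section \<open>Approximation by splines\<close>

lemma pderiv_sum: "pderiv (\<Sum>i\<in>A. f i) = (\<Sum>i\<in>A. pderiv (f i))"
  by (induction A rule: infinite_finite_induct) (simp_all add: pderiv_add)

lemma poly_antiderivative:
  fixes p :: "real poly"
  shows "\<exists>P. pderiv P = p \<and> poly P a = y \<and> degree P \<le> Suc (degree p)"
proof -
  define P0 where "P0 = (\<Sum>i\<le>degree p. monom (coeff p i / real (Suc i)) (Suc i))"
  have "pderiv P0 = (\<Sum>i\<le>degree p. monom (coeff p i) i)"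
    unfolding P0_def by (simp add: pderiv_sum pderiv_monom del: of_nat_Suc)
  also have "\<dots> = p" by (rule poly_as_sum_of_monoms)
  finally have d: "pderiv P0 = p" .
  have deg: "degree P0 \<le> Suc (degree p)" unfolding P0_def
    by (intro degree_sum_le) (auto intro: order_trans[OF degree_monom_le])
  define P where "P = P0 + [:y - poly P0 a:]"
  have "pderiv P = p" by (simp add: P_def pderiv_add pderiv_pCons d)
  moreover have "poly P a = y" by (simp add: P_def)
  moreover have "degree P \<le> Suc (degree p)" unfolding P_def
    by (rule degree_add_le) (use deg in auto)
  ultimately show ?thesis by blast
qed

lemma mesh_ge: "i < J \<Longrightarrow> \<tau> (Suc i) - \<tau> i \<le> mesh J \<tau>"
  unfolding mesh_def by (intro Max_ge) auto

text \<open>Integrate a step function approximating the \<open>m\<close>-th derivative \<open>m\<close> times.\<close>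

lemma poly_piecewise_approx:
  fixes f :: "real poly"
  assumes "\<epsilon> > 0"
  shows "\<exists>\<delta>>0. \<forall>J \<tau>. knot_seq J \<tau> \<longrightarrow> mesh J \<tau> < \<delta> \<longrightarrow> (\<exists>pc. (\<forall>i<J. degree (pc i) \<le> m) \<and> matching m J \<tau> pc
    \<and> (\<forall>i<J. \<forall>t\<in>{\<tau> i..\<tau> (Suc i)}. \<bar>poly f t - poly (pc i) t\<bar> \<le> \<epsilon>))"
proof (induction m arbitrary: f)
  case 0
  have "uniformly_continuous_on unit_ivl (poly f)"
    by (intro compact_uniformly_continuous continuous_intros) simp
  then obtain \<delta> where \<delta>: "\<delta> > 0" "\<And>s t. s \<in> unit_ivl \<Longrightarrow> t \<in> unit_ivl \<Longrightarrow> dist t s < \<delta> \<Longrightarrow> dist (poly f t) (poly f s) < \<epsilon>"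
    using assms unfolding uniformly_continuous_on_def by meson
  show ?case
  proof (intro exI[of _ \<delta>] conjI \<delta>(1) allI impI)
    fix J \<tau> assume J: "knot_seq J \<tau>" and mesh: "mesh J \<tau> < \<delta>"
    show "\<exists>pc. (\<forall>i<J. degree (pc i) \<le> 0) \<and> matching 0 J \<tau> pc
      \<and> (\<forall>i<J. \<forall>t\<in>{\<tau> i..\<tau> (Suc i)}. \<bar>poly f t - poly (pc i) t\<bar> \<le> \<epsilon>)"
    proof (intro exI[of _ "\<lambda>i. [:poly f (\<tau> i):]"] conjI allI impI ballI)
      fix i t assume i: "i < J" and t: "t \<in> {\<tau> i..\<tau> (Suc i)}"
      have "\<tau> i \<in> unit_ivl" "\<tau> (Suc i) \<in> unit_ivl" using knot_seq_unit[OF J] i by auto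
      moreover have "dist t (\<tau> i) < \<delta>" using mesh_ge[of i J \<tau>, OF i] mesh t by (auto simp: dist_real_def)
      ultimately show "\<bar>poly f t - poly [:poly f (\<tau> i):] t\<bar> \<le> \<epsilon>"
        using \<delta>(2)[of "\<tau> i" t] t by (auto simp: dist_real_def)
    qed (auto simp: matching_def)
  qed
next
  case (Suc m)
  obtain \<delta> where \<delta>: "\<delta> > 0" "\<And>J \<tau>. knot_seq J \<tau> \<Longrightarrow> mesh J \<tau> < \<delta> \<Longrightarrow> \<exists>pc. (\<forall>i<J. degree (pc i) \<le> m) \<and> matching m J \<tau> pc
    \<and> (\<forall>i<J. \<forall>t\<in>{\<tau> i..\<tau> (Suc i)}. \<bar>poly (pderiv f) t - poly (pc i) t\<bar> \<le> \<epsilon>)"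
    using Suc.IH[of "pderiv f"] by blast
  show ?case
  proof (intro exI[of _ \<delta>] conjI \<delta>(1) allI impI)
    fix J \<tau> assume J: "knot_seq J \<tau>" and mesh: "mesh J \<tau> < \<delta>"
    obtain pc where pc: "\<And>i. i < J \<Longrightarrow> degree (pc i) \<le> m" "matching m J \<tau> pc"
      "\<And>i t. i < J \<Longrightarrow> t \<in> {\<tau> i..\<tau> (Suc i)} \<Longrightarrow> \<bar>poly (pderiv f) t - poly (pc i) t\<bar> \<le> \<epsilon>"
      using \<delta>(2)[OF J mesh] by blast
    obtain A where A: "\<And>p a y. pderiv (A p a y) = (p :: real poly)" "\<And>p a y. poly (A p a y) a = y"
      "\<And>p a y. degree (A p a y) \<le> Suc (degree p)"
      using poly_antiderivative by metis
    \<comment> \<open>Each piece is integrated starting from the end value of the previous one. This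
      makes the result continuous, which is the one matching condition gained by
      integration.\<close>
    define P where "P = rec_nat (A (pc 0) (\<tau> 0) (poly f (\<tau> 0))) (\<lambda>i p. A (pc (Suc i)) (\<tau> (Suc i)) (poly p (\<tau> (Suc i))))"
    have P0: "P 0 = A (pc 0) (\<tau> 0) (poly f (\<tau> 0))" by (simp add: P_def)
    have PS: "P (Suc i) = A (pc (Suc i)) (\<tau> (Suc i)) (poly (P i) (\<tau> (Suc i)))" for i by (simp add: P_def)
    have dP: "pderiv (P i) = pc i" for i by (cases i) (simp_all add: P0 PS A)
    have degP: "degree (P i) \<le> Suc m" if "i < J" for i
      using order_trans[OF A(3), of "pc i" "Suc m"] pc(1)[OF that] by (cases i) (auto simp: P0 PS)
    have matchP: "poly (P i) (\<tau> (Suc i)) = poly (P (Suc i)) (\<tau> (Suc i))" for i by (simp add: PS A)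
    have match: "matching (Suc m) J \<tau> P"
      unfolding matching_def
    proof (intro allI impI)
      fix i k assume ik: "Suc i < J \<and> k < Suc m"
      show "poly ((pderiv ^^ k) (P i)) (\<tau> (Suc i)) = poly ((pderiv ^^ k) (P (Suc i))) (\<tau> (Suc i))"
      proof (cases k)
        case 0
        then show ?thesis using matchP by simp
      next
        case (Suc k')
        then show ?thesis using pc(2) ik unfolding matching_def
          by (simp add: funpow_Suc_right dP del: funpow.simps)
      qed
    qed
    \<comment> \<open>The error grows at rate at most \<epsilon> and starts from 0, so at t it is at
      most \<epsilon> t \<le> \<epsilon>. No accuracy is lost in an integration, and the mesh bound
      found for the derivative can be reused.\<close>
    have incr: "\<bar>(poly f t - poly (P i) t) - (poly f (\<tau> i) - poly (P i) (\<tau> i))\<bar> \<le> \<epsilon> * (t - \<tau> i)"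
      if i: "i < J" and t: "t \<in> {\<tau> i..\<tau> (Suc i)}" for i t
    proof (cases "t = \<tau> i")
      case False
      then have lt: "\<tau> i < t" using t by simp
      have "((\<lambda>t. poly f t - poly (P i) t) has_real_derivative poly (pderiv f) z - poly (pc i) z) (at z)" for z
        using poly_DERIV[of "P i" z] by (auto intro!: derivative_intros simp: dP)
      then obtain z where z: "\<tau> i < z" "z < t" "(poly f t - poly (P i) t) - (poly f (\<tau> i) - poly (P i) (\<tau> i))
          = (t - \<tau> i) * (poly (pderiv f) z - poly (pc i) z)"
        using MVT2[OF lt, of "\<lambda>t. poly f t - poly (P i) t" "\<lambda>z. poly (pderiv f) z - poly (pc i) z"] by auto
      have "\<bar>poly (pderiv f) z - poly (pc i) z\<bar> \<le> \<epsilon>" using pc(3)[OF i, of z] z t by auto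
      then show ?thesis unfolding z(3) using lt by (simp add: abs_mult mult.commute mult_right_mono)
    qed simp
    have knot: "i \<le> J \<Longrightarrow> i < J \<longrightarrow> \<bar>poly f (\<tau> i) - poly (P i) (\<tau> i)\<bar> \<le> \<epsilon> * \<tau> i" for i
    proof (induction i)
      case 0
      then show ?case using J by (simp add: P0 A knot_seq_def)
    next
      case (Suc i)
      show ?case
      proof
        assume "Suc i < J"
        then have i: "i < J" by simp
        have "\<tau> i < \<tau> (Suc i)" using knot_seq_less[OF J] i by simp
        then show "\<bar>poly f (\<tau> (Suc i)) - poly (P (Suc i)) (\<tau> (Suc i))\<bar> \<le> \<epsilon> * \<tau> (Suc i)"
          using incr[OF i, of "\<tau> (Suc i)"] Suc.IH i matchP[of i] right_diff_distrib[of \<epsilon> "\<tau> (Suc i)" "\<tau> i"]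
          by simp
      qed
    qed
    have "\<bar>poly f t - poly (P i) t\<bar> \<le> \<epsilon>" if i: "i < J" and t: "t \<in> {\<tau> i..\<tau> (Suc i)}" for i t
    proof -
      have "t \<le> 1" using t knot_seq_unit[OF J, of "Suc i"] i by auto
      then have "\<epsilon> * t \<le> \<epsilon>" using assms by simp
      moreover have "\<bar>poly f t - poly (P i) t\<bar> \<le> \<epsilon> * t"
        using incr[OF i t] knot[of i] i right_diff_distrib[of \<epsilon> t "\<tau> i"] by simp
      ultimately show ?thesis by linarith
    qed
    then show "\<exists>pc. (\<forall>i<J. degree (pc i) \<le> Suc m) \<and> matching (Suc m) J \<tau> pc
      \<and> (\<forall>i<J. \<forall>t\<in>{\<tau> i..\<tau> (Suc i)}. \<bar>poly f t - poly (pc i) t\<bar> \<le> \<epsilon>)"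
      using degP match by blast
  qed
qed

text \<open>Weierstrass first replaces the continuous function by a polynomial, because the spline
  construction integrates an approximation of the m-th derivative.\<close>

lemma continuous_spline_approx:
  fixes g :: "real \<Rightarrow> real"
  assumes \<epsilon>: "\<epsilon> > 0" and m: "m \<ge> 1" and g: "continuous_on unit_ivl g"
  shows "\<exists>\<delta>>0. \<forall>J \<tau>. knot_seq J \<tau> \<longrightarrow> mesh J \<tau> < \<delta> \<longrightarrow>
    (\<exists>h\<in>spline_space m J \<tau>. \<forall>t\<in>unit_ivl. \<bar>g t - h t\<bar> \<le> \<epsilon>)"
proof -
  obtain p0 where p0: "real_polynomial_function p0" "\<And>t. t \<in> unit_ivl \<Longrightarrow> \<bar>g t - p0 t\<bar> < \<epsilon> / 2"
    using Stone_Weierstrass_real_polynomial_function[OF compact_Icc g, of "\<epsilon> / 2"] \<epsilon> by auto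
  obtain a n where p0': "p0 = (\<lambda>x. \<Sum>i\<le>n. a i * x ^ i)"
    using p0(1) real_polynomial_function_iff_sum by blast
  define f where "f = (\<Sum>i\<le>n. monom (a i) i)"
  have f: "poly f t = p0 t" for t by (simp add: f_def p0' poly_sum poly_monom)
  obtain \<delta> where \<delta>: "\<delta> > 0" "\<And>J \<tau>. knot_seq J \<tau> \<Longrightarrow> mesh J \<tau> < \<delta> \<Longrightarrow> \<exists>pc. (\<forall>i<J. degree (pc i) \<le> m) \<and> matching m J \<tau> pc
    \<and> (\<forall>i<J. \<forall>t\<in>{\<tau> i..\<tau> (Suc i)}. \<bar>poly f t - poly (pc i) t\<bar> \<le> \<epsilon> / 2)"
    using poly_piecewise_approx[of "\<epsilon> / 2" m f] \<epsilon> by auto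
  show ?thesis
  proof (intro exI[of _ \<delta>] conjI \<delta>(1) allI impI)
    fix J \<tau> assume J: "knot_seq J \<tau>" and mesh: "mesh J \<tau> < \<delta>"
    obtain pc where pc: "\<And>i. i < J \<Longrightarrow> degree (pc i) \<le> m" "matching m J \<tau> pc"
      "\<And>i t. i < J \<Longrightarrow> t \<in> {\<tau> i..\<tau> (Suc i)} \<Longrightarrow> \<bar>poly f t - poly (pc i) t\<bar> \<le> \<epsilon> / 2"
      using \<delta>(2)[OF J mesh] by blast
    have eq: "pp_deriv J \<tau> pc 0 t = poly (pc i) t" if "i < J" "t \<in> {\<tau> i..\<tau> (Suc i)}" for i t
      using pp_deriv_eq[OF J pc(2) that, of 0] m by simp
    show "\<exists>h\<in>spline_space m J \<tau>. \<forall>t\<in>unit_ivl. \<bar>g t - h t\<bar> \<le> \<epsilon>"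
    proof (intro bexI[of _ "pp_deriv J \<tau> pc 0"] ballI)
      fix t :: real assume t: "t \<in> unit_ivl"
      then obtain i where i: "i < J" "t \<in> {\<tau> i..\<tau> (Suc i)}" using knot_seq_cover[OF J] by blast
      show "\<bar>g t - pp_deriv J \<tau> pc 0 t\<bar> \<le> \<epsilon>"
        using pc(3)[OF i] p0(2)[OF t] f[of t] eq[OF i] by linarith
    next
      show "pp_deriv J \<tau> pc 0 \<in> spline_space m J \<tau>"
        unfolding spline_space_def using pc(1,2) eq unfolding matching_def
        by (intro CollectI exI[of _ pc]) auto
    qed
  qed
qed

section \<open>Finite-rank kernels\<close>

lemma L2_inner_eq_integral:
  assumes "continuous_on unit_ivl f" "continuous_on unit_ivl g"
  shows "L2_inner f g = integral unit_ivl (\<lambda>t. f t * g t)"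
  unfolding L2_inner_def
  by (intro set_lebesgue_integral_unit_eq continuous_set_integrable continuous_intros assms)

lemma L2_inner_commute: "L2_inner f g = L2_inner g f"
  by (simp add: L2_inner_def mult.commute)

lemma L2_inner_sum_left:
  assumes f: "\<And>i. i \<in> A \<Longrightarrow> continuous_on unit_ivl (f i)" and g: "continuous_on unit_ivl g" and A: "finite A"
  shows "L2_inner (\<lambda>t. \<Sum>i\<in>A. a i * f i t) g = (\<Sum>i\<in>A. a i * L2_inner (f i) g)"
proof -
  have c: "continuous_on unit_ivl (\<lambda>t. \<Sum>i\<in>A. a i * f i t)"
    by (intro continuous_intros f)
  have "L2_inner (\<lambda>t. \<Sum>i\<in>A. a i * f i t) g = integral unit_ivl (\<lambda>t. \<Sum>i\<in>A. a i * (f i t * g t))"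
    unfolding L2_inner_eq_integral[OF c g] by (simp add: sum_distrib_right mult.assoc)
  also have "\<dots> = (\<Sum>i\<in>A. integral unit_ivl (\<lambda>t. a i * (f i t * g t)))"
    by (intro integral_sum A integrable_continuous_interval continuous_intros f g)
  also have "\<dots> = (\<Sum>i\<in>A. a i * L2_inner (f i) g)"
    by (intro sum.cong refl) (simp add: L2_inner_eq_integral[OF f g])
  finally show ?thesis .
qed

lemma L2_inner_sum_right:
  assumes "\<And>i. i \<in> A \<Longrightarrow> continuous_on unit_ivl (f i)" "continuous_on unit_ivl g" "finite A"
  shows "L2_inner g (\<lambda>t. \<Sum>i\<in>A. a i * f i t) = (\<Sum>i\<in>A. a i * L2_inner g (f i))"
  using L2_inner_sum_left[OF assms, where a = a] by (simp add: L2_inner_commute)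

lemma L2_inner_self_nonneg: "0 \<le> L2_inner f f"
  unfolding L2_inner_def set_lebesgue_integral_def
  by (intro Bochner_Integration.integral_nonneg) auto

lemma L2_norm_diff_square:
  assumes f: "continuous_on unit_ivl f" and g: "continuous_on unit_ivl g"
  shows "(L2_norm (\<lambda>t. f t - g t))\<^sup>2 = L2_inner f f + L2_inner g g - 2 * L2_inner f g"
proof -
  have 1: "(LINT t:unit_ivl|lborel. (f t - g t)\<^sup>2) = L2_inner (\<lambda>t. f t - g t) (\<lambda>t. f t - g t)"
    by (simp add: L2_inner_def power2_eq_square)
  have c: "continuous_on unit_ivl (\<lambda>t. f t - g t)" by (intro continuous_intros f g)
  have "L2_inner (\<lambda>t. f t - g t) (\<lambda>t. f t - g t)
      = integral unit_ivl (\<lambda>t. f t * f t + g t * g t - 2 * (f t * g t))"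
    unfolding L2_inner_eq_integral[OF c c] by (simp add: algebra_simps)
  also have "\<dots> = L2_inner f f + L2_inner g g - 2 * L2_inner f g"
    unfolding L2_inner_eq_integral[OF f f] L2_inner_eq_integral[OF g g] L2_inner_eq_integral[OF f g]
    by (subst integral_diff, (intro integrable_continuous_interval continuous_intros f g)+,
        subst integral_add, (intro integrable_continuous_interval continuous_intros f g)+, simp)
  finally show ?thesis unfolding L2_norm_def 1
    using L2_inner_self_nonneg[of "\<lambda>t. f t - g t"] by simp
qed

lemma bessel:
  fixes R :: nat
  assumes f: "\<And>i. i < R \<Longrightarrow> continuous_on unit_ivl (f i)" and g: "continuous_on unit_ivl g"
    and on: "\<And>i j. i < R \<Longrightarrow> j < R \<Longrightarrow> L2_inner (f i) (f j) = (if i = j then 1 else 0)"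
  shows "(\<Sum>i<R. (L2_inner g (f i))\<^sup>2) \<le> L2_inner g g"
proof -
  define h where "h t = (\<Sum>i<R. L2_inner g (f i) * f i t)" for t
  have h: "continuous_on unit_ivl h" unfolding h_def by (intro continuous_intros f) auto
  have gh: "L2_inner g h = (\<Sum>i<R. (L2_inner g (f i))\<^sup>2)"
    unfolding h_def by (subst L2_inner_sum_right) (auto simp: f g power2_eq_square)
  have fh: "L2_inner (f i) h = L2_inner g (f i)" if "i < R" for i
  proof -
    have "L2_inner (f i) h = (\<Sum>j<R. L2_inner g (f j) * L2_inner (f i) (f j))"
      unfolding h_def by (subst L2_inner_sum_right) (auto simp: f that)
    also have "\<dots> = (\<Sum>j<R. if j = i then L2_inner g (f i) else 0)"
      by (intro sum.cong refl) (use on that in auto)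
    finally show ?thesis using that by simp
  qed
  have hh: "L2_inner h h = (\<Sum>i<R. (L2_inner g (f i))\<^sup>2)"
  proof -
    have "L2_inner h h = (\<Sum>i<R. L2_inner g (f i) * L2_inner (f i) h)"
      by (subst (1) h_def[abs_def], subst L2_inner_sum_left) (auto simp: f h)
    then show ?thesis using fh by (simp add: power2_eq_square)
  qed
  have "0 \<le> (L2_norm (\<lambda>t. g t - h t))\<^sup>2" by simp
  then show ?thesis unfolding L2_norm_diff_square[OF g h] using gh hh by simp
qed

lemma unit_sq_integral_product:
  fixes f g :: "real \<Rightarrow> real"
  assumes f: "continuous_on unit_ivl f" and g: "continuous_on unit_ivl g"
  shows "set_integrable lborel unit_sq (\<lambda>z. f (fst z) * g (snd z))"
    and "(LINT z:unit_sq|lborel. f (fst z) * g (snd z)) = integral unit_ivl f * integral unit_ivl g"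
proof -
  have c: "continuous_on unit_sq (\<lambda>z. f (fst z) * g (snd z))"
    using continuous_on_compose2[OF f continuous_on_fst[OF continuous_on_id], of unit_sq]
      continuous_on_compose2[OF g continuous_on_snd[OF continuous_on_id], of unit_sq]
    by (intro continuous_on_mult) auto
  show i: "set_integrable lborel unit_sq (\<lambda>z. f (fst z) * g (snd z))"
    unfolding set_integrable_def by (rule borel_integrable_compact[OF _ c]) (auto intro: compact_Times)
  have eq: "indicator unit_sq z *\<^sub>R (f (fst z) * g (snd z))
      = (indicator unit_ivl (fst z) * f (fst z)) * (indicator unit_ivl (snd z) * g (snd z))" for z
    by (cases z) (auto simp: indicator_def)
  have "(LINT z:unit_sq|lborel. f (fst z) * g (snd z))
    = (LINT z|(lborel \<Otimes>\<^sub>M lborel). (indicator unit_ivl (fst z) * f (fst z)) * (indicator unit_ivl (snd z) * g (snd z)))"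
    unfolding set_lebesgue_integral_def eq lborel_prod ..
  also have "\<dots> = (LINT s|lborel. (LINT t|lborel. (indicator unit_ivl s * f s) * (indicator unit_ivl t * g t)))"
    using lborel_pair.integral_fst'[of "\<lambda>z. (indicator unit_ivl (fst z) * f (fst z)) * (indicator unit_ivl (snd z) * g (snd z))"]
      i[unfolded set_integrable_def eq] by (simp add: lborel_prod)
  also have "\<dots> = (LINT s:unit_ivl|lborel. f s) * (LINT t:unit_ivl|lborel. g t)"
    by (simp add: set_lebesgue_integral_def)
  finally show "(LINT z:unit_sq|lborel. f (fst z) * g (snd z)) = integral unit_ivl f * integral unit_ivl g"
    using set_lebesgue_integral_unit_eq(1)[OF continuous_set_integrable] f g by simp
qed

text \<open>The squared Hilbert-Schmidt norm of the integral operator with kernel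
  \<open>c\<close>.\<close>

definition hs_square :: "(real \<Rightarrow> real \<Rightarrow> real) \<Rightarrow> real" where
  "hs_square c = (LINT z:unit_sq|lborel. (c (fst z) (snd z))\<^sup>2)"

lemma hs_square_cong:
  assumes "\<And>s t. s \<in> unit_ivl \<Longrightarrow> t \<in> unit_ivl \<Longrightarrow> c s t = c' s t"
  shows "hs_square c = hs_square c'"
  unfolding hs_square_def set_lebesgue_integral_def
  by (intro Bochner_Integration.integral_cong) (auto simp: indicator_def assms)

lemma set_integral_sum:
  fixes f :: "'i \<Rightarrow> 'a \<Rightarrow> real"
  assumes "finite I" "\<And>i. i \<in> I \<Longrightarrow> set_integrable M A (f i)"
  shows "(LINT t:A|M. \<Sum>i\<in>I. f i t) = (\<Sum>i\<in>I. LINT t:A|M. f i t)"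
    and "set_integrable M A (\<lambda>t. \<Sum>i\<in>I. f i t)"
proof -
  show "(LINT t:A|M. \<Sum>i\<in>I. f i t) = (\<Sum>i\<in>I. LINT t:A|M. f i t)"
    using assms(2) unfolding set_lebesgue_integral_def set_integrable_def scaleR_sum_right
    by (rule Bochner_Integration.integral_sum)
  show "set_integrable M A (\<lambda>t. \<Sum>i\<in>I. f i t)"
    using assms(2) unfolding set_integrable_def scaleR_sum_right
    by (rule Bochner_Integration.integrable_sum)
qed

lemma hs_square_sum:
  assumes A: "finite A" and f: "\<And>a. a \<in> A \<Longrightarrow> continuous_on unit_ivl (f a)"
  shows "hs_square (\<lambda>s t. \<Sum>a\<in>A. e a * f a s * f a t)
    = (\<Sum>a\<in>A. \<Sum>b\<in>A. e a * e b * (L2_inner (f a) (f b))\<^sup>2)"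
proof -
  have eq: "(\<Sum>a\<in>A. e a * f a s * f a t)\<^sup>2 = (\<Sum>a\<in>A. \<Sum>b\<in>A. e a * e b * ((f a s * f b s) * (f a t * f b t)))" for s t
    by (simp add: power2_eq_square sum_product mult_ac)
  have I: "set_integrable lborel unit_sq (\<lambda>z. e a * e b * ((f a (fst z) * f b (fst z)) * (f a (snd z) * f b (snd z))))"
    if "a \<in> A" "b \<in> A" for a b
    by (intro set_integrable_mult_right unit_sq_integral_product(1)[of "\<lambda>s. f a s * f b s" "\<lambda>s. f a s * f b s"]
        continuous_intros f that)
  have "hs_square (\<lambda>s t. \<Sum>a\<in>A. e a * f a s * f a t)
    = (\<Sum>a\<in>A. \<Sum>b\<in>A. LINT z:unit_sq|lborel. e a * e b * ((f a (fst z) * f b (fst z)) * (f a (snd z) * f b (snd z))))"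
    unfolding hs_square_def eq using I set_integral_sum(1)[OF A I] set_integral_sum[OF A set_integral_sum(2)[OF A I]]
    by simp
  also have "\<dots> = (\<Sum>a\<in>A. \<Sum>b\<in>A. e a * e b * (L2_inner (f a) (f b))\<^sup>2)"
  proof (intro sum.cong refl)
    fix a b assume ab: "a \<in> A" "b \<in> A"
    have c: "continuous_on unit_ivl (\<lambda>s. f a s * f b s)" by (intro continuous_intros f ab)
    show "(LINT z:unit_sq|lborel. e a * e b * ((f a (fst z) * f b (fst z)) * (f a (snd z) * f b (snd z))))
      = e a * e b * (L2_inner (f a) (f b))\<^sup>2"
      unfolding set_integral_mult_right unit_sq_integral_product(2)[OF c c]
      by (simp add: L2_inner_eq_integral f ab power2_eq_square)
  qed
  finally show ?thesis .
qed

text \<open>The expansion contains the weights only in the mixed term. Adding and subtracting their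
  row and column sums gives the three parts, nonnegative by Bessel if the eigenvalues are arbitrary
  reals, that \<open>spectral_perturbation\<close> expects.\<close>

lemma hs_square_two_systems:
  fixes K R :: nat
  assumes \<chi>: "\<And>i. i < K \<Longrightarrow> continuous_on unit_ivl (\<chi> i)" and \<psi>: "\<And>s. s < R \<Longrightarrow> continuous_on unit_ivl (\<psi> s)"
    and on\<chi>: "\<And>i j. i < K \<Longrightarrow> j < K \<Longrightarrow> L2_inner (\<chi> i) (\<chi> j) = (if i = j then 1 else 0)"
    and on\<psi>: "\<And>i j. i < R \<Longrightarrow> j < R \<Longrightarrow> L2_inner (\<psi> i) (\<psi> j) = (if i = j then 1 else 0)"
  defines "w \<equiv> \<lambda>i s. (L2_inner (\<chi> i) (\<psi> s))\<^sup>2"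
  shows "hs_square (\<lambda>s t. (\<Sum>i<K. d i * \<chi> i s * \<chi> i t) - (\<Sum>r<R. l r * \<psi> r s * \<psi> r t))
    = (\<Sum>i<K. \<Sum>s<R. (d i - l s)\<^sup>2 * w i s) + (\<Sum>i<K. (d i)\<^sup>2 * (1 - (\<Sum>s<R. w i s)))
      + (\<Sum>s<R. (l s)\<^sup>2 * (1 - (\<Sum>i<K. w i s)))"
proof -
  \<comment> \<open>The difference becomes a single signed combination, indexed by the disjoint sum
    of the two index sets.\<close>
  define e where "e = case_sum d (\<lambda>s. - l s)"
  define f where "f = case_sum \<chi> \<psi>"
  define A where "A = {..<K} <+> {..<R}"
  have A: "finite A" by (simp add: A_def)
  have sA: "sum g A = (\<Sum>i<K. g (Inl i)) + (\<Sum>s<R. g (Inr s))" for g :: "nat + nat \<Rightarrow> real"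
    unfolding A_def by (simp add: sum.Plus)
  have "hs_square (\<lambda>s t. (\<Sum>i<K. d i * \<chi> i s * \<chi> i t) - (\<Sum>r<R. l r * \<psi> r s * \<psi> r t))
    = hs_square (\<lambda>s t. \<Sum>a\<in>A. e a * f a s * f a t)"
    by (rule hs_square_cong) (simp add: sA e_def f_def sum_negf)
  also have "\<dots> = (\<Sum>a\<in>A. \<Sum>b\<in>A. e a * e b * (L2_inner (f a) (f b))\<^sup>2)"
    by (rule hs_square_sum[OF A]) (auto simp: A_def f_def \<chi> \<psi>)
  also have "\<dots> = (\<Sum>i<K. \<Sum>j<K. d i * d j * (L2_inner (\<chi> i) (\<chi> j))\<^sup>2) + (\<Sum>i<K. \<Sum>s<R. - (d i * l s * w i s))
      + ((\<Sum>s<R. \<Sum>i<K. - (d i * l s * w i s)) + (\<Sum>s<R. \<Sum>s'<R. l s * l s' * (L2_inner (\<psi> s) (\<psi> s'))\<^sup>2))"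
    unfolding sA by (simp add: e_def f_def w_def sum.distrib L2_inner_commute[of "\<psi> _" "\<chi> _"] mult_ac)
  also have "(\<Sum>i<K. \<Sum>j<K. d i * d j * (L2_inner (\<chi> i) (\<chi> j))\<^sup>2) = (\<Sum>i<K. (d i)\<^sup>2)"
  proof -
    have "(\<Sum>i<K. \<Sum>j<K. d i * d j * (L2_inner (\<chi> i) (\<chi> j))\<^sup>2) = (\<Sum>i<K. \<Sum>j<K. if i = j then (d i)\<^sup>2 else 0)"
      by (intro sum.cong refl) (auto simp: on\<chi> power2_eq_square)
    then show ?thesis by simp
  qed
  also have "(\<Sum>s<R. \<Sum>s'<R. l s * l s' * (L2_inner (\<psi> s) (\<psi> s'))\<^sup>2) = (\<Sum>s<R. (l s)\<^sup>2)"
  proof -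
    have "(\<Sum>s<R. \<Sum>s'<R. l s * l s' * (L2_inner (\<psi> s) (\<psi> s'))\<^sup>2) = (\<Sum>s<R. \<Sum>s'<R. if s = s' then (l s)\<^sup>2 else 0)"
      by (intro sum.cong refl) (auto simp: on\<psi> power2_eq_square)
    then show ?thesis by simp
  qed
  also have "(\<Sum>s<R. \<Sum>i<K. - (d i * l s * w i s)) = (\<Sum>i<K. \<Sum>s<R. - (d i * l s * w i s))" by (rule sum.swap)
  finally have L: "hs_square (\<lambda>s t. (\<Sum>i<K. d i * \<chi> i s * \<chi> i t) - (\<Sum>r<R. l r * \<psi> r s * \<psi> r t))
    = (\<Sum>i<K. (d i)\<^sup>2) + (\<Sum>s<R. (l s)\<^sup>2) - 2 * (\<Sum>i<K. \<Sum>s<R. d i * l s * w i s)"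
    by (simp add: sum_negf)
  have 1: "(\<Sum>i<K. \<Sum>s<R. (d i - l s)\<^sup>2 * w i s) = (\<Sum>i<K. \<Sum>s<R. (d i)\<^sup>2 * w i s) + (\<Sum>i<K. \<Sum>s<R. (l s)\<^sup>2 * w i s)
     - 2 * (\<Sum>i<K. \<Sum>s<R. d i * l s * w i s)"
    by (simp add: power2_diff algebra_simps sum.distrib sum_subtractf sum_distrib_left)
  have 2: "(\<Sum>i<K. (d i)\<^sup>2 * (1 - (\<Sum>s<R. w i s))) = (\<Sum>i<K. (d i)\<^sup>2) - (\<Sum>i<K. \<Sum>s<R. (d i)\<^sup>2 * w i s)"
    by (simp add: right_diff_distrib sum_subtractf sum_distrib_left)
  have 3: "(\<Sum>s<R. (l s)\<^sup>2 * (1 - (\<Sum>i<K. w i s))) = (\<Sum>s<R. (l s)\<^sup>2) - (\<Sum>i<K. \<Sum>s<R. (l s)\<^sup>2 * w i s)"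
    by (subst sum.swap) (simp add: right_diff_distrib sum_subtractf sum_distrib_left)
  show ?thesis unfolding L 1 2 3 by simp
qed

text \<open>Bessel's inequality in both directions supplies the row and column sums required of the
  weights.\<close>

lemma eigen_perturbation:
  fixes K R :: nat
  assumes RK: "R \<le> K"
    and \<chi>: "\<And>i. i < K \<Longrightarrow> continuous_on unit_ivl (\<chi> i)" and \<psi>: "\<And>s. s < R \<Longrightarrow> continuous_on unit_ivl (\<psi> s)"
    and on\<chi>: "\<And>i j. i < K \<Longrightarrow> j < K \<Longrightarrow> L2_inner (\<chi> i) (\<chi> j) = (if i = j then 1 else 0)"
    and on\<psi>: "\<And>i j. i < R \<Longrightarrow> j < R \<Longrightarrow> L2_inner (\<psi> i) (\<psi> j) = (if i = j then 1 else 0)"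
    and dec: "\<And>i j. i \<le> j \<Longrightarrow> j < K \<Longrightarrow> d j \<le> d i"
    and gap: "\<And>s s'. s < s' \<Longrightarrow> s' < R \<Longrightarrow> c \<le> l s - l s'" and lc: "\<And>s. s < R \<Longrightarrow> c \<le> l s"
    and c: "c > 0" and \<epsilon>: "\<epsilon> \<ge> 0" "6 * \<epsilon> < c"
    and le: "hs_square (\<lambda>s t. (\<Sum>i<K. d i * \<chi> i s * \<chi> i t) - (\<Sum>r<R. l r * \<psi> r s * \<psi> r t)) \<le> \<epsilon>\<^sup>2"
    and r: "r < R"
  shows "\<bar>d r - l r\<bar> \<le> \<epsilon>" and "1 - (L2_inner (\<chi> r) (\<psi> r))\<^sup>2 \<le> (2 * \<epsilon> / c)\<^sup>2"
proof -
  let ?w = "\<lambda>i s. (L2_inner (\<chi> i) (\<psi> s))\<^sup>2"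
  have wr: "(\<Sum>s<R. ?w i s) \<le> 1" if "i < K" for i
    using bessel[OF \<psi> \<chi>[OF that] on\<psi>] on\<chi>[OF that that] by simp
  have wc: "(\<Sum>i<K. ?w i s) \<le> 1" if "s < R" for s
    using bessel[OF \<chi> \<psi>[OF that] on\<chi>] on\<psi>[OF that that] by (simp add: L2_inner_commute)
  note P = spectral_perturbation[of R K ?w d c l \<epsilon> r, OF RK _ wr wc dec gap lc c \<epsilon> _ r]
  show "\<bar>d r - l r\<bar> \<le> \<epsilon>" "1 - ?w r r \<le> (2 * \<epsilon> / c)\<^sup>2"
    by (rule P; use le hs_square_two_systems[OF \<chi> \<psi> on\<chi> on\<psi>, of K R d l] in simp)+
qed

section \<open>Spline models\<close>

lemma psi_est_eq:
  assumes "U \<in> carrier_mat K R" "r < R"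
  shows "psi_est K b U r t = (\<Sum>k<K. U $$ (k, r) * b k t)"
  using assms by (auto simp: psi_est_def basis_vec_def scalar_prod_def lessThan_atLeast0 mult.commute intro!: sum.cong)

lemma finite_rank_form:
  assumes U: "U \<in> carrier_mat K R"
  shows "basis_vec K b s \<bullet> ((U * mat_diag R d * transpose_mat U) *\<^sub>v basis_vec K b t)
    = (\<Sum>r<R. d r * psi_est K b U r s * psi_est K b U r t)"
proof -
  let ?W = "U * mat_diag R d * transpose_mat U"
  have W: "?W \<in> carrier_mat K K" by (rule conj_diag_carrier[OF U])
  have "basis_vec K b s \<bullet> (?W *\<^sub>v basis_vec K b t) = (\<Sum>k<K. b k s * (\<Sum>l<K. ?W $$ (k, l) * b l t))"
    using W by (auto simp: basis_vec_def scalar_prod_def lessThan_atLeast0 simp del: index_mult_mat(1) intro!: sum.cong)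
  also have "\<dots> = (\<Sum>k<K. b k s * (\<Sum>l<K. (\<Sum>r<R. d r * U $$ (k, r) * U $$ (l, r)) * b l t))"
    by (intro sum.cong refl arg_cong2[where f = "(*)"]) (simp add: conj_diag_entry[OF U] del: index_mult_mat(1))
  also have "\<dots> = (\<Sum>k<K. \<Sum>l<K. \<Sum>r<R. d r * (U $$ (k, r) * b k s) * (U $$ (l, r) * b l t))"
    by (simp add: sum_distrib_left sum_distrib_right mult_ac)
  also have "\<dots> = (\<Sum>k<K. \<Sum>r<R. \<Sum>l<K. d r * (U $$ (k, r) * b k s) * (U $$ (l, r) * b l t))"
    by (intro sum.cong refl sum.swap)
  also have "\<dots> = (\<Sum>r<R. \<Sum>k<K. \<Sum>l<K. d r * (U $$ (k, r) * b k s) * (U $$ (l, r) * b l t))"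
    by (rule sum.swap)
  also have "\<dots> = (\<Sum>r<R. d r * psi_est K b U r s * psi_est K b U r t)"
    by (intro sum.cong refl) (simp add: psi_est_eq[OF U] sum_distrib_left sum_distrib_right mult_ac)
  finally show ?thesis .
qed

lemma pos_diag_eq_mat_diag:
  assumes "D \<in> pos_diag R"
  shows "D = mat_diag R (\<lambda>r. D $$ (r, r))"
  using assms by (intro eq_matI) (auto simp: pos_diag_def diagonal_mat_def mat_diag_def)

lemma spline_cov_eq:
  assumes "U \<in> carrier_mat K R" "D \<in> pos_diag R"
  shows "spline_cov K b U D s t = (\<Sum>r<R. D $$ (r, r) * psi_est K b U r s * psi_est K b U r t)"
  unfolding spline_cov_def
  by (subst pos_diag_eq_mat_diag[OF assms(2)], subst finite_rank_form[OF assms(1)]) simp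

locale spline_basis =
  fixes m J :: nat and \<tau> :: "nat \<Rightarrow> real" and K :: nat and b :: "nat \<Rightarrow> real \<Rightarrow> real"
  assumes knots: "knot_seq J \<tau>" and basis: "orthonormal_spline_basis m J \<tau> K b" and m: "1 \<le> m"
begin

lemma basis_pieces:
  obtains pc where "\<And>k. k < K \<Longrightarrow> matching m J \<tau> (pc k)"
    "\<And>k t. k < K \<Longrightarrow> t \<in> unit_ivl \<Longrightarrow> b k t = pp_deriv J \<tau> (pc k) 0 t"
proof -
  have "\<exists>pc. matching m J \<tau> pc \<and> (\<forall>t\<in>unit_ivl. b k t = pp_deriv J \<tau> pc 0 t)" if k: "k < K" for k
  proof -
    have "b k \<in> spline_space m J \<tau>" using basis k by (simp add: orthonormal_spline_basis_def)
    then obtain pc where pc: "\<And>i t. i < J \<Longrightarrow> t \<in> {\<tau> i..\<tau> (Suc i)} \<Longrightarrow> b k t = poly (pc i) t"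
      "matching m J \<tau> pc"
      unfolding spline_space_def matching_def by blast
    have "b k t = pp_deriv J \<tau> pc 0 t" if t: "t \<in> unit_ivl" for t
    proof -
      obtain i where i: "i < J" "t \<in> {\<tau> i..\<tau> (Suc i)}" using knot_seq_cover[OF knots t] by blast
      show ?thesis using pc(1)[OF i] pp_deriv_eq[OF knots pc(2) i, of 0] m by simp
    qed
    then show ?thesis using pc(2) by blast
  qed
  then show ?thesis using that by metis
qed

lemma continuous_basis: "k < K \<Longrightarrow> continuous_on unit_ivl (b k)"
proof -
  assume k: "k < K"
  obtain pc where pc: "\<And>k. k < K \<Longrightarrow> matching m J \<tau> (pc k)"
    "\<And>k t. k < K \<Longrightarrow> t \<in> unit_ivl \<Longrightarrow> b k t = pp_deriv J \<tau> (pc k) 0 t"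
    using basis_pieces by blast
  show ?thesis
    by (rule continuous_on_eq[OF continuous_on_pp_deriv[OF knots pc(1)[OF k], of 0]]) (use m pc k in auto)
qed

lemma basis_orthonormal: "k < K \<Longrightarrow> l < K \<Longrightarrow> L2_inner (b k) (b l) = (if k = l then 1 else 0)"
  using basis by (simp add: orthonormal_spline_basis_def)

lemma L2_inner_comb:
  "L2_inner (\<lambda>t. \<Sum>k<K. x k * b k t) (\<lambda>t. \<Sum>k<K. y k * b k t) = (\<Sum>k<K. x k * y k)"
proof -
  have "continuous_on unit_ivl (\<lambda>t. \<Sum>k<K. y k * b k t)"
    by (intro continuous_intros continuous_basis) auto
  then have "L2_inner (\<lambda>t. \<Sum>k<K. x k * b k t) (\<lambda>t. \<Sum>k<K. y k * b k t)
    = (\<Sum>k<K. x k * L2_inner (b k) (\<lambda>t. \<Sum>k<K. y k * b k t))"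
    by (intro L2_inner_sum_left) (auto simp: continuous_basis)
  also have "\<dots> = (\<Sum>k<K. x k * (\<Sum>l<K. y l * L2_inner (b k) (b l)))"
    by (intro sum.cong refl arg_cong2[where f = "(*)"] L2_inner_sum_right) (auto simp: continuous_basis)
  also have "\<dots> = (\<Sum>k<K. x k * (\<Sum>l<K. if k = l then y k else 0))"
    by (intro sum.cong refl arg_cong2[where f = "(*)"]) (auto simp: basis_orthonormal)
  finally show ?thesis by simp
qed

context
  fixes U :: "real mat" and R :: nat
  assumes U: "U \<in> stiefel R K"
begin

lemma psi_est_comb: "r < R \<Longrightarrow> psi_est K b U r = (\<lambda>t. \<Sum>k<K. U $$ (k, r) * b k t)"
  using psi_est_eq[OF stiefelD(1)[OF U]] by blast

lemma continuous_psi_est: "r < R \<Longrightarrow> continuous_on unit_ivl (psi_est K b U r)"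
  unfolding psi_est_comb by (intro continuous_intros continuous_basis) auto

lemma psi_est_orthonormal:
  "r < R \<Longrightarrow> s < R \<Longrightarrow> L2_inner (psi_est K b U r) (psi_est K b U s) = (if r = s then 1 else 0)"
  unfolding psi_est_comb L2_inner_comb by (rule stiefelD(2)[OF U])

end

text \<open>The q-th derivatives and their piecewise versions can differ only at the finitely many
  knots, where \<open>deriv\<close> may have no meaningful value. Integrals ignore this, and the
  quadratic form is the integral of a square.\<close>

lemma Gamma_form:
  assumes q: "q \<le> m" and pc: "\<And>k. k < K \<Longrightarrow> matching m J \<tau> (pc k)"
    "\<And>k t. k < K \<Longrightarrow> t \<in> unit_ivl \<Longrightarrow> b k t = pp_deriv J \<tau> (pc k) 0 t"
  shows "(\<Sum>k<K. \<Sum>l<K. c k * c l * Gamma_mat q K b $$ (k, l))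
    = (LINT t:unit_ivl|lborel. (\<Sum>k<K. c k * pp_step J \<tau> (pc k) q t)\<^sup>2)"
proof -
  have \<Gamma>: "Gamma_mat q K b $$ (k, l) = (LINT t:unit_ivl|lborel. pp_step J \<tau> (pc k) q t * pp_step J \<tau> (pc l) q t)"
    if kl: "k < K" "l < K" for k l
  proof -
    have eq: "(deriv ^^ q) (b k) t = pp_step J \<tau> (pc k) q t"
      if t: "t \<in> unit_ivl" "t \<notin> \<tau> ` {..J}" and k: "k < K" for k t
    proof -
      \<comment> \<open>The endpoints are knots as well; a two-sided derivative there would depend
        on values outside the unit interval.\<close>
      have "t \<noteq> 0" "t \<noteq> 1" using t(2) knots unfolding knot_seq_def by (metis atMost_iff image_eqI le0, metis atMost_iff image_eqI order_refl)
      then have "t \<in> {0<..<1}" using t(1) by auto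
      then have "(deriv ^^ q) (b k) t = pp_deriv J \<tau> (pc k) q t"
        by (intro has_derivative_spline[OF knots pc(1)[OF k] pc(2)[OF k]]) (use q t in auto)
      then show ?thesis using pp_step_eq[OF knots pc(1)[OF k] t] by simp
    qed
    have "L2_inner ((deriv ^^ q) (b k)) ((deriv ^^ q) (b l))
      = (LINT t:unit_ivl|lborel. pp_step J \<tau> (pc k) q t * pp_step J \<tau> (pc l) q t)"
      unfolding L2_inner_def set_lebesgue_integral_def
      by (rule integral_discrete_difference[where X = "\<tau> ` {..J}"])
        (use eq kl in \<open>auto simp: indicator_def intro: countable_finite\<close>)
    then show ?thesis using kl by (simp add: Gamma_mat_def)
  qed
  have I: "set_integrable lborel unit_ivl (\<lambda>t. c k * c l * (pp_step J \<tau> (pc k) q t * pp_step J \<tau> (pc l) q t))" for k l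
    by (intro set_integrable_mult_right pp_step_mult_integrable)
  have "(LINT t:unit_ivl|lborel. (\<Sum>k<K. c k * pp_step J \<tau> (pc k) q t)\<^sup>2)
    = (LINT t:unit_ivl|lborel. (\<Sum>k<K. \<Sum>l<K. c k * c l * (pp_step J \<tau> (pc k) q t * pp_step J \<tau> (pc l) q t)))"
    by (simp add: power2_eq_square sum_product mult_ac)
  also have "\<dots> = (\<Sum>k<K. \<Sum>l<K. LINT t:unit_ivl|lborel. c k * c l * (pp_step J \<tau> (pc k) q t * pp_step J \<tau> (pc l) q t))"
  proof -
    have "(LINT t:unit_ivl|lborel. (\<Sum>k<K. \<Sum>l<K. c k * c l * (pp_step J \<tau> (pc k) q t * pp_step J \<tau> (pc l) q t)))
      = (\<Sum>k<K. LINT t:unit_ivl|lborel. \<Sum>l<K. c k * c l * (pp_step J \<tau> (pc k) q t * pp_step J \<tau> (pc l) q t))"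
      by (rule set_integral_sum(1)) (auto intro!: set_integral_sum(2) I)
    also have "\<dots> = (\<Sum>k<K. \<Sum>l<K. LINT t:unit_ivl|lborel. c k * c l * (pp_step J \<tau> (pc k) q t * pp_step J \<tau> (pc l) q t))"
      by (rule sum.cong[OF refl], rule set_integral_sum(1)) (auto intro!: I)
    finally show ?thesis .
  qed
  also have "\<dots> = (\<Sum>k<K. \<Sum>l<K. c k * c l * Gamma_mat q K b $$ (k, l))"
    by (intro sum.cong refl) (simp add: \<Gamma>)
  finally show ?thesis by simp
qed

lemma mtrace_Gamma:
  assumes U: "U \<in> carrier_mat K R"
  shows "mtrace (transpose_mat U * Gamma_mat q K b * U)
    = (\<Sum>r<R. \<Sum>k<K. \<Sum>l<K. U $$ (k, r) * U $$ (l, r) * Gamma_mat q K b $$ (k, l))"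
proof -
  have G: "Gamma_mat q K b \<in> carrier_mat K K" by (simp add: Gamma_mat_def)
  have "(transpose_mat U * Gamma_mat q K b * U) $$ (r, r)
      = (\<Sum>k<K. \<Sum>l<K. U $$ (k, r) * U $$ (l, r) * Gamma_mat q K b $$ (k, l))" if r: "r < R" for r
  proof -
    define X where "X = transpose_mat U * Gamma_mat q K b"
    have X: "X \<in> carrier_mat R K" using U G by (simp add: X_def)
    have "X $$ (r, l) = (\<Sum>k<K. U $$ (k, r) * Gamma_mat q K b $$ (k, l))" if "l < K" for l
      using U G r that by (auto simp: X_def scalar_prod_def lessThan_atLeast0)
    moreover have "(X * U) $$ (r, r) = (\<Sum>l<K. X $$ (r, l) * U $$ (l, r))"
      using U X r by (auto simp: scalar_prod_def lessThan_atLeast0)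
    ultimately have "(transpose_mat U * Gamma_mat q K b * U) $$ (r, r)
      = (\<Sum>l<K. (\<Sum>k<K. U $$ (k, r) * Gamma_mat q K b $$ (k, l)) * U $$ (l, r))"
      by (simp add: X_def)
    also have "\<dots> = (\<Sum>l<K. \<Sum>k<K. U $$ (k, r) * U $$ (l, r) * Gamma_mat q K b $$ (k, l))"
      by (simp add: sum_distrib_right sum_distrib_left mult_ac)
    also have "\<dots> = (\<Sum>k<K. \<Sum>l<K. U $$ (k, r) * U $$ (l, r) * Gamma_mat q K b $$ (k, l))"
      by (rule sum.swap)
    finally show ?thesis .
  qed
  then show ?thesis using U by (auto simp: mtrace_def intro!: sum.cong)
qed

lemma Gamma_form_nonneg:
  assumes "q \<le> m"
  shows "0 \<le> (\<Sum>k<K. \<Sum>l<K. c k * c l * Gamma_mat q K b $$ (k, l))"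
proof -
  obtain pc where pc: "\<And>k. k < K \<Longrightarrow> matching m J \<tau> (pc k)"
    "\<And>k t. k < K \<Longrightarrow> t \<in> unit_ivl \<Longrightarrow> b k t = pp_deriv J \<tau> (pc k) 0 t"
    using basis_pieces by blast
  have "(\<Sum>k<K. \<Sum>l<K. c k * c l * Gamma_mat q K b $$ (k, l))
    = (LINT t:unit_ivl|lborel. (\<Sum>k<K. c k * pp_step J \<tau> (pc k) q t)\<^sup>2)"
    by (rule Gamma_form[OF assms]) (use pc in auto)
  also have "0 \<le> \<dots>" unfolding set_lebesgue_integral_def
    by (intro Bochner_Integration.integral_nonneg) auto
  finally show ?thesis .
qed

lemma mtrace_Gamma_nonneg:
  assumes "U \<in> carrier_mat K R" "q \<le> m"
  shows "0 \<le> mtrace (transpose_mat U * Gamma_mat q K b * U)"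
  unfolding mtrace_Gamma[OF assms(1)] by (intro sum_nonneg Gamma_form_nonneg assms)

lemma higher_pderiv_comb:
  "(pderiv ^^ j) (\<Sum>k<K. Polynomial.smult (c k) (pc k)) = (\<Sum>k<K. Polynomial.smult (c k) ((pderiv ^^ j) (pc k :: real poly)))"
  by (induction j) (simp_all add: pderiv_sum pderiv_smult)

text \<open>A linear combination of splines on common knots has the combined pieces, so that each
  column of \<open>U\<close> falls under \<open>spline_regular\<close>.\<close>

lemma comb_pieces:
  assumes q: "q \<le> m" and U: "U \<in> stiefel R K" and r: "r < R"
  obtains pf where "matching m J \<tau> pf" "\<And>t. t \<in> unit_ivl \<Longrightarrow> psi_est K b U r t = pp_deriv J \<tau> pf 0 t"
    "(LINT t:unit_ivl|lborel. (pp_step J \<tau> pf q t)\<^sup>2)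
      = (\<Sum>k<K. \<Sum>l<K. U $$ (k, r) * U $$ (l, r) * Gamma_mat q K b $$ (k, l))"
proof -
  obtain pc where pc: "\<And>k. k < K \<Longrightarrow> matching m J \<tau> (pc k)"
    "\<And>k t. k < K \<Longrightarrow> t \<in> unit_ivl \<Longrightarrow> b k t = pp_deriv J \<tau> (pc k) 0 t"
    using basis_pieces by blast
  define pf where "pf i = (\<Sum>k<K. Polynomial.smult (U $$ (k, r)) (pc k i))" for i
  have pp: "poly ((pderiv ^^ j) (pf i)) t = (\<Sum>k<K. U $$ (k, r) * poly ((pderiv ^^ j) (pc k i)) t)" for i j t
    unfolding pf_def higher_pderiv_comb by (simp add: poly_sum)
  show ?thesis
  proof (rule that[of pf])
    show "matching m J \<tau> pf"
      using pc(1) unfolding matching_def pp by (auto intro!: sum.cong)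
    show "psi_est K b U r t = pp_deriv J \<tau> pf 0 t" if "t \<in> unit_ivl" for t
      using pc(2) that unfolding pp_deriv_def pp psi_est_comb[OF U r] by (auto intro!: sum.cong)
    have "pp_step J \<tau> pf q t = (\<Sum>k<K. U $$ (k, r) * pp_step J \<tau> (pc k) q t)" for t
      unfolding pp_step_def pp sum_distrib_left by (subst sum.swap) (simp add: mult_ac)
    then show "(LINT t:unit_ivl|lborel. (pp_step J \<tau> pf q t)\<^sup>2)
      = (\<Sum>k<K. \<Sum>l<K. U $$ (k, r) * U $$ (l, r) * Gamma_mat q K b $$ (k, l))"
      using Gamma_form[OF q pc] by simp
  qed
qed

end

text \<open>The trace penalty is a sum of nonnegative column penalties, so each column obeys the
  bound b0, and orthonormality normalises it in mean square. The constant precedes all quantifiers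
  over knots, basis, dimension and \<open>U\<close>.\<close>

lemma psi_est_regular:
  assumes q: "1 \<le> q" "q \<le> m" and b0: "b0 \<ge> 0"
  shows "\<exists>B\<ge>0. \<forall>J \<tau> K b R U r. spline_basis m J \<tau> K b \<longrightarrow> U \<in> stiefel R K \<longrightarrow>
    mtrace (transpose_mat U * Gamma_mat q K b * U) \<le> b0 \<longrightarrow> r < R \<longrightarrow>
    (\<forall>t\<in>unit_ivl. \<bar>psi_est K b U r t\<bar> \<le> B) \<and>
    (\<forall>s\<in>unit_ivl. \<forall>t\<in>unit_ivl. \<bar>psi_est K b U r s - psi_est K b U r t\<bar> \<le> B * sqrt \<bar>s - t\<bar>)"
proof -
  obtain B where B: "B \<ge> 0" "\<And>J \<tau> pc f. knot_seq J \<tau> \<Longrightarrow> matching m J \<tau> pc \<Longrightarrow> \<forall>t\<in>unit_ivl. f t = pp_deriv J \<tau> pc 0 t \<Longrightarrow>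
    integral unit_ivl (\<lambda>t. (f t)\<^sup>2) \<le> 1 \<Longrightarrow> (LINT t:unit_ivl|lborel. (pp_step J \<tau> pc q t)\<^sup>2) \<le> b0 \<Longrightarrow>
    (\<forall>t\<in>unit_ivl. \<bar>f t\<bar> \<le> B) \<and> (\<forall>s\<in>unit_ivl. \<forall>t\<in>unit_ivl. \<bar>f s - f t\<bar> \<le> B * sqrt \<bar>s - t\<bar>)"
    using spline_regular[OF q b0] by blast
  show ?thesis
  proof (intro exI[of _ B] conjI[OF B(1)] allI impI)
    fix J \<tau> K b R U r
    assume "spline_basis m J \<tau> K b" and U: "U \<in> stiefel R K"
      and tr: "mtrace (transpose_mat U * Gamma_mat q K b * U) \<le> b0" and r: "r < R"
    then interpret spline_basis m J \<tau> K b by simp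
    let ?G = "\<lambda>r. \<Sum>k<K. \<Sum>l<K. U $$ (k, r) * U $$ (l, r) * Gamma_mat q K b $$ (k, l)"
    obtain pf where pf: "matching m J \<tau> pf" "\<And>t. t \<in> unit_ivl \<Longrightarrow> psi_est K b U r t = pp_deriv J \<tau> pf 0 t"
      "(LINT t:unit_ivl|lborel. (pp_step J \<tau> pf q t)\<^sup>2) = ?G r"
      using comb_pieces[OF q(2) U r] by blast
    have "?G r \<le> (\<Sum>r<R. ?G r)"
      by (rule member_le_sum[of r _ ?G]) (use r Gamma_form_nonneg[OF q(2)] in auto)
    then have g: "(LINT t:unit_ivl|lborel. (pp_step J \<tau> pf q t)\<^sup>2) \<le> b0"
      using tr unfolding pf(3) mtrace_Gamma[OF stiefelD(1)[OF U]] by linarith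
    have "integral unit_ivl (\<lambda>t. (psi_est K b U r t)\<^sup>2) = 1"
      using psi_est_orthonormal[OF U r r] L2_inner_eq_integral[OF continuous_psi_est[OF U r] continuous_psi_est[OF U r]]
      by (simp add: power2_eq_square)
    then show "(\<forall>t\<in>unit_ivl. \<bar>psi_est K b U r t\<bar> \<le> B) \<and>
      (\<forall>s\<in>unit_ivl. \<forall>t\<in>unit_ivl. \<bar>psi_est K b U r s - psi_est K b U r t\<bar> \<le> B * sqrt \<bar>s - t\<bar>)"
      using B(2)[OF knots pf(1) _ _ g, of "psi_est K b U r"] pf(2) by simp
  qed
qed

section \<open>The true covariance kernel\<close>

lemma L2_on_mult_integrable:
  fixes f g :: "real \<Rightarrow> real"
  assumes "L2_on A f" "L2_on A g"
  shows "set_integrable lborel A (\<lambda>t. f t * g t)"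
  unfolding set_integrable_def
proof (rule Bochner_Integration.integrable_bound)
  show "integrable lborel (\<lambda>t. indicator A t *\<^sub>R (f t)\<^sup>2 + indicator A t *\<^sub>R (g t)\<^sup>2)"
    using assms by (intro Bochner_Integration.integrable_add) (auto simp: L2_on_def set_integrable_def)
  have "(\<lambda>t. (indicator A t *\<^sub>R f t) * (indicator A t *\<^sub>R g t)) \<in> borel_measurable lborel"
    using assms by (intro borel_measurable_times) (auto simp: L2_on_def set_borel_measurable_def)
  moreover have "(\<lambda>t. (indicator A t *\<^sub>R f t) * (indicator A t *\<^sub>R g t)) = (\<lambda>t. indicator A t *\<^sub>R (f t * g t))"
    by (auto simp: indicator_def)
  ultimately show "(\<lambda>t. indicator A t *\<^sub>R (f t * g t)) \<in> borel_measurable lborel" by simp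
  have "\<bar>x * y\<bar> \<le> x\<^sup>2 + y\<^sup>2" for x y :: real
  proof -
    have "2 * \<bar>x * y\<bar> \<le> x\<^sup>2 + y\<^sup>2"
      using sum_squares_bound[of "\<bar>x\<bar>" "\<bar>y\<bar>"] by (simp add: abs_mult)
    then show ?thesis using zero_le_power2[of x] zero_le_power2[of y] by linarith
  qed
  then show "AE t in lborel. norm (indicator A t *\<^sub>R (f t * g t)) \<le> norm (indicator A t *\<^sub>R (f t)\<^sup>2 + indicator A t *\<^sub>R (g t)\<^sup>2)"
    by (auto simp: indicator_def)
qed

lemma continuous_kernel_bounded:
  fixes kern :: "real \<Rightarrow> real \<Rightarrow> real"
  assumes "continuous_on unit_sq (\<lambda>(s, t). kern s t)"
  obtains B where "B > 0" "\<And>s t. s \<in> unit_ivl \<Longrightarrow> t \<in> unit_ivl \<Longrightarrow> \<bar>kern s t\<bar> \<le> B"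
proof -
  have "bounded ((\<lambda>(s, t). kern s t) ` unit_sq)"
    by (intro compact_imp_bounded compact_continuous_image assms compact_Times) auto
  then obtain B where "B > 0" "\<forall>z\<in>(\<lambda>(s, t). kern s t) ` unit_sq. norm z \<le> B"
    unfolding bounded_pos by blast
  then show ?thesis using that[of B] by force
qed

text \<open>A real supremum bounds its members only when the set is bounded above. The partial sums
  are bounded through the diagonal: there all Mercer terms are nonnegative and sum to the kernel,
  and AM-GM handles the off-diagonal points.\<close>

lemma mercer_finite_rank:
  assumes mercer: "mercer_expansion kern lam psi" and cont: "continuous_on unit_sq (\<lambda>(s, t). kern s t)"
    and rank: "omega kern lam psi R = 0" and st: "s \<in> unit_ivl" "t \<in> unit_ivl"
  shows "kern s t = (\<Sum>r<R. lam r * psi r s * psi r t)"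
proof -
  obtain B where B: "B > 0" "\<And>s t. s \<in> unit_ivl \<Longrightarrow> t \<in> unit_ivl \<Longrightarrow> \<bar>kern s t\<bar> \<le> B"
    using continuous_kernel_bounded[OF cont] by blast
  have lam: "0 \<le> lam r" for r using mercer by (simp add: mercer_expansion_def)
  have diag: "(\<Sum>r<R. lam r * psi r s * psi r s) \<le> B" if s: "s \<in> unit_ivl" for s
  proof -
    have sums: "(\<lambda>r. lam r * psi r s * psi r s) sums kern s s"
      using mercer s by (simp add: mercer_expansion_def)
    have "(\<Sum>r<R. lam r * psi r s * psi r s) \<le> (\<Sum>r. lam r * psi r s * psi r s)"
      using sums lam by (intro sum_le_suminf) (auto simp: sums_iff mult.assoc)
    also have "\<dots> \<le> B" using sums B(2)[OF s s] by (simp add: sums_iff)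
    finally show ?thesis .
  qed
  have part: "\<bar>\<Sum>r<R. lam r * psi r s * psi r t\<bar> \<le> B" if s: "s \<in> unit_ivl" and t: "t \<in> unit_ivl" for s t
  proof -
    have "\<bar>\<Sum>r<R. lam r * psi r s * psi r t\<bar> \<le> (\<Sum>r<R. \<bar>lam r * psi r s * psi r t\<bar>)" by (rule sum_abs)
    also have "\<dots> \<le> (\<Sum>r<R. (lam r * psi r s * psi r s + lam r * psi r t * psi r t) / 2)"
    proof (rule sum_mono)
      fix r
      have "2 * (\<bar>psi r s\<bar> * \<bar>psi r t\<bar>) \<le> psi r s * psi r s + psi r t * psi r t"
        using sum_squares_bound[of "\<bar>psi r s\<bar>" "\<bar>psi r t\<bar>"] by (simp add: power2_eq_square)
      from mult_left_mono[OF this lam[of r]]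
      show "\<bar>lam r * psi r s * psi r t\<bar> \<le> (lam r * psi r s * psi r s + lam r * psi r t * psi r t) / 2"
        using lam[of r] by (simp add: abs_mult algebra_simps)
    qed
    also have "\<dots> \<le> B" using diag[OF s] diag[OF t] by (simp add: sum.distrib flip: sum_divide_distrib)
    finally show ?thesis .
  qed
  define h where "h = (\<lambda>(s, t). \<bar>kern s t - (\<Sum>r<R. lam r * psi r s * psi r t)\<bar>)"
  have "h z \<le> 2 * B" if "z \<in> unit_sq" for z
    using that B(2)[of "fst z" "snd z"] part[of "fst z" "snd z"] by (auto simp: h_def split: prod.splits)
  then have "bdd_above (h ` unit_sq)" by (intro bdd_aboveI[of _ "2 * B"]) auto
  then have "h (s, t) \<le> (SUP z\<in>unit_sq. h z)" by (intro cSUP_upper) (use st in auto)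
  also have "\<dots> = 0" using rank by (simp add: omega_def h_def)
  finally show ?thesis by (simp add: h_def)
qed

text \<open>An eigenfunction with positive eigenvalue is a multiple of its own image under the
  integral operator, and the image inherits the uniform continuity of the kernel. Because the
  expansion holds pointwise, so does the eigenvalue equation.\<close>

lemma eigenfunction_continuous:
  assumes mercer: "mercer_expansion kern lam psi" and cont: "continuous_on unit_sq (\<lambda>(s, t). kern s t)"
    and rank: "omega kern lam psi R = 0" and r: "r < R" "lam r > 0"
  shows "continuous_on unit_ivl (psi r)"
proof -
  have L2: "L2_on unit_ivl (psi r)" for r using mercer by (simp add: mercer_expansion_def)
  have on: "L2_inner (psi i) (psi j) = (if i = j then 1 else 0)" for i j
    using mercer by (simp add: mercer_expansion_def)
  have one: "L2_on unit_ivl (\<lambda>_. 1)"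
    by (auto simp: L2_on_def set_borel_measurable_def set_integrable_def)
  have int1: "set_integrable lborel unit_ivl (psi r)" using L2_on_mult_integrable[OF L2 one] by simp
  have intk: "set_integrable lborel unit_ivl (\<lambda>t. kern s t * psi r t)"
    and eq: "(LINT t:unit_ivl|lborel. kern s t * psi r t) = lam r * psi r s" if s: "s \<in> unit_ivl" for s
  proof -
    have e: "indicator unit_ivl t *\<^sub>R (kern s t * psi r t)
       = indicator unit_ivl t *\<^sub>R (\<Sum>i<R. lam i * psi i s * (psi i t * psi r t))" for t
      using mercer_finite_rank[OF mercer cont rank s, of t]
      by (auto simp: indicator_def sum_distrib_right mult.assoc)
    have I: "set_integrable lborel unit_ivl (\<lambda>t. lam i * psi i s * (psi i t * psi r t))" for i
      by (intro set_integrable_mult_right L2_on_mult_integrable L2)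
    show "set_integrable lborel unit_ivl (\<lambda>t. kern s t * psi r t)"
      using set_integral_sum(2)[of "{..<R}" lborel unit_ivl, OF _ I] unfolding set_integrable_def e by simp
    have "(LINT t:unit_ivl|lborel. kern s t * psi r t)
      = (LINT t:unit_ivl|lborel. \<Sum>i<R. lam i * psi i s * (psi i t * psi r t))"
      unfolding set_lebesgue_integral_def e ..
    also have "\<dots> = (\<Sum>i<R. LINT t:unit_ivl|lborel. lam i * psi i s * (psi i t * psi r t))"
      by (rule set_integral_sum(1)) (auto intro: I)
    also have "\<dots> = (\<Sum>i<R. lam i * psi i s * L2_inner (psi i) (psi r))"
      by (simp add: L2_inner_def)
    also have "\<dots> = (\<Sum>i<R. if i = r then lam r * psi r s else 0)"
      by (intro sum.cong refl) (auto simp: on)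
    finally show "(LINT t:unit_ivl|lborel. kern s t * psi r t) = lam r * psi r s" using r by simp
  qed
  define A where "A = (LINT t:unit_ivl|lborel. \<bar>psi r t\<bar>)"
  have A: "A \<ge> 0" unfolding A_def set_lebesgue_integral_def by (intro Bochner_Integration.integral_nonneg) auto
  have uc: "uniformly_continuous_on unit_sq (\<lambda>(s, t). kern s t)"
    by (intro compact_uniformly_continuous cont compact_Times) auto
  show ?thesis unfolding continuous_on_iff
  proof (intro ballI allI impI)
    fix s \<epsilon> :: real assume s: "s \<in> unit_ivl" and \<epsilon>: "\<epsilon> > 0"
    \<comment> \<open>\<open>A + 1\<close> instead of \<open>A\<close> excludes division by 0 and
      leaves room for a strict inequality at the end.\<close>
    define \<kappa> where "\<kappa> = lam r * \<epsilon> / (2 * (A + 1))"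
    have \<kappa>: "\<kappa> > 0" using \<epsilon> r A by (simp add: \<kappa>_def)
    obtain d where d: "d > 0" "\<And>z z'. z \<in> unit_sq \<Longrightarrow> z' \<in> unit_sq \<Longrightarrow> dist z' z < d \<Longrightarrow>
        dist ((\<lambda>(s, t). kern s t) z') ((\<lambda>(s, t). kern s t) z) < \<kappa>"
      using uc \<kappa> unfolding uniformly_continuous_on_def by meson
    show "\<exists>d>0. \<forall>s'\<in>unit_ivl. dist s' s < d \<longrightarrow> dist (psi r s') (psi r s) < \<epsilon>"
    proof (intro exI[of _ d] conjI d(1) ballI impI)
      fix s' :: real assume s': "s' \<in> unit_ivl" and ds: "dist s' s < d"
      have k: "\<bar>kern s' t - kern s t\<bar> \<le> \<kappa>" if t: "t \<in> unit_ivl" for t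
        using d(2)[of "(s, t)" "(s', t)"] s s' t ds by (simp add: dist_Pair_Pair dist_real_def less_imp_le)
      have "lam r * (psi r s' - psi r s) = (LINT t:unit_ivl|lborel. kern s' t * psi r t - kern s t * psi r t)"
        using set_integral_diff(2)[OF intk[OF s'] intk[OF s]] eq[OF s] eq[OF s'] by (simp add: algebra_simps)
      also have "\<bar>\<dots>\<bar> \<le> (LINT t:unit_ivl|lborel. \<bar>kern s' t * psi r t - kern s t * psi r t\<bar>)"
        using integral_norm_bound[of lborel "\<lambda>t. indicator unit_ivl t *\<^sub>R (kern s' t * psi r t - kern s t * psi r t)"]
        by (simp add: set_lebesgue_integral_def abs_mult)
      also have "\<dots> \<le> (LINT t:unit_ivl|lborel. \<kappa> * \<bar>psi r t\<bar>)"
      proof (rule set_integral_mono)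
        show "set_integrable lborel unit_ivl (\<lambda>t. \<bar>kern s' t * psi r t - kern s t * psi r t\<bar>)"
          by (intro set_integrable_abs set_integral_diff(1) intk s s')
        show "set_integrable lborel unit_ivl (\<lambda>t. \<kappa> * \<bar>psi r t\<bar>)"
          by (intro set_integrable_mult_right set_integrable_abs int1)
        fix t :: real assume "t \<in> unit_ivl"
        then show "\<bar>kern s' t * psi r t - kern s t * psi r t\<bar> \<le> \<kappa> * \<bar>psi r t\<bar>"
          using k[of t] by (simp add: abs_mult mult_right_mono flip: left_diff_distrib)
      qed
      also have "\<dots> = \<kappa> * A" by (simp add: A_def)
      finally have "lam r * \<bar>psi r s' - psi r s\<bar> \<le> \<kappa> * A" using r by (simp add: abs_mult)
      also have "\<dots> < \<kappa> * (2 * (A + 1))" using \<kappa> A by (intro mult_strict_left_mono) auto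
      also have "\<dots> = lam r * \<epsilon>" using A by (simp add: \<kappa>_def)
      finally show "dist (psi r s') (psi r s) < \<epsilon>" using r by (simp add: dist_real_def)
    qed
  qed
qed

section \<open>From mean-square to uniform closeness\<close>

lemma interval_around:
  fixes s0 \<delta> :: real
  assumes "s0 \<in> unit_ivl" "0 < \<delta>" "\<delta> \<le> 1"
  obtains a where "{a..a + \<delta>} \<subseteq> unit_ivl" "\<And>s. s \<in> {a..a + \<delta>} \<Longrightarrow> \<bar>s - s0\<bar> \<le> \<delta>"
proof (cases "s0 \<le> 1 - \<delta>")
  case True
  then show ?thesis using that[of s0] assms by auto
next
  case False
  have "\<bar>s - s0\<bar> \<le> \<delta>" if "s \<in> {1 - \<delta>..1 - \<delta> + \<delta>}" for s
    using False assms that by (auto simp: abs_le_iff)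
  moreover have "{1 - \<delta>..1 - \<delta> + \<delta>} \<subseteq> unit_ivl" using assms by auto
  ultimately show ?thesis using that by blast
qed

text \<open>A value above 2 \<kappa> forces values of at least \<kappa> on a whole square of side
  \<delta>, which contributes (\<delta> \<kappa>)^2 to the integral.\<close>

lemma hs_square_sup_bound:
  assumes cont: "continuous_on unit_sq (\<lambda>(s, t). f s t)" and \<kappa>: "\<kappa> > 0" and \<delta>: "0 < \<delta>" "\<delta> \<le> 1"
    and modulus: "\<And>s s' t t'. s \<in> unit_ivl \<Longrightarrow> s' \<in> unit_ivl \<Longrightarrow> t \<in> unit_ivl \<Longrightarrow> t' \<in> unit_ivl \<Longrightarrow>
      \<bar>s - s'\<bar> \<le> \<delta> \<Longrightarrow> \<bar>t - t'\<bar> \<le> \<delta> \<Longrightarrow> \<bar>f s t - f s' t'\<bar> \<le> \<kappa>"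
    and hs: "hs_square f < (\<delta> * \<kappa>)\<^sup>2" and st: "s0 \<in> unit_ivl" "t0 \<in> unit_ivl"
  shows "\<bar>f s0 t0\<bar> \<le> 2 * \<kappa>"
proof (rule ccontr)
  assume "\<not> \<bar>f s0 t0\<bar> \<le> 2 * \<kappa>"
  then have big: "\<bar>f s0 t0\<bar> > 2 * \<kappa>" by simp
  obtain a where a: "{a..a + \<delta>} \<subseteq> unit_ivl" "\<And>s. s \<in> {a..a + \<delta>} \<Longrightarrow> \<bar>s - s0\<bar> \<le> \<delta>"
    by (rule interval_around[OF st(1) \<delta>]) blast
  obtain c where c: "{c..c + \<delta>} \<subseteq> unit_ivl" "\<And>s. s \<in> {c..c + \<delta>} \<Longrightarrow> \<bar>s - t0\<bar> \<le> \<delta>"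
    by (rule interval_around[OF st(2) \<delta>]) blast
  let ?Q = "{a..a + \<delta>} \<times> {c..c + \<delta>}"
  have ge: "\<kappa>\<^sup>2 \<le> (f s t)\<^sup>2" if "s \<in> {a..a + \<delta>}" "t \<in> {c..c + \<delta>}" for s t
  proof -
    have u: "s \<in> unit_ivl" "t \<in> unit_ivl" using a(1) c(1) that by blast+
    have "\<bar>f s t - f s0 t0\<bar> \<le> \<kappa>" by (rule modulus[OF u(1) st(1) u(2) st(2) a(2) c(2)]) (use that in auto)
    then have "\<kappa> \<le> \<bar>f s t\<bar>" using big by linarith
    then have "\<kappa>\<^sup>2 \<le> \<bar>f s t\<bar>\<^sup>2" using \<kappa> by (intro power_mono) auto
    then show ?thesis by simp
  qed
  have c2: "continuous_on unit_sq (\<lambda>z. (f (fst z) (snd z))\<^sup>2)"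
    using cont by (intro continuous_intros) (simp add: case_prod_unfold)
  have i: "integrable lborel (\<lambda>z. indicator unit_sq z *\<^sub>R (f (fst z) (snd z))\<^sup>2)"
    by (rule borel_integrable_compact[OF _ c2]) (auto intro: compact_Times)
  have m: "emeasure lborel ?Q = ennreal (\<delta> * \<delta>)"
  proof -
    have "emeasure (lborel \<Otimes>\<^sub>M lborel) ?Q = emeasure lborel {a..a + \<delta>} * emeasure lborel {c..c + \<delta>}"
      by (rule lborel.emeasure_pair_measure_Times) auto
    then show ?thesis using \<delta> by (simp add: lborel_prod ennreal_mult)
  qed
  have Q: "?Q \<in> sets lborel" by (simp add: borel_Times)
  have i2: "integrable lborel (\<lambda>z. indicator ?Q z * \<kappa>\<^sup>2)"
    using m Q by (intro integrable_mult_left integrable_real_indicator) auto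
  have "(\<delta> * \<kappa>)\<^sup>2 = (LINT z|lborel. indicator ?Q z * \<kappa>\<^sup>2)"
    using m Q \<delta> by (simp add: measure_def power2_eq_square mult_ac)
  also have "\<dots> \<le> (LINT z|lborel. indicator unit_sq z *\<^sub>R (f (fst z) (snd z))\<^sup>2)"
  proof (rule integral_mono[OF i2 i])
    fix z :: "real \<times> real"
    show "indicator ?Q z * \<kappa>\<^sup>2 \<le> indicator unit_sq z *\<^sub>R (f (fst z) (snd z))\<^sup>2"
      using ge[of "fst z" "snd z"] a(1) c(1) by (cases z) (auto simp: indicator_def)
  qed
  also have "\<dots> = hs_square f" by (simp add: hs_square_def set_lebesgue_integral_def)
  finally show False using hs by simp
qed

lemma hs_square_le:
  assumes cont: "continuous_on unit_sq (\<lambda>(s, t). f s t)" and "0 \<le> \<kappa>"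
    and le: "\<And>s t. s \<in> unit_ivl \<Longrightarrow> t \<in> unit_ivl \<Longrightarrow> \<bar>f s t\<bar> \<le> \<kappa>"
  shows "hs_square f \<le> \<kappa>\<^sup>2"
proof -
  have c2: "continuous_on unit_sq (\<lambda>z. (f (fst z) (snd z))\<^sup>2)"
    using cont by (intro continuous_intros) (simp add: case_prod_unfold)
  have i: "set_integrable lborel unit_sq (\<lambda>z. (f (fst z) (snd z))\<^sup>2)"
    unfolding set_integrable_def by (rule borel_integrable_compact[OF _ c2]) (auto intro: compact_Times)
  have "hs_square f \<le> (LINT z:unit_sq|lborel. (\<lambda>_. \<kappa>\<^sup>2) (fst z) * (\<lambda>_. 1) (snd z))"
    unfolding hs_square_def
  proof (rule set_integral_mono[OF i])
    show "set_integrable lborel unit_sq (\<lambda>z. \<kappa>\<^sup>2 * 1)"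
      by (rule unit_sq_integral_product(1)[of "\<lambda>_. \<kappa>\<^sup>2" "\<lambda>_. 1"]) auto
    fix z assume "z \<in> unit_sq"
    then have "\<bar>f (fst z) (snd z)\<bar>\<^sup>2 \<le> \<kappa>\<^sup>2" using le by (intro power_mono) auto
    then show "(f (fst z) (snd z))\<^sup>2 \<le> \<kappa>\<^sup>2 * 1" by simp
  qed
  also have "\<dots> = \<kappa>\<^sup>2" by (subst unit_sq_integral_product(2)) auto
  finally show ?thesis .
qed

lemma continuous_on_finite_rank:
  fixes f :: "nat \<Rightarrow> real \<Rightarrow> real"
  assumes "\<And>r. r < (R::nat) \<Longrightarrow> continuous_on unit_ivl (f r)"
  shows "continuous_on unit_sq (\<lambda>(s, t). \<Sum>r<R. d r * f r s * f r t)"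
  unfolding case_prod_unfold
  by (intro continuous_on_sum continuous_on_mult continuous_on_const
      continuous_on_compose2[OF assms continuous_on_fst[OF continuous_on_id], of _ unit_sq]
      continuous_on_compose2[OF assms continuous_on_snd[OF continuous_on_id], of _ unit_sq]) auto

lemma kernel_classD:
  assumes "c \<in> kernel_class B \<delta>"
  shows "\<lbrakk>s \<in> unit_ivl; t \<in> unit_ivl\<rbrakk> \<Longrightarrow> c s t = c t s"
    and "\<lbrakk>s \<in> unit_ivl; t \<in> unit_ivl\<rbrakk> \<Longrightarrow> \<bar>c s t\<bar> \<le> B"
    and "(\<And>i. i < (n::nat) \<Longrightarrow> x i \<in> unit_ivl) \<Longrightarrow> 0 \<le> (\<Sum>i<n. \<Sum>j<n. c (x i) (x j) * a i * a j)"
    and "\<lbrakk>\<kappa> > 0; s \<in> unit_ivl; s' \<in> unit_ivl; t \<in> unit_ivl; t' \<in> unit_ivl; \<bar>s - s'\<bar> \<le> \<delta> \<kappa>; \<bar>t - t'\<bar> \<le> \<delta> \<kappa>\<rbrakk>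
      \<Longrightarrow> \<bar>c s t - c s' t'\<bar> \<le> \<kappa>"
  using assms unfolding kernel_class_def mem_Collect_eq by (elim conjE; meson)+

lemma kernel_classI:
  assumes "\<And>s t. s \<in> unit_ivl \<Longrightarrow> t \<in> unit_ivl \<Longrightarrow> c s t = c t s"
    and "\<And>s t. s \<in> unit_ivl \<Longrightarrow> t \<in> unit_ivl \<Longrightarrow> \<bar>c s t\<bar> \<le> B"
    and "\<And>(n::nat) a x. (\<And>i. i < n \<Longrightarrow> x i \<in> unit_ivl) \<Longrightarrow> 0 \<le> (\<Sum>i<n. \<Sum>j<n. c (x i) (x j) * a i * a j)"
    and "\<And>\<kappa> s s' t t'. \<kappa> > 0 \<Longrightarrow> s \<in> unit_ivl \<Longrightarrow> s' \<in> unit_ivl \<Longrightarrow> t \<in> unit_ivl \<Longrightarrow> t' \<in> unit_ivl \<Longrightarrow>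
      \<bar>s - s'\<bar> \<le> \<delta> \<kappa> \<Longrightarrow> \<bar>t - t'\<bar> \<le> \<delta> \<kappa> \<Longrightarrow> \<bar>c s t - c s' t'\<bar> \<le> \<kappa>"
  shows "c \<in> kernel_class B \<delta>"
  unfolding kernel_class_def
  by (intro CollectI conjI ballI allI impI) (rule assms; (assumption | blast))+

lemma kernel_class_mono:
  assumes c: "c \<in> kernel_class B \<delta>" and "B \<le> B'" "\<And>\<kappa>. \<kappa> > 0 \<Longrightarrow> \<delta>' \<kappa> \<le> \<delta> \<kappa>"
  shows "c \<in> kernel_class B' \<delta>'"
proof (rule kernel_classI)
  show "\<bar>c s t\<bar> \<le> B'" if "s \<in> unit_ivl" "t \<in> unit_ivl" for s t
    using kernel_classD(2)[OF c that] assms(2) by linarith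
  show "\<bar>c s t - c s' t'\<bar> \<le> \<kappa>"
    if "\<kappa> > 0" "s \<in> unit_ivl" "s' \<in> unit_ivl" "t \<in> unit_ivl" "t' \<in> unit_ivl"
      "\<bar>s - s'\<bar> \<le> \<delta>' \<kappa>" "\<bar>t - t'\<bar> \<le> \<delta>' \<kappa>" for \<kappa> s s' t t'
    by (rule kernel_classD(4)[OF c that(1-5)]) (use that(6,7) assms(3)[OF that(1)] in linarith)+
qed (fact kernel_classD(1)[OF c], fact kernel_classD(3)[OF c])

lemma finite_rank_psd:
  fixes R n :: nat and a d :: "nat \<Rightarrow> real" and f :: "nat \<Rightarrow> 'x \<Rightarrow> real"
  assumes "\<And>r. r < R \<Longrightarrow> 0 \<le> d r"
  shows "0 \<le> (\<Sum>i<n. \<Sum>j<n. (\<Sum>r<R. d r * f r (t i) * f r (t j)) * a i * a j)"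
proof -
  have "(\<Sum>i<n. \<Sum>j<n. (\<Sum>r<R. d r * f r (t i) * f r (t j)) * a i * a j)
    = (\<Sum>i<n. \<Sum>j<n. \<Sum>r<R. d r * ((f r (t i) * a i) * (f r (t j) * a j)))"
    unfolding sum_distrib_right by (intro sum.cong refl) (simp only: mult_ac)
  also have "\<dots> = (\<Sum>i<n. \<Sum>r<R. \<Sum>j<n. d r * ((f r (t i) * a i) * (f r (t j) * a j)))"
    by (intro sum.cong refl sum.swap)
  also have "\<dots> = (\<Sum>r<R. \<Sum>i<n. \<Sum>j<n. d r * ((f r (t i) * a i) * (f r (t j) * a j)))"
    by (rule sum.swap)
  also have "\<dots> = (\<Sum>r<R. d r * (\<Sum>i<n. f r (t i) * a i)\<^sup>2)"
    unfolding power2_eq_square sum_product sum_distrib_left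
    by (intro sum.cong refl) (simp add: sum_distrib_left sum_distrib_right mult_ac)
  also have "0 \<le> \<dots>" using assms by (intro sum_nonneg mult_nonneg_nonneg) auto
  finally show ?thesis .
qed

text \<open>The increment of a product f(s) f(t) is split in the two variables; Hoelder functions of
  order 1/2 give a bound by square roots, whose inverse modulus is a square. The added 1 keeps the
  denominator positive when the kernel bound is 0.\<close>

lemma finite_rank_kernel_class:
  fixes R :: nat and B L :: real
  assumes d: "\<And>r. r < R \<Longrightarrow> 0 \<le> d r \<and> d r \<le> L" and B: "B \<ge> 0" and L: "L \<ge> 0"
    and f: "\<And>r t. r < R \<Longrightarrow> t \<in> unit_ivl \<Longrightarrow> \<bar>f r t\<bar> \<le> B"
    and h: "\<And>r s t. r < R \<Longrightarrow> s \<in> unit_ivl \<Longrightarrow> t \<in> unit_ivl \<Longrightarrow> \<bar>f r s - f r t\<bar> \<le> B * sqrt \<bar>s - t\<bar>"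
  shows "(\<lambda>s t. \<Sum>r<R. d r * f r s * f r t)
    \<in> kernel_class (real R * (L * B\<^sup>2)) (\<lambda>\<kappa>. (\<kappa> / (2 * (real R * (L * B\<^sup>2)) + 1))\<^sup>2)"
proof -
  define C where "C = real R * (L * B\<^sup>2)"
  have C: "C \<ge> 0" using L by (simp add: C_def)
  have bound: "\<bar>\<Sum>r<R. d r * f r s * f r t\<bar> \<le> C" if st: "s \<in> unit_ivl" "t \<in> unit_ivl" for s t
  proof -
    have "\<bar>\<Sum>r<R. d r * f r s * f r t\<bar> \<le> (\<Sum>r<R. \<bar>d r * f r s * f r t\<bar>)" by (rule sum_abs)
    also have "\<dots> \<le> (\<Sum>r<R. L * B\<^sup>2)"
    proof (rule sum_mono)
      fix r assume "r \<in> {..<R}"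
      then have "\<bar>d r\<bar> * \<bar>f r s\<bar> * \<bar>f r t\<bar> \<le> L * B * B"
        using d[of r] f[of r] st B L by (intro mult_mono) auto
      then show "\<bar>d r * f r s * f r t\<bar> \<le> L * B\<^sup>2" by (simp add: abs_mult power2_eq_square mult.assoc)
    qed
    finally show ?thesis by (simp add: C_def)
  qed
  have diff: "\<bar>(\<Sum>r<R. d r * f r s * f r t) - (\<Sum>r<R. d r * f r s' * f r t')\<bar> \<le> C * (sqrt \<bar>s - s'\<bar> + sqrt \<bar>t - t'\<bar>)"
    if st: "s \<in> unit_ivl" "s' \<in> unit_ivl" "t \<in> unit_ivl" "t' \<in> unit_ivl" for s s' t t'
  proof -
    let ?q = "sqrt \<bar>s - s'\<bar> + sqrt \<bar>t - t'\<bar>"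
    have "\<bar>(\<Sum>r<R. d r * f r s * f r t) - (\<Sum>r<R. d r * f r s' * f r t')\<bar>
        = \<bar>\<Sum>r<R. d r * ((f r s - f r s') * f r t + f r s' * (f r t - f r t'))\<bar>"
      unfolding sum_subtractf[symmetric] by (intro arg_cong[of _ _ abs] sum.cong refl) (simp add: algebra_simps)
    also have "\<dots> \<le> (\<Sum>r<R. \<bar>d r * ((f r s - f r s') * f r t + f r s' * (f r t - f r t'))\<bar>)" by (rule sum_abs)
    also have "\<dots> \<le> (\<Sum>r<R. L * (B * sqrt \<bar>s - s'\<bar> * B + B * (B * sqrt \<bar>t - t'\<bar>)))"
    proof (rule sum_mono)
      fix r assume r: "r \<in> {..<R}"
      have "\<bar>(f r s - f r s') * f r t\<bar> \<le> B * sqrt \<bar>s - s'\<bar> * B"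
        unfolding abs_mult using r st B by (intro mult_mono h f) auto
      moreover have "\<bar>f r s' * (f r t - f r t')\<bar> \<le> B * (B * sqrt \<bar>t - t'\<bar>)"
        unfolding abs_mult using r st B by (intro mult_mono h f) auto
      ultimately have "\<bar>(f r s - f r s') * f r t + f r s' * (f r t - f r t')\<bar> \<le> B * sqrt \<bar>s - s'\<bar> * B + B * (B * sqrt \<bar>t - t'\<bar>)"
        by linarith
      then show "\<bar>d r * ((f r s - f r s') * f r t + f r s' * (f r t - f r t'))\<bar>
        \<le> L * (B * sqrt \<bar>s - s'\<bar> * B + B * (B * sqrt \<bar>t - t'\<bar>))"
        unfolding abs_mult[of "d r"] using d[of r] r L by (intro mult_mono) auto
    qed
    also have "\<dots> = C * ?q" by (simp add: C_def power2_eq_square algebra_simps)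
    finally show ?thesis .
  qed
  have modulus: "\<bar>(\<Sum>r<R. d r * f r s * f r t) - (\<Sum>r<R. d r * f r s' * f r t')\<bar> \<le> \<kappa>"
    if \<kappa>: "\<kappa> > 0" and st: "s \<in> unit_ivl" "s' \<in> unit_ivl" "t \<in> unit_ivl" "t' \<in> unit_ivl"
      and close: "\<bar>s - s'\<bar> \<le> (\<kappa> / (2 * C + 1))\<^sup>2" "\<bar>t - t'\<bar> \<le> (\<kappa> / (2 * C + 1))\<^sup>2" for \<kappa> s s' t t'
  proof -
    have "sqrt \<bar>s - s'\<bar> \<le> \<kappa> / (2 * C + 1)" "sqrt \<bar>t - t'\<bar> \<le> \<kappa> / (2 * C + 1)"
      using close \<kappa> C by (auto intro!: real_le_lsqrt divide_nonneg_pos add_nonneg_pos)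
    then have "C * (sqrt \<bar>s - s'\<bar> + sqrt \<bar>t - t'\<bar>) \<le> C * (\<kappa> / (2 * C + 1) + \<kappa> / (2 * C + 1))"
      using C by (intro mult_left_mono) auto
    also have "\<dots> = \<kappa> * (2 * C / (2 * C + 1))" by simp
    also have "\<dots> \<le> \<kappa> * 1" using \<kappa> C by (intro mult_left_mono) auto
    finally show ?thesis using diff[OF st] by linarith
  qed
  have sym: "(\<Sum>r<R. d r * f r s * f r t) = (\<Sum>r<R. d r * f r t * f r s)" for s t
    by (simp add: mult_ac)
  have pos: "0 \<le> d r" if "r < R" for r using d[OF that] by simp
  show ?thesis
    unfolding C_def[symmetric]
    by (rule kernel_classI[OF sym bound finite_rank_psd[OF pos] modulus])
qed

lemma kernel_class_continuous:
  assumes c: "c \<in> kernel_class B \<delta>" and \<delta>: "\<And>\<kappa>. \<kappa> > 0 \<Longrightarrow> \<delta> \<kappa> > 0"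
  shows "continuous_on unit_sq (\<lambda>(s, t). c s t)"
  unfolding continuous_on_iff
proof (intro ballI allI impI)
  fix z \<epsilon> assume z: "z \<in> unit_sq" and \<epsilon>: "(\<epsilon>::real) > 0"
  have d: "\<delta> (\<epsilon> / 2) > 0" using \<delta> \<epsilon> by simp
  show "\<exists>d>0. \<forall>z'\<in>unit_sq. dist z' z < d \<longrightarrow> dist ((\<lambda>(s, t). c s t) z') ((\<lambda>(s, t). c s t) z) < \<epsilon>"
  proof (intro exI[of _ "\<delta> (\<epsilon> / 2)"] conjI d ballI impI)
    fix z' assume z': "z' \<in> unit_sq" and dz: "dist z' z < \<delta> (\<epsilon> / 2)"
    have "\<bar>fst z' - fst z\<bar> \<le> \<delta> (\<epsilon> / 2)" "\<bar>snd z' - snd z\<bar> \<le> \<delta> (\<epsilon> / 2)"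
      using dist_fst_le[of z' z] dist_snd_le[of z' z] dz by (auto simp: dist_real_def)
    then have "\<bar>c (fst z') (snd z') - c (fst z) (snd z)\<bar> \<le> \<epsilon> / 2"
      using kernel_classD(4)[OF c, of "\<epsilon> / 2" "fst z'" "fst z" "snd z'" "snd z"] z z' \<epsilon> by auto
    then show "dist ((\<lambda>(s, t). c s t) z') ((\<lambda>(s, t). c s t) z) < \<epsilon>"
      using \<epsilon> by (simp add: dist_real_def case_prod_unfold)
  qed
qed

lemma kernel_class_sup_close:
  assumes \<delta>: "\<And>\<kappa>. \<kappa> > 0 \<Longrightarrow> \<delta> \<kappa> > 0" and \<kappa>: "\<kappa> > 0"
  shows "\<exists>e>0. \<forall>c\<in>kernel_class B \<delta>. \<forall>c'\<in>kernel_class B \<delta>. hs_square (\<lambda>s t. c s t - c' s t) < e \<longrightarrow>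
    (\<forall>s\<in>unit_ivl. \<forall>t\<in>unit_ivl. \<bar>c s t - c' s t\<bar> \<le> \<kappa>)"
proof -
  \<comment> \<open>Each kernel moves by at most \<kappa> / 4 within d, their difference by at most
    \<kappa> / 2, and the sup bound doubles this. The cap 1 lets a square of side d fit into the
    unit square.\<close>
  define d where "d = min (\<delta> (\<kappa> / 4)) 1"
  have d: "d > 0" "d \<le> 1" "d \<le> \<delta> (\<kappa> / 4)" using \<delta> \<kappa> by (auto simp: d_def)
  show ?thesis
  proof (intro exI[of _ "(d * (\<kappa> / 2))\<^sup>2"] conjI ballI impI)
    show "0 < (d * (\<kappa> / 2))\<^sup>2" using d \<kappa> by simp
    fix c c' s t assume c: "c \<in> kernel_class B \<delta>" "c' \<in> kernel_class B \<delta>"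
      and hs: "hs_square (\<lambda>s t. c s t - c' s t) < (d * (\<kappa> / 2))\<^sup>2" and st: "s \<in> unit_ivl" "t \<in> unit_ivl"
    have "\<bar>c s t - c' s t\<bar> \<le> 2 * (\<kappa> / 2)"
    proof (rule hs_square_sup_bound[OF _ _ d(1,2) _ hs st])
      show "continuous_on unit_sq (\<lambda>(s, t). c s t - c' s t)"
        using continuous_on_diff[OF kernel_class_continuous[OF c(1) \<delta>] kernel_class_continuous[OF c(2) \<delta>]]
        by (simp add: case_prod_unfold)
      fix s s' t t' assume *: "s \<in> unit_ivl" "s' \<in> unit_ivl" "t \<in> unit_ivl" "t' \<in> unit_ivl"
        "\<bar>s - s'\<bar> \<le> d" "\<bar>t - t'\<bar> \<le> d"
      have "\<bar>c s t - c s' t'\<bar> \<le> \<kappa> / 4" "\<bar>c' s t - c' s' t'\<bar> \<le> \<kappa> / 4"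
        using kernel_classD(4)[OF c(1), of "\<kappa> / 4" s s' t t'] kernel_classD(4)[OF c(2), of "\<kappa> / 4" s s' t t'] * d \<kappa>
        by auto
      then show "\<bar>c s t - c' s t - (c s' t' - c' s' t')\<bar> \<le> \<kappa> / 2" by linarith
    qed (use \<kappa> in auto)
    then show "\<bar>c s t - c' s t\<bar> \<le> \<kappa>" by simp
  qed
qed

section \<open>The true kernel, its spline approximation and the spectral gap\<close>

locale finite_rank_kernel =
  fixes kern :: "real \<Rightarrow> real \<Rightarrow> real" and lam :: "nat \<Rightarrow> real" and psi :: "nat \<Rightarrow> real \<Rightarrow> real"
    and R :: nat and c0 :: real
  assumes mercer: "mercer_expansion kern lam psi"
    and kern_cont: "continuous_on unit_sq (\<lambda>(s, t). kern s t)"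
    and rank: "omega kern lam psi R = 0"
    and gap: "\<And>r r'. r < r' \<Longrightarrow> r' \<le> R \<Longrightarrow> lam r - lam r' \<ge> c0" and c0: "c0 > 0"
begin

text \<open>The gap condition reaches the index R, whose eigenvalue is nonnegative, so the R leading
  eigenvalues stay away from 0.\<close>

lemma lam_ge: "r < R \<Longrightarrow> c0 \<le> lam r"
  using gap[of r R] mercer by (auto simp: mercer_expansion_def intro: order_trans[of _ "lam r - lam R"])

lemma psi_cont: "r < R \<Longrightarrow> continuous_on unit_ivl (psi r)"
  using eigenfunction_continuous[OF mercer kern_cont rank, of r] lam_ge[of r] c0 by simp

lemma psi_orthonormal: "L2_inner (psi i) (psi j) = (if i = j then 1 else 0)"
  using mercer by (simp add: mercer_expansion_def)

lemma kern_eq: "s \<in> unit_ivl \<Longrightarrow> t \<in> unit_ivl \<Longrightarrow> kern s t = (\<Sum>r<R. lam r * psi r s * psi r t)"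
  by (rule mercer_finite_rank[OF mercer kern_cont rank])

lemma kern_class: "\<exists>B \<delta>. (\<forall>\<kappa>>0. \<delta> \<kappa> > 0) \<and> kern \<in> kernel_class B \<delta>"
proof -
  obtain B where B: "\<And>s t. s \<in> unit_ivl \<Longrightarrow> t \<in> unit_ivl \<Longrightarrow> \<bar>kern s t\<bar> \<le> B"
    using continuous_kernel_bounded[OF kern_cont] by blast
  have uc: "uniformly_continuous_on unit_sq (\<lambda>(s, t). kern s t)"
    by (intro compact_uniformly_continuous kern_cont compact_Times) auto
  define P where "P \<kappa> d \<longleftrightarrow> d > 0 \<and> (\<forall>s\<in>unit_ivl. \<forall>s'\<in>unit_ivl. \<forall>t\<in>unit_ivl. \<forall>t'\<in>unit_ivl.
      \<bar>s - s'\<bar> \<le> d \<longrightarrow> \<bar>t - t'\<bar> \<le> d \<longrightarrow> \<bar>kern s t - kern s' t'\<bar> \<le> \<kappa>)" for \<kappa> d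
  have ex: "\<exists>d. P \<kappa> d" if \<kappa>: "\<kappa> > 0" for \<kappa>
  proof -
    obtain d where d: "d > 0" "\<And>z z'. z \<in> unit_sq \<Longrightarrow> z' \<in> unit_sq \<Longrightarrow> dist z' z < d \<Longrightarrow>
        dist ((\<lambda>(s, t). kern s t) z') ((\<lambda>(s, t). kern s t) z) < \<kappa>"
      using uc \<kappa> unfolding uniformly_continuous_on_def by meson
    show ?thesis unfolding P_def
    proof (intro exI[of _ "d / 3"] conjI ballI impI)
      fix s s' t t' assume *: "s \<in> unit_ivl" "s' \<in> unit_ivl" "t \<in> unit_ivl" "t' \<in> unit_ivl"
        "\<bar>s - s'\<bar> \<le> d / 3" "\<bar>t - t'\<bar> \<le> d / 3"
      have "dist (s, t) (s', t') \<le> \<bar>s - s'\<bar> + \<bar>t - t'\<bar>"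
        unfolding dist_Pair_Pair dist_real_def using sqrt_sum_squares_le_sum_abs[of "\<bar>s - s'\<bar>" "\<bar>t - t'\<bar>"] by simp
      then have "dist (s, t) (s', t') < d" using * d(1) by linarith
      then show "\<bar>kern s t - kern s' t'\<bar> \<le> \<kappa>"
        using d(2)[of "(s', t')" "(s, t)"] * by (simp add: dist_real_def)
    qed (use d in auto)
  qed
  define \<delta> where "\<delta> \<kappa> = (SOME d. P \<kappa> d)" for \<kappa>
  have \<delta>: "P \<kappa> (\<delta> \<kappa>)" if "\<kappa> > 0" for \<kappa>
    unfolding \<delta>_def by (rule someI_ex[OF ex[OF that]])
  have "kern \<in> kernel_class B \<delta>"
  proof (rule kernel_classI)
    show "kern s t = kern t s" if "s \<in> unit_ivl" "t \<in> unit_ivl" for s t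
      using kern_eq[OF that] kern_eq[OF that(2,1)] by (simp add: mult_ac)
    have lam0: "0 \<le> lam r" if "r < R" for r using lam_ge[OF that] c0 by simp
    fix n :: nat and a x :: "nat \<Rightarrow> real" assume x: "\<And>i. i < n \<Longrightarrow> x i \<in> unit_ivl"
    have "(\<Sum>i<n. \<Sum>j<n. kern (x i) (x j) * a i * a j) = (\<Sum>i<n. \<Sum>j<n. (\<Sum>r<R. lam r * psi r (x i) * psi r (x j)) * a i * a j)"
      by (intro sum.cong refl) (simp only: lessThan_iff kern_eq[OF x x])
    also have "0 \<le> \<dots>" by (rule finite_rank_psd[OF lam0])
    finally show "0 \<le> (\<Sum>i<n. \<Sum>j<n. kern (x i) (x j) * a i * a j)" .
  next
    fix \<kappa> s s' t t' :: real
    assume *: "\<kappa> > 0" "s \<in> unit_ivl" "s' \<in> unit_ivl" "t \<in> unit_ivl" "t' \<in> unit_ivl"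
      "\<bar>s - s'\<bar> \<le> \<delta> \<kappa>" "\<bar>t - t'\<bar> \<le> \<delta> \<kappa>"
    show "\<bar>kern s t - kern s' t'\<bar> \<le> \<kappa>"
      using \<delta>[OF *(1)] *(2-7) unfolding P_def by simp
  qed (rule B)
  moreover have "\<forall>\<kappa>>0. \<delta> \<kappa> > 0" using \<delta> by (simp add: P_def)
  ultimately show ?thesis by blast
qed

lemma hs_square_kern:
  "hs_square (\<lambda>s t. c s t - kern s t) = hs_square (\<lambda>s t. c s t - (\<Sum>r<R. lam r * psi r s * psi r t))"
  by (rule hs_square_cong) (simp add: kern_eq)

text \<open>The eigenvalues are kept and each eigenfunction is replaced by a uniformly close spline,
  whose coefficients form a column of \<open>C\<close>; then C diag(lam) C^T is an admissible
  symmetric matrix.\<close>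

lemma spline_approx_error:
  assumes \<epsilon>: "\<epsilon> > 0" and m: "m \<ge> 1"
  shows "\<exists>d>0. \<forall>J \<tau> K b. spline_basis m J \<tau> K b \<longrightarrow> mesh J \<tau> < d \<longrightarrow> (\<exists>W\<in>sym_mats K. cov_approx_error kern K b W \<le> \<epsilon>\<^sup>2)"
proof -
  have "\<exists>B\<ge>0. \<forall>r<R. \<forall>t\<in>unit_ivl. \<bar>psi r t\<bar> \<le> B"
  proof -
    have "\<exists>B. \<forall>t\<in>unit_ivl. r < R \<longrightarrow> \<bar>psi r t\<bar> \<le> B" for r
    proof (cases "r < R")
      case True
      have "bounded (psi r ` unit_ivl)"
        by (intro compact_imp_bounded compact_continuous_image psi_cont True) auto
      then show ?thesis unfolding bounded_iff by auto
    qed simp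
    then have "\<forall>r. \<exists>B. \<forall>t\<in>unit_ivl. r < R \<longrightarrow> \<bar>psi r t\<bar> \<le> B" by blast
    from choice[OF this] obtain B where B: "\<And>r t. t \<in> unit_ivl \<Longrightarrow> r < R \<Longrightarrow> \<bar>psi r t\<bar> \<le> B r" by blast
    have "\<bar>psi r t\<bar> \<le> (\<Sum>r<R. \<bar>B r\<bar>)" if "r < R" "t \<in> unit_ivl" for r t
    proof -
      have "\<bar>B r\<bar> \<le> (\<Sum>r<R. \<bar>B r\<bar>)" by (rule member_le_sum) (use that in auto)
      then show ?thesis using B[OF that(2,1)] by linarith
    qed
    then show ?thesis by (intro exI[of _ "\<Sum>r<R. \<bar>B r\<bar>"]) (auto intro: sum_nonneg)
  qed
  then obtain B where B: "B \<ge> 0" "\<And>r t. r < R \<Longrightarrow> t \<in> unit_ivl \<Longrightarrow> \<bar>psi r t\<bar> \<le> B" by blast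
  define L where "L = (\<Sum>r<R. lam r)"
  have lam0: "0 \<le> lam r" if "r < R" for r using lam_ge[OF that] c0 by simp
  have L: "L \<ge> 0" unfolding L_def by (intro sum_nonneg) (use lam0 in auto)
  \<comment> \<open>With \<kappa> \<le> 1 the approximating splines are bounded by B + 1, so each
    rank-one term changes by at most its eigenvalue times \<kappa> (2 B + 1).\<close>
  define \<kappa> where "\<kappa> = min 1 (\<epsilon> / ((2 * B + 1) * L + 1))"
  have \<kappa>: "\<kappa> > 0" "\<kappa> \<le> 1" using \<epsilon> B L by (auto simp: \<kappa>_def intro!: divide_pos_pos add_nonneg_pos)
  have \<kappa>2: "\<kappa> * (2 * B + 1) * L \<le> \<epsilon>"
  proof -
    have p: "(2 * B + 1) * L + 1 > 0" using B L by (intro add_nonneg_pos) auto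
    have "\<kappa> * ((2 * B + 1) * L) \<le> \<kappa> * ((2 * B + 1) * L + 1)" using \<kappa> by simp
    also have "\<dots> \<le> \<epsilon> / ((2 * B + 1) * L + 1) * ((2 * B + 1) * L + 1)"
      using p by (intro mult_right_mono) (auto simp: \<kappa>_def)
    also have "\<dots> = \<epsilon>" using p by simp
    finally show ?thesis by (simp add: mult.assoc)
  qed
  have "\<exists>d>0. \<forall>J \<tau>. r < R \<longrightarrow> knot_seq J \<tau> \<longrightarrow> mesh J \<tau> < d \<longrightarrow>
      (\<exists>h\<in>spline_space m J \<tau>. \<forall>t\<in>unit_ivl. \<bar>psi r t - h t\<bar> \<le> \<kappa>)" for r
    using continuous_spline_approx[OF \<kappa>(1) m psi_cont, of r] by (cases "r < R") (blast, intro exI[of _ 1], simp)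
  then have "\<forall>r. \<exists>d. d > 0 \<and> (\<forall>J \<tau>. r < R \<longrightarrow> knot_seq J \<tau> \<longrightarrow> mesh J \<tau> < d \<longrightarrow>
      (\<exists>h\<in>spline_space m J \<tau>. \<forall>t\<in>unit_ivl. \<bar>psi r t - h t\<bar> \<le> \<kappa>))" by blast
  from choice[OF this] obtain d where d: "\<And>r. d r > 0" "\<And>r J \<tau>. r < R \<Longrightarrow> knot_seq J \<tau> \<Longrightarrow> mesh J \<tau> < d r \<Longrightarrow>
      \<exists>h\<in>spline_space m J \<tau>. \<forall>t\<in>unit_ivl. \<bar>psi r t - h t\<bar> \<le> \<kappa>"
    by blast
  define d' where "d' = Min (insert 1 (d ` {..<R}))"
  have d': "d' > 0" "\<And>r. r < R \<Longrightarrow> d' \<le> d r" using d(1) by (auto simp: d'_def)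
  show ?thesis
  proof (intro exI[of _ d'] conjI d'(1) allI impI)
    fix J \<tau> K b assume sb: "spline_basis m J \<tau> K b" and mesh: "mesh J \<tau> < d'"
    interpret spline_basis m J \<tau> K b by (rule sb)
    have "\<exists>x. \<forall>t\<in>unit_ivl. \<bar>psi r t - (\<Sum>k<K. x k * b k t)\<bar> \<le> \<kappa>" if r: "r < R" for r
    proof -
      obtain h where h: "h \<in> spline_space m J \<tau>" "\<forall>t\<in>unit_ivl. \<bar>psi r t - h t\<bar> \<le> \<kappa>"
        using d(2)[OF r knots less_le_trans[OF mesh d'(2)[OF r]]] by blast
      obtain x where "\<forall>t\<in>unit_ivl. h t = (\<Sum>k<K. x k * b k t)"
        using basis h(1) unfolding orthonormal_spline_basis_def by blast
      then show ?thesis using h(2) by (intro exI[of _ x]) simp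
    qed
    then have "\<forall>r. \<exists>x. r < R \<longrightarrow> (\<forall>t\<in>unit_ivl. \<bar>psi r t - (\<Sum>k<K. x k * b k t)\<bar> \<le> \<kappa>)" by blast
    from choice[OF this] obtain x where x: "\<And>r t. r < R \<Longrightarrow> t \<in> unit_ivl \<Longrightarrow> \<bar>psi r t - (\<Sum>k<K. x r k * b k t)\<bar> \<le> \<kappa>"
      by blast
    define C where "C = Matrix.mat K R (\<lambda>(k, r). x r k)"
    have C: "C \<in> carrier_mat K R" by (simp add: C_def)
    define h where "h r = psi_est K b C r" for r
    have h_eq: "h r t = (\<Sum>k<K. x r k * b k t)" if "r < R" for r t
      unfolding h_def psi_est_eq[OF C that] using that by (intro sum.cong) (simp_all add: C_def)
    have h_cont: "continuous_on unit_ivl (h r)" if "r < R" for r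
    proof -
      have "continuous_on unit_ivl (\<lambda>t. \<Sum>k<K. x r k * b k t)"
        by (intro continuous_intros continuous_basis) auto
      then show ?thesis by (simp only: h_eq[OF that, abs_def])
    qed
    let ?W = "C * mat_diag R lam * transpose_mat C"
    have Wc: "?W \<in> carrier_mat K K" by (rule conj_diag_carrier[OF C])
    have "?W \<in> sym_mats K"
      unfolding sym_mats_def
    proof (intro CollectI conjI Wc eq_matI)
      fix i j assume "i < dim_row ?W" "j < dim_col ?W"
      then have ij: "i < K" "j < K" using Wc by auto
      then have "transpose_mat ?W $$ (i, j) = ?W $$ (j, i)" using Wc by (intro index_transpose_mat(1)) auto
      also have "\<dots> = ?W $$ (i, j)" using ij by (simp add: conj_diag_entry[OF C] mult_ac del: index_mult_mat(1))
      finally show "transpose_mat ?W $$ (i, j) = ?W $$ (i, j)" .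
    qed (use Wc in auto)
    moreover have "cov_approx_error kern K b ?W \<le> \<epsilon>\<^sup>2"
    proof -
      have "cov_approx_error kern K b ?W = hs_square (\<lambda>s t. kern s t - (\<Sum>r<R. lam r * h r s * h r t))"
        unfolding cov_approx_error_def hs_square_def finite_rank_form[OF C] h_def ..
      also have "\<dots> \<le> \<epsilon>\<^sup>2"
      proof (rule hs_square_le)
        show "continuous_on unit_sq (\<lambda>(s, t). kern s t - (\<Sum>r<R. lam r * h r s * h r t))"
          using continuous_on_diff[OF kern_cont continuous_on_finite_rank[OF h_cont]]
          by (simp add: case_prod_unfold)
        fix s t assume st: "s \<in> unit_ivl" "t \<in> unit_ivl"
        have eq: "kern s t - (\<Sum>r<R. lam r * h r s * h r t) = (\<Sum>r<R. lam r * (psi r s * (psi r t - h r t) + h r t * (psi r s - h r s)))"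
          unfolding kern_eq[OF st] sum_subtractf[symmetric] by (intro sum.cong refl) (simp add: algebra_simps)
        have "\<bar>kern s t - (\<Sum>r<R. lam r * h r s * h r t)\<bar> \<le> (\<Sum>r<R. \<bar>lam r * (psi r s * (psi r t - h r t) + h r t * (psi r s - h r s))\<bar>)"
          unfolding eq by (rule sum_abs)
        also have "\<dots> \<le> (\<Sum>r<R. lam r * (\<kappa> * (2 * B + 1)))"
        proof (rule sum_mono)
          fix r assume "r \<in> {..<R}"
          then have r: "r < R" by simp
          have e: "\<bar>psi r t - h r t\<bar> \<le> \<kappa>" "\<bar>psi r s - h r s\<bar> \<le> \<kappa>" using x[OF r] st h_eq[OF r] by auto
          have hB: "\<bar>h r t\<bar> \<le> B + 1" using e(1) B(2)[OF r st(2)] \<kappa>(2) by linarith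
          have "\<bar>psi r s * (psi r t - h r t)\<bar> \<le> B * \<kappa>"
            unfolding abs_mult using e B r st by (intro mult_mono) auto
          moreover have "\<bar>h r t * (psi r s - h r s)\<bar> \<le> (B + 1) * \<kappa>"
            unfolding abs_mult using e hB B by (intro mult_mono) auto
          ultimately have "\<bar>psi r s * (psi r t - h r t) + h r t * (psi r s - h r s)\<bar> \<le> B * \<kappa> + (B + 1) * \<kappa>"
            by linarith
          also have "\<dots> = \<kappa> * (2 * B + 1)" by (simp add: algebra_simps)
          finally show "\<bar>lam r * (psi r s * (psi r t - h r t) + h r t * (psi r s - h r s))\<bar> \<le> lam r * (\<kappa> * (2 * B + 1))"
            using lam0[OF r] by (simp add: abs_mult mult_left_mono)
        qed
        also have "\<dots> = \<kappa> * (2 * B + 1) * L" by (simp add: L_def sum_distrib_left sum_distrib_right mult_ac)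
        also have "\<dots> \<le> \<epsilon>" by (rule \<kappa>2)
        finally show "\<bar>kern s t - (\<Sum>r<R. lam r * h r s * h r t)\<bar> \<le> \<epsilon>" .
      qed (use \<epsilon> in auto)
      finally show ?thesis .
    qed
    ultimately show "\<exists>W\<in>sym_mats K. cov_approx_error kern K b W \<le> \<epsilon>\<^sup>2" by blast
  qed
qed

text \<open>Each of the R^2 mixed terms and 2 R defect terms is at most L^2 e: the matched terms
  vanish because the eigenvalues coincide, and Bessel leaves weight at most e for everything
  else.\<close>

lemma hs_square_same_values_bound:
  fixes \<chi> :: "nat \<Rightarrow> real \<Rightarrow> real"
  assumes \<chi>: "\<And>i. i < R \<Longrightarrow> continuous_on unit_ivl (\<chi> i)"
    and on: "\<And>i j. i < R \<Longrightarrow> j < R \<Longrightarrow> L2_inner (\<chi> i) (\<chi> j) = (if i = j then 1 else 0)"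
    and e: "\<And>i. i < R \<Longrightarrow> 1 - (L2_inner (\<chi> i) (psi i))\<^sup>2 \<le> e" and L: "\<And>r. r < R \<Longrightarrow> lam r \<le> L"
  shows "hs_square (\<lambda>s t. (\<Sum>r<R. lam r * \<chi> r s * \<chi> r t) - kern s t) \<le> ((real R)\<^sup>2 + 2 * real R) * (L\<^sup>2 * e)"
proof -
  let ?w = "\<lambda>i s. (L2_inner (\<chi> i) (psi s))\<^sup>2"
  have lam0: "0 \<le> lam r" if "r < R" for r using lam_ge[OF that] c0 by simp
  have lam2: "(lam r)\<^sup>2 \<le> L\<^sup>2" if "r < R" for r using lam0[OF that] L[OF that] by (intro power_mono) auto
  have wr: "(\<Sum>s<R. ?w i s) \<le> 1" if "i < R" for i
    using bessel[of R psi "\<chi> i"] psi_cont \<chi>[OF that] psi_orthonormal on[OF that that] by simp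
  have wc: "(\<Sum>i<R. ?w i s) \<le> 1" if "s < R" for s
    using bessel[of R \<chi> "psi s"] psi_cont[OF that] \<chi> on psi_orthonormal[of s s] by (simp add: L2_inner_commute)
  have rowge: "1 - (\<Sum>s<R. ?w i s) \<le> e" if i: "i < R" for i
  proof -
    have "?w i i \<le> (\<Sum>s<R. ?w i s)" by (rule member_le_sum) (use i in auto)
    then show ?thesis using e[OF i] by linarith
  qed
  have colge: "1 - (\<Sum>i<R. ?w i s) \<le> e" if s: "s < R" for s
  proof -
    have "?w s s \<le> (\<Sum>i<R. ?w i s)" by (rule member_le_sum[of s _ "\<lambda>i. ?w i s"]) (use s in auto)
    then show ?thesis using e[OF s] by linarith
  qed
  have off: "?w i s \<le> e" if i: "i < R" "s < R" "i \<noteq> s" for i s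
  proof -
    have "?w i i + ?w i s = (\<Sum>k\<in>{i, s}. ?w i k)" using i by simp
    also have "\<dots> \<le> (\<Sum>k<R. ?w i k)" by (rule sum_mono2) (use i in auto)
    finally show ?thesis using wr[OF i(1)] e[OF i(1)] by linarith
  qed
  have "hs_square (\<lambda>s t. (\<Sum>r<R. lam r * \<chi> r s * \<chi> r t) - kern s t)
    = (\<Sum>i<R. \<Sum>s<R. (lam i - lam s)\<^sup>2 * ?w i s) + (\<Sum>i<R. (lam i)\<^sup>2 * (1 - (\<Sum>s<R. ?w i s)))
      + (\<Sum>s<R. (lam s)\<^sup>2 * (1 - (\<Sum>i<R. ?w i s)))"
    unfolding hs_square_kern by (rule hs_square_two_systems[OF \<chi> psi_cont on psi_orthonormal])
  also have "\<dots> \<le> (\<Sum>i<R. \<Sum>s<R. L\<^sup>2 * e) + (\<Sum>i<R. L\<^sup>2 * e) + (\<Sum>s<R. L\<^sup>2 * e)"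
  proof (intro add_mono sum_mono)
    fix i s assume "i \<in> {..<R}" "s \<in> {..<R}"
    then have ii: "i < R" "s < R" by auto
    have e0: "0 \<le> e" using rowge[OF ii(1)] wr[OF ii(1)] by linarith
    show "(lam i - lam s)\<^sup>2 * ?w i s \<le> L\<^sup>2 * e"
    proof (cases "i = s")
      case False
      have "\<bar>lam i - lam s\<bar> \<le> L" using lam0[OF ii(1)] lam0[OF ii(2)] L[OF ii(1)] L[OF ii(2)] by linarith
      then have "\<bar>lam i - lam s\<bar>\<^sup>2 \<le> L\<^sup>2" by (intro power_mono) auto
      then have "(lam i - lam s)\<^sup>2 \<le> L\<^sup>2" by simp
      then show ?thesis by (rule mult_mono[OF _ off[OF ii False] zero_le_power2 zero_le_power2])
    qed (use e0 in simp)
  next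
    fix i assume "i \<in> {..<R}"
    then have i: "i < R" by simp
    have "0 \<le> 1 - (\<Sum>s<R. ?w i s)" using wr[OF i] by simp
    then show "(lam i)\<^sup>2 * (1 - (\<Sum>s<R. ?w i s)) \<le> L\<^sup>2 * e"
      by (rule mult_mono[OF lam2[OF i] rowge[OF i] zero_le_power2])
  next
    fix s assume "s \<in> {..<R}"
    then have s: "s < R" by simp
    have "0 \<le> 1 - (\<Sum>i<R. ?w i s)" using wc[OF s] by simp
    then show "(lam s)\<^sup>2 * (1 - (\<Sum>i<R. ?w i s)) \<le> L\<^sup>2 * e"
      by (rule mult_mono[OF lam2[OF s] colge[OF s] zero_le_power2])
  qed
  also have "\<dots> = ((real R)\<^sup>2 + 2 * real R) * (L\<^sup>2 * e)" by (simp add: power2_eq_square algebra_simps)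
  finally show ?thesis .
qed

text \<open>The optimal parameters combine eigenvectors of the best spline approximation with the
  true eigenvalues. The minimiser inherits a small error from any good approximation, the gap makes
  its leading eigenvectors close to the true ones, and exchanging the eigenvalues then costs
  little.\<close>

lemma optimal_kernel_close:
  assumes \<epsilon>: "\<epsilon> > 0" and m: "m \<ge> 1"
  shows "\<exists>d>0. \<forall>J \<tau> K b W U. spline_basis m J \<tau> K b \<longrightarrow> mesh J \<tau> < d \<longrightarrow>
    is_arg_min (cov_approx_error kern K b) (\<lambda>W. W \<in> sym_mats K) W \<longrightarrow> leading_eigenvectors K R W U \<longrightarrow>
    hs_square (\<lambda>s t. (\<Sum>r<R. lam r * psi_est K b U r s * psi_est K b U r t) - kern s t) < \<epsilon>"
proof -
  define L where "L = (\<Sum>r<R. lam r)"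
  have lam0: "0 \<le> lam r" if "r < R" for r using lam_ge[OF that] c0 by simp
  have L: "lam r \<le> L" if "r < R" for r unfolding L_def by (rule member_le_sum) (use lam0 that in auto)
  define H where "H = ((real R)\<^sup>2 + 2 * real R) * (L\<^sup>2 * (2 / c0)\<^sup>2) + 1"
  have H: "H > 0" unfolding H_def by (intro add_nonneg_pos mult_nonneg_nonneg) auto
  \<comment> \<open>The first cap gives the 6 \<epsilon>' < c0 demanded by the perturbation bound,
    the second makes \<epsilon>'^2 H smaller than \<epsilon>.\<close>
  define \<epsilon>' where "\<epsilon>' = min (c0 / 7) (sqrt (\<epsilon> / (2 * H)))"
  have \<epsilon>': "\<epsilon>' > 0" "6 * \<epsilon>' < c0" using c0 \<epsilon> H by (auto simp: \<epsilon>'_def min_def)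
  have "\<epsilon>'\<^sup>2 \<le> (sqrt (\<epsilon> / (2 * H)))\<^sup>2" using \<epsilon>'(1) by (intro power_mono) (auto simp: \<epsilon>'_def)
  then have e2: "\<epsilon>'\<^sup>2 * H < \<epsilon>" using \<epsilon> H by (simp add: field_simps)
  obtain d where d: "d > 0" "\<And>J \<tau> K b. spline_basis m J \<tau> K b \<Longrightarrow> mesh J \<tau> < d \<Longrightarrow> \<exists>W\<in>sym_mats K. cov_approx_error kern K b W \<le> \<epsilon>'\<^sup>2"
    using spline_approx_error[OF \<epsilon>'(1) m] by blast
  show ?thesis
  proof (intro exI[of _ d] conjI d(1) allI impI)
    fix J \<tau> K b W U
    assume sb: "spline_basis m J \<tau> K b" and mesh: "mesh J \<tau> < d"
      and W: "is_arg_min (cov_approx_error kern K b) (\<lambda>W. W \<in> sym_mats K) W" and U: "leading_eigenvectors K R W U"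
    interpret spline_basis m J \<tau> K b by (rule sb)
    obtain W0 where "W0 \<in> sym_mats K" "cov_approx_error kern K b W0 \<le> \<epsilon>'\<^sup>2" using d(2)[OF sb mesh] by blast
    then have err: "cov_approx_error kern K b W \<le> \<epsilon>'\<^sup>2" using W unfolding is_arg_min_def by force
    obtain Q dd where RK: "R \<le> K" and Q: "Q \<in> stiefel K K" and WQ: "W = Q * mat_diag K dd * transpose_mat Q"
      and dec: "\<And>i j. i \<le> j \<Longrightarrow> j < K \<Longrightarrow> dd j \<le> dd i" and UQ: "U = Matrix.mat K R (\<lambda>(i, r). Q $$ (i, r))"
      using U unfolding leading_eigenvectors_def by blast
    have Qc: "Q \<in> carrier_mat K K" by (rule stiefelD[OF Q])
    have Uc: "U \<in> carrier_mat K R" by (simp add: UQ)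
    have UQ': "psi_est K b U r = psi_est K b Q r" if "r < R" for r
    proof
      fix t
      have "r < K" using that RK by simp
      then show "psi_est K b U r t = psi_est K b Q r t"
        unfolding psi_est_eq[OF Uc that] psi_est_eq[OF Qc \<open>r < K\<close>]
        using that by (intro sum.cong) (simp_all add: UQ)
    qed
    have "hs_square (\<lambda>s t. (\<Sum>i<K. dd i * psi_est K b Q i s * psi_est K b Q i t) - (\<Sum>r<R. lam r * psi r s * psi r t))
      = cov_approx_error kern K b W"
      unfolding hs_square_kern[symmetric] cov_approx_error_def hs_square_def WQ finite_rank_form[OF Qc]
      by (simp add: power2_commute)
    then have le: "hs_square (\<lambda>s t. (\<Sum>i<K. dd i * psi_est K b Q i s * psi_est K b Q i t) - (\<Sum>r<R. lam r * psi r s * psi r t)) \<le> \<epsilon>'\<^sup>2"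
      using err by simp
    have w: "1 - (L2_inner (psi_est K b U r) (psi r))\<^sup>2 \<le> (2 * \<epsilon>' / c0)\<^sup>2" if r: "r < R" for r
      unfolding UQ'[OF r]
      by (rule eigen_perturbation(2)[OF RK continuous_psi_est[OF Q] psi_cont psi_est_orthonormal[OF Q]
            psi_orthonormal dec _ lam_ge c0 less_imp_le[OF \<epsilon>'(1)] \<epsilon>'(2) le r])
        (use gap in auto)
    have "hs_square (\<lambda>s t. (\<Sum>r<R. lam r * psi_est K b U r s * psi_est K b U r t) - kern s t)
      \<le> ((real R)\<^sup>2 + 2 * real R) * (L\<^sup>2 * (2 * \<epsilon>' / c0)\<^sup>2)"
      by (rule hs_square_same_values_bound[OF _ _ w L])
        (use RK UQ' continuous_psi_est[OF Q] psi_est_orthonormal[OF Q] in auto)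
    also have "\<dots> = \<epsilon>'\<^sup>2 * (H - 1)" by (simp add: H_def power_mult_distrib power_divide algebra_simps)
    also have "\<dots> \<le> \<epsilon>'\<^sup>2 * H" by (simp add: algebra_simps)
    finally show "hs_square (\<lambda>s t. (\<Sum>r<R. lam r * psi_est K b U r s * psi_est K b U r t) - kern s t) < \<epsilon>"
      using e2 by linarith
  qed
qed

text \<open>The perturbation bound controls only the square of the inner product x. The sign
  condition and x \<le> 1 give 1 - x \<le> 1 - x^2, which turns it into a bound on the squared
  distance 2 - 2 x.\<close>

lemma estimator_close:
  fixes \<chi> :: "nat \<Rightarrow> real \<Rightarrow> real" and d :: "nat \<Rightarrow> real"
  assumes \<chi>: "\<And>i. i < R \<Longrightarrow> continuous_on unit_ivl (\<chi> i)"
    and on: "\<And>i j. i < R \<Longrightarrow> j < R \<Longrightarrow> L2_inner (\<chi> i) (\<chi> j) = (if i = j then 1 else 0)"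
    and dec: "\<And>i j. i \<le> j \<Longrightarrow> j < R \<Longrightarrow> d j \<le> d i"
    and sgn: "\<And>i. i < R \<Longrightarrow> L2_inner (\<chi> i) (psi i) \<ge> 0"
    and \<epsilon>: "\<epsilon> \<ge> 0" "6 * \<epsilon> < c0"
    and hs: "hs_square (\<lambda>s t. (\<Sum>r<R. d r * \<chi> r s * \<chi> r t) - kern s t) \<le> \<epsilon>\<^sup>2" and r: "r < R"
  shows "\<bar>d r - lam r\<bar> \<le> \<epsilon>" and "(L2_norm (\<lambda>t. \<chi> r t - psi r t))\<^sup>2 \<le> 2 * (2 * \<epsilon> / c0)\<^sup>2"
proof -
  note P = eigen_perturbation[OF order_refl \<chi> psi_cont on psi_orthonormal dec _ lam_ge c0 \<epsilon> hs[unfolded hs_square_kern] r]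
  show "\<bar>d r - lam r\<bar> \<le> \<epsilon>" by (rule P(1)) (use gap in auto)
  have w: "1 - (L2_inner (\<chi> r) (psi r))\<^sup>2 \<le> (2 * \<epsilon> / c0)\<^sup>2" by (rule P(2)) (use gap in auto)
  define x where "x = L2_inner (\<chi> r) (psi r)"
  have "(\<Sum>i<Suc 0. (L2_inner (\<chi> r) (psi r))\<^sup>2) \<le> L2_inner (\<chi> r) (\<chi> r)"
    by (rule bessel[where f = "\<lambda>_. psi r"]) (use psi_cont[OF r] \<chi>[OF r] psi_orthonormal[of r r] in auto)
  then have "x\<^sup>2 \<le> 1" using on[OF r r] by (simp add: x_def)
  then have "x \<le> 1" by (simp add: abs_square_le_1)
  then have "x * x \<le> x * 1" using sgn[OF r] by (intro mult_left_mono) (auto simp: x_def)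
  then have "2 - 2 * x \<le> 2 * (1 - x\<^sup>2)" by (simp add: power2_eq_square)
  moreover have "(L2_norm (\<lambda>t. \<chi> r t - psi r t))\<^sup>2 = 2 - 2 * x"
    unfolding L2_norm_diff_square[OF \<chi>[OF r] psi_cont[OF r]] using on[OF r r] psi_orthonormal[of r r] by (simp add: x_def)
  ultimately show "(L2_norm (\<lambda>t. \<chi> r t - psi r t))\<^sup>2 \<le> 2 * (2 * \<epsilon> / c0)\<^sup>2"
    using w by (simp add: x_def)
qed

end

section \<open>Independence and the weak law of large numbers\<close>

text \<open>The information carried by the sources in \<open>A\<close>. Statistics of different
  subjects are independent because they are measurable with respect to disjoint sets of
  sources.\<close>

definition sub_sigma :: "'w measure \<Rightarrow> ('i \<Rightarrow> 'w set set) \<Rightarrow> 'i set \<Rightarrow> 'w measure" where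
  "sub_sigma M E A = sigma (space M) (\<Union>i\<in>A. E i)"

context prob_space
begin

lemma sub_sigma_basics:
  assumes "indep_sets E I" "A \<subseteq> I"
  shows "space (sub_sigma M E A) = space M" "sets (sub_sigma M E A) = sigma_sets (space M) (\<Union>i\<in>A. E i)"
    and "sets (sub_sigma M E A) \<subseteq> sets M"
proof -
  have ev: "(\<Union>i\<in>A. E i) \<subseteq> events" using assms unfolding indep_sets_def by auto
  then have sub: "(\<Union>i\<in>A. E i) \<subseteq> Pow (space M)" using sets.sets_into_space by blast
  show "space (sub_sigma M E A) = space M" using sub by (simp add: sub_sigma_def space_measure_of)
  show s: "sets (sub_sigma M E A) = sigma_sets (space M) (\<Union>i\<in>A. E i)"
    using sub by (simp add: sub_sigma_def)
  show "sets (sub_sigma M E A) \<subseteq> sets M"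
    unfolding s by (rule sets.sigma_sets_subset[OF ev])
qed

lemma sub_sigma_measurable:
  assumes "indep_sets E I" "A \<subseteq> I" "f \<in> sub_sigma M E A \<rightarrow>\<^sub>M N"
  shows "f \<in> M \<rightarrow>\<^sub>M N"
proof (rule measurableI)
  note b = sub_sigma_basics[OF assms(1,2)]
  show "f w \<in> space N" if "w \<in> space M" for w using measurable_space[OF assms(3)] that b(1) by simp
  show "f -` C \<inter> space M \<in> events" if "C \<in> sets N" for C
    using measurable_sets[OF assms(3) that] b(3) unfolding b(1) by blast
qed

lemma indep_set_sub_sigma:
  assumes E: "indep_sets E I" and stable: "\<And>i. i \<in> I \<Longrightarrow> Int_stable (E i)"
    and AB: "A \<subseteq> I" "B \<subseteq> I" "A \<inter> B = {}"
  shows "indep_set (sigma_sets (space M) (\<Union>i\<in>A. E i)) (sigma_sets (space M) (\<Union>i\<in>B. E i))"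
proof -
  have "indep_sets E (\<Union>j\<in>UNIV. case_bool A B j)"
    by (rule indep_sets_mono_index[OF _ E]) (use AB in \<open>auto split: bool.splits\<close>)
  then have "indep_sets (\<lambda>j. sigma_sets (space M) (\<Union>i\<in>case_bool A B j. E i)) UNIV"
    by (rule indep_sets_collect_sigma)
      (use AB stable in \<open>auto simp: disjoint_family_on_def split: bool.splits\<close>)
  then show ?thesis
    unfolding indep_set_def
    by (rule back_subst[where P = "\<lambda>f. indep_sets f UNIV"]) (auto split: bool.splits)
qed

text \<open>The product law holds for values in arbitrary measurable spaces, so it applies to a
  whole curve against a whole design; Fubini for the two rests on this.\<close>

lemma distr_pair_sub_sigma:
  assumes E: "indep_sets E I" and stable: "\<And>i. i \<in> I \<Longrightarrow> Int_stable (E i)"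
    and AB: "A \<subseteq> I" "B \<subseteq> I" "A \<inter> B = {}"
    and X: "X \<in> sub_sigma M E A \<rightarrow>\<^sub>M S" and Y: "Y \<in> sub_sigma M E B \<rightarrow>\<^sub>M T"
  shows "distr M S X \<Otimes>\<^sub>M distr M T Y = distr M (S \<Otimes>\<^sub>M T) (\<lambda>w. (X w, Y w))"
proof -
  have XM [measurable]: "X \<in> M \<rightarrow>\<^sub>M S" and YM [measurable]: "Y \<in> M \<rightarrow>\<^sub>M T"
    by (rule sub_sigma_measurable[OF E AB(1) X], rule sub_sigma_measurable[OF E AB(2) Y])
  interpret DX: prob_space "distr M S X" by (rule prob_space_distr) measurable
  interpret DY: prob_space "distr M T Y" by (rule prob_space_distr) measurable
  show ?thesis
  proof (rule pair_measure_eqI)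
    fix C D assume "C \<in> sets (distr M S X)" "D \<in> sets (distr M T Y)"
    then have CD [measurable]: "C \<in> sets S" "D \<in> sets T" by auto
    have "X -` C \<inter> space M \<in> sigma_sets (space M) (\<Union>i\<in>A. E i)" "Y -` D \<inter> space M \<in> sigma_sets (space M) (\<Union>i\<in>B. E i)"
      using measurable_sets[OF X CD(1)] measurable_sets[OF Y CD(2)] sub_sigma_basics[OF E AB(1)] sub_sigma_basics[OF E AB(2)]
      by simp_all
    then have "prob ((X -` C \<inter> space M) \<inter> (Y -` D \<inter> space M)) = prob (X -` C \<inter> space M) * prob (Y -` D \<inter> space M)"
      using indep_set_sub_sigma[OF E stable AB] unfolding indep_sets2_eq by blast
    moreover have "(X -` C \<inter> space M) \<inter> (Y -` D \<inter> space M) = (\<lambda>w. (X w, Y w)) -` (C \<times> D) \<inter> space M" by auto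
    ultimately show "emeasure (distr M S X) C * emeasure (distr M T Y) D = emeasure (distr M (S \<Otimes>\<^sub>M T) (\<lambda>w. (X w, Y w))) (C \<times> D)"
      by (simp add: emeasure_distr emeasure_eq_measure ennreal_mult)
  qed (simp_all add: DX.sigma_finite_measure_axioms DY.sigma_finite_measure_axioms)
qed

lemma indep_var_sub_sigma:
  assumes E: "indep_sets E I" and stable: "\<And>i. i \<in> I \<Longrightarrow> Int_stable (E i)"
    and AB: "A \<subseteq> I" "B \<subseteq> I" "A \<inter> B = {}"
    and X: "X \<in> sub_sigma M E A \<rightarrow>\<^sub>M S" and Y: "Y \<in> sub_sigma M E B \<rightarrow>\<^sub>M T"
  shows "indep_var S X T Y"
  unfolding indep_var_distribution_eq
  using sub_sigma_measurable[OF E AB(1) X] sub_sigma_measurable[OF E AB(2) Y]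
    distr_pair_sub_sigma[OF E stable AB X Y] by blast

lemma square_integrable_mult:
  fixes X Y :: "'a \<Rightarrow> real"
  assumes [measurable]: "X \<in> borel_measurable M" "Y \<in> borel_measurable M"
    and "integrable M (\<lambda>w. (X w)\<^sup>2)" "integrable M (\<lambda>w. (Y w)\<^sup>2)"
  shows "integrable M (\<lambda>w. X w * Y w)"
proof (rule Bochner_Integration.integrable_bound)
  show "integrable M (\<lambda>w. (X w)\<^sup>2 + (Y w)\<^sup>2)" using assms by simp
  have "\<bar>a * b\<bar> \<le> a\<^sup>2 + b\<^sup>2" for a b :: real
  proof -
    have "2 * \<bar>a * b\<bar> \<le> a\<^sup>2 + b\<^sup>2"
      using sum_squares_bound[of "\<bar>a\<bar>" "\<bar>b\<bar>"] by (simp add: abs_mult)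
    then show ?thesis using zero_le_power2[of a] zero_le_power2[of b] by linarith
  qed
  then show "AE w in M. norm (X w * Y w) \<le> norm ((X w)\<^sup>2 + (Y w)\<^sup>2)" by simp
qed measurable

text \<open>Chebyshev's inequality: pairwise independence removes the covariances, and second
  moments bound the variances. The laws of the summands may differ, as M_n does.\<close>

lemma weak_law_of_large_numbers:
  fixes Z :: "nat \<Rightarrow> 'a \<Rightarrow> real"
  assumes meas [measurable]: "\<And>n. Z n \<in> borel_measurable M"
    and sq: "\<And>n. integrable M (\<lambda>w. (Z n w)\<^sup>2)" "\<And>n. expectation (\<lambda>w. (Z n w)\<^sup>2) \<le> C"
    and ind: "\<And>n k. n \<noteq> k \<Longrightarrow> indep_var borel (Z n) borel (Z k)"
    and \<delta>: "\<delta> > 0" and N: "N > 0"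
  shows "prob {w \<in> space M. \<bar>(\<Sum>n<N. Z n w) / real N - (\<Sum>n<N. expectation (Z n)) / real N\<bar> \<ge> \<delta>} \<le> C / (real N * \<delta>\<^sup>2)"
proof -
  have int: "integrable M (Z n)" for n by (rule square_integrable_imp_integrable[OF meas sq(1)])
  have ind': "expectation (\<lambda>w. Z n w * Z k w) = expectation (Z n) * expectation (Z k)" if "n \<noteq> k" for n k
    by (rule indep_var_lebesgue_integral[OF ind[OF that] int int])
  have prod: "integrable M (\<lambda>w. Z n w * Z k w)" for n k
    by (rule square_integrable_mult[OF meas meas sq(1) sq(1)])
  define f where "f w = (\<Sum>n<N. Z n w)" for w
  have f [measurable]: "f \<in> borel_measurable M" unfolding f_def by measurable
  have f2: "(f w)\<^sup>2 = (\<Sum>n<N. \<Sum>k<N. Z n w * Z k w)" for w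
    by (simp add: f_def power2_eq_square sum_product)
  have f2i: "integrable M (\<lambda>w. (f w)\<^sup>2)" unfolding f2 using prod by simp
  have Ef: "expectation f = (\<Sum>n<N. expectation (Z n))" unfolding f_def[abs_def] using int by simp
  have fint: "integrable M f" unfolding f_def[abs_def] using int by simp
  have "variance f = expectation (\<lambda>w. (f w)\<^sup>2) - (expectation f)\<^sup>2" by (rule variance_eq[OF fint f2i])
  also have "expectation (\<lambda>w. (f w)\<^sup>2) = (\<Sum>n<N. \<Sum>k<N. expectation (\<lambda>w. Z n w * Z k w))"
    unfolding f2 using prod by simp
  also have "(expectation f)\<^sup>2 = (\<Sum>n<N. \<Sum>k<N. expectation (Z n) * expectation (Z k))"
    unfolding Ef by (simp add: power2_eq_square sum_product)
  also have "(\<Sum>n<N. \<Sum>k<N. expectation (\<lambda>w. Z n w * Z k w)) - (\<Sum>n<N. \<Sum>k<N. expectation (Z n) * expectation (Z k))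
    = (\<Sum>n<N. \<Sum>k<N. if n = k then expectation (\<lambda>w. (Z n w)\<^sup>2) - (expectation (Z n))\<^sup>2 else 0)"
    unfolding sum_subtractf[symmetric] by (intro sum.cong refl) (simp add: ind' power2_eq_square)
  also have "\<dots> = (\<Sum>n<N. expectation (\<lambda>w. (Z n w)\<^sup>2) - (expectation (Z n))\<^sup>2)" by simp
  also have "\<dots> \<le> (\<Sum>n<N. C)" by (intro sum_mono) (use sq(2) in \<open>simp add: add_increasing2 le_diff_eq diff_le_eq\<close>)
  finally have var: "variance f \<le> real N * C" by simp
  have set_eq: "{w \<in> space M. \<bar>(\<Sum>n<N. Z n w) / real N - (\<Sum>n<N. expectation (Z n)) / real N\<bar> \<ge> \<delta>}
    = {w \<in> space M. \<bar>f w - expectation f\<bar> \<ge> real N * \<delta>}"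
  proof -
    have "\<delta> \<le> \<bar>a / real N - b / real N\<bar> \<longleftrightarrow> real N * \<delta> \<le> \<bar>a - b\<bar>" for a b
      using N by (simp add: field_simps flip: diff_divide_distrib)
    then show ?thesis by (simp add: f_def Ef)
  qed
  have "prob {w \<in> space M. \<bar>f w - expectation f\<bar> \<ge> real N * \<delta>} \<le> variance f / (real N * \<delta>)\<^sup>2"
    by (rule Chebyshev_inequality[OF f f2i]) (use N \<delta> in simp)
  also have "\<dots> \<le> real N * C / (real N * \<delta>)\<^sup>2" using var by (intro divide_right_mono) auto
  also have "\<dots> = C / (real N * \<delta>\<^sup>2)" using N \<delta> by (simp add: power2_eq_square)
  finally show ?thesis unfolding set_eq .
qed

end

section \<open>The sampling model\<close>

text \<open>Extends functions on the unit interval to the whole line, continuously if they were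
  continuous, so that measurability can be stated over all of the Borel space.\<close>

definition clamp_unit :: "real \<Rightarrow> real" where "clamp_unit t = max 0 (min 1 t)"

lemma clamp_unit_in [simp]: "0 \<le> clamp_unit t" "clamp_unit t \<le> 1" by (simp_all add: clamp_unit_def)
lemma clamp_unit_id: "t \<in> unit_ivl \<Longrightarrow> clamp_unit t = t" by (auto simp: clamp_unit_def)
lemma continuous_clamp_unit: "continuous_on A clamp_unit"
  unfolding clamp_unit_def[abs_def] by (intro continuous_intros)
lemma clamp_unit_measurable [measurable]: "clamp_unit \<in> borel_measurable borel"
  by (rule borel_measurable_continuous_onI[OF continuous_clamp_unit])

lemma measurable_coordinate [measurable]: "(\<lambda>t :: nat \<Rightarrow> real. t i) \<in> borel_measurable borel"
  by (intro borel_measurable_continuous_onI continuous_on_product_coordinates)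

locale sampling_model = prob_space \<Omega> for \<Omega> :: "'w measure" +
  fixes P :: "'s measure" and x :: "'s \<Rightarrow> real \<Rightarrow> real" and xi :: "nat \<Rightarrow> 'w \<Rightarrow> 's"
    and u eps :: "nat \<Rightarrow> nat \<Rightarrow> 'w \<Rightarrow> real" and Mn :: "nat \<Rightarrow> nat" and Mx :: nat
    and G :: "real \<Rightarrow> real" and kern :: "real \<Rightarrow> real \<Rightarrow> real" and c_g C_m \<sigma>sq B :: real
  assumes random_fun: "random_function P x"
    and kern_def: "kern = cov_fun P x"
    and kern_cont: "continuous_on unit_sq (\<lambda>(s, t). kern s t)"
    and kern_bound: "\<And>s t. s \<in> unit_ivl \<Longrightarrow> t \<in> unit_ivl \<Longrightarrow> \<bar>kern s t\<bar> \<le> B"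
    and xi_measurable: "\<And>n. xi n \<in> \<Omega> \<rightarrow>\<^sub>M P" and xi_distr: "\<And>n. distr \<Omega> P (xi n) = P"
    and independence: "independent_sources \<Omega> P xi u eps Mn"
    and Mn_ge: "\<And>n. 2 \<le> Mn n" and Mn_le: "\<And>n. Mn n \<le> Mx"
    and u_unit: "\<And>n j w. j < Mn n \<Longrightarrow> w \<in> space \<Omega> \<Longrightarrow> u n j w \<in> unit_ivl"
    and u_distr: "\<And>n j. j < Mn n \<Longrightarrow> distributed \<Omega> lborel (u n j) (\<lambda>t. ennreal (G t))"
    and G_measurable [measurable]: "G \<in> borel_measurable borel"
    and c_g: "0 < c_g" and G_ge: "\<And>t. t \<in> unit_ivl \<Longrightarrow> c_g < G t"
    and eps_measurable: "\<And>n j. j < Mn n \<Longrightarrow> eps n j \<in> borel_measurable \<Omega>"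
    and eps_integrable4: "\<And>n j. j < Mn n \<Longrightarrow> integrable \<Omega> (\<lambda>w. (eps n j w) ^ 4)"
    and eps_mean: "\<And>n j. j < Mn n \<Longrightarrow> (LINT w|\<Omega>. eps n j w) = 0"
    and eps_var: "\<And>n j. j < Mn n \<Longrightarrow> (LINT w|\<Omega>. (eps n j w)\<^sup>2) = \<sigma>sq"
    and eps_moment4: "\<And>n j. j < Mn n \<Longrightarrow> (LINT w|\<Omega>. (eps n j w) ^ 4) \<le> C_m * \<sigma>sq\<^sup>2"
    and C_m: "1 \<le> C_m"
    and kurtosis: "conditional_kurtosis_bound \<Omega> x xi u Mn C_m"
begin

sublocale P: prob_space P using random_fun by (simp add: random_function_def)

definition source_sets :: "source \<Rightarrow> 'w set set" where
  "source_sets i = (case i of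
         Curve n \<Rightarrow> sets (vimage_algebra (space \<Omega>) (xi n) P)
       | Design n j \<Rightarrow> sets (vimage_algebra (space \<Omega>) (u n j) borel)
       | Noise n j \<Rightarrow> sets (vimage_algebra (space \<Omega>) (eps n j) borel))"

lemma indep_source_sets: "indep_sets source_sets (sources Mn)"
  using independence unfolding independent_sources_def source_sets_def[abs_def] .

abbreviation sub :: "source set \<Rightarrow> 'w measure" where "sub \<equiv> sub_sigma \<Omega> source_sets"

lemma source_measurable:
  assumes "A \<subseteq> sources Mn" "i \<in> A" "source_sets i = sets (vimage_algebra (space \<Omega>) f N)"
    and "f \<in> space \<Omega> \<rightarrow> space N"
  shows "f \<in> sub A \<rightarrow>\<^sub>M N"
proof (rule measurableI)
  note b = sub_sigma_basics[OF indep_source_sets assms(1)]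
  show "f w \<in> space N" if "w \<in> space (sub A)" for w using assms(4) that b(1) by auto
  show "f -` C \<inter> space (sub A) \<in> sets (sub A)" if "C \<in> sets N" for C
  proof -
    have "f -` C \<inter> space \<Omega> \<in> source_sets i" unfolding assms(3) by (rule in_vimage_algebra[OF that])
    then show ?thesis unfolding b(1,2) using assms(2) by (intro sigma_sets.Basic) blast
  qed
qed

lemma xi_sub: "A \<subseteq> sources Mn \<Longrightarrow> Curve n \<in> A \<Longrightarrow> xi n \<in> sub A \<rightarrow>\<^sub>M P"
  by (rule source_measurable[of A "Curve n"]) (use measurable_space[OF xi_measurable] in \<open>auto simp: source_sets_def\<close>)

lemma u_sub: "A \<subseteq> sources Mn \<Longrightarrow> Design n j \<in> A \<Longrightarrow> u n j \<in> borel_measurable (sub A)"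
  by (rule source_measurable[of A "Design n j"]) (auto simp: source_sets_def)

lemma eps_sub: "A \<subseteq> sources Mn \<Longrightarrow> Noise n j \<in> A \<Longrightarrow> eps n j \<in> borel_measurable (sub A)"
  by (rule source_measurable[of A "Noise n j"]) (auto simp: source_sets_def)

lemma source_sets_Int_stable: "Int_stable (source_sets i)"
  by (cases i) (simp_all add: source_sets_def sets.Int_stable)

lemma indep_sub:
  assumes "A \<subseteq> sources Mn" "A' \<subseteq> sources Mn" "A \<inter> A' = {}"
    and "X \<in> sub A \<rightarrow>\<^sub>M S" "Y \<in> sub A' \<rightarrow>\<^sub>M T"
  shows "indep_var S X T Y"
  by (rule indep_var_sub_sigma[OF indep_source_sets source_sets_Int_stable assms])

definition curve_design :: "nat \<Rightarrow> source set" where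
  "curve_design n = insert (Curve n) (Design n ` {..<Mn n})"

text \<open>Everything that the data of one subject are made of; different subjects have disjoint
  groups.\<close>

definition group :: "nat \<Rightarrow> source set" where
  "group n = curve_design n \<union> Noise n ` {..<Mn n}"

lemma sources_subset: "Curve n \<in> sources Mn" "j < Mn n \<Longrightarrow> Design n j \<in> sources Mn"
  "j < Mn n \<Longrightarrow> Noise n j \<in> sources Mn"
  by (auto simp: sources_def)

lemma curve_design_sources: "curve_design n \<subseteq> sources Mn" "group n \<subseteq> sources Mn"
  "Design n ` {..<Mn n} \<subseteq> sources Mn"
  by (auto simp: curve_design_def group_def sources_subset)

text \<open>The design of a subject as a point of one space for all n. The default 0 beyond M_n lies
  in the unit interval, so every coordinate does.\<close>

definition V :: "nat \<Rightarrow> 'w \<Rightarrow> nat \<Rightarrow> real" where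
  "V n w = (\<lambda>i. if i < Mn n then u n i w else 0)"

lemma V_unit: "w \<in> space \<Omega> \<Longrightarrow> V n w i \<in> unit_ivl"
  using u_unit by (simp add: V_def)

lemma V_sub:
  assumes "A \<subseteq> sources Mn" "Design n ` {..<Mn n} \<subseteq> A"
  shows "V n \<in> borel_measurable (sub A)"
proof (rule measurable_coordinatewise_then_product)
  fix i
  show "(\<lambda>w. V n w i) \<in> borel_measurable (sub A)"
    unfolding V_def using u_sub[OF assms(1), of n i] assms(2) by (cases "i < Mn n") auto
qed

lemma sub_measurable: "A \<subseteq> sources Mn \<Longrightarrow> f \<in> sub A \<rightarrow>\<^sub>M N \<Longrightarrow> f \<in> \<Omega> \<rightarrow>\<^sub>M N"
  by (rule sub_sigma_measurable[OF indep_source_sets])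

lemma V_measurable [measurable]: "V n \<in> borel_measurable \<Omega>"
  by (rule sub_measurable[OF curve_design_sources(3) V_sub[OF curve_design_sources(3) order_refl]])

lemma u_measurable: "j < Mn n \<Longrightarrow> u n j \<in> borel_measurable \<Omega>"
  by (rule sub_measurable[OF curve_design_sources(3)[of n] u_sub[OF curve_design_sources(3)[of n]]]) simp

definition xc :: "'s \<Rightarrow> real \<Rightarrow> real" where "xc \<zeta> t = x \<zeta> (clamp_unit t)"

lemma xc_measurable [measurable]: "(\<lambda>(\<zeta>, t). xc \<zeta> t) \<in> borel_measurable (P \<Otimes>\<^sub>M borel)"
proof -
  have x: "(\<lambda>(\<zeta>, t). x \<zeta> t) \<in> borel_measurable (P \<Otimes>\<^sub>M restrict_space borel unit_ivl)"
    using random_fun by (simp add: random_function_def)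
  have c: "clamp_unit \<in> borel \<rightarrow>\<^sub>M restrict_space borel unit_ivl"
    by (rule measurable_restrict_space2) auto
  have "(\<lambda>z. (fst z, clamp_unit (snd z))) \<in> P \<Otimes>\<^sub>M borel \<rightarrow>\<^sub>M P \<Otimes>\<^sub>M restrict_space borel unit_ivl"
    by (intro measurable_Pair measurable_fst measurable_compose[OF measurable_snd c])
  from measurable_compose[OF this x] show ?thesis by (simp add: case_prod_unfold xc_def)
qed

lemma xc_coordinate [measurable]: "(\<lambda>z. xc (fst z) (snd z i)) \<in> borel_measurable (P \<Otimes>\<^sub>M (borel :: (nat \<Rightarrow> real) measure))"
proof -
  have "(\<lambda>z. (fst z, snd z i)) \<in> P \<Otimes>\<^sub>M (borel :: (nat \<Rightarrow> real) measure) \<rightarrow>\<^sub>M P \<Otimes>\<^sub>M borel"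
    by measurable
  from measurable_compose[OF this xc_measurable] show ?thesis by simp
qed

lemma xc_section [measurable]: "(\<lambda>\<zeta>. xc \<zeta> t) \<in> borel_measurable P"
proof -
  have "(\<lambda>\<zeta>. (\<zeta>, t)) \<in> P \<rightarrow>\<^sub>M P \<Otimes>\<^sub>M borel" by measurable
  from measurable_compose[OF this xc_measurable] show ?thesis by simp
qed

definition X :: "nat \<Rightarrow> nat \<Rightarrow> 'w \<Rightarrow> real" where "X n j w = xc (xi n w) (V n w j)"

lemma observation_eq:
  assumes "w \<in> space \<Omega>" "j < Mn n"
  shows "observation x xi u eps w n j = X n j w + eps n j w"
  using u_unit[OF assms(2,1)] assms(2)
  by (simp add: observation_def X_def xc_def V_def clamp_unit_id)

lemma X_sub:
  assumes "A \<subseteq> sources Mn" "curve_design n \<subseteq> A"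
  shows "X n j \<in> borel_measurable (sub A)"
proof -
  have "V n \<in> borel_measurable (sub A)" "xi n \<in> sub A \<rightarrow>\<^sub>M P"
    using V_sub[OF assms(1)] xi_sub[OF assms(1)] assms(2) by (auto simp: curve_design_def)
  then have "(\<lambda>w. (xi n w, V n w)) \<in> sub A \<rightarrow>\<^sub>M P \<Otimes>\<^sub>M borel" by measurable
  from measurable_compose[OF this xc_coordinate[of j]] show ?thesis by (simp add: X_def[abs_def])
qed

lemma X_measurable [measurable]: "X n j \<in> borel_measurable \<Omega>"
  by (rule sub_measurable[OF curve_design_sources(1) X_sub[OF curve_design_sources(1) order_refl]])

lemma xi_V_distr: "distr \<Omega> (P \<Otimes>\<^sub>M borel) (\<lambda>w. (xi n w, V n w)) = P \<Otimes>\<^sub>M distr \<Omega> borel (V n)"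
proof -
  have "distr \<Omega> P (xi n) \<Otimes>\<^sub>M distr \<Omega> borel (V n) = distr \<Omega> (P \<Otimes>\<^sub>M borel) (\<lambda>w. (xi n w, V n w))"
    by (rule distr_pair_sub_sigma[OF indep_source_sets source_sets_Int_stable,
          of "{Curve n}" "Design n ` {..<Mn n}"])
      (auto intro!: xi_sub V_sub simp: sources_subset)
  then show ?thesis unfolding xi_distr by simp
qed

lemma xi_V_measurable: "(\<lambda>w. (xi n w, V n w)) \<in> \<Omega> \<rightarrow>\<^sub>M P \<Otimes>\<^sub>M borel"
  by (intro measurable_Pair xi_measurable V_measurable)

text \<open>The curve is integrated out with the design held fixed, by independence of the two.
  Conditional moments given the design are computed this way.\<close>

lemma nn_fubini:
  assumes F: "F \<in> borel_measurable (P \<Otimes>\<^sub>M borel)"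
  shows "(\<integral>\<^sup>+ w. F (xi n w, V n w) \<partial>\<Omega>) = (\<integral>\<^sup>+ w. (\<integral>\<^sup>+ \<zeta>. F (\<zeta>, V n w) \<partial>P) \<partial>\<Omega>)"
proof -
  interpret D: prob_space "distr \<Omega> borel (V n)" by (rule prob_space_distr) measurable
  interpret PD: pair_sigma_finite P "distr \<Omega> borel (V n)" ..
  have F': "F \<in> borel_measurable (P \<Otimes>\<^sub>M distr \<Omega> borel (V n))" using F by simp
  have "(\<integral>\<^sup>+ w. F (xi n w, V n w) \<partial>\<Omega>) = (\<integral>\<^sup>+ z. F z \<partial>distr \<Omega> (P \<Otimes>\<^sub>M borel) (\<lambda>w. (xi n w, V n w)))"
    by (rule nn_integral_distr[OF xi_V_measurable, symmetric]) (use F in simp)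
  also have "\<dots> = (\<integral>\<^sup>+ t. (\<integral>\<^sup>+ \<zeta>. F (\<zeta>, t) \<partial>P) \<partial>distr \<Omega> borel (V n))"
    unfolding xi_V_distr by (rule PD.nn_integral_snd[OF F', symmetric])
  also have "\<dots> = (\<integral>\<^sup>+ w. (\<integral>\<^sup>+ \<zeta>. F (\<zeta>, V n w) \<partial>P) \<partial>\<Omega>)"
  proof (rule nn_integral_distr)
    have "(\<lambda>t. \<integral>\<^sup>+ \<zeta>. F (\<zeta>, t) \<partial>P) \<in> borel_measurable borel"
      using F by measurable
    then show "(\<lambda>t. \<integral>\<^sup>+ \<zeta>. F (\<zeta>, t) \<partial>P) \<in> borel_measurable (distr \<Omega> borel (V n))"
      by simp
  qed measurable
  finally show ?thesis .
qed

lemma x_square_integrable: "t \<in> unit_ivl \<Longrightarrow> integrable P (\<lambda>\<zeta>. (x \<zeta> t)\<^sup>2)"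
  using random_fun by (simp add: random_function_def)

lemma xc_square_integrable: "integrable P (\<lambda>\<zeta>. (xc \<zeta> t)\<^sup>2)"
  unfolding xc_def by (rule x_square_integrable) simp

lemma xc_mult_integral: "(LINT \<zeta>|P. xc \<zeta> s * xc \<zeta> t) = kern (clamp_unit s) (clamp_unit t)"
  by (simp add: kern_def cov_fun_def xc_def)

lemma xc_square_nn_integral: "(\<integral>\<^sup>+ \<zeta>. ennreal ((xc \<zeta> t)\<^sup>2) \<partial>P) = ennreal (kern (clamp_unit t) (clamp_unit t))"
  using xc_mult_integral[of t t] nn_integral_eq_integral[OF xc_square_integrable[of t]]
  by (simp add: power2_eq_square)

lemma B_nonneg: "0 \<le> B"
  using order_trans[OF abs_ge_zero kern_bound[of 0 0]] by simp

lemma kern_clamp_continuous: "continuous_on UNIV (\<lambda>z. kern (clamp_unit (fst z)) (clamp_unit (snd z)))"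
proof -
  have "continuous_on UNIV (\<lambda>z. (clamp_unit (fst z), clamp_unit (snd z)))"
    by (intro continuous_on_Pair continuous_on_compose2[OF continuous_clamp_unit[of UNIV]] continuous_intros) auto
  from continuous_on_compose2[OF kern_cont this] show ?thesis by (simp add: image_subset_iff)
qed

lemma kern_clamp_measurable [measurable]:
  "(\<lambda>t :: nat \<Rightarrow> real. kern (clamp_unit (t i)) (clamp_unit (t j))) \<in> borel_measurable borel"
proof -
  have "continuous_on UNIV (\<lambda>t :: nat \<Rightarrow> real. (t i, t j))"
    by (intro continuous_on_Pair continuous_on_product_coordinates)
  from continuous_on_compose2[OF kern_clamp_continuous this]
  show ?thesis by (intro borel_measurable_continuous_onI) auto
qed

lemma X_square_nn_integral: "(\<integral>\<^sup>+ w. ennreal ((X n j w)\<^sup>2) \<partial>\<Omega>) \<le> ennreal B"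
proof -
  have "(\<integral>\<^sup>+ w. ennreal ((X n j w)\<^sup>2) \<partial>\<Omega>) = (\<integral>\<^sup>+ w. (\<integral>\<^sup>+ \<zeta>. ennreal ((xc \<zeta> (V n w j))\<^sup>2) \<partial>P) \<partial>\<Omega>)"
    using nn_fubini[of "\<lambda>z. ennreal ((xc (fst z) (snd z j))\<^sup>2)" n] by (simp add: X_def)
  also have "\<dots> \<le> (\<integral>\<^sup>+ w. ennreal B \<partial>\<Omega>)"
  proof (rule nn_integral_mono)
    fix w
    show "(\<integral>\<^sup>+ \<zeta>. ennreal ((xc \<zeta> (V n w j))\<^sup>2) \<partial>P) \<le> ennreal B"
      unfolding xc_square_nn_integral
      using kern_bound[of "clamp_unit (V n w j)" "clamp_unit (V n w j)"] by (intro ennreal_leI) auto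
  qed
  also have "\<dots> = ennreal B" by (simp add: emeasure_space_1)
  finally show ?thesis .
qed

lemma X_square_integrable: "integrable \<Omega> (\<lambda>w. (X n j w)\<^sup>2)"
  using X_square_nn_integral[of n j] by (intro integrableI_nonneg) (auto intro: le_less_trans)

lemma design_subalgebra: "subalgebra \<Omega> (design_algebra \<Omega> u Mn n)"
proof -
  have m: "(\<lambda>w. \<lambda>j\<in>{..<Mn n}. u n j w) \<in> \<Omega> \<rightarrow>\<^sub>M (\<Pi>\<^sub>M j\<in>{..<Mn n}. borel)"
    by (rule measurable_restrict) (auto intro: u_measurable)
  show ?thesis unfolding subalgebra_def design_algebra_def
    by (auto intro: sets_image_in_sets[OF refl m, THEN subsetD])
qed

text \<open>The conditional second moment is the kernel on the diagonal at the design point. This is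
  verified on the events of the design algebra by integrating out the curve.\<close>

lemma nn_cond_exp_X_square:
  assumes j: "j < Mn n"
  shows "AE w in \<Omega>. nn_cond_exp \<Omega> (design_algebra \<Omega> u Mn n) (\<lambda>w. ennreal ((X n j w)\<^sup>2)) w \<le> ennreal B"
proof -
  let ?F = "design_algebra \<Omega> u Mn n"
  let ?f = "\<lambda>w. \<lambda>j\<in>{..<Mn n}. u n j w"
  interpret F: finite_measure_subalgebra \<Omega> ?F
    by standard (rule design_subalgebra)
  define g where "g w = ennreal (kern (clamp_unit (u n j w)) (clamp_unit (u n j w)))" for w
  have fF: "?f \<in> ?F \<rightarrow>\<^sub>M (\<Pi>\<^sub>M j\<in>{..<Mn n}. borel)"
    unfolding design_algebra_def by (rule measurable_vimage_algebra1) (auto simp: space_PiM)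
  have "(\<lambda>w. ?f w j) \<in> borel_measurable ?F"
    by (rule measurable_compose[OF fF]) (rule measurable_component_singleton, use j in simp)
  then have uF: "u n j \<in> borel_measurable ?F" using j by simp
  have "(\<lambda>t. kern (clamp_unit t) (clamp_unit t)) \<in> borel_measurable borel"
  proof (rule borel_measurable_continuous_onI)
    have "continuous_on UNIV (\<lambda>t :: real. (t, t))" by (intro continuous_intros)
    from continuous_on_compose2[OF kern_clamp_continuous this]
    show "continuous_on UNIV (\<lambda>t. kern (clamp_unit t) (clamp_unit t))" by auto
  qed
  then have "(\<lambda>t. ennreal (kern (clamp_unit t) (clamp_unit t))) \<in> borel_measurable borel"
    by (rule measurable_compose[OF _ measurable_ennreal])
  from measurable_compose[OF uF this] have gF: "g \<in> borel_measurable ?F" by (simp only: g_def[abs_def])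
  have "AE w in \<Omega>. g w = nn_cond_exp \<Omega> ?F (\<lambda>w. ennreal ((X n j w)\<^sup>2)) w"
  proof (rule F.nn_cond_exp_charact[OF _ _ gF])
    fix A assume "A \<in> sets ?F"
    then obtain A' where A': "A' \<in> sets (\<Pi>\<^sub>M j\<in>{..<Mn n}. (borel :: real measure))" "A = ?f -` A' \<inter> space \<Omega>"
      unfolding design_algebra_def by (subst (asm) sets_vimage_algebra2) (auto simp: space_PiM)
    define r :: "(nat \<Rightarrow> real) \<Rightarrow> nat \<Rightarrow> real" where "r t = restrict t {..<Mn n}" for t
    have r: "r \<in> borel \<rightarrow>\<^sub>M (\<Pi>\<^sub>M j\<in>{..<Mn n}. borel)"
      unfolding r_def[abs_def] by (rule measurable_restrict) measurable
    have ind: "indicator A w = (indicator A' (r (V n w)) :: ennreal)" if "w \<in> space \<Omega>" for w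
    proof -
      have "r (V n w) = ?f w" by (auto simp: r_def V_def restrict_def)
      then show ?thesis using that A'(2) by (auto simp: indicator_def)
    qed
    have r': "(\<lambda>t. indicator A' (r t) :: ennreal) \<in> borel_measurable borel"
      by (rule measurable_compose[OF r]) (use A'(1) in measurable)
    have "(\<integral>\<^sup>+ w\<in>A. ennreal ((X n j w)\<^sup>2) \<partial>\<Omega>)
      = (\<integral>\<^sup>+ w. ennreal ((xc (xi n w) (V n w j))\<^sup>2) * indicator A' (r (V n w)) \<partial>\<Omega>)"
      by (intro nn_integral_cong) (simp add: ind X_def)
    also have "\<dots> = (\<integral>\<^sup>+ w. (\<integral>\<^sup>+ \<zeta>. ennreal ((xc \<zeta> (V n w j))\<^sup>2) * indicator A' (r (V n w)) \<partial>P) \<partial>\<Omega>)"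
    proof -
      have "(\<lambda>z. ennreal ((xc (fst z) (snd z j))\<^sup>2) * indicator A' (r (snd z))) \<in> borel_measurable (P \<Otimes>\<^sub>M borel)"
        by (rule borel_measurable_times_ennreal[OF _ measurable_compose[OF measurable_snd r']]) measurable
      from nn_fubini[OF this, of n] show ?thesis by simp
    qed
    also have "\<dots> = (\<integral>\<^sup>+ w. ennreal (kern (clamp_unit (V n w j)) (clamp_unit (V n w j))) * indicator A' (r (V n w)) \<partial>\<Omega>)"
      by (intro nn_integral_cong) (simp add: nn_integral_multc xc_square_nn_integral)
    also have "\<dots> = (\<integral>\<^sup>+ w\<in>A. g w \<partial>\<Omega>)"
      by (intro nn_integral_cong) (simp add: ind g_def V_def j)
    finally show "(\<integral>\<^sup>+ w\<in>A. ennreal ((X n j w)\<^sup>2) \<partial>\<Omega>) = (\<integral>\<^sup>+ w\<in>A. g w \<partial>\<Omega>)" .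
  qed measurable
  moreover have "g w \<le> ennreal B" for w
    unfolding g_def using kern_bound[of "clamp_unit (u n j w)" "clamp_unit (u n j w)"] by (intro ennreal_leI) auto
  ultimately show ?thesis by (auto elim!: eventually_mono) (metis)
qed

text \<open>The kurtosis condition for a unit vector isolates one coordinate; the conditional second
  moment is at most B, and integrating the conditional bound gives the moment.\<close>

lemma X_moment4: 
  assumes j: "j < Mn n"
  shows "integrable \<Omega> (\<lambda>w. (X n j w) ^ 4)" "(LINT w|\<Omega>. (X n j w) ^ 4) \<le> C_m * B\<^sup>2"
proof -
  let ?F = "design_algebra \<Omega> u Mn n"
  interpret F: finite_measure_subalgebra \<Omega> ?F
    by standard (rule design_subalgebra)
  have cv: "curve_vec x xi u Mn n w \<bullet> unit_vec (Mn n) j = x (xi n w) (u n j w)" for w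
    using j by (subst scalar_prod_right_unit[OF j]) (simp add: curve_vec_def)
  have Xw: "x (xi n w) (u n j w) = X n j w" if "w \<in> space \<Omega>" for w
    using u_unit[OF j that] j by (simp add: X_def xc_def V_def clamp_unit_id)
  have kurt: "AE w in \<Omega>. nn_cond_exp \<Omega> ?F (\<lambda>w. ennreal ((x (xi n w) (u n j w)) ^ 4)) w
      \<le> ennreal C_m * (nn_cond_exp \<Omega> ?F (\<lambda>w. ennreal ((x (xi n w) (u n j w))\<^sup>2)) w)\<^sup>2"
    using kurtosis unfolding conditional_kurtosis_bound_def
    by (auto dest!: spec[of _ n] bspec[of _ _ "unit_vec (Mn n) j"] simp: cv)
  have m4: "(\<lambda>w. ennreal ((x (xi n w) (u n j w)) ^ 4)) \<in> borel_measurable \<Omega>"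
    by (rule measurable_cong[THEN iffD1, of _ "\<lambda>w. ennreal ((X n j w) ^ 4)"]) (auto simp: Xw)
  have m2: "(\<lambda>w. ennreal ((x (xi n w) (u n j w))\<^sup>2)) \<in> borel_measurable \<Omega>"
    by (rule measurable_cong[THEN iffD1, of _ "\<lambda>w. ennreal ((X n j w)\<^sup>2)"]) (auto simp: Xw)
  have "AE w in \<Omega>. nn_cond_exp \<Omega> ?F (\<lambda>w. ennreal ((X n j w)\<^sup>2)) w = nn_cond_exp \<Omega> ?F (\<lambda>w. ennreal ((x (xi n w) (u n j w))\<^sup>2)) w"
    by (rule F.nn_cond_exp_cong) (use m2 in \<open>auto simp: Xw\<close>)
  with kurt nn_cond_exp_X_square[OF j]
  have le: "AE w in \<Omega>. nn_cond_exp \<Omega> ?F (\<lambda>w. ennreal ((x (xi n w) (u n j w)) ^ 4)) w \<le> ennreal (C_m * B\<^sup>2)"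
  proof eventually_elim
    case (elim w)
    have "nn_cond_exp \<Omega> ?F (\<lambda>w. ennreal ((x (xi n w) (u n j w)) ^ 4)) w \<le> ennreal C_m * (ennreal B)\<^sup>2"
      by (rule order_trans[OF elim(1) mult_left_mono[OF power_mono]])
        (use elim(2) in \<open>simp_all flip: elim(3)\<close>)
    then show ?case using B_nonneg C_m by (simp add: ennreal_mult ennreal_power)
  qed
  have "(\<integral>\<^sup>+ w. ennreal ((X n j w) ^ 4) \<partial>\<Omega>) = (\<integral>\<^sup>+ w. 1 * ennreal ((x (xi n w) (u n j w)) ^ 4) \<partial>\<Omega>)"
    by (intro nn_integral_cong) (simp add: Xw)
  also have "\<dots> = (\<integral>\<^sup>+ w. 1 * nn_cond_exp \<Omega> ?F (\<lambda>w. ennreal ((x (xi n w) (u n j w)) ^ 4)) w \<partial>\<Omega>)"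
    by (rule F.nn_cond_exp_intg[symmetric]) (use m4 in auto)
  also have "\<dots> \<le> (\<integral>\<^sup>+ w. ennreal (C_m * B\<^sup>2) \<partial>\<Omega>)" by (rule nn_integral_mono_AE) (use le in simp)
  also have "\<dots> = ennreal (C_m * B\<^sup>2)" by (simp add: emeasure_space_1)
  finally have nn: "(\<integral>\<^sup>+ w. ennreal ((X n j w) ^ 4) \<partial>\<Omega>) \<le> ennreal (C_m * B\<^sup>2)" .
  then show i: "integrable \<Omega> (\<lambda>w. (X n j w) ^ 4)"
    by (intro integrableI_nonneg) (auto intro: le_less_trans)
  show "(LINT w|\<Omega>. (X n j w) ^ 4) \<le> C_m * B\<^sup>2"
    using nn nn_integral_eq_integral[OF i] C_m by (simp add: ennreal_le_iff)
qed

end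

section \<open>Moments of the observations given the design\<close>

context sampling_model
begin

definition Y :: "nat \<Rightarrow> nat \<Rightarrow> 'w \<Rightarrow> real" where "Y n j w = X n j w + eps n j w"

lemma observation_eq_Y: "w \<in> space \<Omega> \<Longrightarrow> j < Mn n \<Longrightarrow> observation x xi u eps w n j = Y n j w"
  by (simp add: observation_eq Y_def)

lemma eps_square_integrable: "j < Mn n \<Longrightarrow> integrable \<Omega> (\<lambda>w. (eps n j w)\<^sup>2)"
  using eps_integrable4[of j n] eps_measurable[of j n]
  by (intro square_integrable_imp_integrable[of "\<lambda>w. (eps n j w)\<^sup>2"]) auto

lemma eps_integrable: "j < Mn n \<Longrightarrow> integrable \<Omega> (eps n j)"
  using eps_square_integrable[of j n] eps_measurable[of j n]
  by (intro square_integrable_imp_integrable[of "eps n j"]) auto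

lemma Y_measurable: "j < Mn n \<Longrightarrow> Y n j \<in> borel_measurable \<Omega>"
  unfolding Y_def[abs_def] using eps_measurable[of j n] by measurable

text \<open>A bound for the fourth moment of an observation; the 8 comes from (a + b)^4 \<le> 8 (a^4
  + b^4).\<close>

definition KY :: real where "KY = 8 * (C_m * B\<^sup>2 + C_m * \<sigma>sq\<^sup>2)"

lemma Y_moment4:
  assumes j: "j < Mn n"
  shows "integrable \<Omega> (\<lambda>w. (Y n j w) ^ 4)" "(LINT w|\<Omega>. (Y n j w) ^ 4) \<le> KY"
proof -
  have ineq: "(a + b) ^ 4 \<le> 8 * (a ^ 4 + b ^ 4)" for a b :: real
  proof -
    have sq: "(c + d)\<^sup>2 \<le> 2 * (c\<^sup>2 + d\<^sup>2)" for c d :: real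
      using sum_squares_bound[of c d] by (simp add: power2_sum)
    have "((a + b)\<^sup>2)\<^sup>2 \<le> (2 * (a\<^sup>2 + b\<^sup>2))\<^sup>2" by (intro power_mono sq) simp
    also have "\<dots> = 4 * (a\<^sup>2 + b\<^sup>2)\<^sup>2" by (simp only: power_mult_distrib) simp
    also have "\<dots> \<le> 4 * (2 * ((a\<^sup>2)\<^sup>2 + (b\<^sup>2)\<^sup>2))" by (intro mult_left_mono sq) simp
    finally show ?thesis by simp
  qed
  have i: "integrable \<Omega> (\<lambda>w. 8 * ((X n j w) ^ 4 + (eps n j w) ^ 4))"
    using X_moment4(1)[OF j] eps_integrable4[OF j] by simp
  show iY: "integrable \<Omega> (\<lambda>w. (Y n j w) ^ 4)"
  proof (rule Bochner_Integration.integrable_bound[OF i])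
    show "(\<lambda>w. (Y n j w) ^ 4) \<in> borel_measurable \<Omega>" using Y_measurable[OF j] by measurable
    show "AE w in \<Omega>. norm ((Y n j w) ^ 4) \<le> norm (8 * ((X n j w) ^ 4 + (eps n j w) ^ 4))"
    proof (intro AE_I2)
      fix w
      have "\<bar>(Y n j w) ^ 4\<bar> = (X n j w + eps n j w) ^ 4" by (simp add: Y_def)
      also have "\<dots> \<le> 8 * ((X n j w) ^ 4 + (eps n j w) ^ 4)" by (rule ineq)
      finally show "norm ((Y n j w) ^ 4) \<le> norm (8 * ((X n j w) ^ 4 + (eps n j w) ^ 4))" by simp
    qed
  qed
  have "(LINT w|\<Omega>. (Y n j w) ^ 4) \<le> (LINT w|\<Omega>. 8 * ((X n j w) ^ 4 + (eps n j w) ^ 4))"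
    by (rule integral_mono[OF iY i]) (unfold Y_def, rule ineq)
  also have "\<dots> = 8 * ((LINT w|\<Omega>. (X n j w) ^ 4) + (LINT w|\<Omega>. (eps n j w) ^ 4))"
    using X_moment4(1)[OF j] eps_integrable4[OF j] by simp
  also have "\<dots> \<le> KY" using X_moment4(2)[OF j] eps_moment4[OF j] by (simp add: KY_def)
  finally show "(LINT w|\<Omega>. (Y n j w) ^ 4) \<le> KY" .
qed

lemma integrable_mult_bounded:
  fixes H f :: "'w \<Rightarrow> real"
  assumes f: "integrable \<Omega> f" and H: "H \<in> borel_measurable \<Omega>" "\<And>w. \<bar>H w\<bar> \<le> A"
  shows "integrable \<Omega> (\<lambda>w. H w * f w)"
proof (rule Bochner_Integration.integrable_bound)
  show "integrable \<Omega> (\<lambda>w. A * f w)" using f by simp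
  show "(\<lambda>w. H w * f w) \<in> borel_measurable \<Omega>" using f H(1) by measurable
  have "\<bar>H w * f w\<bar> \<le> \<bar>A * f w\<bar>" for w
    unfolding abs_mult using H(2)[of w] by (intro mult_right_mono) auto
  then show "AE w in \<Omega>. norm (H w * f w) \<le> norm (A * f w)" by simp
qed

lemma XX_moment:
  assumes h: "h \<in> borel_measurable borel" "\<And>t. \<bar>h t\<bar> \<le> A"
  shows "integrable \<Omega> (\<lambda>w. h (V n w) * (X n i w * X n j w))"
    and "(LINT w|\<Omega>. h (V n w) * (X n i w * X n j w)) = (LINT w|\<Omega>. h (V n w) * kern (V n w i) (V n w j))"
proof -
  have H: "(\<lambda>w. h (V n w)) \<in> borel_measurable \<Omega>" by (rule measurable_compose[OF V_measurable h(1)])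
  show int: "integrable \<Omega> (\<lambda>w. h (V n w) * (X n i w * X n j w))"
    by (rule integrable_mult_bounded[OF square_integrable_mult[OF X_measurable X_measurable X_square_integrable X_square_integrable] H h(2)])
  define F where "F z = h (snd z) * (xc (fst z) (snd z i) * xc (fst z) (snd z j))" for z
  have F: "F \<in> borel_measurable (P \<Otimes>\<^sub>M borel)"
    unfolding F_def[abs_def]
    by (intro borel_measurable_times measurable_compose[OF measurable_snd h(1)] xc_coordinate)
  interpret D: prob_space "distr \<Omega> borel (V n)" by (rule prob_space_distr) measurable
  interpret PD: pair_sigma_finite P "distr \<Omega> borel (V n)" ..
  have "integrable (distr \<Omega> (P \<Otimes>\<^sub>M borel) (\<lambda>w. (xi n w, V n w))) F"
    by (subst integrable_distr_eq[OF xi_V_measurable F]) (use int in \<open>simp add: F_def X_def\<close>)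
  then have iF: "integrable (P \<Otimes>\<^sub>M distr \<Omega> borel (V n)) (case_prod (\<lambda>\<zeta> t. F (\<zeta>, t)))"
    unfolding xi_V_distr by simp
  have "(LINT w|\<Omega>. h (V n w) * (X n i w * X n j w)) = (LINT w|\<Omega>. F (xi n w, V n w))"
    by (simp add: F_def X_def)
  also have "\<dots> = (LINT z|distr \<Omega> (P \<Otimes>\<^sub>M borel) (\<lambda>w. (xi n w, V n w)). F z)"
    by (rule integral_distr[OF xi_V_measurable F, symmetric])
  also have "\<dots> = (LINT t|distr \<Omega> borel (V n). (LINT \<zeta>|P. F (\<zeta>, t)))"
    unfolding xi_V_distr using PD.integral_snd[OF iF] by simp
  also have "(\<lambda>t. LINT \<zeta>|P. F (\<zeta>, t)) = (\<lambda>t. h t * kern (clamp_unit (t i)) (clamp_unit (t j)))"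
    by (simp add: F_def xc_mult_integral)
  also have "(LINT t|distr \<Omega> borel (V n). h t * kern (clamp_unit (t i)) (clamp_unit (t j)))
      = (LINT w|\<Omega>. h (V n w) * kern (clamp_unit (V n w i)) (clamp_unit (V n w j)))"
    by (rule integral_distr[OF V_measurable]) (intro borel_measurable_times h(1) kern_clamp_measurable)
  also have "\<dots> = (LINT w|\<Omega>. h (V n w) * kern (V n w i) (V n w j))"
    by (rule Bochner_Integration.integral_cong) (use V_unit in \<open>simp_all add: clamp_unit_id\<close>)
  finally show "(LINT w|\<Omega>. h (V n w) * (X n i w * X n j w)) = (LINT w|\<Omega>. h (V n w) * kern (V n w i) (V n w j))" .
qed

lemma Noise_sub: "j < Mn n \<Longrightarrow> eps n j \<in> borel_measurable (sub {Noise n j})" "j < Mn n \<Longrightarrow> {Noise n j} \<subseteq> sources Mn"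
  by (auto intro!: eps_sub simp: sources_subset)

text \<open>The noise is independent of curve and design together and has mean 0.\<close>

lemma X_eps_moment:
  assumes h: "h \<in> borel_measurable borel" "\<And>t. \<bar>h t\<bar> \<le> A" and j: "j < Mn n"
  shows "integrable \<Omega> (\<lambda>w. (h (V n w) * X n i w) * eps n j w)" "(LINT w|\<Omega>. (h (V n w) * X n i w) * eps n j w) = 0"
proof -
  have H: "(\<lambda>w. h (V n w)) \<in> borel_measurable \<Omega>" by (rule measurable_compose[OF V_measurable h(1)])
  have "(\<lambda>w. h (V n w)) \<in> borel_measurable (sub (curve_design n))"
    by (rule measurable_compose[OF V_sub[OF curve_design_sources(1)] h(1)]) (auto simp: curve_design_def)
  then have m: "(\<lambda>w. h (V n w) * X n i w) \<in> borel_measurable (sub (curve_design n))"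
    using X_sub[OF curve_design_sources(1) order_refl, of n i] by measurable
  have ind: "indep_var borel (\<lambda>w. h (V n w) * X n i w) borel (eps n j)"
    by (rule indep_sub[OF curve_design_sources(1) Noise_sub(2)[OF j] _ m Noise_sub(1)[OF j]]) (auto simp: curve_design_def)
  have "integrable \<Omega> (X n i)" by (rule square_integrable_imp_integrable[OF X_measurable X_square_integrable])
  then have i: "integrable \<Omega> (\<lambda>w. h (V n w) * X n i w)" by (rule integrable_mult_bounded[OF _ H h(2)])
  show "integrable \<Omega> (\<lambda>w. (h (V n w) * X n i w) * eps n j w)"
    by (rule indep_var_integrable[OF ind i eps_integrable[OF j]])
  show "(LINT w|\<Omega>. (h (V n w) * X n i w) * eps n j w) = 0"
    using indep_var_lebesgue_integral[OF ind i eps_integrable[OF j]] eps_mean[OF j] by simp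
qed

text \<open>On the diagonal the squared noise is independent of the design; off the diagonal one
  noise variable is independent of the pair of the design and the other noise variable.\<close>

lemma eps_eps_moment:
  assumes h: "h \<in> borel_measurable borel" "\<And>t. \<bar>h t\<bar> \<le> A" and i: "i < Mn n" and j: "j < Mn n"
  shows "integrable \<Omega> (\<lambda>w. h (V n w) * (eps n i w * eps n j w))"
    and "(LINT w|\<Omega>. h (V n w) * (eps n i w * eps n j w)) = (LINT w|\<Omega>. h (V n w) * (if i = j then \<sigma>sq else 0))"
proof -
  have H: "(\<lambda>w. h (V n w)) \<in> borel_measurable \<Omega>" by (rule measurable_compose[OF V_measurable h(1)])
  show "integrable \<Omega> (\<lambda>w. h (V n w) * (eps n i w * eps n j w))"
    by (rule integrable_mult_bounded[OF square_integrable_mult[OF eps_measurable[OF i] eps_measurable[OF j]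
            eps_square_integrable[OF i] eps_square_integrable[OF j]] H h(2)])
  have Hi: "integrable \<Omega> (\<lambda>w. h (V n w))"
    using integrable_mult_bounded[of "\<lambda>_. 1", OF _ H h(2)] by simp
  show "(LINT w|\<Omega>. h (V n w) * (eps n i w * eps n j w)) = (LINT w|\<Omega>. h (V n w) * (if i = j then \<sigma>sq else 0))"
  proof (cases "i = j")
    case True
    have m: "(\<lambda>w. h (V n w)) \<in> borel_measurable (sub (Design n ` {..<Mn n}))"
      by (rule measurable_compose[OF V_sub[OF curve_design_sources(3) order_refl] h(1)])
    have "(\<lambda>w. (eps n i w)\<^sup>2) \<in> borel_measurable (sub {Noise n i})" using Noise_sub(1)[OF i] by measurable
    from indep_sub[OF curve_design_sources(3) Noise_sub(2)[OF i] _ m this]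
    have ind: "indep_var borel (\<lambda>w. h (V n w)) borel (\<lambda>w. (eps n i w)\<^sup>2)" by auto
    have "(LINT w|\<Omega>. h (V n w) * (eps n i w)\<^sup>2) = (LINT w|\<Omega>. h (V n w)) * \<sigma>sq"
      using indep_var_lebesgue_integral[OF ind Hi eps_square_integrable[OF i]] eps_var[OF i] by simp
    then show ?thesis using True by (simp add: power2_eq_square)
  next
    case False
    let ?A = "insert (Noise n i) (Design n ` {..<Mn n})"
    have A: "?A \<subseteq> sources Mn" using i by (auto simp: sources_subset)
    have "(\<lambda>w. h (V n w)) \<in> borel_measurable (sub ?A)"
      by (rule measurable_compose[OF V_sub[OF A] h(1)]) auto
    then have m: "(\<lambda>w. h (V n w) * eps n i w) \<in> borel_measurable (sub ?A)"
      using eps_sub[OF A, of n i] by measurable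
    have ind: "indep_var borel (\<lambda>w. h (V n w) * eps n i w) borel (eps n j)"
      by (rule indep_sub[OF A Noise_sub(2)[OF j] _ m Noise_sub(1)[OF j]]) (use False in auto)
    have "integrable \<Omega> (\<lambda>w. h (V n w) * eps n i w)" by (rule integrable_mult_bounded[OF eps_integrable[OF i] H h(2)])
    from indep_var_lebesgue_integral[OF ind this eps_integrable[OF j]] show ?thesis
      using eps_mean[OF j] False by (simp add: mult.assoc)
  qed
qed

definition K0 :: "nat \<Rightarrow> nat \<Rightarrow> (nat \<Rightarrow> real) \<Rightarrow> real" where
  "K0 i j t = kern (t i) (t j) + (if i = j then \<sigma>sq else 0)"

lemma K0_measurable: "(\<lambda>w. K0 i j (V n w)) \<in> borel_measurable \<Omega>"
proof -
  have "(\<lambda>t. kern (clamp_unit (t i)) (clamp_unit (t j)) + (if i = j then \<sigma>sq else 0)) \<in> borel_measurable borel"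
    by measurable
  from measurable_compose[OF V_measurable this, of n]
  show ?thesis by (rule measurable_cong[THEN iffD1, rotated]) (use V_unit in \<open>simp add: K0_def clamp_unit_id\<close>)
qed

lemma hK0_integrable:
  assumes h: "h \<in> borel_measurable borel" "\<And>t. \<bar>h t\<bar> \<le> A"
  shows "integrable \<Omega> (\<lambda>w. h (V n w) * K0 i j (V n w))"
proof (rule integrable_mult_bounded[OF _ measurable_compose[OF V_measurable h(1)] h(2)])
  show "integrable \<Omega> (\<lambda>w. K0 i j (V n w))"
  proof (rule integrable_const_bound[where B = "B + \<bar>\<sigma>sq\<bar>"])
    have "\<bar>K0 i j (V n w)\<bar> \<le> B + \<bar>\<sigma>sq\<bar>" if w: "w \<in> space \<Omega>" for w
      using kern_bound[OF V_unit[OF w] V_unit[OF w], of n i n j] by (auto simp: K0_def)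
    then show "AE w in \<Omega>. norm (K0 i j (V n w)) \<le> B + \<bar>\<sigma>sq\<bar>" by simp
  qed (rule K0_measurable)
qed

text \<open>Unbiasedness of the outer product of observations given the design, expressed by testing
  against bounded functions \<open>h\<close> of the design instead of conditional expectations. The
  mixed terms of curve and noise have mean 0.\<close>

lemma YY_moment:
  assumes h: "h \<in> borel_measurable borel" "\<And>t. \<bar>h t\<bar> \<le> A" and i: "i < Mn n" and j: "j < Mn n"
  shows "integrable \<Omega> (\<lambda>w. h (V n w) * (Y n i w * Y n j w))"
    and "(LINT w|\<Omega>. h (V n w) * (Y n i w * Y n j w)) = (LINT w|\<Omega>. h (V n w) * K0 i j (V n w))"
proof -
  have eq: "h (V n w) * (Y n i w * Y n j w) = h (V n w) * (X n i w * X n j w) + (h (V n w) * X n i w) * eps n j w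
     + (h (V n w) * X n j w) * eps n i w + h (V n w) * (eps n i w * eps n j w)" for w
    by (simp add: Y_def algebra_simps)
  note I = XX_moment[OF h, of n i j] X_eps_moment[OF h j, of i] X_eps_moment[OF h i, of j] eps_eps_moment[OF h i j]
  show "integrable \<Omega> (\<lambda>w. h (V n w) * (Y n i w * Y n j w))"
    unfolding eq by (intro Bochner_Integration.integrable_add I)
  have k: "integrable \<Omega> (\<lambda>w. h (V n w) * kern (V n w i) (V n w j))"
  proof -
    have "integrable \<Omega> (\<lambda>w. h (V n w) * K0 i j (V n w) - (if i = j then \<sigma>sq else 0) * (h (V n w) * 1))"
      by (intro Bochner_Integration.integrable_diff hK0_integrable[OF h] integrable_mult_right
          integrable_mult_bounded[OF _ measurable_compose[OF V_measurable h(1)] h(2)]) simp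
    then show ?thesis by (simp add: K0_def algebra_simps)
  qed
  have s: "integrable \<Omega> (\<lambda>w. h (V n w) * (if i = j then \<sigma>sq else 0))"
    by (rule integrable_mult_bounded[OF _ measurable_compose[OF V_measurable h(1)] h(2)]) simp
  have "(LINT w|\<Omega>. h (V n w) * (Y n i w * Y n j w)) = (LINT w|\<Omega>. h (V n w) * kern (V n w i) (V n w j))
     + (LINT w|\<Omega>. h (V n w) * (if i = j then \<sigma>sq else 0))"
    unfolding eq using I(2,4,6,8)
    by (subst Bochner_Integration.integral_add, (intro Bochner_Integration.integrable_add I)+)+ linarith
  also have "\<dots> = (LINT w|\<Omega>. h (V n w) * K0 i j (V n w))"
    unfolding Bochner_Integration.integral_add[OF k s, symmetric] by (simp add: K0_def distrib_left)
  finally show "(LINT w|\<Omega>. h (V n w) * (Y n i w * Y n j w)) = (LINT w|\<Omega>. h (V n w) * K0 i j (V n w))" .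
qed

end

section \<open>Laws of large numbers for quadratic statistics\<close>

context sampling_model
begin

text \<open>The shape of one subject's loss: a function of the design minus a quadratic form in the
  observations whose coefficients are functions of the design.\<close>

definition quad_stat :: "((nat \<Rightarrow> real) \<Rightarrow> real) \<Rightarrow> (nat \<Rightarrow> nat \<Rightarrow> (nat \<Rightarrow> real) \<Rightarrow> real) \<Rightarrow> nat \<Rightarrow> 'w \<Rightarrow> real" where
  "quad_stat a h n w = a (V n w) - (\<Sum>i<Mn n. \<Sum>j<Mn n. h i j (V n w) * (Y n i w * Y n j w))"

definition quad_coeff :: "real \<Rightarrow> ((nat \<Rightarrow> real) \<Rightarrow> real) \<Rightarrow> (nat \<Rightarrow> nat \<Rightarrow> (nat \<Rightarrow> real) \<Rightarrow> real) \<Rightarrow> bool" where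
  "quad_coeff A a h \<longleftrightarrow> a \<in> borel_measurable borel \<and> (\<forall>t. \<bar>a t\<bar> \<le> A)
     \<and> (\<forall>i j. h i j \<in> borel_measurable borel \<and> (\<forall>t. \<bar>h i j t\<bar> \<le> A))"

lemma quad_coeffD:
  assumes "quad_coeff A a h"
  shows "a \<in> borel_measurable borel" "\<bar>a t\<bar> \<le> A" "h i j \<in> borel_measurable borel" "\<bar>h i j t\<bar> \<le> A" "0 \<le> A"
  using assms order_trans[OF abs_ge_zero, of "a (\<lambda>_. 0)" A] by (auto simp: quad_coeff_def)

text \<open>Taking means replaces the products of observations by the true covariance entries, by
  unbiasedness.\<close>

lemma expectation_quad_stat:
  assumes c: "quad_coeff A a h"
  shows "integrable \<Omega> (quad_stat a h n)"
    and "expectation (quad_stat a h n) = (LINT w|\<Omega>. a (V n w) - (\<Sum>i<Mn n. \<Sum>j<Mn n. h i j (V n w) * K0 i j (V n w)))"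
proof -
  have ai: "integrable \<Omega> (\<lambda>w. a (V n w))"
    using integrable_mult_bounded[of "\<lambda>_. 1", OF _ measurable_compose[OF V_measurable quad_coeffD(1)[OF c]] quad_coeffD(2)[OF c]]
    by simp
  have yi: "integrable \<Omega> (\<lambda>w. h i j (V n w) * (Y n i w * Y n j w))"
    and ye: "(LINT w|\<Omega>. h i j (V n w) * (Y n i w * Y n j w)) = (LINT w|\<Omega>. h i j (V n w) * K0 i j (V n w))"
    if "i < Mn n" "j < Mn n" for i j
    using YY_moment[OF quad_coeffD(3)[OF c] quad_coeffD(4)[OF c] that] by auto
  have ki: "integrable \<Omega> (\<lambda>w. h i j (V n w) * K0 i j (V n w))" for i j
    by (rule hK0_integrable[OF quad_coeffD(3)[OF c] quad_coeffD(4)[OF c]])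
  have si: "integrable \<Omega> (\<lambda>w. \<Sum>i<Mn n. \<Sum>j<Mn n. h i j (V n w) * (Y n i w * Y n j w))"
    by (intro Bochner_Integration.integrable_sum yi) auto
  have ski: "integrable \<Omega> (\<lambda>w. \<Sum>i<Mn n. \<Sum>j<Mn n. h i j (V n w) * K0 i j (V n w))"
    by (intro Bochner_Integration.integrable_sum ki)
  show "integrable \<Omega> (quad_stat a h n)" unfolding quad_stat_def[abs_def]
    by (rule Bochner_Integration.integrable_diff[OF ai si])
  have s1: "(LINT w|\<Omega>. (\<Sum>i<Mn n. \<Sum>j<Mn n. h i j (V n w) * (Y n i w * Y n j w)))
    = (\<Sum>i<Mn n. \<Sum>j<Mn n. (LINT w|\<Omega>. h i j (V n w) * (Y n i w * Y n j w)))"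
    by (subst Bochner_Integration.integral_sum, (intro Bochner_Integration.integrable_sum yi; simp),
        intro sum.cong refl, subst Bochner_Integration.integral_sum, (intro yi; simp), simp)
  have s2: "(LINT w|\<Omega>. (\<Sum>i<Mn n. \<Sum>j<Mn n. h i j (V n w) * K0 i j (V n w)))
    = (\<Sum>i<Mn n. \<Sum>j<Mn n. (LINT w|\<Omega>. h i j (V n w) * K0 i j (V n w)))"
    by (subst Bochner_Integration.integral_sum, (intro Bochner_Integration.integrable_sum ki),
        intro sum.cong refl, subst Bochner_Integration.integral_sum, (intro ki), simp)
  show "expectation (quad_stat a h n) = (LINT w|\<Omega>. a (V n w) - (\<Sum>i<Mn n. \<Sum>j<Mn n. h i j (V n w) * K0 i j (V n w)))"
    unfolding quad_stat_def[abs_def] Bochner_Integration.integral_diff[OF ai si]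
      Bochner_Integration.integral_diff[OF ai ski] s1 s2
    by (simp add: ye)
qed

text \<open>A second-moment bound for statistics with coefficients at most A. Of the factor M^3, M^2
  comes from squaring M times a sum of squares, the third M from Cauchy-Schwarz for the square of
  that sum.\<close>

definition KZ :: "real \<Rightarrow> real" where
  "KZ A = 2 * A\<^sup>2 + 2 * A\<^sup>2 * real Mx ^ 3 * (real Mx * KY)"

lemma sum_abs_products_le:
  fixes y :: "nat \<Rightarrow> real"
  shows "(\<Sum>i<n. \<Sum>j<n. \<bar>y i * y j\<bar>) \<le> real n * (\<Sum>i<n. (y i)\<^sup>2)"
proof -
  have "(\<Sum>i<n. \<Sum>j<n. \<bar>y i * y j\<bar>) \<le> (\<Sum>i<n. \<Sum>j<n. ((y i)\<^sup>2 + (y j)\<^sup>2) / 2)"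
  proof (intro sum_mono)
    fix i j
    show "\<bar>y i * y j\<bar> \<le> ((y i)\<^sup>2 + (y j)\<^sup>2) / 2"
      using sum_squares_bound[of "\<bar>y i\<bar>" "\<bar>y j\<bar>"] by (simp add: abs_mult)
  qed
  also have "\<dots> = real n * (\<Sum>i<n. (y i)\<^sup>2)"
    by (simp add: sum.distrib flip: sum_divide_distrib sum_distrib_left)
  finally show ?thesis .
qed

lemma quad_stat_measurable_group:
  assumes c: "quad_coeff A a h"
  shows "quad_stat a h n \<in> borel_measurable (sub (group n))"
proof -
  have V: "V n \<in> borel_measurable (sub (group n))"
    by (rule V_sub[OF curve_design_sources(2)]) (auto simp: group_def curve_design_def)
  have Y: "Y n i \<in> borel_measurable (sub (group n))" if "i < Mn n" for i
  proof -
    have "X n i \<in> borel_measurable (sub (group n))"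
      by (rule X_sub[OF curve_design_sources(2)]) (auto simp: group_def)
    moreover have "eps n i \<in> borel_measurable (sub (group n))"
      by (rule eps_sub[OF curve_design_sources(2)]) (use that in \<open>auto simp: group_def\<close>)
    ultimately show ?thesis unfolding Y_def[abs_def] by measurable
  qed
  show ?thesis unfolding quad_stat_def[abs_def]
    by (intro borel_measurable_diff borel_measurable_sum borel_measurable_times
        measurable_compose[OF V] quad_coeffD[OF c] Y) auto
qed

lemma quad_stat_measurable: "quad_coeff A a h \<Longrightarrow> quad_stat a h n \<in> borel_measurable \<Omega>"
  by (rule sub_measurable[OF curve_design_sources(2) quad_stat_measurable_group])

lemma quad_stat_square:
  assumes c: "quad_coeff A a h"
  shows "integrable \<Omega> (\<lambda>w. (quad_stat a h n w)\<^sup>2)" "expectation (\<lambda>w. (quad_stat a h n w)\<^sup>2) \<le> KZ A"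
proof -
  note A0 = quad_coeffD(5)[OF c]
  have KY: "0 \<le> KY"
    using order_trans[OF integral_nonneg_AE Y_moment4(2)[of 0 0]] Mn_ge[of 0] by simp
  have bound: "(quad_stat a h n w)\<^sup>2 \<le> 2 * A\<^sup>2 + 2 * A\<^sup>2 * real (Mn n) ^ 3 * (\<Sum>i<Mn n. (Y n i w) ^ 4)" for w
  proof -
    let ?S = "\<Sum>i<Mn n. (Y n i w)\<^sup>2"
    have "\<bar>\<Sum>i<Mn n. \<Sum>j<Mn n. h i j (V n w) * (Y n i w * Y n j w)\<bar>
      \<le> (\<Sum>i<Mn n. \<Sum>j<Mn n. \<bar>h i j (V n w) * (Y n i w * Y n j w)\<bar>)"
      by (rule order_trans[OF sum_abs sum_mono[OF sum_abs]])
    also have "\<dots> \<le> (\<Sum>i<Mn n. \<Sum>j<Mn n. A * \<bar>Y n i w * Y n j w\<bar>)"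
      by (intro sum_mono) (simp add: abs_mult[of "h _ _ _"] mult_right_mono quad_coeffD(4)[OF c])
    also have "\<dots> = A * (\<Sum>i<Mn n. \<Sum>j<Mn n. \<bar>Y n i w * Y n j w\<bar>)" by (simp add: sum_distrib_left)
    also have "\<dots> \<le> A * (real (Mn n) * ?S)" by (intro mult_left_mono sum_abs_products_le A0)
    finally have "\<bar>quad_stat a h n w\<bar> \<le> A + A * (real (Mn n) * ?S)"
      using quad_coeffD(2)[OF c, of "V n w"] unfolding quad_stat_def by linarith
    then have "\<bar>quad_stat a h n w\<bar>\<^sup>2 \<le> (A + A * (real (Mn n) * ?S))\<^sup>2" by (intro power_mono) auto
    also have "\<dots> \<le> 2 * A\<^sup>2 + 2 * (A * (real (Mn n) * ?S))\<^sup>2"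
      using sum_squares_bound[of A "A * (real (Mn n) * ?S)"] by (simp add: power2_sum)
    also have "(A * (real (Mn n) * ?S))\<^sup>2 = A\<^sup>2 * (real (Mn n))\<^sup>2 * ?S\<^sup>2" by (simp add: power_mult_distrib)
    also have "2 * A\<^sup>2 + 2 * (A\<^sup>2 * (real (Mn n))\<^sup>2 * ?S\<^sup>2) \<le> 2 * A\<^sup>2 + 2 * (A\<^sup>2 * (real (Mn n))\<^sup>2 * (real (Mn n) * (\<Sum>i<Mn n. (Y n i w) ^ 4)))"
    proof -
      have "?S\<^sup>2 = (\<Sum>i<Mn n. \<Sum>j<Mn n. \<bar>(Y n i w)\<^sup>2 * (Y n j w)\<^sup>2\<bar>)"
        by (simp add: power2_eq_square sum_product abs_mult)
      also have "\<dots> \<le> real (Mn n) * (\<Sum>i<Mn n. ((Y n i w)\<^sup>2)\<^sup>2)" by (rule sum_abs_products_le)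
      finally have "?S\<^sup>2 \<le> real (Mn n) * (\<Sum>i<Mn n. (Y n i w) ^ 4)" by simp
      then show ?thesis by (intro add_left_mono mult_left_mono) auto
    qed
    finally show ?thesis by (simp add: power2_eq_square power3_eq_cube mult_ac)
  qed
  have i: "integrable \<Omega> (\<lambda>w. 2 * A\<^sup>2 + 2 * A\<^sup>2 * real (Mn n) ^ 3 * (\<Sum>i<Mn n. (Y n i w) ^ 4))"
    by (intro Bochner_Integration.integrable_add integrable_mult_right Bochner_Integration.integrable_sum Y_moment4(1)) auto
  show sq: "integrable \<Omega> (\<lambda>w. (quad_stat a h n w)\<^sup>2)"
  proof (rule Bochner_Integration.integrable_bound[OF i])
    show "(\<lambda>w. (quad_stat a h n w)\<^sup>2) \<in> borel_measurable \<Omega>" using quad_stat_measurable[OF c, of n] by measurable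
    show "AE w in \<Omega>. norm ((quad_stat a h n w)\<^sup>2) \<le> norm (2 * A\<^sup>2 + 2 * A\<^sup>2 * real (Mn n) ^ 3 * (\<Sum>i<Mn n. (Y n i w) ^ 4))"
    proof (intro AE_I2)
      fix w
      show "norm ((quad_stat a h n w)\<^sup>2) \<le> norm (2 * A\<^sup>2 + 2 * A\<^sup>2 * real (Mn n) ^ 3 * (\<Sum>i<Mn n. (Y n i w) ^ 4))"
        unfolding real_norm_def using order_trans[OF bound[of w] abs_ge_self] by simp
    qed
  qed
  have "expectation (\<lambda>w. (quad_stat a h n w)\<^sup>2) \<le> (LINT w|\<Omega>. 2 * A\<^sup>2 + 2 * A\<^sup>2 * real (Mn n) ^ 3 * (\<Sum>i<Mn n. (Y n i w) ^ 4))"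
    by (rule integral_mono[OF sq i]) (rule bound)
  also have "\<dots> = 2 * A\<^sup>2 + 2 * A\<^sup>2 * real (Mn n) ^ 3 * (\<Sum>i<Mn n. (LINT w|\<Omega>. (Y n i w) ^ 4))"
    using Y_moment4(1) by (subst Bochner_Integration.integral_add) (auto simp: prob_space)
  also have "\<dots> \<le> KZ A" unfolding KZ_def
  proof (intro add_left_mono mult_mono order_refl power_mono)
    have "(\<Sum>i<Mn n. (LINT w|\<Omega>. (Y n i w) ^ 4)) \<le> (\<Sum>i<Mn n. KY)" by (intro sum_mono Y_moment4(2)) simp
    also have "\<dots> \<le> real Mx * KY" using Mn_le[of n] KY by (simp add: mult_right_mono)
    finally show "(\<Sum>i<Mn n. (LINT w|\<Omega>. (Y n i w) ^ 4)) \<le> real Mx * KY" .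
    show "0 \<le> (\<Sum>i<Mn n. (LINT w|\<Omega>. (Y n i w) ^ 4))" by (intro sum_nonneg integral_nonneg_AE) auto
  qed (use Mn_le[of n] in auto)
  finally show "expectation (\<lambda>w. (quad_stat a h n w)\<^sup>2) \<le> KZ A" .
qed

text \<open>Different subjects use disjoint groups of sources, which gives the pairwise
  independence.\<close>

lemma quad_stat_lln:
  assumes c: "\<And>n. quad_coeff A (a n) (h n)" and \<delta>: "\<delta> > 0" and N: "N > 0"
  shows "prob {w \<in> space \<Omega>. \<bar>(\<Sum>n<N. quad_stat (a n) (h n) n w) / real N
      - (\<Sum>n<N. expectation (quad_stat (a n) (h n) n)) / real N\<bar> \<ge> \<delta>} \<le> KZ A / (real N * \<delta>\<^sup>2)"
proof (rule weak_law_of_large_numbers[OF _ _ _ _ \<delta> N])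
  fix n k :: nat assume "n \<noteq> k"
  then have "group n \<inter> group k = {}" by (auto simp: group_def curve_design_def)
  then show "indep_var borel (quad_stat (a n) (h n) n) borel (quad_stat (a k) (h k) k)"
    by (rule indep_sub[OF curve_design_sources(2,2) _ quad_stat_measurable_group[OF c] quad_stat_measurable_group[OF c]])
qed (rule quad_stat_measurable[OF c] quad_stat_square[OF c])+

text \<open>The random oscillation between neighbouring coefficients is controlled by the envelope
  \<open>1 + M \<Sum> Y\<^sub>i\<^sup>2\<close>, which obeys the law of large numbers itself.\<close>

lemma uniform_lln:
  fixes a :: "'p \<Rightarrow> nat \<Rightarrow> (nat \<Rightarrow> real) \<Rightarrow> real" and h :: "'p \<Rightarrow> nat \<Rightarrow> nat \<Rightarrow> nat \<Rightarrow> (nat \<Rightarrow> real) \<Rightarrow> real"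
  assumes c: "\<And>\<theta> n. \<theta> \<in> \<Theta> \<Longrightarrow> quad_coeff A (a \<theta> n) (h \<theta> n)"
    and net: "\<And>\<epsilon>. \<epsilon> > 0 \<Longrightarrow> \<exists>\<Theta>0. finite \<Theta>0 \<and> \<Theta>0 \<subseteq> \<Theta> \<and> (\<forall>\<theta>\<in>\<Theta>. \<exists>\<theta>'\<in>\<Theta>0. \<forall>n t. (\<forall>i. t i \<in> unit_ivl) \<longrightarrow>
        \<bar>a \<theta> n t - a \<theta>' n t\<bar> \<le> \<epsilon> \<and> (\<forall>i<Mn n. \<forall>j<Mn n. \<bar>h \<theta> n i j t - h \<theta>' n i j t\<bar> \<le> \<epsilon>))"
    and \<epsilon>: "\<epsilon> > 0"
  shows "\<exists>Bad. (\<forall>N. Bad N \<in> events) \<and> (\<lambda>N. prob (Bad N)) \<longlonglongrightarrow> 0 \<and>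
    (\<forall>N>0. \<forall>w\<in>space \<Omega> - Bad N. \<forall>\<theta>\<in>\<Theta>. \<bar>(\<Sum>n<N. quad_stat (a \<theta> n) (h \<theta> n) n w) / real N
      - (\<Sum>n<N. expectation (quad_stat (a \<theta> n) (h \<theta> n) n)) / real N\<bar> \<le> \<epsilon>)"
proof -
  define A1 where "A1 = real Mx + 1"
  define env where "env n w = 1 + real Mx * (\<Sum>i<Mn n. (Y n i w)\<^sup>2)" for n w
  \<comment> \<open>The quadratic form enters \<open>quad_stat\<close> with a minus sign, so the
    diagonal coefficients are negative; the envelope thereby becomes a quadratic statistic.\<close>
  define ha where "ha i j t = (if i = j then - real Mx else 0)" for i j :: nat and t :: "nat \<Rightarrow> real"
  have cenv: "quad_coeff A1 (\<lambda>_. 1) ha" by (auto simp: quad_coeff_def ha_def[abs_def] A1_def)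
  have env_eq: "env n = quad_stat (\<lambda>_. 1) ha n" for n
  proof
    fix w
    have "(\<Sum>i<Mn n. \<Sum>j<Mn n. ha i j (V n w) * (Y n i w * Y n j w)) = (\<Sum>i<Mn n. - real Mx * (Y n i w)\<^sup>2)"
      by (intro sum.cong refl) (simp add: ha_def if_distrib if_distribR power2_eq_square cong: if_cong)
    then show "env n w = quad_stat (\<lambda>_. 1) ha n w" by (simp add: env_def quad_stat_def sum_negf sum_distrib_left)
  qed
  have env_int: "integrable \<Omega> (env n)" for n unfolding env_eq by (rule expectation_quad_stat(1)[OF cenv])
  \<comment> \<open>From y \<le> 1 + y^2 and the second-moment bound for the envelope.\<close>
  define CS where "CS = 1 + KZ A1"
  have Eenv: "expectation (env n) \<le> CS" for n
  proof -
    have "expectation (env n) \<le> expectation (\<lambda>w. 1 + (env n w)\<^sup>2)"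
    proof (rule integral_mono[OF env_int])
      show "integrable \<Omega> (\<lambda>w. 1 + (env n w)\<^sup>2)" unfolding env_eq using quad_stat_square(1)[OF cenv] by simp
      fix w
      show "env n w \<le> 1 + (env n w)\<^sup>2" using sum_squares_bound[of "env n w" 1] zero_le_power2[of "env n w"]
        unfolding mult_1_right one_power2 by linarith
    qed
    also have "\<dots> = 1 + expectation (\<lambda>w. (env n w)\<^sup>2)"
      unfolding env_eq using quad_stat_square(1)[OF cenv, of n] by (simp add: prob_space)
    also have "\<dots> \<le> CS" unfolding env_eq CS_def using quad_stat_square(2)[OF cenv, of n] by simp
    finally show ?thesis .
  qed
  have CS0: "0 \<le> CS"
  proof -
    have "0 \<le> expectation (env 0)" by (intro integral_nonneg_AE) (auto simp: env_def intro!: add_nonneg_nonneg mult_nonneg_nonneg sum_nonneg)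
    then show ?thesis using Eenv[of 0] by linarith
  qed
  \<comment> \<open>Half of \<epsilon> is left for the deviation at the net point; the other half
    covers the oscillation of the sample average, \<epsilon>' (CS + 1), and of the mean, \<epsilon>'
    CS.\<close>
  define \<epsilon>' where "\<epsilon>' = \<epsilon> / (2 * (2 * CS + 1))"
  have \<epsilon>': "\<epsilon>' > 0" "\<epsilon>' * (2 * CS + 1) = \<epsilon> / 2" using \<epsilon> CS0 by (auto simp: \<epsilon>'_def field_simps)
  obtain \<Theta>0 where \<Theta>0: "finite \<Theta>0" "\<Theta>0 \<subseteq> \<Theta>" and nt: "\<And>\<theta>. \<theta> \<in> \<Theta> \<Longrightarrow> \<exists>\<theta>'\<in>\<Theta>0. \<forall>n t. (\<forall>i. t i \<in> unit_ivl) \<longrightarrow>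
        \<bar>a \<theta> n t - a \<theta>' n t\<bar> \<le> \<epsilon>' \<and> (\<forall>i<Mn n. \<forall>j<Mn n. \<bar>h \<theta> n i j t - h \<theta>' n i j t\<bar> \<le> \<epsilon>')"
    using net[OF \<epsilon>'(1)] by blast
  define dev where "dev \<theta> N w = \<bar>(\<Sum>n<N. quad_stat (a \<theta> n) (h \<theta> n) n w) / real N
      - (\<Sum>n<N. expectation (quad_stat (a \<theta> n) (h \<theta> n) n)) / real N\<bar>" for \<theta> N w
  define dev1 where "dev1 N w = \<bar>(\<Sum>n<N. env n w) / real N - (\<Sum>n<N. expectation (env n)) / real N\<bar>" for N w
  \<comment> \<open>Finitely many events, one for each net point and one for the envelope. None
    refers to the parameter outside the net, which makes the law uniform.\<close>
  define Bad where "Bad N = (\<Union>\<theta>\<in>\<Theta>0. {w \<in> space \<Omega>. dev \<theta> N w \<ge> \<epsilon> / 2}) \<union> {w \<in> space \<Omega>. dev1 N w \<ge> 1}" for N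
  have ev1: "{w \<in> space \<Omega>. dev \<theta> N w \<ge> \<epsilon> / 2} \<in> events" if "\<theta> \<in> \<Theta>0" for \<theta> N
  proof -
    have [measurable]: "quad_stat (a \<theta> n) (h \<theta> n) n \<in> borel_measurable \<Omega>" for n
      using quad_stat_measurable[OF c] that \<Theta>0(2) by blast
    show ?thesis unfolding dev_def by measurable
  qed
  have ev2: "{w \<in> space \<Omega>. dev1 N w \<ge> 1} \<in> events" for N
  proof -
    have [measurable]: "env n \<in> borel_measurable \<Omega>" for n unfolding env_eq by (rule quad_stat_measurable[OF cenv])
    show ?thesis unfolding dev1_def by measurable
  qed
  have ev: "Bad N \<in> events" for N unfolding Bad_def using ev1 ev2 \<Theta>0(1) by (intro sets.Un sets.finite_UN) auto
  define Q where "Q = real (card \<Theta>0) * (KZ A / (\<epsilon> / 2)\<^sup>2) + KZ A1"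
  have pb: "prob (Bad N) \<le> Q / real N" if N: "N > 0" for N
  proof -
    have "prob (Bad N) \<le> prob (\<Union>\<theta>\<in>\<Theta>0. {w \<in> space \<Omega>. dev \<theta> N w \<ge> \<epsilon> / 2}) + prob {w \<in> space \<Omega>. dev1 N w \<ge> 1}"
      unfolding Bad_def using ev1 ev2 \<Theta>0(1) by (intro measure_Un_le sets.finite_UN) auto
    also have "prob (\<Union>\<theta>\<in>\<Theta>0. {w \<in> space \<Omega>. dev \<theta> N w \<ge> \<epsilon> / 2}) \<le> (\<Sum>\<theta>\<in>\<Theta>0. prob {w \<in> space \<Omega>. dev \<theta> N w \<ge> \<epsilon> / 2})"
      using ev1 by (intro measure_UNION_le \<Theta>0(1)) auto
    also have "\<dots> \<le> (\<Sum>\<theta>\<in>\<Theta>0. KZ A / (real N * (\<epsilon> / 2)\<^sup>2))"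
      unfolding dev_def by (intro sum_mono quad_stat_lln c) (use \<Theta>0(2) \<epsilon> N in auto)
    also have "prob {w \<in> space \<Omega>. dev1 N w \<ge> 1} \<le> KZ A1 / (real N * 1\<^sup>2)"
      unfolding dev1_def env_eq by (rule quad_stat_lln[OF cenv _ N]) simp
    finally show ?thesis by (simp add: Q_def add_divide_distrib mult_ac)
  qed
  have "(\<lambda>N. prob (Bad N)) \<longlonglongrightarrow> 0"
  proof (rule tendsto_sandwich[OF _ _ tendsto_const])
    show "\<forall>\<^sub>F N in sequentially. prob (Bad N) \<le> Q / real N"
      using eventually_gt_at_top[of 0] by eventually_elim (rule pb)
    show "(\<lambda>N. Q / real N) \<longlonglongrightarrow> 0" by (rule lim_const_over_n)
  qed auto
  moreover have "dev \<theta> N w \<le> \<epsilon>" if N: "N > 0" and w: "w \<in> space \<Omega> - Bad N" and \<theta>: "\<theta> \<in> \<Theta>" for N w \<theta>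
  proof -
    obtain \<theta>' where \<theta>': "\<theta>' \<in> \<Theta>0" and cl: "\<And>n t. (\<forall>i. t i \<in> unit_ivl) \<Longrightarrow>
        \<bar>a \<theta> n t - a \<theta>' n t\<bar> \<le> \<epsilon>' \<and> (\<forall>i<Mn n. \<forall>j<Mn n. \<bar>h \<theta> n i j t - h \<theta>' n i j t\<bar> \<le> \<epsilon>')"
      using nt[OF \<theta>] by blast
    have near: "\<bar>quad_stat (a \<theta> n) (h \<theta> n) n v - quad_stat (a \<theta>' n) (h \<theta>' n) n v\<bar> \<le> \<epsilon>' * env n v"
      if v: "v \<in> space \<Omega>" for n v
    proof -
      have c1: "\<bar>a \<theta> n (V n v) - a \<theta>' n (V n v)\<bar> \<le> \<epsilon>'"
        and c2: "\<And>i j. i < Mn n \<Longrightarrow> j < Mn n \<Longrightarrow> \<bar>h \<theta> n i j (V n v) - h \<theta>' n i j (V n v)\<bar> \<le> \<epsilon>'"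
        using cl[of "V n v" n] V_unit[OF v] by auto
      have "\<bar>(\<Sum>i<Mn n. \<Sum>j<Mn n. h \<theta> n i j (V n v) * (Y n i v * Y n j v)) - (\<Sum>i<Mn n. \<Sum>j<Mn n. h \<theta>' n i j (V n v) * (Y n i v * Y n j v))\<bar>
        = \<bar>\<Sum>i<Mn n. \<Sum>j<Mn n. (h \<theta> n i j (V n v) - h \<theta>' n i j (V n v)) * (Y n i v * Y n j v)\<bar>"
        by (simp add: left_diff_distrib sum_subtractf)
      also have "\<dots> \<le> (\<Sum>i<Mn n. \<Sum>j<Mn n. \<bar>(h \<theta> n i j (V n v) - h \<theta>' n i j (V n v)) * (Y n i v * Y n j v)\<bar>)"
        by (rule order_trans[OF sum_abs sum_mono[OF sum_abs]])
      also have "\<dots> \<le> (\<Sum>i<Mn n. \<Sum>j<Mn n. \<epsilon>' * \<bar>Y n i v * Y n j v\<bar>)"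
      proof (intro sum_mono)
        fix i j assume "i \<in> {..<Mn n}" "j \<in> {..<Mn n}"
        then show "\<bar>(h \<theta> n i j (V n v) - h \<theta>' n i j (V n v)) * (Y n i v * Y n j v)\<bar> \<le> \<epsilon>' * \<bar>Y n i v * Y n j v\<bar>"
          unfolding abs_mult[of "_ - _"] by (intro mult_right_mono c2) auto
      qed
      also have "\<dots> = \<epsilon>' * (\<Sum>i<Mn n. \<Sum>j<Mn n. \<bar>Y n i v * Y n j v\<bar>)" by (simp add: sum_distrib_left)
      also have "\<dots> \<le> \<epsilon>' * (real (Mn n) * (\<Sum>i<Mn n. (Y n i v)\<^sup>2))"
        by (intro mult_left_mono sum_abs_products_le) (use \<epsilon>' in simp)
      also have "\<dots> \<le> \<epsilon>' * (real Mx * (\<Sum>i<Mn n. (Y n i v)\<^sup>2))"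
        using \<epsilon>' Mn_le[of n] by (intro mult_left_mono mult_right_mono) (auto intro: sum_nonneg)
      finally show ?thesis using c1 unfolding quad_stat_def env_def distrib_left by linarith
    qed
    have ns: "norm (z / real N) = \<bar>z\<bar> / real N" for z using N by simp
    have d1: "\<bar>(\<Sum>n<N. quad_stat (a \<theta> n) (h \<theta> n) n w) / real N - (\<Sum>n<N. quad_stat (a \<theta>' n) (h \<theta>' n) n w) / real N\<bar>
      \<le> \<epsilon>' * ((\<Sum>n<N. env n w) / real N)"
    proof -
      have "\<bar>(\<Sum>n<N. quad_stat (a \<theta> n) (h \<theta> n) n w) - (\<Sum>n<N. quad_stat (a \<theta>' n) (h \<theta>' n) n w)\<bar> \<le> (\<Sum>n<N. \<epsilon>' * env n w)"
        unfolding sum_subtractf[symmetric] by (rule order_trans[OF sum_abs]) (intro sum_mono near, use w in simp)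
      then show ?thesis using N by (simp add: divide_right_mono flip: diff_divide_distrib sum_distrib_left)
    qed
    have d2: "\<bar>(\<Sum>n<N. expectation (quad_stat (a \<theta> n) (h \<theta> n) n)) / real N - (\<Sum>n<N. expectation (quad_stat (a \<theta>' n) (h \<theta>' n) n)) / real N\<bar>
      \<le> \<epsilon>' * CS"
    proof -
      have e: "\<bar>expectation (quad_stat (a \<theta> n) (h \<theta> n) n) - expectation (quad_stat (a \<theta>' n) (h \<theta>' n) n)\<bar> \<le> \<epsilon>' * CS" for n
      proof -
        have i1: "integrable \<Omega> (quad_stat (a \<theta> n) (h \<theta> n) n)" by (rule expectation_quad_stat(1)[OF c[OF \<theta>]])
        have i2: "integrable \<Omega> (quad_stat (a \<theta>' n) (h \<theta>' n) n)"
          using expectation_quad_stat(1)[OF c] \<theta>' \<Theta>0(2) by blast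
        have "\<bar>expectation (quad_stat (a \<theta> n) (h \<theta> n) n) - expectation (quad_stat (a \<theta>' n) (h \<theta>' n) n)\<bar>
          = \<bar>LINT v|\<Omega>. quad_stat (a \<theta> n) (h \<theta> n) n v - quad_stat (a \<theta>' n) (h \<theta>' n) n v\<bar>"
          using i1 i2 by simp
        also have "\<dots> \<le> (LINT v|\<Omega>. \<bar>quad_stat (a \<theta> n) (h \<theta> n) n v - quad_stat (a \<theta>' n) (h \<theta>' n) n v\<bar>)"
          by (rule integral_abs_bound)
        also have "\<dots> \<le> (LINT v|\<Omega>. \<epsilon>' * env n v)"
          by (rule integral_mono) (use i1 i2 env_int near in auto)
        also have "\<dots> = \<epsilon>' * expectation (env n)" by simp
        also have "\<dots> \<le> \<epsilon>' * CS" using Eenv[of n] \<epsilon>' by (intro mult_left_mono) auto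
        finally show ?thesis .
      qed
      have "\<bar>(\<Sum>n<N. expectation (quad_stat (a \<theta> n) (h \<theta> n) n)) - (\<Sum>n<N. expectation (quad_stat (a \<theta>' n) (h \<theta>' n) n))\<bar> \<le> (\<Sum>n<N. \<epsilon>' * CS)"
        unfolding sum_subtractf[symmetric] by (rule order_trans[OF sum_abs]) (intro sum_mono e)
      then show ?thesis using N by (simp add: field_simps flip: diff_divide_distrib)
    qed
    have d3: "dev \<theta>' N w < \<epsilon> / 2" and d4: "dev1 N w < 1" using w \<theta>' by (auto simp: Bad_def not_le)
    have "(\<Sum>n<N. expectation (env n)) / real N \<le> CS"
      using sum_mono[of "{..<N}" "\<lambda>n. expectation (env n)" "\<lambda>_. CS"] Eenv N by (simp add: field_simps)
    then have "(\<Sum>n<N. env n w) / real N \<le> CS + 1" using d4 unfolding dev1_def by linarith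
    then have "\<epsilon>' * ((\<Sum>n<N. env n w) / real N) \<le> \<epsilon>' * (CS + 1)" using \<epsilon>' by (intro mult_left_mono) auto
    moreover have "\<epsilon>' * (CS + 1) + \<epsilon>' * CS = \<epsilon> / 2" using \<epsilon>'(2) by (simp add: algebra_simps)
    ultimately show ?thesis using d1 d2 d3 unfolding dev_def by linarith
  qed
  ultimately show ?thesis using ev unfolding dev_def by blast
qed

text \<open>Two distinct design points are independent with density at least c_g, so their joint
  density is at least c_g^2 on the unit square. The kernel distance is therefore visible in a single
  off-diagonal entry.\<close>

lemma pair_lower_bound:
  assumes f: "continuous_on unit_sq (\<lambda>(s, t). f s t)" and ij: "i < Mn n" "j < Mn n" "i \<noteq> j"
  shows "integrable \<Omega> (\<lambda>w. (f (V n w i) (V n w j))\<^sup>2)"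
    and "c_g\<^sup>2 * hs_square f \<le> (LINT w|\<Omega>. (f (V n w i) (V n w j))\<^sup>2)"
proof -
  define g where "g z = (f (clamp_unit (fst z)) (clamp_unit (snd z)))\<^sup>2" for z
  have gc: "continuous_on UNIV g"
  proof -
    have "continuous_on UNIV (\<lambda>z. (clamp_unit (fst z), clamp_unit (snd z)))"
      by (intro continuous_on_Pair continuous_on_compose2[OF continuous_clamp_unit[of UNIV]] continuous_intros) auto
    from continuous_on_compose2[OF f this] show ?thesis unfolding g_def[abs_def]
      by (intro continuous_intros) (simp add: image_subset_iff)
  qed
  then have gm [measurable]: "g \<in> borel_measurable borel" by (rule borel_measurable_continuous_onI)
  have uu: "(\<lambda>w. (u n i w, u n j w)) \<in> \<Omega> \<rightarrow>\<^sub>M lborel \<Otimes>\<^sub>M lborel"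
    using u_measurable[OF ij(1)] u_measurable[OF ij(2)] by (intro measurable_Pair) auto
  have gV: "g (u n i w, u n j w) = (f (V n w i) (V n w j))\<^sup>2" if "w \<in> space \<Omega>" for w
    using u_unit[OF ij(1) that] u_unit[OF ij(2) that] ij by (simp add: g_def clamp_unit_id V_def)
  obtain B' where B': "\<And>s t. s \<in> unit_ivl \<Longrightarrow> t \<in> unit_ivl \<Longrightarrow> \<bar>f s t\<bar> \<le> B'"
    using continuous_kernel_bounded[OF f] by blast
  have gB: "\<bar>g z\<bar> \<le> B'\<^sup>2" for z
    using power_mono[OF B'[of "clamp_unit (fst z)" "clamp_unit (snd z)"] abs_ge_zero, of 2] by (simp add: g_def)
  have gmm: "g \<in> borel_measurable (lborel \<Otimes>\<^sub>M lborel)" using gm by (simp add: lborel_prod)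
  have gi: "integrable \<Omega> (\<lambda>w. g (u n i w, u n j w))"
    by (rule integrable_const_bound[where B = "B'\<^sup>2"]) (use gB measurable_compose[OF uu gmm] in auto)
  show iV: "integrable \<Omega> (\<lambda>w. (f (V n w i) (V n w j))\<^sup>2)"
    using gi by (rule Bochner_Integration.integrable_cong[THEN iffD1, rotated 2]) (simp_all add: gV)
  have dens: "distr \<Omega> lborel (u n k) = density lborel (\<lambda>t. ennreal (G t))" if "k < Mn n" for k
    using u_distr[OF that] by (simp add: distributed_def)
  have joint: "distr \<Omega> (lborel \<Otimes>\<^sub>M lborel) (\<lambda>w. (u n i w, u n j w))
    = density lborel (\<lambda>t. ennreal (G t)) \<Otimes>\<^sub>M density lborel (\<lambda>t. ennreal (G t))"
  proof -
    have s: "{Design n i} \<subseteq> sources Mn" "{Design n j} \<subseteq> sources Mn" using ij by (auto simp: sources_subset)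
    have "distr \<Omega> lborel (u n i) \<Otimes>\<^sub>M distr \<Omega> lborel (u n j) = distr \<Omega> (lborel \<Otimes>\<^sub>M lborel) (\<lambda>w. (u n i w, u n j w))"
      by (rule distr_pair_sub_sigma[OF indep_source_sets source_sets_Int_stable s])
        (use u_sub[OF s(1)] u_sub[OF s(2)] ij in auto)
    then show ?thesis using dens ij by simp
  qed
  interpret Gp: prob_space "density lborel (\<lambda>t. ennreal (G t))"
  proof -
    have "prob_space (distr \<Omega> lborel (u n i))" using u_measurable[OF ij(1)] by (intro prob_space_distr) auto
    then show "prob_space (density lborel (\<lambda>t. ennreal (G t)))" using dens[OF ij(1)] by simp
  qed
  have hsi: "integrable lborel (\<lambda>z. indicator unit_sq z * g z)"
    using borel_integrable_compact[of unit_sq g] gc continuous_on_subset[OF gc, of unit_sq]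
    by (simp add: compact_Times)
  have hs_eq: "hs_square f = (LINT z|lborel. indicator unit_sq z * g z)"
    unfolding hs_square_def set_lebesgue_integral_def
    by (intro Bochner_Integration.integral_cong) (auto simp: indicator_def g_def clamp_unit_id)
  have g0: "0 \<le> g z" for z by (simp add: g_def)
  have "ennreal (c_g\<^sup>2 * hs_square f) = ennreal (c_g\<^sup>2) * (\<integral>\<^sup>+ z. ennreal (indicator unit_sq z * g z) \<partial>lborel)"
    unfolding hs_eq using g0 by (subst nn_integral_eq_integral[OF hsi]) (auto simp: ennreal_mult)
  also have "\<dots> = (\<integral>\<^sup>+ z. ennreal (c_g\<^sup>2) * ennreal (indicator unit_sq z * g z) \<partial>lborel)"
    by (rule nn_integral_cmult[symmetric])
      (rule measurable_compose[OF borel_measurable_integrable[OF hsi] measurable_ennreal])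
  also have "\<dots> \<le> (\<integral>\<^sup>+ z. (case z of (s, t) \<Rightarrow> ennreal (G s) * ennreal (G t)) * ennreal (g z) \<partial>lborel)"
  proof (rule nn_integral_mono)
    fix z :: "real \<times> real"
    show "ennreal (c_g\<^sup>2) * ennreal (indicator unit_sq z * g z) \<le> (case z of (s, t) \<Rightarrow> ennreal (G s) * ennreal (G t)) * ennreal (g z)"
    proof (cases "z \<in> unit_sq")
      case True
      then have "c_g \<le> G (fst z)" "c_g \<le> G (snd z)" using G_ge[of "fst z"] G_ge[of "snd z"] by (auto intro: less_imp_le)
      then have "ennreal c_g * ennreal c_g \<le> ennreal (G (fst z)) * ennreal (G (snd z))"
        by (intro mult_mono ennreal_leI) auto
      then have "ennreal (c_g\<^sup>2) \<le> ennreal (G (fst z)) * ennreal (G (snd z))"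
        using c_g by (simp add: power2_eq_square ennreal_mult)
      then show ?thesis using True by (auto simp: case_prod_unfold intro: mult_right_mono)
    qed simp
  qed
  also have "\<dots> = (\<integral>\<^sup>+ z. ennreal (g z) \<partial>density (lborel \<Otimes>\<^sub>M lborel) (\<lambda>(s, t). ennreal (G s) * ennreal (G t)))"
    by (subst nn_integral_density) (auto simp: lborel_prod[symmetric] intro: measurable_compose[OF gmm measurable_ennreal])
  also have "density (lborel \<Otimes>\<^sub>M lborel) (\<lambda>(s, t). ennreal (G s) * ennreal (G t))
     = density lborel (\<lambda>t. ennreal (G t)) \<Otimes>\<^sub>M density lborel (\<lambda>t. ennreal (G t))"
    by (rule pair_measure_density[symmetric]) (auto intro: lborel.sigma_finite_measure_axioms Gp.sigma_finite_measure_axioms)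
  also have "(\<integral>\<^sup>+ z. ennreal (g z) \<partial>(density lborel (\<lambda>t. ennreal (G t)) \<Otimes>\<^sub>M density lborel (\<lambda>t. ennreal (G t))))
    = (\<integral>\<^sup>+ w. ennreal (g (u n i w, u n j w)) \<partial>\<Omega>)"
    unfolding joint[symmetric] by (rule nn_integral_distr[OF uu]) (use gmm in simp)
  also have "\<dots> = ennreal (LINT w|\<Omega>. g (u n i w, u n j w))"
    by (rule nn_integral_eq_integral[OF gi]) (simp add: g0)
  also have "(LINT w|\<Omega>. g (u n i w, u n j w)) = (LINT w|\<Omega>. (f (V n w i) (V n w j))\<^sup>2)"
    by (rule Bochner_Integration.integral_cong) (simp_all add: gV)
  finally show "c_g\<^sup>2 * hs_square f \<le> (LINT w|\<Omega>. (f (V n w i) (V n w j))\<^sup>2)"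
    by (subst (asm) ennreal_le_iff) (auto intro: integral_nonneg_AE)
qed

end

section \<open>Total boundedness of the kernel class\<close>

text \<open>The net has to consist of members of \<Theta>, for which the law of large numbers is
  available, so each code is represented by one of its preimages.\<close>

lemma finite_code_net:
  assumes fin: "finite (code ` \<Theta>)"
  shows "\<exists>\<Theta>0. finite \<Theta>0 \<and> \<Theta>0 \<subseteq> \<Theta> \<and> (\<forall>\<theta>\<in>\<Theta>. \<exists>\<theta>'\<in>\<Theta>0. code \<theta> = code \<theta>')"
proof (intro exI[of _ "inv_into \<Theta> code ` code ` \<Theta>"] conjI ballI)
  show "finite (inv_into \<Theta> code ` code ` \<Theta>)" using fin by simp
  show "inv_into \<Theta> code ` code ` \<Theta> \<subseteq> \<Theta>" by (auto intro: inv_into_into)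
  fix \<theta> assume "\<theta> \<in> \<Theta>"
  then show "\<exists>\<theta>'\<in>inv_into \<Theta> code ` code ` \<Theta>. code \<theta> = code \<theta>'"
    by (intro bexI[of _ "inv_into \<Theta> code (code \<theta>)"]) (auto simp: f_inv_into_f)
qed

lemma floor_divide_eq_imp_close:
  fixes a b :: real
  assumes "\<lfloor>a / \<kappa>\<rfloor> = \<lfloor>b / \<kappa>\<rfloor>" "\<kappa> > 0"
  shows "\<bar>a - b\<bar> \<le> \<kappa>"
proof -
  have "\<bar>a / \<kappa> - b / \<kappa>\<bar> \<le> 1"
    using floor_correct[of "a / \<kappa>"] floor_correct[of "b / \<kappa>"] assms(1) by linarith
  then have "\<bar>(a - b) / \<kappa>\<bar> \<le> 1" by (simp add: diff_divide_distrib)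
  then show ?thesis using assms(2) by (simp add: abs_divide)
qed

lemma floor_divide_in:
  fixes a :: real
  assumes "\<bar>a\<bar> \<le> B" "\<kappa> > 0"
  shows "\<lfloor>a / \<kappa>\<rfloor> \<in> {- \<lceil>B / \<kappa>\<rceil>..\<lceil>B / \<kappa>\<rceil>}"
proof -
  have "- (B / \<kappa>) \<le> a / \<kappa>" "a / \<kappa> \<le> B / \<kappa>"
    using assms divide_right_mono[of "-B" a \<kappa>] divide_right_mono[of a B \<kappa>] by auto
  then show ?thesis using floor_mono[of "- (B / \<kappa>)" "a / \<kappa>"] floor_mono[of "a / \<kappa>" "B / \<kappa>"]
    by (auto simp: floor_minus intro: order_trans[OF _ floor_le_ceiling])
qed

text \<open>The code of a parameter is its kernel on a finite grid and its variance, all rounded.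
  Equal codes give kernels within \<kappa> / 3 on the grid, and equicontinuity adds \<kappa> / 3 for
  each of the two kernels on the way to a nearby grid point.\<close>

lemma kernel_class_net:
  assumes \<delta>: "\<And>\<kappa>. \<kappa> > 0 \<Longrightarrow> \<delta> \<kappa> > 0" and \<kappa>: "\<kappa> > 0"
  shows "\<exists>\<Theta>0. finite \<Theta>0 \<and> \<Theta>0 \<subseteq> kernel_class B \<delta> \<times> {b1..b2} \<and> (\<forall>\<theta>\<in>kernel_class B \<delta> \<times> {b1..b2}. \<exists>\<theta>'\<in>\<Theta>0.
    (\<forall>s\<in>unit_ivl. \<forall>t\<in>unit_ivl. \<bar>fst \<theta> s t - fst \<theta>' s t\<bar> \<le> \<kappa>) \<and> \<bar>snd \<theta> - snd \<theta>'\<bar> \<le> \<kappa>)"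
proof -
  have "\<delta> (\<kappa> / 3) > 0" using \<delta> \<kappa> by simp
  then obtain T0 where "1 / real (Suc T0) < \<delta> (\<kappa> / 3)" by (rule nat_approx_posE)
  then obtain T :: nat where T: "T > 0" "1 / real T < \<delta> (\<kappa> / 3)" by blast
  let ?I = "{..T} \<times> {..T}"
  define code where "code \<theta> = ((\<lambda>(i, j)\<in>?I. \<lfloor>fst \<theta> (real i / real T) (real j / real T) / (\<kappa> / 3)\<rfloor>), \<lfloor>snd \<theta> / \<kappa>\<rfloor>)"
    for \<theta> :: "(real \<Rightarrow> real \<Rightarrow> real) \<times> real"
  have gridu: "real i / real T \<in> unit_ivl" if "i \<le> T" for i using that T by (simp add: divide_le_eq)
  let ?\<Theta> = "kernel_class B \<delta> \<times> {b1..b2}"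
  define L where "L = max \<bar>b1\<bar> \<bar>b2\<bar>"
  have "code ` ?\<Theta> \<subseteq> (\<Pi>\<^sub>E ij\<in>?I. {- \<lceil>B / (\<kappa> / 3)\<rceil>..\<lceil>B / (\<kappa> / 3)\<rceil>}) \<times> {- \<lceil>L / \<kappa>\<rceil>..\<lceil>L / \<kappa>\<rceil>}"
  proof (rule image_subsetI)
    fix \<theta> assume "\<theta> \<in> ?\<Theta>"
    then have c: "fst \<theta> \<in> kernel_class B \<delta>" and v: "snd \<theta> \<in> {b1..b2}" by auto
    have "\<bar>snd \<theta>\<bar> \<le> L" using v by (auto simp: L_def abs_le_iff max_def split: if_splits)
    then have "\<lfloor>snd \<theta> / \<kappa>\<rfloor> \<in> {- \<lceil>L / \<kappa>\<rceil>..\<lceil>L / \<kappa>\<rceil>}" using \<kappa> by (rule floor_divide_in)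
    moreover have "\<lfloor>fst \<theta> (real i / real T) (real j / real T) / (\<kappa> / 3)\<rfloor> \<in> {- \<lceil>B / (\<kappa> / 3)\<rceil>..\<lceil>B / (\<kappa> / 3)\<rceil>}"
      if "i \<le> T" "j \<le> T" for i j
      by (rule floor_divide_in[OF kernel_classD(2)[OF c gridu[OF that(1)] gridu[OF that(2)]]]) (use \<kappa> in simp)
    ultimately show "code \<theta> \<in> (\<Pi>\<^sub>E ij\<in>?I. {- \<lceil>B / (\<kappa> / 3)\<rceil>..\<lceil>B / (\<kappa> / 3)\<rceil>}) \<times> {- \<lceil>L / \<kappa>\<rceil>..\<lceil>L / \<kappa>\<rceil>}"
      unfolding code_def by (intro SigmaI PiE_I) auto
  qed
  then have "finite (code ` ?\<Theta>)" by (rule finite_subset) (intro finite_cartesian_product finite_PiE; simp)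
  from finite_code_net[OF this] obtain \<Theta>0 where \<Theta>0: "finite \<Theta>0" "\<Theta>0 \<subseteq> ?\<Theta>"
    "\<And>\<theta>. \<theta> \<in> ?\<Theta> \<Longrightarrow> \<exists>\<theta>'\<in>\<Theta>0. code \<theta> = code \<theta>'" by blast
  show ?thesis
  proof (intro exI[of _ \<Theta>0] conjI \<Theta>0(1,2) ballI)
    fix \<theta> assume \<theta>: "\<theta> \<in> ?\<Theta>"
    obtain \<theta>' where \<theta>': "\<theta>' \<in> \<Theta>0" "code \<theta> = code \<theta>'" using \<Theta>0(3)[OF \<theta>] by blast
    have c: "fst \<theta> \<in> kernel_class B \<delta>" "fst \<theta>' \<in> kernel_class B \<delta>" using \<theta> \<theta>' \<Theta>0(2) by auto
    have grid: "\<bar>fst \<theta> (real i / real T) (real j / real T) - fst \<theta>' (real i / real T) (real j / real T)\<bar> \<le> \<kappa> / 3"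
      if ij: "i \<le> T" "j \<le> T" for i j
    proof (rule floor_divide_eq_imp_close)
      have "(\<lambda>(i, j)\<in>?I. \<lfloor>fst \<theta> (real i / real T) (real j / real T) / (\<kappa> / 3)\<rfloor>)
        = (\<lambda>(i, j)\<in>?I. \<lfloor>fst \<theta>' (real i / real T) (real j / real T) / (\<kappa> / 3)\<rfloor>)"
        using \<theta>'(2) by (simp only: code_def prod.inject)
      from fun_cong[OF this, of "(i, j)"] ij
      show "\<lfloor>fst \<theta> (real i / real T) (real j / real T) / (\<kappa> / 3)\<rfloor> = \<lfloor>fst \<theta>' (real i / real T) (real j / real T) / (\<kappa> / 3)\<rfloor>"
        by simp
    qed (use \<kappa> in simp)
    have v: "\<bar>snd \<theta> - snd \<theta>'\<bar> \<le> \<kappa>"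
      by (rule floor_divide_eq_imp_close[OF _ \<kappa>]) (use \<theta>'(2) in \<open>simp only: code_def prod.inject\<close>)
    have near: "\<exists>i\<le>T. \<bar>s - real i / real T\<bar> \<le> \<delta> (\<kappa> / 3)" if s: "s \<in> unit_ivl" for s
    proof (intro exI[of _ "nat \<lfloor>s * real T\<rfloor>"] conjI)
      have "s * real T \<le> 1 * real T" using s by (intro mult_right_mono) auto
      then show "nat \<lfloor>s * real T\<rfloor> \<le> T" by linarith
      have "\<lfloor>s * real T\<rfloor> \<ge> 0" using s by simp
      then have "\<bar>s * real T - real (nat \<lfloor>s * real T\<rfloor>)\<bar> \<le> 1" by linarith
      moreover have "s - real (nat \<lfloor>s * real T\<rfloor>) / real T = (s * real T - real (nat \<lfloor>s * real T\<rfloor>)) / real T"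
        using T by (simp add: field_simps)
      ultimately have "\<bar>s - real (nat \<lfloor>s * real T\<rfloor>) / real T\<bar> \<le> 1 / real T"
        using T by (simp add: abs_divide divide_right_mono)
      then show "\<bar>s - real (nat \<lfloor>s * real T\<rfloor>) / real T\<bar> \<le> \<delta> (\<kappa> / 3)" using T(2) by linarith
    qed
    have "\<bar>fst \<theta> s t - fst \<theta>' s t\<bar> \<le> \<kappa>" if st: "s \<in> unit_ivl" "t \<in> unit_ivl" for s t
    proof -
      obtain i where i: "i \<le> T" "\<bar>s - real i / real T\<bar> \<le> \<delta> (\<kappa> / 3)" using near[OF st(1)] by blast
      obtain j where j: "j \<le> T" "\<bar>t - real j / real T\<bar> \<le> \<delta> (\<kappa> / 3)" using near[OF st(2)] by blast
      have k3: "\<kappa> / 3 > 0" using \<kappa> by simp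
      show ?thesis
        using kernel_classD(4)[OF c(1) k3 st(1) gridu[OF i(1)] st(2) gridu[OF j(1)] i(2) j(2)]
          kernel_classD(4)[OF c(2) k3 st(1) gridu[OF i(1)] st(2) gridu[OF j(1)] i(2) j(2)]
          grid[OF i(1) j(1)] by linarith
    qed
    then show "\<exists>\<theta>'\<in>\<Theta>0. (\<forall>s\<in>unit_ivl. \<forall>t\<in>unit_ivl. \<bar>fst \<theta> s t - fst \<theta>' s t\<bar> \<le> \<kappa>) \<and> \<bar>snd \<theta> - snd \<theta>'\<bar> \<le> \<kappa>"
      using \<theta>'(1) v by blast
  qed
qed

section \<open>The loss as a quadratic statistic\<close>

locale kernel_loss =
  fixes \<phi> :: "real \<Rightarrow> real" and b1 b2 B :: real and \<delta> :: "real \<Rightarrow> real" and Mx :: nat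
  assumes convex: "strictly_convex_pos \<phi>" and smooth: "C2_pos \<phi>"
    and b1: "0 < b1" and b12: "b1 \<le> b2" and B: "0 \<le> B" and \<delta>: "\<And>\<kappa>. \<kappa> > 0 \<Longrightarrow> \<delta> \<kappa> > 0"
begin

definition hi :: real where "hi = real Mx * B + b2"

definition \<Theta> :: "((real \<Rightarrow> real \<Rightarrow> real) \<times> real) set" where "\<Theta> = kernel_class B \<delta> \<times> {b1..b2}"

text \<open>Clamping makes this a total function of the design; for parameters in
  \<open>\<Theta>\<close> and M \<le> Mx its spectrum lies in [b1, hi] everywhere. On actual designs
  it is the model matrix.\<close>

definition Cm :: "(real \<Rightarrow> real \<Rightarrow> real) \<times> real \<Rightarrow> nat \<Rightarrow> (nat \<Rightarrow> real) \<Rightarrow> real mat" where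
  "Cm \<theta> M t = kernel_mat (fst \<theta>) (snd \<theta>) M (\<lambda>i. clamp_unit (t i))"

lemma Cm_carrier [simp]: "Cm \<theta> M t \<in> carrier_mat M M" by (simp add: Cm_def)

lemma Cm_spectrum: "\<theta> \<in> \<Theta> \<Longrightarrow> M \<le> Mx \<Longrightarrow> spectrum_in b1 hi M (Cm \<theta> M t)"
  unfolding Cm_def hi_def \<Theta>_def by (rule kernel_mat_spectrum) (use B in auto)

lemma Cm_unit: "(\<And>i. t i \<in> unit_ivl) \<Longrightarrow> Cm \<theta> M t = kernel_mat (fst \<theta>) (snd \<theta>) M t"
  unfolding Cm_def by (simp only: clamp_unit_id)

lemma continuous_seed:
  "continuous_on {b1..hi} \<phi>" "continuous_on {b1..hi} (deriv \<phi>)" "continuous_on {b1..hi} (conj_seed \<phi>)"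
proof -
  have s: "{b1..hi} \<subseteq> {0<..}" using b1 by auto
  show 1: "continuous_on {b1..hi} \<phi>" "continuous_on {b1..hi} (deriv \<phi>)"
    using continuous_on_subset[OF C2_pos_continuous(1)[OF smooth] s] continuous_on_subset[OF C2_pos_continuous(2)[OF smooth] s] .
  show "continuous_on {b1..hi} (conj_seed \<phi>)" unfolding conj_seed_def[abs_def] by (intro continuous_intros 1)
qed

text \<open>Both the parameter and the design may vary: with a common parameter the statement yields
  continuity in the design, with a common design the closeness required of a net.\<close>

lemma mat_fun_Cm_close:
  assumes f: "continuous_on {b1..hi} f" and \<epsilon>: "\<epsilon> > 0"
  shows "\<exists>\<kappa>>0. \<forall>M\<le>Mx. \<forall>\<theta>\<in>\<Theta>. \<forall>\<theta>'\<in>\<Theta>. \<forall>t t'.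
    (\<forall>i<M. \<forall>j<M. \<bar>Cm \<theta> M t $$ (i, j) - Cm \<theta>' M t' $$ (i, j)\<bar> \<le> \<kappa>) \<longrightarrow>
    (\<forall>i<M. \<forall>j<M. \<bar>mat_fun f (Cm \<theta> M t) $$ (i, j) - mat_fun f (Cm \<theta>' M t') $$ (i, j)\<bar> \<le> \<epsilon>)"
proof -
  from mat_fun_uniformly_continuous[OF f \<epsilon>, of Mx]
  obtain \<kappa> where \<kappa>: "\<kappa> > 0" and cl: "\<forall>n\<le>Mx. \<forall>A B. spectrum_in b1 hi n A \<longrightarrow> spectrum_in b1 hi n B \<longrightarrow>
    (\<forall>i<n. \<forall>j<n. \<bar>A $$ (i, j) - B $$ (i, j)\<bar> \<le> \<kappa>) \<longrightarrow>
    (\<forall>i<n. \<forall>j<n. \<bar>mat_fun f A $$ (i, j) - mat_fun f B $$ (i, j)\<bar> \<le> \<epsilon>)"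
    by (elim exE conjE) (rule that)
  show ?thesis
  proof (intro exI[of _ \<kappa>] conjI[OF \<kappa>] allI impI ballI)
    fix M \<theta> \<theta>' t t' i j
    assume M: "M \<le> Mx" and th: "\<theta> \<in> \<Theta>" "\<theta>' \<in> \<Theta>" and e: "\<forall>i<M. \<forall>j<M. \<bar>Cm \<theta> M t $$ (i, j) - Cm \<theta>' M t' $$ (i, j)\<bar> \<le> \<kappa>"
      and ij: "i < M" "j < M"
    show "\<bar>mat_fun f (Cm \<theta> M t) $$ (i, j) - mat_fun f (Cm \<theta>' M t') $$ (i, j)\<bar> \<le> \<epsilon>"
      by (rule cl[rule_format, OF M Cm_spectrum[OF th(1) M] Cm_spectrum[OF th(2) M] e[rule_format] ij])
  qed
qed

lemma Cm_entry_close: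
  assumes th: "\<theta> \<in> \<Theta>" and M: "M \<le> Mx" and \<kappa>: "\<kappa> > 0"
    and t: "\<And>i. i < M \<Longrightarrow> \<bar>t i - t' i\<bar> \<le> \<delta> \<kappa>" and ij: "i < M" "j < M"
  shows "\<bar>Cm \<theta> M t $$ (i, j) - Cm \<theta> M t' $$ (i, j)\<bar> \<le> \<kappa>"
proof -
  have cl: "\<bar>clamp_unit a - clamp_unit b\<bar> \<le> \<bar>a - b\<bar>" for a b by (auto simp: clamp_unit_def max_def min_def)
  have c: "fst \<theta> \<in> kernel_class B \<delta>" using th by (auto simp: \<Theta>_def)
  show ?thesis unfolding Cm_def
    using kernel_classD(4)[OF c \<kappa>, of "clamp_unit (t i)" "clamp_unit (t' i)" "clamp_unit (t j)" "clamp_unit (t' j)"]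
      order_trans[OF cl t[OF ij(1)]] order_trans[OF cl t[OF ij(2)]] ij
    by (simp add: kernel_mat_entry)
qed

text \<open>Measurability is obtained from continuity in the product topology, without a measurable
  choice of eigenvectors. The matrix depends on finitely many coordinates, so finitely many
  neighbourhoods suffice.\<close>

lemma mat_fun_Cm_measurable:
  assumes f: "continuous_on {b1..hi} f" and th: "\<theta> \<in> \<Theta>" and M: "M \<le> Mx" and ij: "i < M" "j < M"
  shows "(\<lambda>t. mat_fun f (Cm \<theta> M t) $$ (i, j)) \<in> borel_measurable borel"
proof (rule borel_measurable_continuous_onI)
  have "isCont (\<lambda>t. mat_fun f (Cm \<theta> M t) $$ (i, j)) t" for t
    unfolding continuous_at
  proof (rule tendstoI)
    fix e :: real assume e: "e > 0"
    have e2: "e / 2 > 0" using e by simp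
    from mat_fun_Cm_close[OF f e2]
    obtain \<kappa> where \<kappa>: "\<kappa> > 0" and cl: "\<forall>M\<le>Mx. \<forall>\<theta>\<in>\<Theta>. \<forall>\<theta>'\<in>\<Theta>. \<forall>t t'.
    (\<forall>i<M. \<forall>j<M. \<bar>Cm \<theta> M t $$ (i, j) - Cm \<theta>' M t' $$ (i, j)\<bar> \<le> \<kappa>) \<longrightarrow>
    (\<forall>i<M. \<forall>j<M. \<bar>mat_fun f (Cm \<theta> M t) $$ (i, j) - mat_fun f (Cm \<theta>' M t') $$ (i, j)\<bar> \<le> e / 2)"
      by (elim exE conjE) (rule that)
    have "\<forall>\<^sub>F t' in at t. \<forall>k\<in>{..<M}. dist (t' k) (t k) < \<delta> \<kappa>"
    proof (rule eventually_ball_finite)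
      show "\<forall>k\<in>{..<M}. \<forall>\<^sub>F t' in at t. dist (t' k) (t k) < \<delta> \<kappa>"
      proof
        fix k
        have "continuous_on UNIV (\<lambda>t :: nat \<Rightarrow> real. t k)" by (rule continuous_on_product_coordinates)
        then have "isCont (\<lambda>t :: nat \<Rightarrow> real. t k) t"
          unfolding continuous_on_eq_continuous_at[OF open_UNIV] by blast
        then show "\<forall>\<^sub>F t' in at t. dist (t' k) (t k) < \<delta> \<kappa>"
          unfolding continuous_at by (rule tendstoD) (rule \<delta>[OF \<kappa>])
      qed
    qed simp
    then show "\<forall>\<^sub>F t' in at t. dist (mat_fun f (Cm \<theta> M t') $$ (i, j)) (mat_fun f (Cm \<theta> M t) $$ (i, j)) < e"
    proof eventually_elim
      case (elim t')
      then have "\<bar>t' k - t k\<bar> \<le> \<delta> \<kappa>" if "k < M" for k using that by (force simp: dist_real_def)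
      then have "\<bar>Cm \<theta> M t' $$ (i, j) - Cm \<theta> M t $$ (i, j)\<bar> \<le> \<kappa>" if "i < M" "j < M" for i j
        using that by (intro Cm_entry_close[OF th M \<kappa>])
      then have "\<bar>mat_fun f (Cm \<theta> M t') $$ (i, j) - mat_fun f (Cm \<theta> M t) $$ (i, j)\<bar> \<le> e / 2"
        by (rule cl[rule_format, OF M th th _ ij])
      then show ?case using e by (simp add: dist_real_def)
    qed
  qed
  then show "continuous_on UNIV (\<lambda>t. mat_fun f (Cm \<theta> M t) $$ (i, j))" by (simp add: continuous_on_eq_continuous_at)
qed

definition score_a :: "(real \<Rightarrow> real \<Rightarrow> real) \<times> real \<Rightarrow> nat \<Rightarrow> (nat \<Rightarrow> real) \<Rightarrow> real" where
  "score_a \<theta> M t = mtrace (mat_fun (conj_seed \<phi>) (Cm \<theta> M t)) / (real M)\<^sup>2"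

text \<open>The value 0 outside the matrix makes the bound hold for all indices, as
  \<open>quad_coeff\<close> requires.\<close>

definition score_h :: "(real \<Rightarrow> real \<Rightarrow> real) \<times> real \<Rightarrow> nat \<Rightarrow> nat \<Rightarrow> nat \<Rightarrow> (nat \<Rightarrow> real) \<Rightarrow> real" where
  "score_h \<theta> M i j t = (if i < M \<and> j < M then mat_fun (deriv \<phi>) (Cm \<theta> M t) $$ (i, j) / (real M)\<^sup>2 else 0)"

lemma mtrace_mat_fun_Cm:
  assumes "\<theta> \<in> \<Theta>" "M \<le> Mx"
  shows "mtrace (mat_fun f (Cm \<theta> M t)) = (\<Sum>i<M. mat_fun f (Cm \<theta> M t) $$ (i, i))"
  using mat_fun_carrier[OF Cm_spectrum[OF assms], of f t] by (auto simp: mtrace_def)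

definition cbound :: real where
  "cbound = (SOME A. A \<ge> 0 \<and> (\<forall>y\<in>{b1..hi}. \<bar>deriv \<phi> y\<bar> \<le> A \<and> \<bar>conj_seed \<phi> y\<bar> \<le> A \<and> \<bar>\<phi> y\<bar> \<le> A))"

lemma cbound: "cbound \<ge> 0" "y \<in> {b1..hi} \<Longrightarrow> \<bar>deriv \<phi> y\<bar> \<le> cbound" "y \<in> {b1..hi} \<Longrightarrow> \<bar>conj_seed \<phi> y\<bar> \<le> cbound"
  "y \<in> {b1..hi} \<Longrightarrow> \<bar>\<phi> y\<bar> \<le> cbound"
proof -
  have "\<exists>A\<ge>0. \<forall>y\<in>{b1..hi}. \<bar>f y\<bar> \<le> A" if "continuous_on {b1..hi} f" for f :: "real \<Rightarrow> real"
  proof -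
    have "bounded (f ` {b1..hi})" by (intro compact_imp_bounded compact_continuous_image that) simp
    then obtain A where "A > 0" "\<forall>y\<in>{b1..hi}. \<bar>f y\<bar> \<le> A" unfolding bounded_pos by auto
    then show ?thesis by (intro exI[of _ A]) auto
  qed
  from this[OF continuous_seed(1)] this[OF continuous_seed(2)] this[OF continuous_seed(3)]
  obtain A1 A2 A3 where A: "A1 \<ge> 0" "\<And>y. y \<in> {b1..hi} \<Longrightarrow> \<bar>\<phi> y\<bar> \<le> A1" "A2 \<ge> 0" "\<And>y. y \<in> {b1..hi} \<Longrightarrow> \<bar>deriv \<phi> y\<bar> \<le> A2"
    "A3 \<ge> 0" "\<And>y. y \<in> {b1..hi} \<Longrightarrow> \<bar>conj_seed \<phi> y\<bar> \<le> A3" by blast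
  have "\<exists>A. A \<ge> 0 \<and> (\<forall>y\<in>{b1..hi}. \<bar>deriv \<phi> y\<bar> \<le> A \<and> \<bar>conj_seed \<phi> y\<bar> \<le> A \<and> \<bar>\<phi> y\<bar> \<le> A)"
  proof (intro exI[of _ "A1 + A2 + A3"] conjI ballI)
    fix y assume y: "y \<in> {b1..hi}"
    show "\<bar>deriv \<phi> y\<bar> \<le> A1 + A2 + A3" "\<bar>conj_seed \<phi> y\<bar> \<le> A1 + A2 + A3" "\<bar>\<phi> y\<bar> \<le> A1 + A2 + A3"
      using A(1,3,5) A(2)[OF y] A(4)[OF y] A(6)[OF y] by linarith+
  qed (use A in simp)
  from someI_ex[OF this, folded cbound_def]
  have *: "cbound \<ge> 0 \<and> (\<forall>y\<in>{b1..hi}. \<bar>deriv \<phi> y\<bar> \<le> cbound \<and> \<bar>conj_seed \<phi> y\<bar> \<le> cbound \<and> \<bar>\<phi> y\<bar> \<le> cbound)" .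
  then show "cbound \<ge> 0" ..
  show "y \<in> {b1..hi} \<Longrightarrow> \<bar>deriv \<phi> y\<bar> \<le> cbound" "y \<in> {b1..hi} \<Longrightarrow> \<bar>conj_seed \<phi> y\<bar> \<le> cbound"
    "y \<in> {b1..hi} \<Longrightarrow> \<bar>\<phi> y\<bar> \<le> cbound" using * by blast+
qed

lemma mtrace_bound:
  assumes th: "\<theta> \<in> \<Theta>" and M: "1 \<le> M" "M \<le> Mx" and f: "\<And>y. y \<in> {b1..hi} \<Longrightarrow> \<bar>f y\<bar> \<le> A" and A: "0 \<le> A"
  shows "\<bar>mtrace (mat_fun f (Cm \<theta> M t)) / (real M)\<^sup>2\<bar> \<le> A"
proof -
  have "\<bar>mtrace (mat_fun f (Cm \<theta> M t))\<bar> \<le> (\<Sum>i<M. \<bar>mat_fun f (Cm \<theta> M t) $$ (i, i)\<bar>)"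
    unfolding mtrace_mat_fun_Cm[OF th M(2)] by (rule sum_abs)
  also have "\<dots> \<le> (\<Sum>i<M. A)"
    by (intro sum_mono mat_fun_entry_bound[OF Cm_spectrum[OF th M(2)] f]) auto
  also have "\<dots> = A * real M" by simp
  also have "\<dots> \<le> A * (real M)\<^sup>2"
    using A M(1) by (intro mult_left_mono) (auto simp: power2_eq_square)
  finally show ?thesis using M(1) by (simp add: divide_le_eq)
qed

lemma entry_bound:
  assumes th: "\<theta> \<in> \<Theta>" and M: "1 \<le> M" "M \<le> Mx" and f: "\<And>y. y \<in> {b1..hi} \<Longrightarrow> \<bar>f y\<bar> \<le> A" and A: "0 \<le> A"
    and ij: "i < M" "j < M"
  shows "\<bar>mat_fun f (Cm \<theta> M t) $$ (i, j) / (real M)\<^sup>2\<bar> \<le> A"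
proof -
  have "\<bar>mat_fun f (Cm \<theta> M t) $$ (i, j)\<bar> \<le> A" by (rule mat_fun_entry_bound[OF Cm_spectrum[OF th M(2)] f ij])
  also have "A * 1 \<le> A * (real M)\<^sup>2" using A M(1) by (intro mult_left_mono) auto
  then have "A \<le> A * (real M)\<^sup>2" by simp
  finally show ?thesis using M(1) by (simp add: divide_le_eq)
qed

lemma score_close:
  assumes \<epsilon>: "\<epsilon> > 0"
  shows "\<exists>\<kappa>>0. \<forall>M. 1 \<le> M \<longrightarrow> M \<le> Mx \<longrightarrow> (\<forall>\<theta>\<in>\<Theta>. \<forall>\<theta>'\<in>\<Theta>. (\<forall>s\<in>unit_ivl. \<forall>t\<in>unit_ivl. \<bar>fst \<theta> s t - fst \<theta>' s t\<bar> \<le> \<kappa>) \<longrightarrow>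
    \<bar>snd \<theta> - snd \<theta>'\<bar> \<le> \<kappa> \<longrightarrow>
    (\<forall>t. \<bar>score_a \<theta> M t - score_a \<theta>' M t\<bar> \<le> \<epsilon> \<and> (\<forall>i j. \<bar>score_h \<theta> M i j t - score_h \<theta>' M i j t\<bar> \<le> \<epsilon>)))"
proof -
  from mat_fun_Cm_close[OF continuous_seed(3) \<epsilon>]
  obtain k1 where k1: "k1 > 0" and c1: "\<forall>M\<le>Mx. \<forall>\<theta>\<in>\<Theta>. \<forall>\<theta>'\<in>\<Theta>. \<forall>t t'.
    (\<forall>i<M. \<forall>j<M. \<bar>Cm \<theta> M t $$ (i, j) - Cm \<theta>' M t' $$ (i, j)\<bar> \<le> k1) \<longrightarrow>
    (\<forall>i<M. \<forall>j<M. \<bar>mat_fun (conj_seed \<phi>) (Cm \<theta> M t) $$ (i, j) - mat_fun (conj_seed \<phi>) (Cm \<theta>' M t') $$ (i, j)\<bar> \<le> \<epsilon>)"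
    by (elim exE conjE) (rule that)
  from mat_fun_Cm_close[OF continuous_seed(2) \<epsilon>]
  obtain k2 where k2: "k2 > 0" and c2: "\<forall>M\<le>Mx. \<forall>\<theta>\<in>\<Theta>. \<forall>\<theta>'\<in>\<Theta>. \<forall>t t'.
    (\<forall>i<M. \<forall>j<M. \<bar>Cm \<theta> M t $$ (i, j) - Cm \<theta>' M t' $$ (i, j)\<bar> \<le> k2) \<longrightarrow>
    (\<forall>i<M. \<forall>j<M. \<bar>mat_fun (deriv \<phi>) (Cm \<theta> M t) $$ (i, j) - mat_fun (deriv \<phi>) (Cm \<theta>' M t') $$ (i, j)\<bar> \<le> \<epsilon>)"
    by (elim exE conjE) (rule that)
  \<comment> \<open>A diagonal entry moves by the change of the kernel plus the change of the
    variance, hence the division by 2.\<close>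
  define \<kappa> where "\<kappa> = min k1 k2 / 2"
  show ?thesis
  proof (intro exI[of _ \<kappa>] conjI allI impI ballI)
    show "\<kappa> > 0" using k1 k2 by (simp add: \<kappa>_def)
    fix M \<theta> \<theta>' t assume M: "1 \<le> M" "M \<le> Mx" and th: "\<theta> \<in> \<Theta>" "\<theta>' \<in> \<Theta>"
      and c: "\<forall>s\<in>unit_ivl. \<forall>t\<in>unit_ivl. \<bar>fst \<theta> s t - fst \<theta>' s t\<bar> \<le> \<kappa>" and v: "\<bar>snd \<theta> - snd \<theta>'\<bar> \<le> \<kappa>"
    have e: "\<bar>Cm \<theta> M t $$ (i, j) - Cm \<theta>' M t $$ (i, j)\<bar> \<le> min k1 k2" if "i < M" "j < M" for i j
    proof -
      have "\<bar>fst \<theta> (clamp_unit (t i)) (clamp_unit (t j)) - fst \<theta>' (clamp_unit (t i)) (clamp_unit (t j))\<bar> \<le> \<kappa>" using c by simp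
      then have "\<bar>Cm \<theta> M t $$ (i, j) - Cm \<theta>' M t $$ (i, j)\<bar> \<le> \<kappa> + \<kappa>"
        using v that unfolding Cm_def by (auto simp: kernel_mat_entry abs_le_iff)
      then show ?thesis by (simp add: \<kappa>_def)
    qed
    have M2: "1 \<le> (real M)\<^sup>2" "real M \<le> (real M)\<^sup>2"
      using M(1) one_le_power[of "real M" 2] by (auto simp: power2_eq_square)
    have d1: "\<bar>mat_fun (conj_seed \<phi>) (Cm \<theta> M t) $$ (i, i) - mat_fun (conj_seed \<phi>) (Cm \<theta>' M t) $$ (i, i)\<bar> \<le> \<epsilon>" if "i < M" for i
    proof (rule c1[rule_format, OF M(2) th _ that that])
      fix i j assume "i < M" "j < M"
      then show "\<bar>Cm \<theta> M t $$ (i, j) - Cm \<theta>' M t $$ (i, j)\<bar> \<le> k1" using e[of i j] by simp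
    qed
    have "\<bar>mtrace (mat_fun (conj_seed \<phi>) (Cm \<theta> M t)) - mtrace (mat_fun (conj_seed \<phi>) (Cm \<theta>' M t))\<bar> \<le> (\<Sum>i<M. \<epsilon>)"
      unfolding mtrace_mat_fun_Cm[OF th(1) M(2)] mtrace_mat_fun_Cm[OF th(2) M(2)] sum_subtractf[symmetric]
      by (rule order_trans[OF sum_abs]) (intro sum_mono d1, simp)
    also have "\<dots> \<le> \<epsilon> * (real M)\<^sup>2" using M2 \<epsilon> by simp
    finally show "\<bar>score_a \<theta> M t - score_a \<theta>' M t\<bar> \<le> \<epsilon>"
      using M(1) by (simp add: score_a_def divide_le_eq flip: diff_divide_distrib)
    fix i j
    show "\<bar>score_h \<theta> M i j t - score_h \<theta>' M i j t\<bar> \<le> \<epsilon>"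
    proof (cases "i < M \<and> j < M")
      case True
      then have ij: "i < M" "j < M" by auto
      have "\<bar>mat_fun (deriv \<phi>) (Cm \<theta> M t) $$ (i, j) - mat_fun (deriv \<phi>) (Cm \<theta>' M t) $$ (i, j)\<bar> \<le> \<epsilon>"
      proof (rule c2[rule_format, OF M(2) th _ ij])
        fix i j assume "i < M" "j < M"
        then show "\<bar>Cm \<theta> M t $$ (i, j) - Cm \<theta>' M t $$ (i, j)\<bar> \<le> k2" using e[of i j] by simp
      qed
      also have "\<epsilon> \<le> \<epsilon> * (real M)\<^sup>2" using M2 \<epsilon> mult_left_mono[of 1 "(real M)\<^sup>2" \<epsilon>] by simp
      finally show ?thesis using True M(1) by (simp add: score_h_def divide_le_eq flip: diff_divide_distrib)
    qed (use \<epsilon> in \<open>auto simp: score_h_def\<close>)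
  qed
qed

end

section \<open>The population risk and how it identifies the parameters\<close>

locale sampling_loss = sampling_model \<Omega> P x xi u eps Mn Mx G kern c_g C_m \<sigma>sq B + kernel_loss \<phi> b1 b2 B \<delta> Mx
  for \<Omega> :: "'w measure" and P :: "'s measure" and x xi u eps Mn Mx G kern c_g C_m \<sigma>sq B \<phi> b1 b2 \<delta> +
  assumes kern_in_class: "kern \<in> kernel_class B \<delta>" and \<sigma>sq_in: "\<sigma>sq \<in> {b1..b2}"
begin

abbreviation true_param :: "(real \<Rightarrow> real \<Rightarrow> real) \<times> real" where "true_param \<equiv> (kern, \<sigma>sq)"

lemma true_param_in: "true_param \<in> \<Theta>" using kern_in_class \<sigma>sq_in by (simp add: \<Theta>_def)

lemma Mn_pos: "1 \<le> Mn n" using Mn_ge[of n] by simp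

lemma score_coeff: "\<theta> \<in> \<Theta> \<Longrightarrow> quad_coeff cbound (score_a \<theta> (Mn n)) (score_h \<theta> (Mn n))"
  unfolding quad_coeff_def
proof (intro conjI allI)
  assume th: "\<theta> \<in> \<Theta>"
  have "(\<lambda>t. mtrace (mat_fun (conj_seed \<phi>) (Cm \<theta> (Mn n) t))) \<in> borel_measurable borel"
    unfolding mtrace_mat_fun_Cm[OF th Mn_le]
    by (intro borel_measurable_sum mat_fun_Cm_measurable continuous_seed th Mn_le) auto
  then show "score_a \<theta> (Mn n) \<in> borel_measurable borel"
    unfolding score_a_def[abs_def] by measurable
  show "\<bar>score_a \<theta> (Mn n) t\<bar> \<le> cbound" for t
    unfolding score_a_def by (rule mtrace_bound[OF th Mn_pos Mn_le cbound(3) cbound(1)])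
  fix i j
  show "score_h \<theta> (Mn n) i j \<in> borel_measurable borel"
  proof (cases "i < Mn n \<and> j < Mn n")
    case True
    then have "(\<lambda>t. mat_fun (deriv \<phi>) (Cm \<theta> (Mn n) t) $$ (i, j)) \<in> borel_measurable borel"
      by (intro mat_fun_Cm_measurable continuous_seed th Mn_le) auto
    then show ?thesis using True unfolding score_h_def[abs_def] by simp
  next
    case False
    then have "score_h \<theta> (Mn n) i j = (\<lambda>_. 0)" by (auto simp: score_h_def)
    then show ?thesis by simp
  qed
  show "\<bar>score_h \<theta> (Mn n) i j t\<bar> \<le> cbound" for t
    using entry_bound[OF th Mn_pos Mn_le cbound(2) cbound(1)] cbound(1) by (simp add: score_h_def)
qed

definition divergence :: "(real \<Rightarrow> real \<Rightarrow> real) \<times> real \<Rightarrow> nat \<Rightarrow> 'w \<Rightarrow> real" where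
  "divergence \<theta> n w =
     bregman \<phi> (Cm true_param (Mn n) (V n w)) (Cm \<theta> (Mn n) (V n w)) / (real (Mn n))\<^sup>2"

text \<open>The part of the divergence that is free of the candidate, so it drops out when two
  candidates are compared.\<close>

definition base :: "nat \<Rightarrow> 'w \<Rightarrow> real" where
  "base n w = mtrace (mat_fun \<phi> (Cm true_param (Mn n) (V n w))) / (real (Mn n))\<^sup>2"

text \<open>The loss with the data matrix replaced by its conditional mean given the design.\<close>

definition population_score :: "(real \<Rightarrow> real \<Rightarrow> real) \<times> real \<Rightarrow> nat \<Rightarrow> 'w \<Rightarrow> real" where
  "population_score \<theta> n w = score_a \<theta> (Mn n) (V n w)
     - (\<Sum>i<Mn n. \<Sum>j<Mn n. score_h \<theta> (Mn n) i j (V n w) * K0 i j (V n w))"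

lemma Cm_true_entry:
  "w \<in> space \<Omega> \<Longrightarrow> i < Mn n \<Longrightarrow> j < Mn n \<Longrightarrow> Cm true_param (Mn n) (V n w) $$ (i, j) = K0 i j (V n w)"
  using V_unit by (simp add: Cm_def kernel_mat_entry K0_def clamp_unit_id del: atLeastAtMost_iff)

text \<open>The relation between loss and divergence holds for each design, before expectations are
  taken. The symmetry of the true kernel reconciles the transposed index in the trace with the
  quadratic form.\<close>

lemma divergence_eq:
  assumes th: "\<theta> \<in> \<Theta>" and w: "w \<in> space \<Omega>"
  shows "divergence \<theta> n w = base n w + population_score \<theta> n w"
proof -
  let ?F = "\<lambda>i j. mat_fun (deriv \<phi>) (Cm \<theta> (Mn n) (V n w)) $$ (i, j)"
  have sym: "Cm true_param (Mn n) (V n w) $$ (j, i) = K0 i j (V n w)" if "i < Mn n" "j < Mn n" for i j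
    using Cm_true_entry[OF w that(2,1)] kernel_classD(1)[OF kern_in_class V_unit[OF w, of n i] V_unit[OF w, of n j]]
    by (simp add: K0_def)
  have "(\<Sum>i<Mn n. \<Sum>j<Mn n. ?F i j * Cm true_param (Mn n) (V n w) $$ (j, i)) / (real (Mn n))\<^sup>2
    = (\<Sum>i<Mn n. \<Sum>j<Mn n. score_h \<theta> (Mn n) i j (V n w) * K0 i j (V n w))"
    unfolding sum_divide_distrib by (intro sum.cong refl) (simp add: sym score_h_def)
  then show ?thesis
    unfolding divergence_def base_def population_score_def score_a_def
      bregman_eq_loss[OF Cm_spectrum[OF th Mn_le] Cm_carrier]
    by (simp add: add_divide_distrib diff_divide_distrib)
qed

lemma divergence_nonneg:
  assumes th: "\<theta> \<in> \<Theta>" shows "0 \<le> divergence \<theta> n w"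
  unfolding divergence_def
  by (intro divide_nonneg_nonneg bregman_nonneg[OF convex smooth b1 Cm_spectrum[OF true_param_in Mn_le] Cm_spectrum[OF th Mn_le]]) auto

lemma base_integrable: "integrable \<Omega> (base n)"
proof (rule integrable_const_bound[where B = cbound])
  have "(\<lambda>t. mtrace (mat_fun \<phi> (Cm true_param (Mn n) t))) \<in> borel_measurable borel"
    unfolding mtrace_mat_fun_Cm[OF true_param_in Mn_le]
    by (intro borel_measurable_sum mat_fun_Cm_measurable continuous_seed true_param_in Mn_le) auto
  from measurable_compose[OF V_measurable this, of n]
  show "base n \<in> borel_measurable \<Omega>" unfolding base_def[abs_def] by measurable
  show "AE w in \<Omega>. norm (base n w) \<le> cbound"
    unfolding base_def real_norm_def
    by (intro AE_I2 mtrace_bound[OF true_param_in Mn_pos Mn_le cbound(4) cbound(1)])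
qed

lemma population_score_integrable:
  assumes th: "\<theta> \<in> \<Theta>" shows "integrable \<Omega> (population_score \<theta> n)"
proof -
  note c = score_coeff[OF th, of n]
  have "integrable \<Omega> (\<lambda>w. score_a \<theta> (Mn n) (V n w))"
    using integrable_mult_bounded[of "\<lambda>_. 1", OF _ measurable_compose[OF V_measurable quad_coeffD(1)[OF c]] quad_coeffD(2)[OF c]]
    by simp
  then show ?thesis unfolding population_score_def[abs_def]
    by (intro Bochner_Integration.integrable_diff Bochner_Integration.integrable_sum
        hK0_integrable[OF quad_coeffD(3)[OF c] quad_coeffD(4)[OF c]])
qed

definition risk :: "nat \<Rightarrow> (real \<Rightarrow> real \<Rightarrow> real) \<times> real \<Rightarrow> real" where
  "risk n \<theta> = expectation (divergence \<theta> n)"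

lemma divergence_integrable: "\<theta> \<in> \<Theta> \<Longrightarrow> integrable \<Omega> (divergence \<theta> n)"
  using Bochner_Integration.integrable_add[OF base_integrable[of n] population_score_integrable[of \<theta> n]]
  by (subst Bochner_Integration.integrable_cong[OF refl divergence_eq]) auto

text \<open>Mean loss and risk differ by a term free of the candidate, so differences of mean losses
  are differences of risks.\<close>

lemma risk_eq:
  assumes th: "\<theta> \<in> \<Theta>"
  shows "risk n \<theta> = expectation (base n) + expectation (quad_stat (score_a \<theta> (Mn n)) (score_h \<theta> (Mn n)) n)"
proof -
  have "risk n \<theta> = (LINT w|\<Omega>. base n w + population_score \<theta> n w)"
    unfolding risk_def by (intro Bochner_Integration.integral_cong refl divergence_eq[OF th])
  also have "\<dots> = expectation (base n) + expectation (population_score \<theta> n)"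
    by (rule Bochner_Integration.integral_add[OF base_integrable population_score_integrable[OF th]])
  also have "expectation (population_score \<theta> n) = expectation (quad_stat (score_a \<theta> (Mn n)) (score_h \<theta> (Mn n)) n)"
    unfolding expectation_quad_stat(2)[OF score_coeff[OF th]] population_score_def[abs_def] ..
  finally show ?thesis .
qed

text \<open>At the truth the divergence is 0 for every design, and the scores vary uniformly
  continuously with the parameter, so a kernel uniformly close to the truth has small divergence
  pointwise.\<close>

lemma risk_upper:
  assumes e: "e > 0"
  shows "\<exists>\<kappa>>0. \<forall>\<theta>\<in>\<Theta>. (\<forall>s\<in>unit_ivl. \<forall>t\<in>unit_ivl. \<bar>fst \<theta> s t - kern s t\<bar> \<le> \<kappa>) \<longrightarrow> snd \<theta> = \<sigma>sq \<longrightarrow>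
    (\<forall>n. risk n \<theta> \<le> e)"
proof -
  \<comment> \<open>One unit for the offset, and at most Mx^2 entries, each weighted by a covariance
    of size at most B + |\<sigma>sq|.\<close>
  define H where "H = 1 + (real Mx)\<^sup>2 * (B + \<bar>\<sigma>sq\<bar>)"
  have H: "H \<ge> 1" using B by (simp add: H_def)
  define \<epsilon> where "\<epsilon> = e / H"
  have \<epsilon>: "\<epsilon> > 0" "\<epsilon> * H = e" using e H by (auto simp: \<epsilon>_def)
  from score_close[OF \<epsilon>(1)] obtain \<kappa> where \<kappa>: "\<kappa> > 0" and sc:
    "\<forall>M. 1 \<le> M \<longrightarrow> M \<le> Mx \<longrightarrow> (\<forall>\<theta>\<in>\<Theta>. \<forall>\<theta>'\<in>\<Theta>. (\<forall>s\<in>unit_ivl. \<forall>t\<in>unit_ivl. \<bar>fst \<theta> s t - fst \<theta>' s t\<bar> \<le> \<kappa>) \<longrightarrow>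
    \<bar>snd \<theta> - snd \<theta>'\<bar> \<le> \<kappa> \<longrightarrow>
    (\<forall>t. \<bar>score_a \<theta> M t - score_a \<theta>' M t\<bar> \<le> \<epsilon> \<and> (\<forall>i j. \<bar>score_h \<theta> M i j t - score_h \<theta>' M i j t\<bar> \<le> \<epsilon>)))"
    by (elim exE conjE) (rule that)
  show ?thesis
  proof (intro exI[of _ \<kappa>] conjI \<kappa> ballI impI allI)
    fix \<theta> n assume th: "\<theta> \<in> \<Theta>" and c: "\<forall>s\<in>unit_ivl. \<forall>t\<in>unit_ivl. \<bar>fst \<theta> s t - kern s t\<bar> \<le> \<kappa>" and v: "snd \<theta> = \<sigma>sq"
    have "\<forall>t. \<bar>score_a \<theta> (Mn n) t - score_a true_param (Mn n) t\<bar> \<le> \<epsilon>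
      \<and> (\<forall>i j. \<bar>score_h \<theta> (Mn n) i j t - score_h true_param (Mn n) i j t\<bar> \<le> \<epsilon>)"
      by (rule sc[rule_format, OF Mn_pos Mn_le th true_param_in, THEN allI]) (use c v \<kappa> in auto)
    then have s: "\<bar>score_a \<theta> (Mn n) t - score_a true_param (Mn n) t\<bar> \<le> \<epsilon>"
      "\<bar>score_h \<theta> (Mn n) i j t - score_h true_param (Mn n) i j t\<bar> \<le> \<epsilon>" for t i j by blast+
    have "divergence \<theta> n w \<le> e" if w: "w \<in> space \<Omega>" for w
    proof -
      have k: "\<bar>K0 i j (V n w)\<bar> \<le> B + \<bar>\<sigma>sq\<bar>" for i j
        using kern_bound[OF V_unit[OF w] V_unit[OF w], of n i n j] by (auto simp: K0_def)
      let ?d = "\<lambda>i j. (score_h \<theta> (Mn n) i j (V n w) - score_h true_param (Mn n) i j (V n w)) * K0 i j (V n w)"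
      have "divergence true_param n w = 0" by (simp add: divergence_def bregman_self)
      then have "divergence \<theta> n w = population_score \<theta> n w - population_score true_param n w"
        unfolding divergence_eq[OF th w] divergence_eq[OF true_param_in w] by linarith
      also have "\<dots> = (score_a \<theta> (Mn n) (V n w) - score_a true_param (Mn n) (V n w)) - (\<Sum>i<Mn n. \<Sum>j<Mn n. ?d i j)"
        by (simp add: population_score_def left_diff_distrib sum_subtractf)
      also have "\<dots> \<le> \<epsilon> + (\<Sum>i<Mn n. \<Sum>j<Mn n. \<epsilon> * (B + \<bar>\<sigma>sq\<bar>))"
      proof -
        have "\<bar>?d i j\<bar> \<le> \<epsilon> * (B + \<bar>\<sigma>sq\<bar>)" for i j
          unfolding abs_mult by (rule mult_mono[OF s(2) k]) (use \<epsilon> in auto)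
        then have "- ?d i j \<le> \<epsilon> * (B + \<bar>\<sigma>sq\<bar>)" for i j using abs_le_D2 by blast
        then have "(\<Sum>i<Mn n. \<Sum>j<Mn n. - ?d i j) \<le> (\<Sum>i<Mn n. \<Sum>j<Mn n. \<epsilon> * (B + \<bar>\<sigma>sq\<bar>))"
          by (intro sum_mono)
        moreover have "(\<Sum>i<Mn n. \<Sum>j<Mn n. - ?d i j) = - (\<Sum>i<Mn n. \<Sum>j<Mn n. ?d i j)"
          by (simp only: sum_negf)
        ultimately show ?thesis using s(1)[of "V n w"] by linarith
      qed
      also have "\<dots> = \<epsilon> * (1 + (real (Mn n))\<^sup>2 * (B + \<bar>\<sigma>sq\<bar>))" by (simp add: power2_eq_square algebra_simps)
      also have "\<dots> \<le> \<epsilon> * H" unfolding H_def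
        using \<epsilon> B Mn_le[of n] by (intro mult_left_mono add_left_mono mult_right_mono power_mono) auto
      finally show ?thesis using \<epsilon> by simp
    qed
    then show "risk n \<theta> \<le> e" unfolding risk_def
      by (intro integral_le_const divergence_integrable[OF th] AE_I2)
  qed
qed

text \<open>An off-diagonal entry contains the kernel only and yields its mean-square distance. A
  diagonal entry contains kernel plus noise, so the variance can be read off only up to a uniform
  bound \<kappa> on the kernel error; the second claim is relative to such a bound. The constant is
  the same for all n.\<close>

lemma risk_lower:
  assumes e: "e > 0"
  shows "\<exists>C\<ge>0. \<forall>\<theta>\<in>\<Theta>. \<forall>n. c_g\<^sup>2 * hs_square (\<lambda>s t. fst \<theta> s t - kern s t) \<le> e + C * risk n \<theta> \<and>
    (\<forall>\<kappa>\<ge>0. (\<forall>s\<in>unit_ivl. \<forall>t\<in>unit_ivl. \<bar>fst \<theta> s t - kern s t\<bar> \<le> \<kappa>) \<longrightarrow> \<kappa> \<le> \<bar>snd \<theta> - \<sigma>sq\<bar> \<longrightarrow>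
       (\<bar>snd \<theta> - \<sigma>sq\<bar> - \<kappa>)\<^sup>2 \<le> e + C * risk n \<theta>)"
proof -
  \<comment> \<open>The matrix form of the modulus multiplies the additive error by the size of the
    matrix, at most Mx.\<close>
  define e' where "e' = e / (real Mx + 1)"
  have e': "e' > 0" using e by (simp add: e'_def)
  obtain C where C: "C \<ge> 0" "\<forall>x\<in>{b1..hi}. \<forall>y\<in>{b1..hi}. (x - y)\<^sup>2 \<le> e' + C * (\<phi> x - \<phi> y - deriv \<phi> y * (x - y))"
    using scalar_bregman_modulus[OF convex smooth b1 e', of hi] by blast
  define C' where "C' = C * (real Mx)\<^sup>2"
  have C': "C' \<ge> 0" using C by (simp add: C'_def)
  have entry: "(Cm true_param (Mn n) (V n w) $$ (i, j) - Cm \<theta> (Mn n) (V n w) $$ (i, j))\<^sup>2 \<le> e + C' * divergence \<theta> n w"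
    if th: "\<theta> \<in> \<Theta>" and ij: "i < Mn n" "j < Mn n" for \<theta> n w i j
  proof -
    let ?f = "\<lambda>i j. (Cm true_param (Mn n) (V n w) $$ (i, j) - Cm \<theta> (Mn n) (V n w) $$ (i, j))\<^sup>2"
    let ?b = "bregman \<phi> (Cm true_param (Mn n) (V n w)) (Cm \<theta> (Mn n) (V n w))"
    have "?f i j \<le> (\<Sum>j<Mn n. ?f i j)" by (rule member_le_sum) (use ij in auto)
    also have "\<dots> \<le> (\<Sum>i<Mn n. \<Sum>j<Mn n. ?f i j)" by (rule member_le_sum) (use ij in \<open>auto intro: sum_nonneg\<close>)
    also have "\<dots> \<le> real (Mn n) * e' + C * ?b"
      by (rule bregman_frobenius_modulus[OF Cm_spectrum[OF true_param_in Mn_le] Cm_spectrum[OF th Mn_le]])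
        (use C(2) in blast)
    also have "real (Mn n) * e' \<le> (real Mx + 1) * e'" using Mn_le[of n] e' by (intro mult_right_mono) auto
    also have "(real Mx + 1) * e' = e" by (simp add: e'_def)
    also have "?b = divergence \<theta> n w * (real (Mn n))\<^sup>2" using Mn_pos[of n] by (simp add: divergence_def)
    also have "C * (divergence \<theta> n w * (real (Mn n))\<^sup>2) \<le> C * (divergence \<theta> n w * (real Mx)\<^sup>2)"
      using C(1) Mn_le[of n] divergence_nonneg[OF th] by (intro mult_left_mono power_mono) auto
    finally show ?thesis by (simp add: C'_def mult_ac)
  qed
  have ub: "c \<le> e + C' * risk n \<theta>" if th: "\<theta> \<in> \<Theta>" and g: "integrable \<Omega> g" and c: "c \<le> expectation g"
    and gb: "\<And>w. w \<in> space \<Omega> \<Longrightarrow> g w \<le> e + C' * divergence \<theta> n w" for c g \<theta> n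
  proof -
    have "c \<le> expectation g" by (rule c)
    also have "\<dots> \<le> expectation (\<lambda>w. e + C' * divergence \<theta> n w)"
      by (rule integral_mono[OF g]) (use divergence_integrable[OF th] gb in auto)
    also have "\<dots> = e + C' * risk n \<theta>" unfolding risk_def
      using divergence_integrable[OF th, of n] by (simp add: prob_space)
    finally show ?thesis .
  qed
  show ?thesis
  proof (intro exI[of _ C'] conjI C' ballI allI impI)
    fix \<theta> n assume th: "\<theta> \<in> \<Theta>"
    \<comment> \<open>At least two observations per subject provide the off-diagonal entry (0,
      1).\<close>
    have ij: "0 < Mn n" "1 < Mn n" "(0::nat) \<noteq> 1" using Mn_ge[of n] by auto
    have cc: "continuous_on unit_sq (\<lambda>(s, t). fst \<theta> s t - kern s t)"
      using continuous_on_diff[OF kernel_class_continuous[of "fst \<theta>" B \<delta>] kern_cont] th \<delta>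
      by (simp add: case_prod_unfold \<Theta>_def mem_Times_iff)
    have eC: "Cm \<theta>' (Mn n) (V n w) $$ (i, j) = fst \<theta>' (V n w i) (V n w j) + (if i = j then snd \<theta>' else 0)"
      if "w \<in> space \<Omega>" "i < Mn n" "j < Mn n" for \<theta>' w i j
      using V_unit[OF that(1)] that by (simp add: Cm_def kernel_mat_entry clamp_unit_id del: atLeastAtMost_iff)
    show "c_g\<^sup>2 * hs_square (\<lambda>s t. fst \<theta> s t - kern s t) \<le> e + C' * risk n \<theta>"
    proof (rule ub[OF th pair_lower_bound[OF cc ij]])
      fix w assume w: "w \<in> space \<Omega>"
      show "(fst \<theta> (V n w 0) (V n w 1) - kern (V n w 0) (V n w 1))\<^sup>2 \<le> e + C' * divergence \<theta> n w"
        using entry[OF th ij(1,2), of w] unfolding eC[OF w ij(1,2)] by (simp add: power2_commute)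
    qed
    fix \<kappa> assume \<kappa>: "0 \<le> \<kappa>" "\<forall>s\<in>unit_ivl. \<forall>t\<in>unit_ivl. \<bar>fst \<theta> s t - kern s t\<bar> \<le> \<kappa>" "\<kappa> \<le> \<bar>snd \<theta> - \<sigma>sq\<bar>"
    show "(\<bar>snd \<theta> - \<sigma>sq\<bar> - \<kappa>)\<^sup>2 \<le> e + C' * risk n \<theta>"
    proof (rule ub[OF th integrable_const[of "(\<bar>snd \<theta> - \<sigma>sq\<bar> - \<kappa>)\<^sup>2"]])
      fix w assume w: "w \<in> space \<Omega>"
      define d where "d = fst \<theta> (V n w 0) (V n w 0) - kern (V n w 0) (V n w 0)"
      have "\<bar>d\<bar> \<le> \<kappa>" using \<kappa>(2) V_unit[OF w, of n 0] by (simp add: d_def)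
      then have "\<bar>snd \<theta> - \<sigma>sq\<bar> - \<kappa> \<le> \<bar>d + (snd \<theta> - \<sigma>sq)\<bar>" by linarith
      then have "(\<bar>snd \<theta> - \<sigma>sq\<bar> - \<kappa>)\<^sup>2 \<le> \<bar>d + (snd \<theta> - \<sigma>sq)\<bar>\<^sup>2" using \<kappa>(3) by (intro power_mono) auto
      also have "\<dots> = (Cm true_param (Mn n) (V n w) $$ (0, 0) - Cm \<theta> (Mn n) (V n w) $$ (0, 0))\<^sup>2"
        unfolding eC[OF w ij(1) ij(1)] by (simp add: d_def power2_commute algebra_simps)
      also have "\<dots> \<le> e + C' * divergence \<theta> n w" by (rule entry[OF th ij(1) ij(1)])
      finally show "(\<bar>snd \<theta> - \<sigma>sq\<bar> - \<kappa>)\<^sup>2 \<le> e + C' * divergence \<theta> n w" .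
    qed (auto simp: prob_space)
  qed
qed

definition emp_risk :: "nat \<Rightarrow> (real \<Rightarrow> real \<Rightarrow> real) \<times> real \<Rightarrow> 'w \<Rightarrow> real" where
  "emp_risk N \<theta> w = (\<Sum>n<N. quad_stat (score_a \<theta> (Mn n)) (score_h \<theta> (Mn n)) n w) / real N"

text \<open>A net of the kernel class, carried over to the scores by \<open>score_close\<close>, is
  the net demanded by \<open>uniform_lln\<close>.\<close>

lemma emp_risk_uniform:
  assumes \<epsilon>: "\<epsilon> > 0"
  shows "\<exists>Bad. (\<forall>N. Bad N \<in> events) \<and> (\<lambda>N. prob (Bad N)) \<longlonglongrightarrow> 0 \<and>
    (\<forall>N>0. \<forall>w\<in>space \<Omega> - Bad N. \<forall>\<theta>\<in>\<Theta>. \<bar>emp_risk N \<theta> w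
      - (\<Sum>n<N. expectation (quad_stat (score_a \<theta> (Mn n)) (score_h \<theta> (Mn n)) n)) / real N\<bar> \<le> \<epsilon>)"
  unfolding emp_risk_def
proof (rule uniform_lln[where a = "\<lambda>\<theta> n. score_a \<theta> (Mn n)" and h = "\<lambda>\<theta> n. score_h \<theta> (Mn n)" and \<Theta> = \<Theta>, OF _ _ \<epsilon>])
  show "quad_coeff cbound (score_a \<theta> (Mn n)) (score_h \<theta> (Mn n))" if "\<theta> \<in> \<Theta>" for \<theta> n
    by (rule score_coeff[OF that])
  fix \<epsilon> :: real assume \<epsilon>: "\<epsilon> > 0"
  from score_close[OF \<epsilon>] obtain \<kappa> where \<kappa>: "\<kappa> > 0" and sc:
    "\<forall>M. 1 \<le> M \<longrightarrow> M \<le> Mx \<longrightarrow> (\<forall>\<theta>\<in>\<Theta>. \<forall>\<theta>'\<in>\<Theta>. (\<forall>s\<in>unit_ivl. \<forall>t\<in>unit_ivl. \<bar>fst \<theta> s t - fst \<theta>' s t\<bar> \<le> \<kappa>) \<longrightarrow>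
    \<bar>snd \<theta> - snd \<theta>'\<bar> \<le> \<kappa> \<longrightarrow>
    (\<forall>t. \<bar>score_a \<theta> M t - score_a \<theta>' M t\<bar> \<le> \<epsilon> \<and> (\<forall>i j. \<bar>score_h \<theta> M i j t - score_h \<theta>' M i j t\<bar> \<le> \<epsilon>)))"
    by (elim exE conjE) (rule that)
  obtain \<Theta>0 where \<Theta>0: "finite \<Theta>0" "\<Theta>0 \<subseteq> \<Theta>" and net: "\<forall>\<theta>\<in>\<Theta>. \<exists>\<theta>'\<in>\<Theta>0.
    (\<forall>s\<in>unit_ivl. \<forall>t\<in>unit_ivl. \<bar>fst \<theta> s t - fst \<theta>' s t\<bar> \<le> \<kappa>) \<and> \<bar>snd \<theta> - snd \<theta>'\<bar> \<le> \<kappa>"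
    by (rule exE[OF kernel_class_net[where B = B and \<delta> = \<delta> and ?b1.0 = b1 and ?b2.0 = b2, OF \<delta> \<kappa>, folded \<Theta>_def]],
        assumption, elim conjE, rule that)
  show "\<exists>\<Theta>0. finite \<Theta>0 \<and> \<Theta>0 \<subseteq> \<Theta> \<and> (\<forall>\<theta>\<in>\<Theta>. \<exists>\<theta>'\<in>\<Theta>0. \<forall>n t. (\<forall>i. t i \<in> unit_ivl) \<longrightarrow>
     \<bar>score_a \<theta> (Mn n) t - score_a \<theta>' (Mn n) t\<bar> \<le> \<epsilon>
     \<and> (\<forall>i<Mn n. \<forall>j<Mn n. \<bar>score_h \<theta> (Mn n) i j t - score_h \<theta>' (Mn n) i j t\<bar> \<le> \<epsilon>))"
  proof (intro exI[of _ \<Theta>0] conjI \<Theta>0 ballI)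
    fix \<theta> assume th: "\<theta> \<in> \<Theta>"
    obtain \<theta>' where th': "\<theta>' \<in> \<Theta>0" and c: "\<forall>s\<in>unit_ivl. \<forall>t\<in>unit_ivl. \<bar>fst \<theta> s t - fst \<theta>' s t\<bar> \<le> \<kappa>" and v: "\<bar>snd \<theta> - snd \<theta>'\<bar> \<le> \<kappa>"
      using net[rule_format, OF th] by (elim bexE conjE) (rule that)
    have th'': "\<theta>' \<in> \<Theta>" using th' \<Theta>0(2) by blast
    have s: "\<bar>score_a \<theta> (Mn n) t - score_a \<theta>' (Mn n) t\<bar> \<le> \<epsilon>
      \<and> (\<forall>i j. \<bar>score_h \<theta> (Mn n) i j t - score_h \<theta>' (Mn n) i j t\<bar> \<le> \<epsilon>)" for n t
      by (rule sc[rule_format, OF Mn_pos Mn_le th th'']) (use c v in auto)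
    then show "\<exists>\<theta>'\<in>\<Theta>0. \<forall>n t. (\<forall>i. t i \<in> unit_ivl) \<longrightarrow>
     \<bar>score_a \<theta> (Mn n) t - score_a \<theta>' (Mn n) t\<bar> \<le> \<epsilon>
     \<and> (\<forall>i<Mn n. \<forall>j<Mn n. \<bar>score_h \<theta> (Mn n) i j t - score_h \<theta>' (Mn n) i j t\<bar> \<le> \<epsilon>)"
      by (intro bexI[OF _ th'] allI impI conjI) (simp_all add: s)
  qed
qed

text \<open>\<open>\<theta>'\<close> plays the spline approximation of the truth and
  \<open>\<theta>\<close> the minimiser; the slack \<kappa> absorbs the penalty. Small average risk
  of \<open>\<theta>'\<close> passes to \<open>\<theta>\<close> through the empirical risks.\<close>

lemma consistency:
  assumes \<epsilon>: "\<epsilon> > 0"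
  shows "\<exists>\<kappa>>0. \<exists>Bad. (\<forall>N. Bad N \<in> events) \<and> (\<lambda>N. prob (Bad N)) \<longlonglongrightarrow> 0 \<and>
    (\<forall>N>0. \<forall>w\<in>space \<Omega> - Bad N. \<forall>\<theta>\<in>\<Theta>. \<forall>\<theta>'\<in>\<Theta>.
      (\<forall>s\<in>unit_ivl. \<forall>t\<in>unit_ivl. \<bar>fst \<theta>' s t - kern s t\<bar> \<le> \<kappa>) \<longrightarrow> snd \<theta>' = \<sigma>sq \<longrightarrow>
      emp_risk N \<theta> w \<le> emp_risk N \<theta>' w + \<kappa> \<longrightarrow>
      hs_square (\<lambda>s t. fst \<theta> s t - kern s t) \<le> \<epsilon> \<and> \<bar>snd \<theta> - \<sigma>sq\<bar> \<le> \<epsilon>)"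
proof -
  have \<epsilon>2: "\<epsilon> / 2 > 0" using \<epsilon> by simp
  obtain e1 where e1: "e1 > 0" and sup: "\<forall>c\<in>kernel_class B \<delta>. \<forall>c'\<in>kernel_class B \<delta>. hs_square (\<lambda>s t. c s t - c' s t) < e1 \<longrightarrow>
    (\<forall>s\<in>unit_ivl. \<forall>t\<in>unit_ivl. \<bar>c s t - c' s t\<bar> \<le> \<epsilon> / 2)"
    by (rule exE[OF kernel_class_sup_close[where B = B and \<delta> = \<delta>, OF \<delta> \<epsilon>2]], assumption, elim conjE, rule that)
  \<comment> \<open>Below g all targets are met: the first entry gives kernel distance under
    \<epsilon> and under the threshold e1 for uniform closeness \<epsilon> / 2, the second lets the
    variance error exceed \<epsilon> / 2 by less than \<epsilon> / 2.\<close>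
  define g where "g = min (c_g\<^sup>2 * min \<epsilon> e1) ((\<epsilon> / 2)\<^sup>2)"
  have g: "g > 0" using \<epsilon> e1 c_g by (simp add: g_def)
  then have g2: "g / 2 > 0" by simp
  from risk_lower[OF g2] obtain C where C: "C \<ge> 0" and
    lower: "\<forall>\<theta>\<in>\<Theta>. \<forall>n. c_g\<^sup>2 * hs_square (\<lambda>s t. fst \<theta> s t - kern s t) \<le> g / 2 + C * risk n \<theta> \<and>
    (\<forall>\<kappa>\<ge>0. (\<forall>s\<in>unit_ivl. \<forall>t\<in>unit_ivl. \<bar>fst \<theta> s t - kern s t\<bar> \<le> \<kappa>) \<longrightarrow> \<kappa> \<le> \<bar>snd \<theta> - \<sigma>sq\<bar> \<longrightarrow>
       (\<bar>snd \<theta> - \<sigma>sq\<bar> - \<kappa>)\<^sup>2 \<le> g / 2 + C * risk n \<theta>)"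
    by (elim exE conjE) (rule that)
  \<comment> \<open>The average risk of the minimiser will be at most four quarters of \<rho>: the
    risk of \<open>\<theta>'\<close>, the two uniform errors, and the slack \<kappa>.\<close>
  define \<rho> where "\<rho> = g / (2 * (C + 1))"
  have \<rho>: "\<rho> > 0" using g C by (simp add: \<rho>_def)
  have C\<rho>: "C * \<rho> < g / 2"
  proof -
    have "C * \<rho> < (C + 1) * \<rho>" using \<rho> by simp
    also have "(C + 1) * \<rho> = g / 2" using C unfolding \<rho>_def by (subst times_divide_eq_right, subst frac_eq_eq) auto
    finally show ?thesis .
  qed
  have \<rho>4: "\<rho> / 4 > 0" using \<rho> by simp
  from risk_upper[OF \<rho>4] obtain \<kappa>2 where \<kappa>2: "\<kappa>2 > 0" and
    upper: "\<forall>\<theta>\<in>\<Theta>. (\<forall>s\<in>unit_ivl. \<forall>t\<in>unit_ivl. \<bar>fst \<theta> s t - kern s t\<bar> \<le> \<kappa>2) \<longrightarrow> snd \<theta> = \<sigma>sq \<longrightarrow> (\<forall>n. risk n \<theta> \<le> \<rho> / 4)"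
    by (elim exE conjE) (rule that)
  from emp_risk_uniform[OF \<rho>4] obtain Bad where Bad: "\<forall>N. Bad N \<in> events" "(\<lambda>N. prob (Bad N)) \<longlonglongrightarrow> 0"
    and unif: "\<forall>N>0. \<forall>w\<in>space \<Omega> - Bad N. \<forall>\<theta>\<in>\<Theta>. \<bar>emp_risk N \<theta> w
      - (\<Sum>n<N. expectation (quad_stat (score_a \<theta> (Mn n)) (score_h \<theta> (Mn n)) n)) / real N\<bar> \<le> \<rho> / 4"
    by (elim exE conjE) (rule that)
  define \<kappa> where "\<kappa> = min \<kappa>2 (\<rho> / 4)"
  show ?thesis
  proof (intro exI[of _ \<kappa>] exI[of _ Bad] conjI Bad ballI allI impI)
    show "\<kappa> > 0" using \<kappa>2 \<rho> by (simp add: \<kappa>_def)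
  next
    fix N :: nat and w \<theta> \<theta>' assume N: "N > 0" and w: "w \<in> space \<Omega> - Bad N" and th: "\<theta> \<in> \<Theta>" "\<theta>' \<in> \<Theta>"
      and c: "\<forall>s\<in>unit_ivl. \<forall>t\<in>unit_ivl. \<bar>fst \<theta>' s t - kern s t\<bar> \<le> \<kappa>" and v: "snd \<theta>' = \<sigma>sq"
      and emp: "emp_risk N \<theta> w \<le> emp_risk N \<theta>' w + \<kappa>"
    have avg: "(\<Sum>n<N. risk n t) / real N = (\<Sum>n<N. expectation (base n)) / real N
      + (\<Sum>n<N. expectation (quad_stat (score_a t (Mn n)) (score_h t (Mn n)) n)) / real N" if "t \<in> \<Theta>" for t
      by (simp add: risk_eq[OF that] sum.distrib add_divide_distrib)
    have "\<forall>s\<in>unit_ivl. \<forall>t\<in>unit_ivl. \<bar>fst \<theta>' s t - kern s t\<bar> \<le> \<kappa>2"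
    proof (intro ballI)
      fix s t assume st: "s \<in> unit_ivl" "t \<in> unit_ivl"
      show "\<bar>fst \<theta>' s t - kern s t\<bar> \<le> \<kappa>2" using c[rule_format, OF st] by (simp add: \<kappa>_def)
    qed
    then have "risk n \<theta>' \<le> \<rho> / 4" for n using upper[rule_format, OF th(2) _ v] by blast
    then have "(\<Sum>n<N. risk n \<theta>') \<le> (\<Sum>n<N. \<rho> / 4)" by (intro sum_mono)
    then have "(\<Sum>n<N. risk n \<theta>') / real N \<le> \<rho> / 4" using N by (simp add: divide_le_eq mult_ac)
    moreover have "\<kappa> \<le> \<rho> / 4" by (simp add: \<kappa>_def)
    ultimately have "(\<Sum>n<N. risk n \<theta>) / real N \<le> \<rho>"
      using unif[rule_format, OF N w th(1)] unif[rule_format, OF N w th(2)] emp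
      unfolding avg[OF th(1)] avg[OF th(2)] by linarith
    then have "(\<Sum>n<N. risk n \<theta>) \<le> \<rho> * real N" using N by (simp add: divide_le_eq)
    \<comment> \<open>One subject is enough for the lower bound, since its constants do not depend
      on n.\<close>
    have "\<exists>n<N. risk n \<theta> \<le> \<rho>"
    proof (rule ccontr)
      assume "\<not> ?thesis"
      then have "(\<Sum>n<N. \<rho>) < (\<Sum>n<N. risk n \<theta>)" using N by (intro sum_strict_mono) auto
      then show False using \<open>(\<Sum>n<N. risk n \<theta>) \<le> \<rho> * real N\<close> by (simp add: mult_ac)
    qed
    then obtain n where n: "risk n \<theta> \<le> \<rho>" by blast
    have "C * risk n \<theta> \<le> C * \<rho>" using n C by (rule mult_left_mono)
    then have small: "g / 2 + C * risk n \<theta> < g" using C\<rho> by linarith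
    from lower[rule_format, OF th(1), of n] have low1: "c_g\<^sup>2 * hs_square (\<lambda>s t. fst \<theta> s t - kern s t) < g"
      and low2: "\<And>\<kappa>. \<kappa> \<ge> 0 \<Longrightarrow> \<forall>s\<in>unit_ivl. \<forall>t\<in>unit_ivl. \<bar>fst \<theta> s t - kern s t\<bar> \<le> \<kappa> \<Longrightarrow> \<kappa> \<le> \<bar>snd \<theta> - \<sigma>sq\<bar> \<Longrightarrow>
        (\<bar>snd \<theta> - \<sigma>sq\<bar> - \<kappa>)\<^sup>2 < g" using small by (auto intro: le_less_trans)
    have "c_g\<^sup>2 * hs_square (\<lambda>s t. fst \<theta> s t - kern s t) < c_g\<^sup>2 * min \<epsilon> e1" using low1 by (simp add: g_def)
    then have hs: "hs_square (\<lambda>s t. fst \<theta> s t - kern s t) < min \<epsilon> e1" using c_g by simp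
    then show "hs_square (\<lambda>s t. fst \<theta> s t - kern s t) \<le> \<epsilon>" by simp
    have "fst \<theta> \<in> kernel_class B \<delta>" using th by (auto simp: \<Theta>_def)
    then have s: "\<forall>s\<in>unit_ivl. \<forall>t\<in>unit_ivl. \<bar>fst \<theta> s t - kern s t\<bar> \<le> \<epsilon> / 2"
      using sup[rule_format, OF _ kern_in_class, of "fst \<theta>"] hs by auto
    \<comment> \<open>The uniform kernel error \<epsilon> / 2 is subtracted first; if the variance
      error is already below it, nothing remains to be shown.\<close>
    show "\<bar>snd \<theta> - \<sigma>sq\<bar> \<le> \<epsilon>"
    proof (cases "\<epsilon> / 2 \<le> \<bar>snd \<theta> - \<sigma>sq\<bar>")
      case True
      have "(\<bar>snd \<theta> - \<sigma>sq\<bar> - \<epsilon> / 2)\<^sup>2 < (\<epsilon> / 2)\<^sup>2"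
        using low2[OF less_imp_le[OF \<epsilon>2] s True] by (simp add: g_def)
      then have "\<bar>snd \<theta> - \<sigma>sq\<bar> - \<epsilon> / 2 < \<epsilon> / 2" by (rule power_less_imp_less_base) (use \<epsilon>2 in simp)
      then show ?thesis by simp
    qed (use \<epsilon> in simp)
  qed
qed

text \<open>Inside the sample space the clamping and the default coordinates of \<open>V\<close> are
  invisible, so the loss on the actual data is exactly an average of quadratic statistics.\<close>

lemma loss_eq_emp_risk:
  assumes th: "(spline_cov K b U D, v) \<in> \<Theta>" and w: "w \<in> space \<Omega>"
  shows "loss \<phi> K b N Mn (\<lambda>n j. u n j w) (observation x xi u eps w) (U, D, v) = emp_risk N (spline_cov K b U D, v) w"
proof -
  define \<theta> where "\<theta> = (spline_cov K b U D, v)"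
  have th': "\<theta> \<in> \<Theta>" using th by (simp add: \<theta>_def)
  have "1 / (real (Mn n))\<^sup>2 * (let C = model_cov K b U D v (Mn n) (\<lambda>j. u n j w); S = emp_cov (Mn n) (observation x xi u eps w n)
        in mtrace (- mat_fun \<phi> C - mat_fun (deriv \<phi>) C * (S - C)))
    = quad_stat (score_a \<theta> (Mn n)) (score_h \<theta> (Mn n)) n w" for n
  proof -
    have mc: "model_cov K b U D v (Mn n) (\<lambda>j. u n j w) = Cm \<theta> (Mn n) (V n w)"
    proof -
      have "kernel_mat (spline_cov K b U D) v (Mn n) (\<lambda>j. u n j w) = kernel_mat (spline_cov K b U D) v (Mn n) (V n w)"
        unfolding kernel_mat_def by (rule arg_cong[where f = "\<lambda>A. A + _"], rule eq_matI) (auto simp: V_def)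
      then show ?thesis
        unfolding model_cov_eq_kernel_mat by (subst Cm_unit) (simp_all add: V_unit[OF w] \<theta>_def del: atLeastAtMost_iff)
    qed
    have S: "emp_cov (Mn n) (observation x xi u eps w n) \<in> carrier_mat (Mn n) (Mn n)" by (simp add: emp_cov_def)
    let ?F = "mat_fun (deriv \<phi>) (Cm \<theta> (Mn n) (V n w))"
    have "(\<Sum>i<Mn n. \<Sum>j<Mn n. ?F $$ (i, j) * emp_cov (Mn n) (observation x xi u eps w n) $$ (j, i)) / (real (Mn n))\<^sup>2
      = (\<Sum>i<Mn n. \<Sum>j<Mn n. score_h \<theta> (Mn n) i j (V n w) * (Y n i w * Y n j w))"
      unfolding sum_divide_distrib
      by (intro sum.cong refl) (simp add: emp_cov_def score_h_def observation_eq_Y[OF w] mult_ac)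
    then show ?thesis
      unfolding mc Let_def loss_term_eq[OF Cm_spectrum[OF th' Mn_le] S] quad_stat_def score_a_def
      by (simp add: diff_divide_distrib)
  qed
  then show ?thesis unfolding loss_def emp_risk_def \<theta>_def[symmetric] by simp
qed

end

section \<open>Consistency\<close>

text \<open>The exceptional set is covered by a measurable bad event and a null set, which bounds
  its outer probability.\<close>

lemma small_o_p1I:
  assumes "prob_space \<Omega>"
    and X: "\<And>\<epsilon>. \<epsilon> > 0 \<Longrightarrow> \<exists>Bad. (\<forall>N. Bad N \<in> sets \<Omega>) \<and> (\<lambda>N. measure \<Omega> (Bad N)) \<longlonglongrightarrow> 0
      \<and> (\<forall>\<^sub>F N in sequentially. AE w in \<Omega>. w \<notin> Bad N \<longrightarrow> \<bar>X N w\<bar> \<le> \<epsilon>)"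
  shows "small_o_p1 \<Omega> X"
  unfolding small_o_p1_def
proof (intro allI impI)
  interpret prob_space \<Omega> by fact
  fix \<epsilon> :: real assume "\<epsilon> > 0"
  from X[OF this] obtain Bad where Bad: "\<And>N. Bad N \<in> sets \<Omega>" "(\<lambda>N. measure \<Omega> (Bad N)) \<longlonglongrightarrow> 0"
    and ae: "\<forall>\<^sub>F N in sequentially. AE w in \<Omega>. w \<notin> Bad N \<longrightarrow> \<bar>X N w\<bar> \<le> \<epsilon>" by blast
  have "(\<lambda>N. ennreal (measure \<Omega> (Bad N))) \<longlonglongrightarrow> ennreal 0" by (intro tendsto_ennrealI Bad)
  then have lim: "(\<lambda>N. emeasure \<Omega> (Bad N)) \<longlonglongrightarrow> 0" by (simp add: emeasure_eq_measure)
  show "(\<lambda>N. outer_measure_of \<Omega> {w \<in> space \<Omega>. \<epsilon> < \<bar>X N w\<bar>}) \<longlonglongrightarrow> 0"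
  proof (rule tendsto_sandwich[OF _ _ tendsto_const lim])
    show "\<forall>\<^sub>F N in sequentially. outer_measure_of \<Omega> {w \<in> space \<Omega>. \<epsilon> < \<bar>X N w\<bar>} \<le> emeasure \<Omega> (Bad N)"
      using ae
    proof eventually_elim
      case (elim N)
      from AE_E3[OF elim] obtain S where S: "\<And>w. w \<in> space \<Omega> - S \<Longrightarrow> w \<notin> Bad N \<longrightarrow> \<bar>X N w\<bar> \<le> \<epsilon>" "S \<in> null_sets \<Omega>"
        by blast
      have "{w \<in> space \<Omega>. \<epsilon> < \<bar>X N w\<bar>} \<subseteq> Bad N \<union> S"
      proof
        fix w assume "w \<in> {w \<in> space \<Omega>. \<epsilon> < \<bar>X N w\<bar>}"
        then show "w \<in> Bad N \<union> S" using S(1)[of w] by fastforce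
      qed
      then have "outer_measure_of \<Omega> {w \<in> space \<Omega>. \<epsilon> < \<bar>X N w\<bar>} \<le> outer_measure_of \<Omega> (Bad N \<union> S)"
        by (rule outer_measure_of_mono)
      also have "\<dots> = emeasure \<Omega> (Bad N \<union> S)" by (rule outer_measure_of_eq) (use Bad S in auto)
      also have "\<dots> = emeasure \<Omega> (Bad N)" by (rule emeasure_Un_null_set[OF Bad(1) S(2)])
      finally show ?case .
    qed
  qed simp
qed

theorem theorem8p1:
  fixes \<Omega> :: "'w measure" and P :: "'s measure"
    and x :: "'s \<Rightarrow> real \<Rightarrow> real" and xi :: "nat \<Rightarrow> 'w \<Rightarrow> 's"
    and u eps :: "nat \<Rightarrow> nat \<Rightarrow> 'w \<Rightarrow> real" and Mn :: "nat \<Rightarrow> nat"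
    and G :: "real \<Rightarrow> real"
    and kern :: "real \<Rightarrow> real \<Rightarrow> real" and lam0 :: "nat \<Rightarrow> real" and psi0 :: "nat \<Rightarrow> real \<Rightarrow> real"
    and R p m q :: nat and K :: "nat \<Rightarrow> nat" and \<eta> :: "nat \<Rightarrow> real"
    and J :: "nat \<Rightarrow> nat" and \<tau> :: "nat \<Rightarrow> nat \<Rightarrow> real" and b :: "nat \<Rightarrow> nat \<Rightarrow> real \<Rightarrow> real"
    and \<phi> :: "real \<Rightarrow> real"
    and C_E M_lo M_hi c_g C_g C_m \<sigma>0sq b0 b1 b2 :: real
    and W_bar U_bar :: "nat \<Rightarrow> real mat"
    and U_hat D_hat :: "nat \<Rightarrow> 'w \<Rightarrow> real mat" and \<sigma>sq_hat :: "nat \<Rightarrow> 'w \<Rightarrow> real"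
  assumes fixed_integers: "R \<ge> 1" "p \<ge> 1" "m \<ge> 1" "1 \<le> q" "q \<le> m"
    and random_fun: "random_function P x"
    and mean_zero: "\<forall>t\<in>{0..1}. (LINT \<zeta>|P. x \<zeta> t) = 0"
    and kern_def: "kern = cov_fun P x"
    and kern_cont: "continuous_on ({0..1} \<times> {0..1}) (\<lambda>(s, t). kern s t)"
    and mercer: "mercer_expansion kern lam0 psi0"
    and condition1: "sobolev_cov p kern"
    and condition2: "C_E > 0" "\<forall>r r'. r < r' \<and> r' \<le> R \<longrightarrow> lam0 r - lam0 r' \<ge> C_E"
    and rank_R: "omega kern lam0 psi0 R = 0"
    and prob: "prob_space \<Omega>"
    and curves: "\<forall>n. xi n \<in> \<Omega> \<rightarrow>\<^sub>M P" "\<forall>n. distr \<Omega> P (xi n) = P"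
    and independence: "independent_sources \<Omega> P xi u eps Mn"
    and condition3i: "M_lo > 1" "\<forall>n. M_lo \<le> real (Mn n) \<and> real (Mn n) \<le> M_hi"
    and condition3ii:
      "\<forall>n. \<forall>j<Mn n. u n j \<in> space \<Omega> \<rightarrow> {0..1} \<and> distributed \<Omega> lborel (u n j) (\<lambda>t. ennreal (G t))"
      "G \<in> borel_measurable borel" "\<forall>t. t \<notin> {0..1} \<longrightarrow> G t = 0"
      "0 < c_g" "\<forall>t\<in>{0..1}. c_g < G t \<and> G t < C_g"
    and condition4i: "C_m \<ge> 1"
      "\<forall>n. \<forall>j<Mn n. eps n j \<in> borel_measurable \<Omega> \<and> integrable \<Omega> (\<lambda>w. (eps n j w) ^ 4)
         \<and> (LINT w|\<Omega>. eps n j w) = 0 \<and> (LINT w|\<Omega>. (eps n j w)\<^sup>2) = \<sigma>0sq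
         \<and> (LINT w|\<Omega>. (eps n j w) ^ 4) \<le> C_m * \<sigma>0sq\<^sup>2"
    and condition4ii: "conditional_kurtosis_bound \<Omega> x xi u Mn C_m"
    \<comment> \<open>the spline spaces are refined over the whole interval as \<open>N\<close> grows\<close>
    and knots: "\<forall>N. knot_seq (J N) (\<tau> N)" "(\<lambda>N. mesh (J N) (\<tau> N)) \<longlonglongrightarrow> 0"
    and basis: "\<forall>N. orthonormal_spline_basis m (J N) (\<tau> N) (K N) (b N)"
    and seed: "seed_function \<phi>"
    and eta_pos: "\<forall>N. \<eta> N > 0"
    and K_top: "filterlim K at_top sequentially"
    and K_rate: "(\<lambda>N. (real (K N))\<^sup>2 * ln (real (K N)) / real N) \<longlonglongrightarrow> 0"
    and eta_rate: "(\<lambda>N. \<eta> N * real (K N) powr (1 + 2 * max (real q - real p) 0)) \<longlonglongrightarrow> 0"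
    and bounds: "b0 > 0" "b1 > 0" "b2 > b1"
    and optimal_params: "\<forall>\<^sub>F N in sequentially.
         is_arg_min (cov_approx_error kern (K N) (b N)) (\<lambda>W. W \<in> sym_mats (K N)) (W_bar N)
         \<and> leading_eigenvectors (K N) R (W_bar N) (U_bar N)
         \<and> (U_bar N, mat_diag R lam0, \<sigma>0sq) \<in> param_set R q (K N) (b N) b0 b1 b2"
    and minimizer: "\<forall>\<^sub>F N in sequentially. AE w in \<Omega>.
         is_arg_min
           (pen_loss \<phi> q (\<eta> N) (K N) (b N) N Mn (\<lambda>n j. u n j w) (observation x xi u eps w))
           (\<lambda>\<theta>. \<theta> \<in> param_set R q (K N) (b N) b0 b1 b2)
           (U_hat N w, D_hat N w, \<sigma>sq_hat N w)"
    \<comment> \<open>permuting or changing the signs of the columns of \<open>U_hat\<close> does not change the loss;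
        this fixes the representative to which the conclusion refers\<close>
    and identification: "\<forall>\<^sub>F N in sequentially. AE w in \<Omega>.
         (\<forall>r r'. r \<le> r' \<and> r' < R \<longrightarrow> D_hat N w $$ (r', r') \<le> D_hat N w $$ (r, r))
         \<and> (\<forall>r<R. L2_inner (psi_est (K N) (b N) (U_hat N w) r) (psi0 r) \<ge> 0)"
  shows "\<forall>r<R.
      small_o_p1 \<Omega> (\<lambda>N w. \<bar>D_hat N w $$ (r, r) - lam0 r\<bar>)
    \<and> small_o_p1 \<Omega> (\<lambda>N w. (L2_norm (\<lambda>t. psi_est (K N) (b N) (U_hat N w) r t - psi0 r t))\<^sup>2)
    \<and> small_o_p1 \<Omega> (\<lambda>N w. \<bar>\<sigma>sq_hat N w - \<sigma>0sq\<bar>)"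
proof -
  have sc: "strictly_convex_pos \<phi>" and C2: "C2_pos \<phi>" using seed by (auto simp: seed_function_def)
  interpret fk: finite_rank_kernel kern lam0 psi0 R C_E
    by unfold_locales (use mercer kern_cont rank_R condition2 in auto)
  interpret prob_space \<Omega> by (rule prob)
  obtain B1 \<delta>1 where kc1: "\<forall>\<kappa>>0. \<delta>1 \<kappa> > 0" "kern \<in> kernel_class B1 \<delta>1"
    using fk.kern_class by (elim exE conjE) (rule that)
  obtain Bs where Bs: "Bs \<ge> 0" and reg: "\<forall>J \<tau> K b R U r. spline_basis m J \<tau> K b \<longrightarrow> U \<in> stiefel R K \<longrightarrow>
    mtrace (transpose_mat U * Gamma_mat q K b * U) \<le> b0 \<longrightarrow> r < R \<longrightarrow>
    (\<forall>t\<in>unit_ivl. \<bar>psi_est K b U r t\<bar> \<le> Bs) \<and>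
    (\<forall>s\<in>unit_ivl. \<forall>t\<in>unit_ivl. \<bar>psi_est K b U r s - psi_est K b U r t\<bar> \<le> Bs * sqrt \<bar>s - t\<bar>)"
    using psi_est_regular[OF fixed_integers(4,5) less_imp_le[OF bounds(1)]] by (elim exE conjE) (rule that)
  \<comment> \<open>The constants of \<open>finite_rank_kernel_class\<close> for R terms with
    eigenvalues at most b2 and functions bounded by Bs; they are free of N.\<close>
  define B2 where "B2 = real R * (b2 * Bs\<^sup>2)"
  define \<delta>2 where "\<delta>2 \<kappa> = (\<kappa> / (2 * B2 + 1))\<^sup>2" for \<kappa>
  have b2: "b2 > 0" using bounds by linarith
  have B2: "B2 \<ge> 0" using b2 by (simp add: B2_def)
  \<comment> \<open>One class for the truth, known only to have the modulus of a continuous kernel,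
    and for all candidates, which are Hoelder continuous.\<close>
  define B where "B = max B1 B2"
  define \<delta> where "\<delta> \<kappa> = min (\<delta>1 \<kappa>) (\<delta>2 \<kappa>)" for \<kappa>
  have B: "B \<ge> 0" using B2 by (simp add: B_def)
  have \<delta>: "\<delta> \<kappa> > 0" if "\<kappa> > 0" for \<kappa> using kc1(1) that B2 by (simp add: \<delta>_def \<delta>2_def)
  have kern_class: "kern \<in> kernel_class B \<delta>"
    by (rule kernel_class_mono[OF kc1(2)]) (simp_all add: B_def \<delta>_def)
  have opt: "\<forall>\<^sub>F N in sequentially. (U_bar N, mat_diag R lam0, \<sigma>0sq) \<in> param_set R q (K N) (b N) b0 b1 b2"
    using optimal_params by eventually_elim simp
  \<comment> \<open>The true variance is the same for all N, so a single admissible N0 places it in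
    the interval.\<close>
  obtain N0 where "(U_bar N0, mat_diag R lam0, \<sigma>0sq) \<in> param_set R q (K N0) (b N0) b0 b1 b2"
    using eventually_happens[OF opt] by auto
  then have \<sigma>_in: "\<sigma>0sq \<in> {b1..b2}" by (simp add: param_set_def)
  define Mx where "Mx = nat \<lceil>M_hi\<rceil>"
  interpret sl: sampling_loss \<Omega> P x xi u eps Mn Mx G kern c_g C_m \<sigma>0sq B \<phi> b1 b2 \<delta>
  proof unfold_locales
    show "2 \<le> Mn n" for n
    proof -
      have "1 < real (Mn n)" using condition3i by (meson less_le_trans)
      then show ?thesis by simp
    qed
    show "Mn n \<le> Mx" for n
      using condition3i(2)[rule_format, of n] by (simp add: Mx_def) linarith
    show "\<bar>kern s t\<bar> \<le> B" if "s \<in> unit_ivl" "t \<in> unit_ivl" for s t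
      by (rule kernel_classD(2)[OF kern_class that])
    show "u n j w \<in> unit_ivl" if "j < Mn n" "w \<in> space \<Omega>" for n j w
      using condition3ii(1) that by blast
  qed (use random_fun kern_def kern_cont curves independence condition3ii condition4i condition4ii
      sc C2 bounds B \<delta> kern_class \<sigma>_in in \<open>simp_all (no_asm_use)\<close>; force)+
  have sb: "spline_basis m (J N) (\<tau> N) (K N) (b N)" for N
    using knots(1) basis fixed_integers(3) by (simp add: spline_basis_def)
  have form: "spline_cov (K N) (b N) U D = (\<lambda>s t. \<Sum>r<R. D $$ (r, r) * psi_est (K N) (b N) U r s * psi_est (K N) (b N) U r t)"
    and in_\<Theta>: "(spline_cov (K N) (b N) U D, v) \<in> sl.\<Theta>"
    if "(U, D, v) \<in> param_set R q (K N) (b N) b0 b1 b2" for N U D v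
  proof -
    have U: "U \<in> stiefel R (K N)" and D: "D \<in> pos_diag R" and tr: "mtrace (transpose_mat U * Gamma_mat q (K N) (b N) * U) \<le> b0"
      and d: "\<And>r. r < R \<Longrightarrow> D $$ (r, r) \<in> {b1..b2}" and v: "v \<in> {b1..b2}"
      using that by (auto simp: param_set_def)
    show eq: "spline_cov (K N) (b N) U D = (\<lambda>s t. \<Sum>r<R. D $$ (r, r) * psi_est (K N) (b N) U r s * psi_est (K N) (b N) U r t)"
      by (intro ext spline_cov_eq[OF stiefelD(1)[OF U] D])
    have "spline_cov (K N) (b N) U D \<in> kernel_class B2 \<delta>2"
      unfolding eq B2_def \<delta>2_def[abs_def]
    proof (rule finite_rank_kernel_class)
      fix r assume r: "r < R"
      show "0 \<le> D $$ (r, r) \<and> D $$ (r, r) \<le> b2" using d[OF r] bounds by auto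
      note reg' = reg[rule_format, OF sb U tr r]
      show "\<bar>psi_est (K N) (b N) U r t\<bar> \<le> Bs" if "t \<in> unit_ivl" for t using reg'[THEN conjunct1] that by (rule bspec)
      show "\<bar>psi_est (K N) (b N) U r s - psi_est (K N) (b N) U r t\<bar> \<le> Bs * sqrt \<bar>s - t\<bar>"
        if "s \<in> unit_ivl" "t \<in> unit_ivl" for s t using reg'[THEN conjunct2] that by blast
    qed (use Bs b2 in auto)
    then have "spline_cov (K N) (b N) U D \<in> kernel_class B \<delta>"
      by (rule kernel_class_mono) (simp_all add: B_def \<delta>_def)
    then show "(spline_cov (K N) (b N) U D, v) \<in> sl.\<Theta>" using v by (simp add: sl.\<Theta>_def)
  qed
  \<comment> \<open>One family of bad events serves all R components and the variance at
    once.\<close>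
  have main: "\<exists>Bad. (\<forall>N. Bad N \<in> sets \<Omega>) \<and> (\<lambda>N. measure \<Omega> (Bad N)) \<longlonglongrightarrow> 0 \<and>
    (\<forall>\<^sub>F N in sequentially. AE w in \<Omega>. w \<notin> Bad N \<longrightarrow> (\<forall>r<R. \<bar>D_hat N w $$ (r, r) - lam0 r\<bar> \<le> \<epsilon> \<and>
      (L2_norm (\<lambda>t. psi_est (K N) (b N) (U_hat N w) r t - psi0 r t))\<^sup>2 \<le> \<epsilon>) \<and> \<bar>\<sigma>sq_hat N w - \<sigma>0sq\<bar> \<le> \<epsilon>)"
    if \<epsilon>: "\<epsilon> > 0" for \<epsilon> :: real
  proof -
    \<comment> \<open>The caps serve the eigenvalue error, the condition 6 \<epsilon>1 < C_E of the
      perturbation bound, and the eigenfunction error 2 (2 \<epsilon>1 / C_E)^2 \<le>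
      \<epsilon>.\<close>
    define \<epsilon>1 where "\<epsilon>1 = min \<epsilon> (min (C_E / 7) (C_E * sqrt (\<epsilon> / 8)))"
    have \<epsilon>1: "\<epsilon>1 > 0" "\<epsilon>1 \<le> \<epsilon>" "6 * \<epsilon>1 < C_E" "\<epsilon>1 \<le> C_E * sqrt (\<epsilon> / 8)"
    proof -
      have le: "\<epsilon>1 \<le> \<epsilon>" "\<epsilon>1 \<le> C_E / 7" "\<epsilon>1 \<le> C_E * sqrt (\<epsilon> / 8)" unfolding \<epsilon>1_def by linarith+
      show "\<epsilon>1 > 0" using \<epsilon> condition2(1) by (simp add: \<epsilon>1_def)
      show "\<epsilon>1 \<le> \<epsilon>" "6 * \<epsilon>1 < C_E" "\<epsilon>1 \<le> C_E * sqrt (\<epsilon> / 8)" using le condition2(1) by linarith+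
    qed
    have \<epsilon>1': "2 * (2 * \<epsilon>1 / C_E)\<^sup>2 \<le> \<epsilon>"
    proof -
      have "\<epsilon>1 / C_E \<le> sqrt (\<epsilon> / 8)" using \<epsilon>1(4) condition2(1) by (simp add: divide_le_eq mult.commute)
      then have "(\<epsilon>1 / C_E)\<^sup>2 \<le> (sqrt (\<epsilon> / 8))\<^sup>2" using \<epsilon>1(1) condition2(1) by (intro power_mono) auto
      then show ?thesis using \<epsilon> by (simp add: power_divide power_mult_distrib mult.commute)
    qed
    \<comment> \<open>The perturbation bound takes the Hilbert-Schmidt error as the square of
      \<epsilon>1, while the variance error is compared with \<epsilon> directly.\<close>
    define \<epsilon>2 where "\<epsilon>2 = min \<epsilon>1 (\<epsilon>1\<^sup>2)"
    have \<epsilon>2: "\<epsilon>2 > 0" "\<epsilon>2 \<le> \<epsilon>" "\<epsilon>2 \<le> \<epsilon>1\<^sup>2" using \<epsilon>1 by (auto simp: \<epsilon>2_def)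
    from sl.consistency[OF \<epsilon>2(1)] obtain \<kappa> Bad where \<kappa>: "\<kappa> > 0" and
      Bad: "\<forall>N. Bad N \<in> events" "(\<lambda>N. prob (Bad N)) \<longlonglongrightarrow> 0" and
      cons: "\<forall>N>0. \<forall>w\<in>space \<Omega> - Bad N. \<forall>\<theta>\<in>sl.\<Theta>. \<forall>\<theta>'\<in>sl.\<Theta>.
      (\<forall>s\<in>unit_ivl. \<forall>t\<in>unit_ivl. \<bar>fst \<theta>' s t - kern s t\<bar> \<le> \<kappa>) \<longrightarrow> snd \<theta>' = \<sigma>0sq \<longrightarrow>
      sl.emp_risk N \<theta> w \<le> sl.emp_risk N \<theta>' w + \<kappa> \<longrightarrow>
      hs_square (\<lambda>s t. fst \<theta> s t - kern s t) \<le> \<epsilon>2 \<and> \<bar>snd \<theta> - \<sigma>0sq\<bar> \<le> \<epsilon>2"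
      by (elim exE conjE) (rule that)
    obtain e2 where e2: "e2 > 0" and
      sup: "\<forall>c\<in>kernel_class B \<delta>. \<forall>c'\<in>kernel_class B \<delta>. hs_square (\<lambda>s t. c s t - c' s t) < e2 \<longrightarrow>
    (\<forall>s\<in>unit_ivl. \<forall>t\<in>unit_ivl. \<bar>c s t - c' s t\<bar> \<le> \<kappa>)"
      by (rule exE[OF kernel_class_sup_close[where B = B and \<delta> = \<delta>, OF \<delta> \<kappa>]], assumption, elim conjE, rule that)
    from fk.optimal_kernel_close[OF e2 fixed_integers(3)] obtain d where d: "d > 0" and
      optc: "\<forall>J \<tau> K b W U. spline_basis m J \<tau> K b \<longrightarrow> mesh J \<tau> < d \<longrightarrow>
    is_arg_min (cov_approx_error kern K b) (\<lambda>W. W \<in> sym_mats K) W \<longrightarrow> leading_eigenvectors K R W U \<longrightarrow>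
    hs_square (\<lambda>s t. (\<Sum>r<R. lam0 r * psi_est K b U r s * psi_est K b U r t) - kern s t) < e2"
      by (elim exE conjE) (rule that)
    have ev_mesh: "\<forall>\<^sub>F N in sequentially. mesh (J N) (\<tau> N) < d" by (rule order_tendstoD(2)[OF knots(2) d])
    \<comment> \<open>The power of K in the rate is at least 1 once K \<ge> 1, so \<eta> itself
      becomes small and the penalty at the optimal parameters, at most \<eta> b0, fits into the
      slack \<kappa>.\<close>
    have ev_\<eta>: "\<forall>\<^sub>F N in sequentially. \<eta> N * b0 \<le> \<kappa>"
    proof -
      have "\<kappa> / b0 > 0" using \<kappa> bounds by simp
      from order_tendstoD(2)[OF eta_rate this]
      have "\<forall>\<^sub>F N in sequentially. \<eta> N * real (K N) powr (1 + 2 * max (real q - real p) 0) < \<kappa> / b0" .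
      moreover have "\<forall>\<^sub>F N in sequentially. 1 \<le> K N" using K_top by (simp add: filterlim_at_top)
      ultimately show ?thesis
      proof eventually_elim
        case (elim N)
        have "\<eta> N * 1 \<le> \<eta> N * real (K N) powr (1 + 2 * max (real q - real p) 0)"
          using elim(2) eta_pos by (intro mult_left_mono ge_one_powr_ge_zero) (auto intro: less_imp_le)
        then have "\<eta> N < \<kappa> / b0" using elim(1) by simp
        then show ?case using bounds(1) by (simp add: less_divide_eq)
      qed
    qed
    show ?thesis
    proof (intro exI[of _ Bad] conjI Bad)
      show "\<forall>\<^sub>F N in sequentially. AE w in \<Omega>. w \<notin> Bad N \<longrightarrow> (\<forall>r<R. \<bar>D_hat N w $$ (r, r) - lam0 r\<bar> \<le> \<epsilon> \<and>
      (L2_norm (\<lambda>t. psi_est (K N) (b N) (U_hat N w) r t - psi0 r t))\<^sup>2 \<le> \<epsilon>) \<and> \<bar>\<sigma>sq_hat N w - \<sigma>0sq\<bar> \<le> \<epsilon>"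
        using eventually_gt_at_top[of 0] ev_mesh ev_\<eta> optimal_params minimizer identification
      proof eventually_elim
        case (elim N)
        note N = elim(1) and mesh = elim(2) and \<eta> = elim(3) and optp = elim(4)
        let ?K = "K N" and ?b = "b N"
        let ?tr = "\<lambda>U. mtrace (transpose_mat U * Gamma_mat q ?K ?b * U)"
        define cbar where "cbar = spline_cov ?K ?b (U_bar N) (mat_diag R lam0)"
        have bar: "(U_bar N, mat_diag R lam0, \<sigma>0sq) \<in> param_set R q ?K ?b b0 b1 b2" using optp by simp
        have cbar_in: "(cbar, \<sigma>0sq) \<in> sl.\<Theta>" unfolding cbar_def by (rule in_\<Theta>[OF bar])
        have "hs_square (\<lambda>s t. cbar s t - kern s t) < e2"
        proof -
          have "cbar = (\<lambda>s t. \<Sum>r<R. lam0 r * psi_est ?K ?b (U_bar N) r s * psi_est ?K ?b (U_bar N) r t)"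
            unfolding cbar_def form[OF bar] by (intro ext sum.cong refl) (simp add: mat_diag_def)
          then show ?thesis
            using optc[rule_format, OF sb mesh optp[THEN conjunct1] optp[THEN conjunct2, THEN conjunct1]] by simp
        qed
        then have cbar_close: "\<forall>s\<in>unit_ivl. \<forall>t\<in>unit_ivl. \<bar>cbar s t - kern s t\<bar> \<le> \<kappa>"
          using sup[rule_format, OF _ kern_class, of cbar] cbar_in by (auto simp: sl.\<Theta>_def)
        have tr_bar: "?tr (U_bar N) \<le> b0" using bar by (simp add: param_set_def)
        show ?case
          using elim(5,6) AE_space
        proof (eventually_elim, intro impI)
          case (elim w)
          assume notBad: "w \<notin> Bad N"
          let ?U = "U_hat N w" and ?D = "D_hat N w" and ?v = "\<sigma>sq_hat N w"
          note am = elim(1)[unfolded is_arg_min_linorder] and ident = elim(2) and w = elim(3)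
          have hat: "(?U, ?D, ?v) \<in> param_set R q ?K ?b b0 b1 b2" using am by blast
          have U: "?U \<in> stiefel R ?K" using hat by (simp add: param_set_def)
          define chat where "chat = spline_cov ?K ?b ?U ?D"
          have chat_in: "(chat, ?v) \<in> sl.\<Theta>" unfolding chat_def by (rule in_\<Theta>[OF hat])
          have "pen_loss \<phi> q (\<eta> N) ?K ?b N Mn (\<lambda>n j. u n j w) (observation x xi u eps w) (?U, ?D, ?v)
            \<le> pen_loss \<phi> q (\<eta> N) ?K ?b N Mn (\<lambda>n j. u n j w) (observation x xi u eps w) (U_bar N, mat_diag R lam0, \<sigma>0sq)"
            using am bar by blast
          then have "sl.emp_risk N (chat, ?v) w + \<eta> N * ?tr ?U \<le> sl.emp_risk N (cbar, \<sigma>0sq) w + \<eta> N * ?tr (U_bar N)"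
            unfolding pen_loss_def case_prod_conv chat_def cbar_def
              sl.loss_eq_emp_risk[OF in_\<Theta>[OF hat] w] sl.loss_eq_emp_risk[OF in_\<Theta>[OF bar] w] .
          moreover have "0 \<le> \<eta> N * ?tr ?U"
            using spline_basis.mtrace_Gamma_nonneg[OF sb stiefelD(1)[OF U] fixed_integers(5)] eta_pos by (simp add: less_imp_le)
          moreover have "\<eta> N * ?tr (U_bar N) \<le> \<eta> N * b0" using tr_bar eta_pos by (simp add: less_imp_le)
          ultimately have le: "sl.emp_risk N (chat, ?v) w \<le> sl.emp_risk N (cbar, \<sigma>0sq) w + \<kappa>" using \<eta> by linarith
          have wB: "w \<in> space \<Omega> - Bad N" using w notBad by simp
          have "hs_square (\<lambda>s t. fst (chat, ?v) s t - kern s t) \<le> \<epsilon>2 \<and> \<bar>snd (chat, ?v) - \<sigma>0sq\<bar> \<le> \<epsilon>2"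
            by (rule cons[rule_format, OF N wB chat_in cbar_in _ _ le]) (use cbar_close in simp_all)
          then have hs: "hs_square (\<lambda>s t. chat s t - kern s t) \<le> \<epsilon>1\<^sup>2" and v: "\<bar>?v - \<sigma>0sq\<bar> \<le> \<epsilon>"
            using \<epsilon>2 by auto
          note est = fk.estimator_close[where \<chi> = "psi_est ?K ?b ?U" and d = "\<lambda>r. ?D $$ (r, r)",
              OF spline_basis.continuous_psi_est[OF sb U] spline_basis.psi_est_orthonormal[OF sb U] _ _
                less_imp_le[OF \<epsilon>1(1)] \<epsilon>1(3) hs[unfolded chat_def form[OF hat]]]
          show "(\<forall>r<R. \<bar>?D $$ (r, r) - lam0 r\<bar> \<le> \<epsilon> \<and>
            (L2_norm (\<lambda>t. psi_est ?K ?b ?U r t - psi0 r t))\<^sup>2 \<le> \<epsilon>) \<and> \<bar>?v - \<sigma>0sq\<bar> \<le> \<epsilon>"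
          proof (intro conjI allI impI v)
            fix r assume r: "r < R"
            have "\<bar>?D $$ (r, r) - lam0 r\<bar> \<le> \<epsilon>1" by (rule est(1)) (use ident r in auto)
            then show "\<bar>?D $$ (r, r) - lam0 r\<bar> \<le> \<epsilon>" using \<epsilon>1(2) by linarith
            have "(L2_norm (\<lambda>t. psi_est ?K ?b ?U r t - psi0 r t))\<^sup>2 \<le> 2 * (2 * \<epsilon>1 / C_E)\<^sup>2"
              by (rule est(2)) (use ident r in auto)
            then show "(L2_norm (\<lambda>t. psi_est ?K ?b ?U r t - psi0 r t))\<^sup>2 \<le> \<epsilon>" using \<epsilon>1' by linarith
          qed
        qed
      qed
    qed
  qed
  \<comment> \<open>\<open>X\<close> stands for any of the three errors; each is dominated pointwise
    by the joint bound of \<open>main\<close>.\<close>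
  have small: "small_o_p1 \<Omega> X" if X: "\<And>\<epsilon> N w. (\<forall>r<R. \<bar>D_hat N w $$ (r, r) - lam0 r\<bar> \<le> \<epsilon> \<and>
      (L2_norm (\<lambda>t. psi_est (K N) (b N) (U_hat N w) r t - psi0 r t))\<^sup>2 \<le> \<epsilon>) \<and> \<bar>\<sigma>sq_hat N w - \<sigma>0sq\<bar> \<le> \<epsilon>
      \<Longrightarrow> \<bar>X N w\<bar> \<le> \<epsilon>" for X
  proof (rule small_o_p1I[OF prob])
    fix \<epsilon> :: real assume "\<epsilon> > 0"
    from main[OF this] obtain Bad where Bad: "\<forall>N. Bad N \<in> sets \<Omega>" "(\<lambda>N. measure \<Omega> (Bad N)) \<longlonglongrightarrow> 0"
      and ev: "\<forall>\<^sub>F N in sequentially. AE w in \<Omega>. w \<notin> Bad N \<longrightarrow> (\<forall>r<R. \<bar>D_hat N w $$ (r, r) - lam0 r\<bar> \<le> \<epsilon> \<and>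
        (L2_norm (\<lambda>t. psi_est (K N) (b N) (U_hat N w) r t - psi0 r t))\<^sup>2 \<le> \<epsilon>) \<and> \<bar>\<sigma>sq_hat N w - \<sigma>0sq\<bar> \<le> \<epsilon>"
      by (elim exE conjE) (rule that)
    have "\<forall>\<^sub>F N in sequentially. AE w in \<Omega>. w \<notin> Bad N \<longrightarrow> \<bar>X N w\<bar> \<le> \<epsilon>"
      using ev
    proof eventually_elim
      case (elim N)
      then show ?case by eventually_elim (intro impI X, erule mp)
    qed
    then show "\<exists>Bad. (\<forall>N. Bad N \<in> sets \<Omega>) \<and> (\<lambda>N. measure \<Omega> (Bad N)) \<longlonglongrightarrow> 0
      \<and> (\<forall>\<^sub>F N in sequentially. AE w in \<Omega>. w \<notin> Bad N \<longrightarrow> \<bar>X N w\<bar> \<le> \<epsilon>)"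
      by (intro exI[of _ Bad] conjI Bad)
  qed
  show ?thesis by (intro allI impI conjI small) auto
qed

end
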